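(* Let the unit disk $M$ be equipped with the metric $g_\kappa$ for $\kappa\in(-1,1)$ fixed. Suppose $u\in C^\infty(\partial_+SM)$ is such that $\mathcal{S}_A^*u=u$. Then the following conditions are equivalent: (1) $u$ belongs to the range of $I_0\colon C^\infty(M)\to C^\infty(\partial_+SM)$. (2) There exists $w\in C^\infty_{\alpha,+,-}(\partial_+SM)$ such that $u=P_-w$. (3) $C_-u=0$. (4) $u$ satisfies a complete set of orthogonality/moment conditions: $(u,\psi^\kappa_{n,k})_{L^2(\partial_+SM,d\Sigma^2)}=0$ for all integers $n\ge 0$ and all $k\in\mathbb{Z}$ such that $k<0$ or $k>n$, where in fan-beam coordinates $$\psi^\kappa_{n,k}(\beta,\alpha):=\frac{(-1)^n}{4\pi}\sqrt{\mathfrak{s}_\kappa'(\alpha)}\,e^{i(n-2k)(\beta+\mathfrak{s}_\kappa(\alpha))}\left(e^{i(n+1)\mathfrak{s}_\kappa(\alpha)}+(-1)^ne^{-i(n+1)\mathfrak{s}_\kappa(\alpha)}\right),\qquad \mathfrak{s}_\kappa(\alpha):=\tan^{-1}\left(\frac{1-\kappa}{1+\kappa}\tan\alpha\right).$$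
   Context: Setting. $M=\{z\in\mathbb{C}:|z|\le1\}$ with metric $g_\kappa(z)=(1+\kappa|z|^2)^{-2}|dz|^2$ (constant curvature $4\kappa$). $SM$ is the unit circle bundle. The boundary $\partial SM$ is parameterized by fan-beam coordinates $(\beta,\alpha)\in(\mathbb{R}/2\pi\mathbb{Z})^2$: base point $e^{i\beta}$, unit vector $(1+\kappa)e^{i(\beta+\pi+\alpha)}$. The inward boundary is $\partial_+SM=\{\alpha\in[-\pi/2,\pi/2]\}$ and the outward boundary is $\partial_-SM=\{\alpha\in[\pi/2,3\pi/2]\}$. The measure is $d\Sigma^2=(1+\kappa)^{-1}d\beta\,d\alpha$. X-ray transform: $I_0f(x,v)=\int_0^{\tau(x,v)}f(\gamma_{x,v}(t))\,dt$ for $(x,v)\in\partial_+SM$, where $\gamma_{x,v}$ is the unit-speed $g_\kappa$-geodesic with $\gamma_{x,v}(0)=x$, $\dot\gamma_{x,v}(0)=v$, and $\tau(x,v)$ is its first exit time from $M$. Scattering: the function $\mathfrak{s}_\kappa$ given in the claim on $(-\pi/2,\pi/2)$ is extended smoothly by $\mathfrak{s}_\kappa(\alpha+\pi)=\mathfrak{s}_\kappa(\alpha)+\pi$. The scattering relation $\mathcal{S}\colon\partial SM\to\partial SM$ maps a vector in $\partial_\pm SM$ to the one at the other end of its geodesic (following the geodesic flow forward from $\partial_+SM$ and backward from $\partial_-SM$); explicitly $\mathcal{S}(\beta,\alpha)=(\beta+\pi+2\mathfrak{s}_\kappa(\alpha),\pi-\alpha)$. The antipodal scattering relation (composition of $\mathcal{S}$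 with $\alpha\mapsto\alpha+\pi$) is $\mathcal{S}_A(\beta,\alpha)=(\beta+\pi+2\mathfrak{s}_\kappa(\alpha),-\alpha)$. Pullback: $\mathcal{S}_A^*u=u\circ\mathcal{S}_A$. Operators and spaces: for $u$ on $\partial_+SM$, $A_\pm u$ is the function on $\partial SM$ equal to $u$ on $\partial_+SM$ and to $\pm u\circ\mathcal{S}$ on $\partial_-SM$. For $u$ on $\partial SM$, $A_\pm^*u=(u\pm u\circ\mathcal{S})|_{\partial_+SM}$. $C^\infty_{\alpha,\pm}(\partial_+SM)=\{u\in C^\infty(\partial_+SM):A_\pm u\in C^\infty(\partial SM)\}$, and $C^\infty_{\alpha,+,-}(\partial_+SM)=\{u\in C^\infty_{\alpha,+}(\partial_+SM):\mathcal{S}_A^*u=-u\}$. The fiberwise Hilbert transform on $\partial SM$ is $Hu(\beta,\alpha)=\sum_{k\in\mathbb{Z}}-i\,\mathrm{sign}(k)u_k(\beta)e^{ik\alpha}$ for $u=\sum_ku_k(\beta)e^{ik\alpha}$, with $\mathrm{sign}(0)=0$; $H_-$ is its restriction to odd Fourier modes in $\alpha$ (zero on even modes). Finally $P_-=A_-^*H_-A_+$ and $C_-=\frac12A_-^*H_-A_-$. In the smooth setting these are defined as $P_-\colon C^\infty_{\alpha,+}(\partial_+SM)\to C^\infty(\partial_+SM)$ and $C_-\colon C^\infty_{\alpha,-}(\partial_+SM)\to C^\infty(\partial_+SM)$; both are also viewed as bounded operators from $L^2(\partial_+SM,d\Sigma^2)$ into itself.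
   Formalization: Condition (4) also requires u to lie in C^∞_{α,-}(∂_+SM), and (3) is read with C_- on this, its smooth domain; without this the claim fails: u=1 is S_A-invariant and satisfies all moment conditions, but is not in the range of I_0, whose elements vanish at glancing vectors. *)

theory Defs
  imports "HOL-Analysis.Analysis"
begin

section \<open>Smoothness up to the boundary\<close>

text \<open>
  Derivatives are taken within the set. The notion is used for the whole plane and for convex
  closed sets with nonempty interior (the closed disk and a closed strip). There derivatives
  within the set are unique, and smoothness means that all partial derivatives exist in the
  interior and extend continuously to the boundary.
\<close>

primrec Ck_on :: "nat \<Rightarrow> 'a::real_normed_vector set \<Rightarrow> ('a \<Rightarrow> 'b::real_normed_vector) \<Rightarrow> bool" where
  "Ck_on 0 S f \<longleftrightarrow> continuous_on S f"
| "Ck_on (Suc k) S f \<longleftrightarrow>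
     (\<exists>f'. (\<forall>x\<in>S. (f has_derivative f' x) (at x within S)) \<and> (\<forall>v. Ck_on k S (\<lambda>x. f' x v)))"

definition smooth_on :: "'a::real_normed_vector set \<Rightarrow> ('a \<Rightarrow> 'b::real_normed_vector) \<Rightarrow> bool" where
  "smooth_on S f \<longleftrightarrow> (\<forall>k. Ck_on k S f)"

section \<open>Geodesics of a planar Riemannian metric\<close>

text \<open>A metric is a map \<open>g z v w\<close>: the inner product of \<open>v\<close> and \<open>w\<close> in the tangent space at \<open>z\<close>.\<close>

type_synonym metric = "complex \<Rightarrow> complex \<Rightarrow> complex \<Rightarrow> real"

text \<open>
  Christoffel symbols of the first kind: the inner product, with \<open>w\<close>, of the Levi-Civita derivative
  of the constant field \<open>v\<close> in direction \<open>u\<close>.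
\<close>

definition christoffel :: "metric \<Rightarrow> complex \<Rightarrow> complex \<Rightarrow> complex \<Rightarrow> complex \<Rightarrow> real" where
  "christoffel g z u v w =
     (frechet_derivative (\<lambda>y. g y v w) (at z) u
      + frechet_derivative (\<lambda>y. g y u w) (at z) v
      - frechet_derivative (\<lambda>y. g y u v) (at z) w) / 2"

definition geodesic_on ::
    "metric \<Rightarrow> real set \<Rightarrow> (real \<Rightarrow> complex) \<Rightarrow> (real \<Rightarrow> complex) \<Rightarrow> bool" where
  "geodesic_on g J \<gamma> \<gamma>' \<longleftrightarrow>
     (\<exists>\<gamma>''. \<forall>t\<in>J. (\<gamma> has_vector_derivative \<gamma>' t) (at t within J)
        \<and> (\<gamma>' has_vector_derivative \<gamma>'' t) (at t within J)
        \<and> (\<forall>w. g (\<gamma> t) (\<gamma>'' t) w + christoffel g (\<gamma> t) (\<gamma>' t) (\<gamma>' t) w = 0))"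

section \<open>The disk of constant curvature and its X-ray transform\<close>

abbreviation disk :: "complex set" where
  "disk \<equiv> cball 0 1"

definition g_kappa :: "real \<Rightarrow> metric" where
  "g_kappa \<kappa> z v w = (v \<bullet> w) / (1 + \<kappa> * (norm z)\<^sup>2)\<^sup>2"

definition geodesic_in_disk ::
    "real \<Rightarrow> complex \<Rightarrow> complex \<Rightarrow> real \<Rightarrow> (real \<Rightarrow> complex) \<Rightarrow> bool" where
  "geodesic_in_disk \<kappa> x v T \<gamma> \<longleftrightarrow>
     0 \<le> T \<and> \<gamma> ` {0..T} \<subseteq> disk \<and> \<gamma> 0 = x
     \<and> (\<exists>\<gamma>'. \<gamma>' 0 = v \<and> geodesic_on (g_kappa \<kappa>) {0..T} \<gamma> \<gamma>')"

definition exit_time :: "real \<Rightarrow> complex \<Rightarrow> complex \<Rightarrow> real" where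
  "exit_time \<kappa> x v = Sup {T. \<exists>\<gamma>. geodesic_in_disk \<kappa> x v T \<gamma>}"

text \<open>
  By uniqueness of geodesics, \<open>geod\<close> is determined on \<open>{0..exit_time \<kappa> x v}\<close>; its values elsewhere
  are arbitrary and never used. For glancing \<open>v\<close> the exit time is \<open>0\<close>.
\<close>

definition geod :: "real \<Rightarrow> complex \<Rightarrow> complex \<Rightarrow> real \<Rightarrow> complex" where
  "geod \<kappa> x v = (SOME \<gamma>. geodesic_in_disk \<kappa> x v (exit_time \<kappa> x v) \<gamma>)"

text \<open>
  Functions on the boundary of the unit circle bundle are functions of the fan-beam coordinates
  \<open>(\<beta>, \<alpha>)\<close>, \<open>2\<pi>\<close>-periodic in both. Functions on the inward boundary are \<open>2\<pi>\<close>-periodic in \<open>\<beta>\<close>,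
  and only their values on the strip \<open>influx\<close> matter.
\<close>

type_synonym bdry_fun = "real \<times> real \<Rightarrow> complex"

definition influx :: "(real \<times> real) set" where
  "influx = UNIV \<times> {- (pi/2)..pi/2}"

definition fan_point :: "real \<times> real \<Rightarrow> complex" where
  "fan_point = (\<lambda>(\<beta>, \<alpha>). cis \<beta>)"

definition fan_vector :: "real \<Rightarrow> real \<times> real \<Rightarrow> complex" where
  "fan_vector \<kappa> = (\<lambda>(\<beta>, \<alpha>). of_real (1 + \<kappa>) * cis (\<beta> + pi + \<alpha>))"

definition xray :: "real \<Rightarrow> (complex \<Rightarrow> complex) \<Rightarrow> bdry_fun" where
  "xray \<kappa> f p =
     integral {0..exit_time \<kappa> (fan_point p) (fan_vector \<kappa> p)}
       (\<lambda>t. f (geod \<kappa> (fan_point p) (fan_vector \<kappa> p) t))"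

section \<open>Scattering\<close>

text \<open>
  With \<open>\<alpha> = m\<pi> + a\<close>, \<open>a \<in> [-\<pi>/2, \<pi>/2)\<close>, this is \<open>m\<pi> + arctan ((1-\<kappa>)/(1+\<kappa>) tan a)\<close>. The endpoint
  \<open>a = -\<pi>/2\<close>, where the library has \<open>tan a = 0\<close>, is filled in by continuity.
\<close>

definition scat_angle :: "real \<Rightarrow> real \<Rightarrow> real" where
  "scat_angle \<kappa> \<alpha> =
     (let m = of_int \<lfloor>\<alpha> / pi + 1/2\<rfloor>; a = \<alpha> - m * pi
      in m * pi + (if a = - (pi/2) then - (pi/2) else arctan ((1 - \<kappa>) / (1 + \<kappa>) * tan a)))"

definition scat :: "real \<Rightarrow> real \<times> real \<Rightarrow> real \<times> real" where
  "scat \<kappa> = (\<lambda>(\<beta>, \<alpha>). (\<beta> + pi + 2 * scat_angle \<kappa> \<alpha>, pi - \<alpha>))"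

definition antipodal_scat :: "real \<Rightarrow> real \<times> real \<Rightarrow> real \<times> real" where
  "antipodal_scat \<kappa> = (\<lambda>(\<beta>, \<alpha>). (\<beta> + pi + 2 * scat_angle \<kappa> \<alpha>, - \<alpha>))"

section \<open>Function spaces and boundary operators\<close>

text \<open>
  The sign \<open>\<epsilon> = \<plusminus>1\<close> selects \<open>A\<^sub>+\<close> or \<open>A\<^sub>-\<close>. The angle is first reduced to
  \<open>a \<in> [-\<pi>/2, 3\<pi>/2)\<close>. On the glancing set the inward and outward prescriptions overlap, and the
  inward value is taken; a continuous \<open>A_ext \<kappa> (-1) u\<close> vanishes there.
\<close>

definition A_ext :: "real \<Rightarrow> complex \<Rightarrow> bdry_fun \<Rightarrow> bdry_fun" where
  "A_ext \<kappa> \<epsilon> u = (\<lambda>(\<beta>, \<alpha>).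
     let a = \<alpha> - 2 * pi * of_int \<lfloor>(\<alpha> + pi/2) / (2 * pi)\<rfloor>
     in if a \<le> pi/2 then u (\<beta>, a) else \<epsilon> * u (scat \<kappa> (\<beta>, a)))"

definition A_adj :: "real \<Rightarrow> complex \<Rightarrow> bdry_fun \<Rightarrow> bdry_fun" where
  "A_adj \<kappa> \<epsilon> u p = u p + \<epsilon> * u (scat \<kappa> p)"

definition smooth_bdry :: "bdry_fun set" where
  "smooth_bdry = {u. (\<forall>\<beta> \<alpha>. u (\<beta> + 2*pi, \<alpha>) = u (\<beta>, \<alpha>) \<and> u (\<beta>, \<alpha> + 2*pi) = u (\<beta>, \<alpha>))
                     \<and> smooth_on UNIV u}"

definition smooth_influx :: "bdry_fun set" where
  "smooth_influx = {u. (\<forall>\<beta> \<alpha>. (\<beta>, \<alpha>) \<in> influx \<longrightarrow> u (\<beta> + 2*pi, \<alpha>) = u (\<beta>, \<alpha>))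
                       \<and> smooth_on influx u}"

definition smooth_alpha :: "real \<Rightarrow> complex \<Rightarrow> bdry_fun set" where
  "smooth_alpha \<kappa> \<epsilon> = {u \<in> smooth_influx. A_ext \<kappa> \<epsilon> u \<in> smooth_bdry}"

definition smooth_alpha_plus_minus :: "real \<Rightarrow> bdry_fun set" where
  "smooth_alpha_plus_minus \<kappa> =
     {w \<in> smooth_alpha \<kappa> 1. \<forall>p\<in>influx. w (antipodal_scat \<kappa> p) = - w p}"

definition fiber_coeff :: "bdry_fun \<Rightarrow> int \<Rightarrow> real \<Rightarrow> complex" where
  "fiber_coeff u k \<beta> =
     integral {0..2*pi} (\<lambda>\<alpha>. u (\<beta>, \<alpha>) * cis (- (of_int k * \<alpha>))) / of_real (2 * pi)"

definition hilbert_modes :: "int set \<Rightarrow> bdry_fun \<Rightarrow> bdry_fun" where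
  "hilbert_modes K u = (\<lambda>(\<beta>, \<alpha>).
     \<Sum>\<^sub>\<infinity>k\<in>K. - \<i> * of_int (sgn k) * fiber_coeff u k \<beta> * cis (of_int k * \<alpha>))"

text \<open>
  The full transform \<open>H\<close> is \<open>hilbert_modes UNIV\<close>. These operators are only applied to smooth
  functions on the torus, for which the series converges absolutely.
\<close>

definition H_minus :: "bdry_fun \<Rightarrow> bdry_fun" where
  "H_minus = hilbert_modes {k. odd k}"

definition P_minus :: "real \<Rightarrow> bdry_fun \<Rightarrow> bdry_fun" where
  "P_minus \<kappa> w = A_adj \<kappa> (-1) (H_minus (A_ext \<kappa> 1 w))"

definition C_minus :: "real \<Rightarrow> bdry_fun \<Rightarrow> bdry_fun" where
  "C_minus \<kappa> u p = 1/2 * A_adj \<kappa> (-1) (H_minus (A_ext \<kappa> (-1) u)) p"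

section \<open>Moment functions\<close>

definition fan_measure :: "real \<Rightarrow> (real \<times> real) measure" where
  "fan_measure \<kappa> = density lborel (\<lambda>_. ennreal (1 / (1 + \<kappa>)))"

definition inner_influx :: "real \<Rightarrow> bdry_fun \<Rightarrow> bdry_fun \<Rightarrow> complex" where
  "inner_influx \<kappa> u v =
     set_lebesgue_integral (fan_measure \<kappa>) ({0..2*pi} \<times> {- (pi/2)..pi/2}) (\<lambda>p. u p * cnj (v p))"

definition psi :: "real \<Rightarrow> nat \<Rightarrow> int \<Rightarrow> bdry_fun" where
  "psi \<kappa> n k = (\<lambda>(\<beta>, \<alpha>).
     let s = scat_angle \<kappa> \<alpha>
     in (-1) ^ n / of_real (4 * pi) * of_real (sqrt (deriv (scat_angle \<kappa>) \<alpha>))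
        * cis (of_int (int n - 2 * k) * (\<beta> + s))
        * (cis (of_nat (n + 1) * s) + (-1) ^ n * cis (- (of_nat (n + 1) * s))))"

text \<open>
  Orthogonality to all \<open>psi \<kappa> n k\<close> with \<open>k < 0\<close> or \<open>k > n\<close> forces a smooth \<open>u\<close> with
  \<open>u \<circ> antipodal_scat \<kappa> = u\<close> into the range of \<open>xray \<kappa>\<close> only if also \<open>u \<in> smooth_alpha \<kappa> (-1)\<close>,
  the smooth domain of \<open>C_minus \<kappa>\<close>. The constant \<open>1\<close> is smooth, invariant, and orthogonal to all these
  \<open>psi \<kappa> n k\<close> (integrate in \<open>\<beta>\<close>; the frequency \<open>n - 2k\<close> is nonzero), but X-ray transforms vanish at
  glancing vectors.
\<close>

end

theory Submission
  imports Defs "HOL-Complex_Analysis.Complex_Analysis"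
begin

text \<open>
  Write \<open>\<theta> = \<beta> + s\<^sub>\<kappa>(\<alpha>)\<close> and \<open>t = s\<^sub>\<kappa>(\<alpha>)\<close>. Conjugation by this change of variables and the weight
  \<open>\<surd>s\<^sub>\<kappa>'\<close> removes \<open>\<kappa>\<close> from every object, up to constant factors. The scattering relation becomes \<open>t \<mapsto> \<pi> - t\<close>; since
  \<open>s\<^sub>\<kappa>\<close> is the boundary action of a Moebius map of the disk, the fiberwise Hilbert transform acts by the sign
  of \<open>m + l\<close> on the modes with \<open>m + l\<close> odd, \<open>e\<^bsup>i(m\<theta> + lt)\<^esup>\<close>; and in the projective model the geodesics are chords, so
  that the X-ray transform is the Euclidean Radon transform of \<open>f\<close> times a smooth positive factor.
  On the Fourier side the conditions (2), (3), (4) all say that the coefficients of \<open>A\<^sub>- u\<close> vanish for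
  \<open>|l| \<le> |m|\<close>. Radon transforms of monomials satisfy this, hence so do all Radon transforms, by
  polynomial approximation. Conversely, Zernike polynomials, written as averages of Chebyshev ridge functions,
  invert each remaining mode with polynomially bounded derivatives, so that the series for \<open>f\<close> converges
  with all its derivatives.
\<close>

section \<open>Smooth functions\<close>

text \<open>The reflection t \<mapsto> \<pi> - t and the antipodal symmetry together kill every mode
  with m + l even. This helps twice: the weighted exponentials with odd m + l are, in the fiber
  variable, boundary values of holomorphic or antiholomorphic functions, so that only the sign of m
  + l survives the Hilbert transform; and |l| = |m| never occurs, so that the cone |l| \<le> |m| has
  no delicate edge. Since scattering replaces l by -l, the multipliers of C_- and P_- are
  proportional to sgn (m + l) + sgn (m - l) and sgn (m + l) - sgn (m - l); off the edge, one
  vanishes exactly where the other does not. The moments enumerate the same cone through m = n - 2k,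
  l = n + 1. The X-ray transform is defined by arbitrary solutions of the geodesic equation and a
  supremum of existence times. Two facts are therefore proved separately: every solution runs along
  a chord (by a conserved quantity), and the chord, traversed at the right speed, is a solution (by
  explicit derivatives). Glancing vectors are chords of length 0.\<close>

lemma Ck_on_cong:
  assumes "\<And>x. x \<in> S \<Longrightarrow> f x = g x"
  shows "Ck_on k S f \<longleftrightarrow> Ck_on k S g"
proof (cases k)
  case 0 then show ?thesis using assms by (auto cong: continuous_on_cong)
next
  case (Suc j)
  have "(f has_derivative f') (at x within S) \<longleftrightarrow> (g has_derivative f') (at x within S)" if "x \<in> S" for x f'
    using assms that by (metis has_derivative_transform)
  then show ?thesis unfolding Suc by simp
qed

lemma Ck_on_SucE:
  assumes "Ck_on (Suc k) S f"
  obtains f' where "\<And>x. x \<in> S \<Longrightarrow> (f has_derivative f' x) (at x within S)" "\<And>v. Ck_on k S (\<lambda>x. f' x v)"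
  using assms that by (subst (asm) Ck_on.simps(2)) blast

lemma Ck_on_SucD:
  "Ck_on (Suc k) S f \<Longrightarrow> \<exists>f'. (\<forall>x\<in>S. (f has_derivative f' x) (at x within S)) \<and> (\<forall>v. Ck_on k S (\<lambda>x. f' x v))"
  by (subst (asm) Ck_on.simps(2))

lemma Ck_on_SucI:
  assumes "\<And>x. x \<in> S \<Longrightarrow> (f has_derivative f' x) (at x within S)" "\<And>v. Ck_on k S (\<lambda>x. f' x v)"
  shows "Ck_on (Suc k) S f"
  using assms by (subst Ck_on.simps(2)) blast

declare Ck_on.simps(2) [simp del]

lemma Ck_on_Suc_imp: "Ck_on (Suc k) S f \<Longrightarrow> Ck_on k S f"
proof (induction k arbitrary: f)
  case 0
  then show ?case by (elim Ck_on_SucE) (auto intro: has_derivative_continuous_on)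
next
  case (Suc k)
  from Suc.prems show ?case
  proof (rule Ck_on_SucE)
    fix f' assume "\<And>x. x\<in>S \<Longrightarrow> (f has_derivative f' x) (at x within S)" "\<And>v. Ck_on (Suc k) S (\<lambda>x. f' x v)"
    with Suc.IH show ?thesis by (metis Ck_on_SucI)
  qed
qed

lemma Ck_on_continuous: "Ck_on k S f \<Longrightarrow> continuous_on S f"
  by (induction k) (auto dest: Ck_on_Suc_imp)

lemma Ck_on_subset: "Ck_on k S f \<Longrightarrow> T \<subseteq> S \<Longrightarrow> Ck_on k T f"
proof (induction k arbitrary: f)
  case 0 then show ?case by (auto intro: continuous_on_subset)
next
  case (Suc k)
  from Suc.prems(1) show ?case
  proof (rule Ck_on_SucE)
    fix f' assume f': "\<And>x. x\<in>S \<Longrightarrow> (f has_derivative f' x) (at x within S)" "\<And>v. Ck_on k S (\<lambda>x. f' x v)"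
    show ?thesis
    proof (rule Ck_on_SucI)
      show "(f has_derivative f' x) (at x within T)" if "x \<in> T" for x
        using f'(1) Suc.prems(2) that by (meson has_derivative_subset subsetD)
    qed (use Suc.IH f'(2) Suc.prems(2) in blast)
  qed
qed

lemma Ck_on_const: "Ck_on k S (\<lambda>x. c)"
proof (induction k arbitrary: c)
  case (Suc k)
  show ?case by (rule Ck_on_SucI[where f' = "\<lambda>x h. 0"]) (auto intro: Suc)
qed auto

lemma Ck_on_bounded_linear: "bounded_linear f \<Longrightarrow> Ck_on k S f"
proof (cases k)
  case (Suc j)
  assume "bounded_linear f"
  then show ?thesis unfolding Suc
    by (intro Ck_on_SucI[where f' = "\<lambda>x. f"] Ck_on_const bounded_linear_imp_has_derivative)
qed (auto intro: linear_continuous_on)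

lemma Ck_on_add: "Ck_on k S f \<Longrightarrow> Ck_on k S g \<Longrightarrow> Ck_on k S (\<lambda>x. f x + g x)"
proof (induction k arbitrary: f g)
  case 0 then show ?case by (auto intro: continuous_intros)
next
  case (Suc k)
  obtain f' where f': "\<And>x. x\<in>S \<Longrightarrow> (f has_derivative f' x) (at x within S)" "\<And>v. Ck_on k S (\<lambda>x. f' x v)"
    using Ck_on_SucD[OF Suc.prems(1)] by blast
  obtain g' where g': "\<And>x. x\<in>S \<Longrightarrow> (g has_derivative g' x) (at x within S)" "\<And>v. Ck_on k S (\<lambda>x. g' x v)"
    using Ck_on_SucD[OF Suc.prems(2)] by blast
  show ?case
    by (rule Ck_on_SucI[where f' = "\<lambda>x v. f' x v + g' x v"]) (use f' g' Suc.IH in \<open>auto intro: has_derivative_add\<close>)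
qed

lemma Ck_on_sum: "finite A \<Longrightarrow> (\<And>i. i \<in> A \<Longrightarrow> Ck_on k S (f i)) \<Longrightarrow> Ck_on k S (\<lambda>x. \<Sum>i\<in>A. f i x)"
  by (induction A rule: finite_induct) (auto intro: Ck_on_const Ck_on_add)

lemma Ck_on_bilinear:
  assumes pr: "bounded_bilinear pr"
  shows "Ck_on k S f \<Longrightarrow> Ck_on k S g \<Longrightarrow> Ck_on k S (\<lambda>x. pr (f x) (g x))"
proof (induction k arbitrary: f g)
  case 0 then show ?case by (auto intro: bounded_bilinear.continuous_on[OF pr])
next
  case (Suc k)
  obtain f' where f': "\<And>x. x\<in>S \<Longrightarrow> (f has_derivative f' x) (at x within S)" "\<And>v. Ck_on k S (\<lambda>x. f' x v)"
    using Ck_on_SucD[OF Suc.prems(1)] by blast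
  obtain g' where g': "\<And>x. x\<in>S \<Longrightarrow> (g has_derivative g' x) (at x within S)" "\<And>v. Ck_on k S (\<lambda>x. g' x v)"
    using Ck_on_SucD[OF Suc.prems(2)] by blast
  have "Ck_on k S f" "Ck_on k S g" using Suc.prems by (blast intro: Ck_on_Suc_imp)+
  then show ?case
    by (intro Ck_on_SucI[where f' = "\<lambda>x v. pr (f x) (g' x v) + pr (f' x v) (g x)"] Ck_on_add
        bounded_bilinear.FDERIV[OF pr] Suc.IH f' g')
qed

text \<open>The chain rule evaluates \<open>f'\<close> in the direction \<open>g' x v\<close>, which
  varies with \<open>x\<close>, while \<open>Ck_on\<close> controls only fixed directions. Expanding
  \<open>g' x v\<close> in a basis reduces to fixed directions; hence the Euclidean type of the
  intermediate space.\<close>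

lemma Ck_on_compose:
  fixes g :: "'a::real_normed_vector \<Rightarrow> 'b::euclidean_space"
  assumes "Ck_on k T f" "Ck_on k S g" "g ` S \<subseteq> T"
  shows "Ck_on k S (\<lambda>x. f (g x))"
  using assms
proof (induction k arbitrary: f)
  case 0 then show ?case by (auto intro: continuous_on_compose2)
next
  case (Suc k)
  obtain f' where f': "\<And>x. x\<in>T \<Longrightarrow> (f has_derivative f' x) (at x within T)" "\<And>v. Ck_on k T (\<lambda>x. f' x v)"
    using Ck_on_SucD[OF Suc.prems(1)] by blast
  obtain g' where g': "\<And>x. x\<in>S \<Longrightarrow> (g has_derivative g' x) (at x within S)" "\<And>v. Ck_on k S (\<lambda>x. g' x v)"
    using Ck_on_SucD[OF Suc.prems(2)] by blast
  have g: "Ck_on k S g" by (rule Ck_on_Suc_imp[OF Suc.prems(2)])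
  have d: "((\<lambda>x. f (g x)) has_derivative (\<lambda>v. f' (g x) (g' x v))) (at x within S)" if "x \<in> S" for x
    by (rule has_derivative_in_compose2[OF f'(1) Suc.prems(3) that g'(1)[OF that]])
  have "Ck_on k S (\<lambda>x. f' (g x) (g' x v))" for v
  proof -
    have e: "f' (g x) (g' x v) = (\<Sum>b\<in>Basis. (g' x v \<bullet> b) *\<^sub>R f' (g x) b)" if "x \<in> S" for x
    proof -
      have "linear (f' (g x))"
        using f'(1)[of "g x"] that Suc.prems(3) has_derivative_linear by blast
      then have "f' (g x) (\<Sum>b\<in>Basis. (g' x v \<bullet> b) *\<^sub>R b) = (\<Sum>b\<in>Basis. (g' x v \<bullet> b) *\<^sub>R f' (g x) b)"
        by (simp add: linear_sum linear_cmul)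
      then show ?thesis by (simp add: euclidean_representation)
    qed
    have s: "Ck_on k S (\<lambda>x. \<Sum>b\<in>Basis. (g' x v \<bullet> b) *\<^sub>R f' (g x) b)"
    proof (rule Ck_on_sum)
      show "Ck_on k S (\<lambda>x. (g' x v \<bullet> b) *\<^sub>R f' (g x) b)" for b
        by (rule Ck_on_bilinear[OF bounded_bilinear_scaleR
              Ck_on_bilinear[OF bounded_bilinear_inner g'(2) Ck_on_const] Suc.IH[OF f'(2) g Suc.prems(3)]])
    qed simp
    show ?thesis by (rule iffD2[OF Ck_on_cong s]) (rule e)
  qed
  then show ?case using d by (intro Ck_on_SucI)
qed

lemma smooth_on_Ck: "smooth_on S f \<Longrightarrow> Ck_on k S f"
  by (simp add: smooth_on_def)

lemma smooth_on_continuous: "smooth_on S f \<Longrightarrow> continuous_on S f"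
  using Ck_on_continuous smooth_on_Ck by blast

lemma smooth_on_subset: "smooth_on S f \<Longrightarrow> T \<subseteq> S \<Longrightarrow> smooth_on T f"
  unfolding smooth_on_def by (blast intro: Ck_on_subset)

lemma smooth_on_cong: "(\<And>x. x \<in> S \<Longrightarrow> f x = g x) \<Longrightarrow> smooth_on S f \<longleftrightarrow> smooth_on S g"
  unfolding smooth_on_def using Ck_on_cong[of S f g] by blast

named_theorems smooth_intros

lemma smooth_on_const [smooth_intros]: "smooth_on S (\<lambda>x. c)"
  by (simp add: smooth_on_def Ck_on_const)

lemma smooth_on_bounded_linear: "bounded_linear f \<Longrightarrow> smooth_on S f"
  by (simp add: smooth_on_def Ck_on_bounded_linear)

lemma smooth_on_add [smooth_intros]: "smooth_on S f \<Longrightarrow> smooth_on S g \<Longrightarrow> smooth_on S (\<lambda>x. f x + g x)"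
  by (simp add: smooth_on_def Ck_on_add)

lemma smooth_on_bilinear:
  "bounded_bilinear pr \<Longrightarrow> smooth_on S f \<Longrightarrow> smooth_on S g \<Longrightarrow> smooth_on S (\<lambda>x. pr (f x) (g x))"
  by (simp add: smooth_on_def Ck_on_bilinear)

lemma smooth_on_compose:
  fixes g :: "'a::real_normed_vector \<Rightarrow> 'b::euclidean_space"
  shows "smooth_on T f \<Longrightarrow> smooth_on S g \<Longrightarrow> g ` S \<subseteq> T \<Longrightarrow> smooth_on S (\<lambda>x. f (g x))"
  unfolding smooth_on_def using Ck_on_compose by blast

text \<open>Direct induction instead of \<open>smooth_on_compose\<close>, because the inner function
  may take values in any normed space.\<close>

lemma (in bounded_linear) smooth_on_linear:
  "smooth_on S g \<Longrightarrow> smooth_on S (\<lambda>x. f (g x))"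
proof -
  have "Ck_on k S g \<Longrightarrow> Ck_on k S (\<lambda>x. f (g x))" for k
  proof (induction k arbitrary: g)
    case 0 then show ?case by (auto intro: continuous_on)
  next
    case (Suc k)
    obtain g' where "\<And>x. x\<in>S \<Longrightarrow> (g has_derivative g' x) (at x within S)" "\<And>v. Ck_on k S (\<lambda>x. g' x v)"
      using Ck_on_SucD[OF Suc.prems] by blast
    then show ?case by (intro Ck_on_SucI[where f' = "\<lambda>x v. f (g' x v)"] has_derivative Suc.IH)
  qed
  then show "smooth_on S g \<Longrightarrow> smooth_on S (\<lambda>x. f (g x))" by (simp add: smooth_on_def)
qed

lemma smooth_on_id [smooth_intros]: "smooth_on S (\<lambda>x. x)"
  by (simp add: smooth_on_bounded_linear bounded_linear_ident)

lemmas smooth_on_scaleR [smooth_intros] = smooth_on_bilinear[OF bounded_bilinear_scaleR]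
lemmas smooth_on_inner [smooth_intros] = smooth_on_bilinear[OF bounded_bilinear_inner]
lemmas smooth_on_fst [smooth_intros] = bounded_linear.smooth_on_linear[OF bounded_linear_fst]
lemmas smooth_on_snd [smooth_intros] = bounded_linear.smooth_on_linear[OF bounded_linear_snd]
lemmas smooth_on_of_real [smooth_intros] = bounded_linear.smooth_on_linear[OF bounded_linear_of_real]

lemma smooth_on_mult [smooth_intros]:
  fixes f g :: "_ \<Rightarrow> 'b::real_normed_algebra"
  shows "smooth_on S f \<Longrightarrow> smooth_on S g \<Longrightarrow> smooth_on S (\<lambda>x. f x * g x)"
  by (rule smooth_on_bilinear[OF bounded_bilinear_mult])

lemma smooth_on_minus [smooth_intros]: "smooth_on S f \<Longrightarrow> smooth_on S (\<lambda>x. - f x)"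
  by (rule bounded_linear.smooth_on_linear[OF bounded_linear_minus[OF bounded_linear_ident]])

lemma smooth_on_diff [smooth_intros]:
  "smooth_on S f \<Longrightarrow> smooth_on S g \<Longrightarrow> smooth_on S (\<lambda>x. f x - g x)"
  unfolding diff_conv_add_uminus by (intro smooth_intros)

lemma smooth_on_power [smooth_intros]:
  fixes f :: "_ \<Rightarrow> 'b::real_normed_algebra_1"
  shows "smooth_on S f \<Longrightarrow> smooth_on S (\<lambda>x. f x ^ n)"
proof (induction n)
  case (Suc n)
  then show ?case unfolding power_Suc by (intro smooth_on_mult)
qed (simp add: smooth_on_const)

lemma smooth_on_Pair [smooth_intros]:
  fixes f :: "_ \<Rightarrow> 'b::real_normed_vector" and g :: "_ \<Rightarrow> 'c::real_normed_vector"
  assumes "smooth_on S f" "smooth_on S g"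
  shows "smooth_on S (\<lambda>x. (f x, g x))"
proof -
  have *: "bounded_linear (\<lambda>x::'b. (x, 0::'c))" "bounded_linear (\<lambda>x::'c. (0::'b, x))"
    by (intro bounded_linear_Pair bounded_linear_ident bounded_linear_zero)+
  have "smooth_on S (\<lambda>x. (f x, 0::'c) + (0::'b, g x))"
    by (rule smooth_on_add[OF bounded_linear.smooth_on_linear[OF *(1) assms(1)]
          bounded_linear.smooth_on_linear[OF *(2) assms(2)]])
  then show ?thesis by simp
qed

lemma Ck_on_vector_derivativeI:
  fixes f :: "real \<Rightarrow> 'b::real_normed_vector"
  assumes "\<And>x. x \<in> S \<Longrightarrow> (f has_vector_derivative f' x) (at x within S)" "Ck_on k S f'"
  shows "Ck_on (Suc k) S f"
  by (rule Ck_on_SucI[where f' = "\<lambda>x v. v *\<^sub>R f' x"])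
     (use assms Ck_on_bilinear[OF bounded_bilinear_scaleR Ck_on_const] in \<open>auto simp: has_vector_derivative_def\<close>)

lemma smooth_on_cis_UNIV: "smooth_on UNIV cis"
proof -
  have "Ck_on k UNIV cis" for k
  proof (induction k)
    case 0 then show ?case by (auto intro: continuous_intros)
  next
    case (Suc k)
    have "Ck_on k UNIV (\<lambda>x. \<i> * cis x)"
      by (rule Ck_on_bilinear[OF bounded_bilinear_mult Ck_on_const Suc])
    moreover have "(cis has_vector_derivative \<i> * cis x) (at x)" for x
      by (auto simp: has_vector_derivative_def scaleR_conv_of_real intro!: derivative_eq_intros)
    ultimately show ?case by (intro Ck_on_vector_derivativeI[of UNIV cis])
  qed
  then show ?thesis by (simp add: smooth_on_def)
qed

text \<open>As for \<open>cis\<close>, a bootstrap: the derivative is a polynomial in the function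
  itself, so smoothness of order k for the function gives order k for its derivative.\<close>

lemma smooth_on_inverse_real: "smooth_on {x::real. x \<noteq> 0} inverse"
proof -
  have "Ck_on k {x::real. x \<noteq> 0} inverse" for k
  proof (induction k)
    case 0 then show ?case by (auto intro: continuous_intros)
  next
    case (Suc k)
    have "Ck_on k {x::real. x \<noteq> 0} (\<lambda>x. (-1) * (inverse x * inverse x))"
      by (rule Ck_on_bilinear[OF bounded_bilinear_mult Ck_on_const Ck_on_bilinear[OF bounded_bilinear_mult Suc Suc]])
    moreover have "(inverse has_vector_derivative (-1) * (inverse x * inverse x)) (at x within {x::real. x \<noteq> 0})"
      if "x \<noteq> 0" for x :: real
      using DERIV_inverse'[OF DERIV_ident, of x "{x::real. x \<noteq> 0}"] that
      by (simp add: has_real_derivative_iff_has_vector_derivative)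
    ultimately show ?case by (intro Ck_on_vector_derivativeI) auto
  qed
  then show ?thesis by (simp add: smooth_on_def)
qed

lemma smooth_on_sqrt_pos: "smooth_on {x::real. x > 0} sqrt"
proof -
  have "Ck_on k {x::real. x > 0} sqrt" for k
  proof (induction k)
    case 0 then show ?case by (auto intro: continuous_intros)
  next
    case (Suc k)
    have "Ck_on k {x::real. x > 0} (\<lambda>x. (1/2) * inverse (sqrt x))"
      by (intro Ck_on_bilinear[OF bounded_bilinear_mult] Ck_on_const
          Ck_on_compose[OF smooth_on_Ck[OF smooth_on_inverse_real] Suc]) auto
    moreover have "(sqrt has_vector_derivative (1/2) * inverse (sqrt x)) (at x within {x::real. x > 0})"
      if "x > 0" for x :: real
      unfolding has_real_derivative_iff_has_vector_derivative[symmetric]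
      using that by (auto intro!: derivative_eq_intros)
    ultimately show ?case by (intro Ck_on_vector_derivativeI) auto
  qed
  then show ?thesis by (simp add: smooth_on_def)
qed

lemma smooth_on_inverse [smooth_intros]:
  fixes f :: "_ \<Rightarrow> real"
  shows "smooth_on S f \<Longrightarrow> (\<And>x. x \<in> S \<Longrightarrow> f x \<noteq> 0) \<Longrightarrow> smooth_on S (\<lambda>x. inverse (f x))"
  by (rule smooth_on_compose[OF smooth_on_inverse_real]) auto

lemma smooth_on_divide [smooth_intros]:
  fixes f g :: "_ \<Rightarrow> real"
  shows "smooth_on S f \<Longrightarrow> smooth_on S g \<Longrightarrow> (\<And>x. x \<in> S \<Longrightarrow> g x \<noteq> 0) \<Longrightarrow> smooth_on S (\<lambda>x. f x / g x)"
  unfolding divide_inverse by (intro smooth_intros)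

lemma smooth_on_sqrt [smooth_intros]:
  fixes f :: "_ \<Rightarrow> real"
  shows "smooth_on S f \<Longrightarrow> (\<And>x. x \<in> S \<Longrightarrow> f x > 0) \<Longrightarrow> smooth_on S (\<lambda>x. sqrt (f x))"
  by (rule smooth_on_compose[OF smooth_on_sqrt_pos]) auto

lemma smooth_on_arctan [smooth_intros]: "smooth_on S f \<Longrightarrow> smooth_on S (\<lambda>x. arctan (f x))"
proof -
  have "Ck_on k UNIV arctan" for k
  proof (cases k)
    case 0 then show ?thesis by (auto intro: continuous_intros)
  next
    case (Suc j)
    have "smooth_on UNIV (\<lambda>x::real. inverse (1 + x^2))"
      by (intro smooth_intros) (simp add: power2_eq_square sum_squares_gt_zero_iff add_nonneg_eq_0_iff)
    then have "Ck_on j UNIV (\<lambda>x::real. inverse (1 + x^2))" by (rule smooth_on_Ck)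
    moreover have "(arctan has_vector_derivative inverse (1 + x^2)) (at x)" for x
      using DERIV_arctan by (simp add: has_real_derivative_iff_has_vector_derivative)
    ultimately show ?thesis unfolding Suc by (intro Ck_on_vector_derivativeI) auto
  qed
  then show "smooth_on S f \<Longrightarrow> smooth_on S (\<lambda>x. arctan (f x))"
    using smooth_on_compose[of UNIV arctan S f] by (simp add: smooth_on_def)
qed

lemma smooth_on_cis [smooth_intros]: "smooth_on S f \<Longrightarrow> smooth_on S (\<lambda>x. cis (f x))"
  by (rule smooth_on_compose[OF smooth_on_cis_UNIV]) auto

lemma smooth_on_cos [smooth_intros]:
  fixes f :: "_ \<Rightarrow> real"
  assumes "smooth_on S f" shows "smooth_on S (\<lambda>x. cos (f x))"
  using bounded_linear.smooth_on_linear[OF bounded_linear_Re smooth_on_cis[OF assms]] by simp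

lemma smooth_on_sin [smooth_intros]:
  fixes f :: "_ \<Rightarrow> real"
  assumes "smooth_on S f" shows "smooth_on S (\<lambda>x. sin (f x))"
  using bounded_linear.smooth_on_linear[OF bounded_linear_Im smooth_on_cis[OF assms]] by simp

text \<open>Each order in \<open>Ck_on\<close> comes with a derivative of its own. Uniqueness of
  derivatives on the whole space identifies them all, so one \<open>f'\<close> serves every
  order.\<close>

lemma smooth_on_derivative:
  assumes "smooth_on UNIV f"
  obtains f' where "\<And>x. (f has_derivative f' x) (at x)" "\<And>v. smooth_on UNIV (\<lambda>x. f' x v)"
proof -
  have "\<exists>f'. (\<forall>x. (f has_derivative f' x) (at x)) \<and> (\<forall>v. Ck_on k UNIV (\<lambda>x. f' x v))" for k
    using assms[unfolded smooth_on_def, rule_format, of "Suc k"] by (simp add: Ck_on.simps(2))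
  then obtain g where g: "\<And>k x. (f has_derivative g k x) (at x)" "\<And>k v. Ck_on k UNIV (\<lambda>x. g k x v)"
    by metis
  have "g k = g 0" for k using g(1) by (metis ext has_derivative_unique)
  then show thesis using that[of "g 0"] g by (metis smooth_on_def)
qed

section \<open>Uniform derivative bounds, termwise differentiation, parameter integrals\<close>

text \<open>The bound passes to the derivative in direction v with the factor \<open>norm v\<close>.
  So \<open>B\<close> controls all iterated directional derivatives up to order k along unit
  vectors, and the estimate is homogeneous, as termwise differentiation requires.\<close>

primrec Ck_bounded ::
    "nat \<Rightarrow> 'a::real_normed_vector set \<Rightarrow> ('a \<Rightarrow> 'b::real_normed_vector) \<Rightarrow> real \<Rightarrow> bool" where
  "Ck_bounded 0 S f B \<longleftrightarrow> continuous_on S f \<and> (\<forall>x\<in>S. norm (f x) \<le> B)"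
| "Ck_bounded (Suc k) S f B \<longleftrightarrow> (\<forall>x\<in>S. norm (f x) \<le> B) \<and>
     (\<exists>f'. (\<forall>x\<in>S. (f has_derivative f' x) (at x within S)) \<and>
           (\<forall>v. Ck_bounded k S (\<lambda>x. f' x v) (B * norm v)))"

lemma Ck_bounded_norm: "Ck_bounded k S f B \<Longrightarrow> x \<in> S \<Longrightarrow> norm (f x) \<le> B"
  by (cases k) auto

lemma Ck_on_suminf:
  fixes \<phi> :: "nat \<Rightarrow> 'a::real_normed_vector \<Rightarrow> 'b::banach"
  assumes S: "convex S" and "\<And>i. Ck_bounded k S (\<phi> i) (B i)" and "summable B"
  shows "Ck_on k S (\<lambda>x. \<Sum>i. \<phi> i x)"
  using assms(2,3)
proof (induction k arbitrary: \<phi> B)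
  case 0
  have ul: "uniform_limit S (\<lambda>n x. \<Sum>i<n. \<phi> i x) (\<lambda>x. \<Sum>i. \<phi> i x) sequentially"
    using 0 by (intro Weierstrass_m_test) auto
  have "continuous_on S (\<lambda>x. \<Sum>i<n. \<phi> i x)" for n
    using 0 by (intro continuous_on_sum) auto
  then have "continuous_on S (\<lambda>x. \<Sum>i. \<phi> i x)"
    by (intro uniform_limit_theorem[OF _ ul sequentially_bot] always_eventually allI)
  then show ?case by simp
next
  case (Suc k)
  then have "\<forall>i. \<exists>f'. (\<forall>x\<in>S. (\<phi> i has_derivative f' x) (at x within S)) \<and>
           (\<forall>v. Ck_bounded k S (\<lambda>x. f' x v) (B i * norm v))" by auto
  then obtain \<phi>' where d: "\<And>i x. x \<in> S \<Longrightarrow> (\<phi> i has_derivative \<phi>' i x) (at x within S)"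
    and b: "\<And>i v. Ck_bounded k S (\<lambda>x. \<phi>' i x v) (B i * norm v)" by metis
  have sB: "summable (\<lambda>i. B i * norm v)" for v :: 'a using Suc.prems(2) by (rule summable_mult2)
  have bn: "norm (\<phi>' i x v) \<le> B i * norm v" if "x \<in> S" for i x v
    using Ck_bounded_norm[OF b that] .
  have s0: "summable (\<lambda>i. \<phi> i x)" if "x \<in> S" for x
    using Suc.prems that by (auto intro!: summable_comparison_test[OF _ Suc.prems(2)])
  have s1: "summable (\<lambda>i. \<phi>' i x v)" if "x \<in> S" for x v
    using bn that by (auto intro!: summable_comparison_test[OF _ sB])
  have "((\<lambda>x. \<Sum>i. \<phi> i x) has_derivative (\<lambda>v. \<Sum>i. \<phi>' i x v)) (at x within S)" if "x \<in> S" for x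
  proof -
    \<comment> \<open>The tail of the differentiated series is at most the tail of the sum of
      \<open>B\<close> times \<open>norm h\<close>, uniformly in x. This is the uniformity that
      \<open>has_derivative_series\<close> asks for.\<close>
    have "\<forall>\<^sub>F n in sequentially. \<forall>x\<in>S. \<forall>h. norm (sum (\<lambda>i. \<phi>' i x h) {..<n} - (\<Sum>i. \<phi>' i x h)) \<le> e * norm h"
      if "e > 0" for e
    proof -
      have "(\<lambda>n. \<Sum>i. B (i + n)) \<longlonglongrightarrow> 0" by (rule suminf_exist_split2[OF Suc.prems(2)])
      then have "\<forall>\<^sub>F n in sequentially. norm (\<Sum>i. B (i + n)) < e"
        using that by (simp add: tendsto_iff)
      then show ?thesis
      proof eventually_elim
        case (elim n)
        show ?case
        proof (intro ballI allI)
          fix x h assume "x \<in> S"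
          have "norm (sum (\<lambda>i. \<phi>' i x h) {..<n} - (\<Sum>i. \<phi>' i x h)) = norm (\<Sum>i. \<phi>' (i+n) x h)"
            using suminf_minus_initial_segment[OF s1[OF \<open>x\<in>S\<close>, of h], of n] by (simp add: norm_minus_commute)
          also have "\<dots> \<le> (\<Sum>i. B (i+n) * norm h)"
            using bn[OF \<open>x\<in>S\<close>] summable_ignore_initial_segment[OF sB[of h], of n]
            by (intro norm_suminf_le) auto
          also have "\<dots> = (\<Sum>i. B (i+n)) * norm h"
            using summable_ignore_initial_segment[OF Suc.prems(2), of n]
            by (metis suminf_mult2)
          also have "\<dots> \<le> e * norm h" using elim by (intro mult_right_mono) auto
          finally show "norm (sum (\<lambda>i. \<phi>' i x h) {..<n} - (\<Sum>i. \<phi>' i x h)) \<le> e * norm h" .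
        qed
      qed
    qed
    from has_derivative_series[OF S d this that summable_sums[OF s0[OF that]]]
    obtain g where "\<And>x. x\<in>S \<Longrightarrow> (\<lambda>n. \<phi> n x) sums (g x) \<and> (g has_derivative (\<lambda>v. \<Sum>i. \<phi>' i x v)) (at x within S)"
      by blast
    then show ?thesis using that by (metis (no_types, lifting) has_derivative_transform sums_unique)
  qed
  moreover have "Ck_on k S (\<lambda>x. \<Sum>i. \<phi>' i x v)" for v
    by (rule Suc.IH[OF b sB])
  ultimately show ?case by (intro Ck_on_SucI)
qed

text \<open>Absolute convergence makes the unordered sum equal to the series along any enumeration
  of \<open>I\<close>, so \<open>Ck_on_suminf\<close> applies.\<close>

lemma Ck_on_infsum:
  fixes \<phi> :: "'i \<Rightarrow> 'a::real_normed_vector \<Rightarrow> 'b::banach"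
  assumes S: "convex S" and I: "countable I" "infinite I"
    and b: "\<And>i. i \<in> I \<Longrightarrow> Ck_bounded k S (\<phi> i) (B i)" and sB: "B summable_on I"
  shows "Ck_on k S (\<lambda>x. \<Sum>\<^sub>\<infinity>i\<in>I. \<phi> i x)"
proof (cases "S = {}")
  case True then show ?thesis by (induction k) (auto simp: Ck_on.simps(2))
next
  case False
  then obtain x0 where x0: "x0 \<in> S" by auto
  define e where "e = from_nat_into I"
  have e: "bij_betw e UNIV I" unfolding e_def by (rule bij_betw_from_nat_into[OF I])
  have eI: "e n \<in> I" for n using e by (auto simp: bij_betw_def)
  have B0: "B i \<ge> 0" if "i \<in> I" for i using Ck_bounded_norm[OF b[OF that] x0] norm_ge_zero order_trans by blast
  have "(\<lambda>n. B (e n)) summable_on UNIV" using sB summable_on_reindex_bij_betw[OF e] by blast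
  then have sBe: "summable (\<lambda>n. B (e n))" by (rule summable_on_imp_summable)
  have "(\<Sum>\<^sub>\<infinity>i\<in>I. \<phi> i x) = (\<Sum>n. \<phi> (e n) x)" if "x \<in> S" for x
  proof -
    have "(\<Sum>\<^sub>\<infinity>i\<in>I. \<phi> i x) = (\<Sum>\<^sub>\<infinity>n. \<phi> (e n) x)" by (rule infsum_reindex_bij_betw[OF e, symmetric])
    also have "\<dots> = (\<Sum>n. \<phi> (e n) x)"
    proof -
      have "(\<lambda>n. norm (\<phi> (e n) x)) summable_on UNIV"
        by (rule Infinite_Sum.abs_summable_on_comparison_test'[OF \<open>(\<lambda>n. B (e n)) summable_on UNIV\<close>])
           (use Ck_bounded_norm[OF b[OF eI] that] in auto)
      then have "((\<lambda>n. \<phi> (e n) x) has_sum (\<Sum>\<^sub>\<infinity>n. \<phi> (e n) x)) UNIV"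
        by (rule has_sum_infsum[OF abs_summable_summable])
      then have "(\<lambda>n. \<phi> (e n) x) sums (\<Sum>\<^sub>\<infinity>n. \<phi> (e n) x)" by (rule has_sum_imp_sums)
      then show ?thesis by (rule sums_unique)
    qed
    finally show ?thesis .
  qed
  moreover have "Ck_on k S (\<lambda>x. \<Sum>n. \<phi> (e n) x)"
    by (rule Ck_on_suminf[OF S _ sBe]) (use b eI in auto)
  ultimately show ?thesis by (subst Ck_on_cong[of S])
qed

lemma Ck_on_integral:
  fixes h :: "'a::euclidean_space \<times> real \<Rightarrow> 'b::banach"
  assumes "Ck_on k (UNIV \<times> {a..b}) h"
  shows "Ck_on k UNIV (\<lambda>x. integral {a..b} (\<lambda>y. h (x, y)))"
  using assms
proof (induction k arbitrary: h)
  case 0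
  then show ?case using integral_continuous_on_param[of UNIV a b "\<lambda>x y. h (x,y)"] by simp
next
  case (Suc k)
  obtain h' where d: "\<And>p. p \<in> UNIV \<times> {a..b} \<Longrightarrow> (h has_derivative h' p) (at p within UNIV \<times> {a..b})"
    and c: "\<And>v. Ck_on k (UNIV \<times> {a..b}) (\<lambda>p. h' p v)" using Ck_on_SucD[OF Suc.prems] by blast
  \<comment> \<open>\<open>leibniz_rule\<close> wants the derivative as a continuous family of
    bounded linear maps. On a Euclidean space continuity can be tested on basis vectors, where it is
    continuity of partial derivatives.\<close>
  define H where "H = (\<lambda>x y. Blinfun (\<lambda>v. h' (x, y) (v, 0)))"
  have bl: "bounded_linear (\<lambda>v. h' (x,y) (v, 0))" if "y \<in> {a..b}" for x y
    using d[of "(x,y)"] that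
    by (intro bounded_linear_compose[OF has_derivative_bounded_linear bounded_linear_Pair[OF bounded_linear_ident bounded_linear_zero]]) auto
  have H: "blinfun_apply (H x y) v = h' (x, y) (v, 0)" if "y \<in> {a..b}" for x y v
    using bl[OF that] by (simp add: H_def bounded_linear_Blinfun_apply)
  have dH: "((\<lambda>x. h (x, y)) has_derivative blinfun_apply (H x y)) (at x within UNIV)" if "y \<in> {a..b}" for x y
  proof -
    have "((\<lambda>x. h (x, y)) has_derivative (\<lambda>v. h' (x,y) (v, 0))) (at x within UNIV)"
      by (rule has_derivative_in_compose2[where f = "\<lambda>x. (x, y)" and g = h and t = "UNIV \<times> {a..b}" and g' = h'])
         (use d that in \<open>auto intro!: derivative_eq_intros\<close>)
    moreover have "blinfun_apply (H x y) = (\<lambda>v. h' (x,y) (v, 0))" using H[OF that] by auto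
    ultimately show ?thesis by simp
  qed
  have cont: "continuous_on (UNIV \<times> {a..b}) h"
    using Suc.prems Ck_on_continuous by blast
  have hint: "(\<lambda>y. h (x, y)) integrable_on {a..b}" for x
    by (intro integrable_continuous_real continuous_on_compose2[OF cont]) (auto intro: continuous_intros)
  have cH: "continuous_on (UNIV \<times> {a..b}) (\<lambda>(x, t). H x t)"
  proof (rule continuous_on_blinfun_componentwise)
    fix i :: 'a assume "i \<in> Basis"
    have "continuous_on (UNIV \<times> {a..b}) (\<lambda>p. h' p (i, 0))" using c Ck_on_continuous by blast
    then show "continuous_on (UNIV \<times> {a..b}) (\<lambda>p. blinfun_apply (case p of (x, t) \<Rightarrow> H x t) i)"
      by (rule continuous_on_eq) (auto simp: H)
  qed
  have int: "H x integrable_on {a..b}" for x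
    by (intro integrable_continuous_real continuous_on_compose2[OF cH, of _ "\<lambda>t. (x,t)", simplified])
       (auto intro!: continuous_intros)
  have "((\<lambda>x. integral {a..b} (\<lambda>y. h (x, y))) has_derivative (\<lambda>v. integral {a..b} (\<lambda>y. h' (x,y) (v,0)))) (at x)" for x
  proof -
    have "((\<lambda>x. integral (cbox a b) (\<lambda>y. h (x, y))) has_derivative blinfun_apply (integral (cbox a b) (H x))) (at x within UNIV)"
      by (rule leibniz_rule) (use dH hint cH in auto)
    moreover have "blinfun_apply (integral {a..b} (H x)) v = integral {a..b} (\<lambda>y. h' (x,y) (v,0))" for v
    proof -
      have "blinfun_apply (integral {a..b} (H x)) v = integral {a..b} (\<lambda>y. blinfun_apply (H x y) v)"
        using blinfun_apply_integral[OF int] .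
      also have "\<dots> = integral {a..b} (\<lambda>y. h' (x,y) (v,0))"
        by (intro Henstock_Kurzweil_Integration.integral_cong H)
      finally show ?thesis .
    qed
    then have "blinfun_apply (integral {a..b} (H x)) = (\<lambda>v. integral {a..b} (\<lambda>y. h' (x,y) (v,0)))" by auto
    ultimately show ?thesis by simp
  qed
  moreover have "Ck_on k UNIV (\<lambda>x. integral {a..b} (\<lambda>y. h' (x,y) (v,0)))" for v
    by (rule Suc.IH[OF c])
  ultimately show ?case by (intro Ck_on_SucI)
qed

section \<open>Fourier series on the torus\<close>

lemma cis_of_int_2pi [simp]: "cis (of_int k * (2 * pi)) = 1" "cis (of_int k * (pi * 2)) = 1"
  by (metis Ints_of_int cis_multiple_2pi mult.commute)+

lemma one_plus_cos_nonneg [simp]: "0 \<le> 1 + cos (x::real)"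
  using cos_ge_minus_one[of x] by linarith

lemma integral_periodic:
  fixes f :: "real \<Rightarrow> complex"
  assumes c: "continuous_on UNIV f" and p: "\<And>x. f (x + p) = f x" and "p > 0"
  shows "integral {a..a+p} f = integral {0..p} f"
proof -
  have fi: "f integrable_on {x..y}" for x y
    using c by (intro integrable_continuous_real) (auto intro: continuous_on_subset)
  have perZ: "f (x + of_int n * p) = f x" for x n
  proof (induction n rule: int_induct[where k = 0])
    case (step1 i) then show ?case using p[of "x + of_int i * p"] by (simp add: algebra_simps)
  next
    case (step2 i) then show ?case using p[of "x + of_int (i - 1) * p"] by (simp add: algebra_simps)
  qed simp
  have sh: "integral {u..v} f = integral {u + of_int n * p..v + of_int n * p} f" for u v n
    using integral_shift[of u "of_int n * p" v f] c perZ by (auto simp: o_def intro: continuous_on_subset)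
  define n where "n = \<lfloor>a / p\<rfloor>"
  have n: "of_int n \<le> a / p" "a / p < of_int n + 1" unfolding n_def by linarith+
  define r where "r = a - of_int n * p"
  have "of_int n * p \<le> a" "a \<le> of_int n * p + p"
    using \<open>p > 0\<close> n by (simp_all add: pos_le_divide_eq pos_divide_less_eq algebra_simps)
  then have r: "0 \<le> r" "r \<le> p" by (auto simp: r_def)
  have "integral {a..a+p} f = integral {r..r+p} f"
    using sh[of r "r+p" n] by (simp add: r_def algebra_simps)
  also have "\<dots> = integral {r..p} f + integral {p..r+p} f"
    using r \<open>p > 0\<close> by (intro Henstock_Kurzweil_Integration.integral_combine[symmetric] fi) auto
  also have "integral {p..r+p} f = integral {0..r} f"
    using sh[of 0 r 1] by simp
  also have "integral {r..p} f + integral {0..r} f = integral {0..p} f"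
    using Henstock_Kurzweil_Integration.integral_combine[OF r fi] by (simp add: add.commute)
  finally show ?thesis .
qed

text \<open>Peak kernel argument. The kernel ((1 + cos t)/2)^n is a trigonometric polynomial, hence
  orthogonal to every translate of \<open>f\<close>; but it concentrates at 0, where the translate
  \<open>g\<close> has the nonzero value \<open>f x0\<close>.\<close>

lemma fourier_unique:
  fixes f :: "real \<Rightarrow> complex"
  assumes c: "continuous_on UNIV f" and p: "\<And>x. f (x + 2*pi) = f x"
    and z: "\<And>k::int. integral {0..2*pi} (\<lambda>t. f t * cis (- (of_int k * t))) = 0"
  shows "f x0 = 0"
proof (rule ccontr)
  assume nz: "f x0 \<noteq> 0"
  define g where "g t = f (x0 + t)" for t
  have gc: "continuous_on A g" for A unfolding g_def
    by (intro continuous_on_compose2[OF c] continuous_intros) auto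
  have gz: "integral {-pi..pi} (\<lambda>t. g t * cis (of_int k * t)) = 0" for k :: int
  proof -
    define h where "h t = f t * cis (of_int k * t)" for t
    have hc: "continuous_on A h" for A unfolding h_def
      by (intro continuous_intros continuous_on_subset[OF c]) auto
    have hp: "h (x + 2*pi) = h x" for x
      using p by (simp add: h_def ring_distribs cis_mult[symmetric])
    have "integral {-pi..pi} (\<lambda>t. g t * cis (of_int k * t)) = integral {-pi..pi} (\<lambda>t. cis (- (of_int k * x0)) * (h \<circ> (\<lambda>x. x + x0)) t)"
      by (intro Henstock_Kurzweil_Integration.integral_cong)
         (auto simp: g_def h_def cis_mult algebra_simps)
    also have "\<dots> = cis (- (of_int k * x0)) * integral {-pi+x0..pi+x0} h"
      using integral_shift[of "-pi" x0 pi h] hc by (simp add: o_def)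
    also have "integral {-pi+x0..pi+x0} h = integral {-pi+x0..-pi+x0+2*pi} h"
      by (simp add: algebra_simps)
    also have "\<dots> = integral {0..2*pi} h" by (rule integral_periodic[OF hc hp]) simp
    also have "\<dots> = 0" using z[of "-k"] by (simp add: h_def[abs_def])
    finally show ?thesis by simp
  qed
  define Q where "Q n t = ((1 + cos t) / 2) ^ n" for n :: nat and t :: real
  have Qc: "continuous_on A (Q n)" for A n unfolding Q_def by (intro continuous_intros) auto
  have gQ: "integral {-pi..pi} (\<lambda>t. g t * of_real (Q n t) * cis (of_int k * t)) = 0" for n k
  \<comment> \<open>Multiplication by (1 + cos t)/2 mixes the frequencies k - 1, k and k + 1, so all
    k are carried along.\<close>
  proof (induction n arbitrary: k)
    case 0 then show ?case using gz by (simp add: Q_def)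
  next
    case (Suc n)
    let ?I = "\<lambda>k t. g t * of_real (Q n t) * cis (of_int k * t)"
    have ii: "?I k integrable_on {-pi..pi}" for k :: int
      by (intro integrable_continuous_real continuous_intros gc Qc)
    have cc: "of_real (cos t) = (cis t + cis (-t)) / 2" for t by (simp add: complex_eq_iff)
    have "g t * of_real (Q (Suc n) t) * cis (of_int k * t)
        = (1/2) * ?I k t + (1/4) * (?I (k+1) t + ?I (k-1) t)" for t
    proof -
      have "of_real (Q (Suc n) t) = of_real (Q n t) * (1 + (cis t + cis (-t))/2) / 2"
        by (simp add: Q_def cc)
      moreover have "cis (of_int (k + 1) * t) = cis t * cis (of_int k * t)" "cis (of_int (k - 1) * t) = cis (-t) * cis (of_int k * t)"
        by (simp_all add: cis_mult algebra_simps)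
      ultimately show ?thesis by (simp add: algebra_simps add_divide_distrib)
    qed
    then have "integral {-pi..pi} (\<lambda>t. g t * of_real (Q (Suc n) t) * cis (of_int k * t))
      = integral {-pi..pi} (\<lambda>t. (1/2) * ?I k t + (1/4) * (?I (k+1) t + ?I (k-1) t))" by simp
    also have "\<dots> = (1/2) * integral {-pi..pi} (?I k) + (1/4) * (integral {-pi..pi} (?I (k+1)) + integral {-pi..pi} (?I (k-1)))"
      using ii by (simp only: Henstock_Kurzweil_Integration.integral_add integrable_add integrable_on_mult_right
         Henstock_Kurzweil_Integration.integral_mult_right)
    also have "\<dots> = 0" unfolding Suc by simp
    finally show ?case .
  qed
  define c0 where "c0 = norm (g 0)"
  have c0: "c0 > 0" using nz by (simp add: c0_def g_def)
  obtain M where M: "\<And>t. t \<in> {-pi..pi} \<Longrightarrow> norm (g t) \<le> M"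
    using compact_imp_bounded[OF compact_continuous_image[OF gc[of "{-pi..pi}"] compact_Icc]]
    unfolding bounded_iff by (metis imageI)
  have M0: "M \<ge> c0" using M[of 0] by (simp add: c0_def)
  have "continuous (at 0) g" using gc[of UNIV] by (simp add: continuous_on_eq_continuous_at)
  then obtain d0 where d0: "d0 > 0" "\<And>t. \<bar>t\<bar> < d0 \<Longrightarrow> norm (g t - g 0) < c0/2"
    using c0 unfolding continuous_at_eps_delta by (metis dist_norm half_gt_zero diff_0_right real_norm_def)
  define d where "d = min (d0/2) 1"
  have d: "d > 0" "d < pi" "\<And>t. \<bar>t\<bar> \<le> d \<Longrightarrow> norm (g t - g 0) < c0/2"
    using d0 pi_gt3 by (auto simp: d_def)
  \<comment> \<open>The kernel is at least r^n for |t| \<le> d/2 and at most q^n for d \<le> |t|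
    \<le> \<pi>. Since q < r, its mass near 0 outgrows its tail exponentially, which
    \<open>bound\<close> turns into a contradiction.\<close>
  define q r where "q = (1 + cos d) / 2" and "r = (1 + cos (d/2)) / 2"
  have qr: "q < r" "q \<ge> 0" using d cos_monotone_0_pi[of "d/2" d] cos_ge_minus_one[of d]
    by (simp_all add: q_def r_def)
  have bound: "c0/2 * d * r ^ n \<le> 2 * pi * (M + c0) * q ^ n" for n
  proof -
    have pw: "norm ((g 0 - g t) * of_real (Q n t)) \<le> c0/2 * Q n t + (M + c0) * q ^ n" if "t \<in> {-pi..pi}" for t
    proof -
      have Q0: "Q n t \<ge> 0" using cos_ge_minus_one[of t] by (simp add: Q_def)
      show ?thesis
      proof (cases "\<bar>t\<bar> \<le> d")
        case True
        have "norm (g 0 - g t) * Q n t \<le> c0/2 * Q n t"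
          using d(3)[OF True] Q0 by (intro mult_right_mono) (auto simp: norm_minus_commute)
        moreover have "(M + c0) * q ^ n \<ge> 0" using M0 c0 qr by simp
        ultimately show ?thesis using Q0 by (simp add: norm_mult)
      next
        case False
        have "cos \<bar>t\<bar> \<le> cos d" using False d that by (intro cos_monotone_0_pi_le) auto
        then have "Q n t \<le> q ^ n" using cos_ge_minus_one[of t] unfolding Q_def q_def
          by (intro power_mono) auto
        moreover have "norm (g 0 - g t) \<le> M + c0"
          using norm_triangle_ineq4[of "g 0" "g t"] M[OF that] by (simp add: c0_def)
        ultimately have "norm (g 0 - g t) * Q n t \<le> (M + c0) * q ^ n"
          using Q0 M0 c0 by (intro mult_mono) auto
        moreover have "c0 / 2 * Q n t \<ge> 0" using c0 Q0 by simp
        ultimately show ?thesis using Q0 by (simp add: norm_mult)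
      qed
    qed
    have Qi: "Q n integrable_on {x..y}" for x y by (intro integrable_continuous_real Qc)
    have gi: "(\<lambda>t. g t * of_real (Q n t)) integrable_on {-pi..pi}"
      "(\<lambda>t. g 0 * of_real (Q n t)) integrable_on {-pi..pi}"
      by (intro integrable_continuous_real continuous_intros gc Qc)+
    have I0: "integral {-pi..pi} (\<lambda>t. g t * of_real (Q n t)) = 0" using gQ[of n 0] by simp
    have "integral {-pi..pi} (\<lambda>t. (g 0 - g t) * of_real (Q n t))
        = integral {-pi..pi} (\<lambda>t. g 0 * of_real (Q n t))"
      using Henstock_Kurzweil_Integration.integral_diff[OF gi(2,1)] I0 by (simp add: left_diff_distrib)
    also have "\<dots> = g 0 * integral {-pi..pi} (\<lambda>t. of_real (Q n t))"
      by (rule integral_mult_right)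
    also have "integral {-pi..pi} (\<lambda>t. complex_of_real (Q n t)) = complex_of_real (integral {-pi..pi} (Q n))"
      using integral_linear[OF Qi, of "of_real :: real \<Rightarrow> complex" "-pi" pi] by (simp add: o_def bounded_linear_of_real)
    finally have e1: "integral {-pi..pi} (\<lambda>t. (g 0 - g t) * of_real (Q n t)) = g 0 * of_real (integral {-pi..pi} (Q n))" .
    have Ipos: "integral {-pi..pi} (Q n) \<ge> d * r ^ n"
    proof -
      have "integral {-(d/2)..d/2} (\<lambda>t. r ^ n) \<le> integral {-(d/2)..d/2} (Q n)"
      proof (intro integral_le Qi)
        fix t assume t: "t \<in> {-(d/2)..d/2}"
        have "cos (d/2) \<le> cos \<bar>t\<bar>" using d t by (intro cos_monotone_0_pi_le) auto
        then show "r ^ n \<le> Q n t" using cos_ge_minus_one[of "d/2"] unfolding r_def Q_def by (intro power_mono) auto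
      qed auto
      also have "\<dots> \<le> integral {-pi..pi} (Q n)"
        using d by (intro integral_subset_le Qi) (auto simp: Q_def)
      finally show ?thesis using d by simp
    qed
    have "norm (g 0 * of_real (integral {-pi..pi} (Q n))) \<le> integral {-pi..pi} (\<lambda>t. c0/2 * Q n t + (M + c0) * q ^ n)"
      unfolding e1[symmetric] using pw
      by (intro integral_norm_bound_integral integrable_continuous_real continuous_intros gc Qc) auto
    also have "\<dots> = c0/2 * integral {-pi..pi} (Q n) + 2 * pi * (M + c0) * q ^ n"
      by (subst Henstock_Kurzweil_Integration.integral_add) (auto intro!: integrable_continuous_real continuous_intros Qc)
    finally have "c0 * integral {-pi..pi} (Q n) \<le> c0/2 * integral {-pi..pi} (Q n) + 2 * pi * (M + c0) * q ^ n"
      using Ipos d qr by (simp add: norm_mult c0_def abs_le_iff) (smt (verit) mult_left_mono norm_ge_zero abs_ge_self)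
    then have "c0/2 * integral {-pi..pi} (Q n) \<le> 2 * pi * (M + c0) * q ^ n" by simp
    moreover have "c0/2 * (d * r ^ n) \<le> c0/2 * integral {-pi..pi} (Q n)" using Ipos c0 by simp
    ultimately show ?thesis by simp
  qed
  have qr': "0 \<le> q/r" "q/r < 1" using qr by auto
  have "(\<lambda>n. 2 * pi * (M + c0) * (q/r) ^ n) \<longlonglongrightarrow> 2 * pi * (M + c0) * 0"
    by (rule tendsto_mult[OF tendsto_const LIMSEQ_realpow_zero[OF qr']])
  moreover have "c0/2 * d \<le> 2 * pi * (M + c0) * (q/r) ^ n" for n
    using bound[of n] qr by (simp add: power_divide field_simps)
  ultimately have "c0/2 * d \<le> 2 * pi * (M + c0) * 0" by (intro LIMSEQ_le_const) auto
  moreover have "c0 * d > 0" using c0 d by simp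
  ultimately show False by simp
qed

lemma has_sum_integral_infsum:
  fixes \<phi> :: "'i \<Rightarrow> real \<Rightarrow> complex"
  assumes c: "\<And>i. i \<in> I \<Longrightarrow> continuous_on {a..b} (\<phi> i)" and b: "\<And>i x. i \<in> I \<Longrightarrow> x \<in> {a..b} \<Longrightarrow> norm (\<phi> i x) \<le> B i"
    and s: "B summable_on I"
  shows "((\<lambda>i. integral {a..b} (\<phi> i)) has_sum integral {a..b} (\<lambda>x. \<Sum>\<^sub>\<infinity>i\<in>I. \<phi> i x)) I"
proof -
  \<comment> \<open>Replacing the terms outside \<open>I\<close> by 0 makes every finite partial sum
    continuous, including those with indices outside \<open>I\<close>.\<close>
  define \<psi> where "\<psi> i = (if i \<in> I then \<phi> i else (\<lambda>x. 0))" for i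
  have \<psi>: "continuous_on {a..b} (\<psi> i)" for i using c by (auto simp: \<psi>_def)
  have ul: "uniform_limit {a..b} (\<lambda>X x. \<Sum>i\<in>X. \<psi> i x) (\<lambda>x. \<Sum>\<^sub>\<infinity>i\<in>I. \<psi> i x) (finite_subsets_at_top I)"
    using b s by (intro Weierstrass_m_test_general) (auto simp: \<psi>_def)
  have "finite_subsets_at_top I \<noteq> bot" by simp
  from uniform_limit_integral[OF ul continuous_on_sum[OF \<psi>] this] obtain F J where
    F: "\<And>X. ((\<lambda>x. \<Sum>i\<in>X. \<psi> i x) has_integral F X) {a..b}"
    and J: "((\<lambda>x. \<Sum>\<^sub>\<infinity>i\<in>I. \<psi> i x) has_integral J) {a..b}" "(F \<longlongrightarrow> J) (finite_subsets_at_top I)" by blast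
  have FX: "F X = (\<Sum>i\<in>X. integral {a..b} (\<psi> i))" if "finite X" for X
  proof -
    have "((\<lambda>x. \<Sum>i\<in>X. \<psi> i x) has_integral (\<Sum>i\<in>X. integral {a..b} (\<psi> i))) {a..b}"
      using that \<psi> by (intro has_integral_sum integrable_integral integrable_continuous_real)
    then show ?thesis using F has_integral_unique by blast
  qed
  have "((\<lambda>i. integral {a..b} (\<psi> i)) has_sum J) I"
    unfolding has_sum_def
    by (rule Lim_transform_eventually[OF J(2)]) (auto simp: FX intro: eventually_finite_subsets_at_top_weakI)
  moreover have "J = integral {a..b} (\<lambda>x. \<Sum>\<^sub>\<infinity>i\<in>I. \<psi> i x)" using J(1) by (simp add: integral_unique)
  moreover have "(\<Sum>\<^sub>\<infinity>i\<in>I. \<psi> i x) = (\<Sum>\<^sub>\<infinity>i\<in>I. \<phi> i x)" for x by (intro infsum_cong) (simp add: \<psi>_def)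
  moreover have "((\<lambda>i. integral {a..b} (\<psi> i)) has_sum J) I \<longleftrightarrow> ((\<lambda>i. integral {a..b} (\<phi> i)) has_sum J) I"
    by (intro has_sum_cong) (simp add: \<psi>_def)
  ultimately show ?thesis by simp
qed

section \<open>Double Fourier series\<close>

definition biperiodic :: "bdry_fun \<Rightarrow> bool" where
  "biperiodic G \<longleftrightarrow> (\<forall>\<theta> s. G (\<theta> + 2*pi, s) = G (\<theta>, s) \<and> G (\<theta>, s + 2*pi) = G (\<theta>, s))"

definition mode :: "int \<times> int \<Rightarrow> bdry_fun" where
  "mode j p = cis (of_int (fst j) * fst p + of_int (snd j) * snd p)"

definition coef :: "bdry_fun \<Rightarrow> int \<times> int \<Rightarrow> complex" where
  "coef G j = integral {0..2*pi} (\<lambda>s. integral {0..2*pi} (\<lambda>\<theta>. G (\<theta>, s) * mode (- j) (\<theta>, s))) / of_real (4 * pi\<^sup>2)"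

lemma smooth_bdry_iff: "G \<in> smooth_bdry \<longleftrightarrow> biperiodic G \<and> smooth_on UNIV G"
  by (auto simp: smooth_bdry_def biperiodic_def)

lemma norm_mode [simp]: "norm (mode j p) = 1"
  by (simp add: mode_def)

lemma continuous_on_mode [continuous_intros]:
  "continuous_on A f \<Longrightarrow> continuous_on A (\<lambda>x. mode j (f x))"
  unfolding mode_def by (intro continuous_intros)

lemma biperiodic_mode [simp]: "biperiodic (mode j)"
proof -
  have "cis (x * (y + 2 * pi) + z) = cis (x * y + z)" "cis (z + x * (y + 2 * pi)) = cis (z + x * y)"
    if "x = of_int k" for k x y z
  proof -
    have "cis (x * (y + 2 * pi) + z) = cis (x * y + z) * cis (of_int k * (2*pi))"
      unfolding cis_mult that by (simp add: algebra_simps)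
    then show "cis (x * (y + 2 * pi) + z) = cis (x * y + z)" by simp
    then show "cis (z + x * (y + 2 * pi)) = cis (z + x * y)" by (simp add: add.commute)
  qed
  then show ?thesis unfolding biperiodic_def mode_def by simp
qed

lemma integral_cis_int:
  "integral {0..2*pi} (\<lambda>t. cis (of_int k * t)) = (if k = 0 then of_real (2*pi) else 0)"
proof (cases "k = 0")
  case False
  have "((\<lambda>t. cis (of_int k * t)) has_integral (cis (of_int k * (2*pi)) / (\<i> * of_int k) - cis (of_int k * 0) / (\<i> * of_int k))) {0..2*pi}"
  proof (rule fundamental_theorem_of_calculus)
    fix x :: real
    have "cis (of_int k * x) = \<i> * of_int k * cis (of_int k * x) / (\<i> * of_int k)" using False by simp
    then show "((\<lambda>t. cis (of_int k * t) / (\<i> * of_int k)) has_vector_derivative cis (of_int k * x)) (at x within {0..2*pi})"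
      using False unfolding has_vector_derivative_def
      by (auto intro!: derivative_eq_intros simp: scaleR_conv_of_real field_simps)
  qed simp
  then show ?thesis using False by (simp add: integral_unique)
qed (simp add: scaleR_conv_of_real)

lemma coef_mode: "coef (mode i) j = (if i = j then 1 else 0)"
proof -
  have "integral {0..2*pi} (\<lambda>s. integral {0..2*pi} (\<lambda>\<theta>. mode i (\<theta>, s) * mode (- j) (\<theta>, s)))
      = integral {0..2*pi} (\<lambda>s. integral {0..2*pi} (\<lambda>\<theta>. cis (of_int (snd i - snd j) * s) * cis (of_int (fst i - fst j) * \<theta>)))"
    by (simp add: mode_def cis_mult algebra_simps)
  also have "\<dots> = integral {0..2*pi} (\<lambda>s. cis (of_int (snd i - snd j) * s)) * (if fst i - fst j = 0 then of_real (2*pi) else 0)"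
    by (simp only: integral_mult_right integral_mult_left integral_cis_int)
  also have "\<dots> = (if i = j then of_real (4 * pi\<^sup>2) else 0)"
    unfolding integral_cis_int by (auto simp: prod_eq_iff power2_eq_square)
  finally show ?thesis by (simp add: coef_def)
qed

lemma continuous_on_UNIV_slice:
  fixes G :: bdry_fun
  assumes "continuous_on UNIV G"
  shows "continuous_on A (\<lambda>\<theta>. G (\<theta>, s))" "continuous_on A (\<lambda>s. G (\<theta>, s))"
  by (intro continuous_on_compose2[OF assms] continuous_intros; simp)+

lemma continuous_on_inner_integral:
  fixes G :: bdry_fun
  assumes "continuous_on UNIV G"
  shows "continuous_on A (\<lambda>s. integral {a..b} (\<lambda>\<theta>. G (\<theta>, s)))"
proof -
  have "continuous_on (A \<times> cbox a b) (\<lambda>(s, \<theta>). G (\<theta>, s))"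
    unfolding case_prod_unfold by (intro continuous_on_compose2[OF assms] continuous_intros) auto
  from integral_continuous_on_param[OF this] show ?thesis by simp
qed

text \<open>The sum is exchanged with the inner and then with the outer integral; the inner one
  costs the factor 2\<pi> in the majorant.\<close>

lemma coef_has_sum:
  fixes \<phi> :: "'i \<Rightarrow> bdry_fun"
  assumes c: "\<And>i. continuous_on UNIV (\<phi> i)" and b: "\<And>i p. norm (\<phi> i p) \<le> B i" and s: "B summable_on UNIV"
  shows "((\<lambda>i. coef (\<phi> i) j) has_sum coef (\<lambda>p. \<Sum>\<^sub>\<infinity>i. \<phi> i p) j) UNIV"
proof -
  let ?f = "\<lambda>i p. \<phi> i p * mode (- j) p"
  have fc: "continuous_on UNIV (?f i)" for i by (intro continuous_intros c)
  have fb: "norm (?f i p) \<le> B i" for i p using b by (simp add: norm_mult)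
  have B0: "B i \<ge> 0" for i using b[of i "(0,0)"] norm_ge_zero order_trans by blast
  have "((\<lambda>i. integral {0..2*pi} (\<lambda>\<theta>. ?f i (\<theta>, s))) has_sum integral {0..2*pi} (\<lambda>\<theta>. \<Sum>\<^sub>\<infinity>i. ?f i (\<theta>, s))) UNIV" for s
    by (rule has_sum_integral_infsum[OF continuous_on_UNIV_slice(1)[OF fc] fb assms(3)])
  then have inner: "(\<Sum>\<^sub>\<infinity>i. integral {0..2*pi} (\<lambda>\<theta>. ?f i (\<theta>, s))) = integral {0..2*pi} (\<lambda>\<theta>. \<Sum>\<^sub>\<infinity>i. ?f i (\<theta>, s))" for s
    by (rule infsumI)
  have nb: "norm (integral {0..2*pi} (\<lambda>\<theta>. ?f i (\<theta>, s))) \<le> B i * (2*pi)" for i s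
    using integral_bound[of 0 "2*pi" "\<lambda>\<theta>. ?f i (\<theta>, s)" "B i"] fb continuous_on_UNIV_slice(1)[OF fc] by simp
  have "((\<lambda>i. integral {0..2*pi} (\<lambda>s. integral {0..2*pi} (\<lambda>\<theta>. ?f i (\<theta>, s)))) has_sum
     integral {0..2*pi} (\<lambda>s. \<Sum>\<^sub>\<infinity>i. integral {0..2*pi} (\<lambda>\<theta>. ?f i (\<theta>, s)))) UNIV"
    by (rule has_sum_integral_infsum[OF continuous_on_inner_integral[OF fc] nb summable_on_cmult_left[OF s]])
  moreover have "(\<Sum>\<^sub>\<infinity>i. ?f i p) = (\<Sum>\<^sub>\<infinity>i. \<phi> i p) * mode (- j) p" for p
    by (rule infsum_cmult_left')
  ultimately have "((\<lambda>i. integral {0..2*pi} (\<lambda>s. integral {0..2*pi} (\<lambda>\<theta>. ?f i (\<theta>, s)))) has_sum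
     integral {0..2*pi} (\<lambda>s. integral {0..2*pi} (\<lambda>\<theta>. (\<Sum>\<^sub>\<infinity>i. \<phi> i (\<theta>, s)) * mode (- j) (\<theta>, s)))) UNIV"
    by (simp add: inner)
  from has_sum_divide_const[OF this, of "of_real (4 * pi\<^sup>2)"] show ?thesis by (simp only: coef_def)
qed

lemma coef_cmult: "coef (\<lambda>p. c * G p) j = c * coef G j"
  unfolding coef_def mult.assoc by (simp only: integral_mult_right times_divide_eq_right)

section \<open>Rapidly decreasing coefficients and smooth functions on the torus\<close>

definition rapid :: "(int \<times> int \<Rightarrow> complex) \<Rightarrow> bool" where
  "rapid c \<longleftrightarrow> (\<forall>N. (\<lambda>j. norm (c j) * (1 + \<bar>of_int (fst j)\<bar> + \<bar>of_int (snd j)\<bar>) ^ N) summable_on UNIV)"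

definition fourier :: "(int \<times> int \<Rightarrow> complex) \<Rightarrow> bdry_fun" where
  "fourier c p = (\<Sum>\<^sub>\<infinity>j. c j * mode j p)"

lemma rapid_abs_summable: "rapid c \<Longrightarrow> (\<lambda>j. norm (c j)) summable_on UNIV"
  unfolding rapid_def by (erule allE[of _ 0]) simp

lemma rapid_mono:
  assumes "rapid c" "\<And>j. norm (d j) \<le> M * norm (c j)"
  shows "rapid d"
  unfolding rapid_def
proof
  fix N
  let ?w = "\<lambda>j::int \<times> int. (1 + \<bar>of_int (fst j)\<bar> + \<bar>of_int (snd j)\<bar>) ^ N :: real"
  have "(\<lambda>j. M * (norm (c j) * ?w j)) summable_on UNIV"
    using assms(1) by (intro summable_on_cmult_right) (auto simp: rapid_def)
  then show "(\<lambda>j. norm (d j) * ?w j) summable_on UNIV"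
  proof (rule summable_on_comparison_test)
    show "norm (d j) * ?w j \<le> M * (norm (c j) * ?w j)" for j
      using mult_right_mono[OF assms(2)[of j], of "?w j"] by (simp add: mult.assoc)
  qed simp
qed

lemma coef_fourier:
  assumes "(\<lambda>j. norm (c j)) summable_on UNIV"
  shows "coef (fourier c) j = c j"
proof -
  have "((\<lambda>i. coef (\<lambda>p. c i * mode i p) j) has_sum coef (\<lambda>p. \<Sum>\<^sub>\<infinity>i. c i * mode i p) j) UNIV"
    by (rule coef_has_sum[OF _ _ assms]) (auto intro!: continuous_intros simp: norm_mult)
  moreover have "((\<lambda>i. coef (\<lambda>p. c i * mode i p) j) has_sum c j) UNIV"
    by (rule has_sum_finite_neutralI[of "{j}"]) (auto simp: coef_cmult coef_mode)
  ultimately show ?thesis using has_sum_unique by (fastforce simp: fourier_def[abs_def])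
qed

lemma Ck_bounded_mono: "Ck_bounded k S f B \<Longrightarrow> B \<le> B' \<Longrightarrow> Ck_bounded k S f B'"
proof (induction k arbitrary: f B B')
  case 0 then show ?case by fastforce
next
  case (Suc k)
  then obtain f' where "\<forall>x\<in>S. (f has_derivative f' x) (at x within S)" "\<forall>v. Ck_bounded k S (\<lambda>x. f' x v) (B * norm v)"
    by auto
  moreover have "B * norm v \<le> B' * norm v" for v :: 'a using Suc.prems(2) by (intro mult_right_mono) auto
  ultimately have "\<forall>v. Ck_bounded k S (\<lambda>x. f' x v) (B' * norm v)" using Suc.IH by blast
  moreover have "\<forall>x\<in>S. norm (f x) \<le> B'"
    using Suc.prems Ck_bounded_norm[OF Suc.prems(1)] order_trans by blast
  ultimately show ?case using \<open>\<forall>x\<in>S. (f has_derivative f' x) (at x within S)\<close>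
    unfolding Ck_bounded.simps by blast
qed

text \<open>A derivative in direction v multiplies a mode by a factor of size at most the weight 1 +
  |m| + |l| times \<open>norm v\<close>. The bound is thus of the kind that \<open>rapid\<close>
  sums.\<close>

lemma Ck_bounded_mode:
  "Ck_bounded k UNIV (\<lambda>p. a * mode j p) (norm a * (1 + \<bar>of_int (fst j)\<bar> + \<bar>of_int (snd j)\<bar>) ^ k)"
proof (induction k arbitrary: a)
  case 0
  then show ?case by (auto intro!: continuous_intros simp: norm_mult)
next
  case (Suc k)
  let ?w = "1 + \<bar>of_int (fst j)\<bar> + \<bar>of_int (snd j)\<bar> :: real"
  let ?L = "\<lambda>v::real \<times> real. of_int (fst j) * fst v + of_int (snd j) * snd v :: real"
  have "((\<lambda>p. a * mode j p) has_derivative (\<lambda>v. a * (\<i> * of_real (?L v)) * mode j p)) (at p)" for p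
    unfolding mode_def
    by (auto intro!: derivative_eq_intros simp: scaleR_conv_of_real algebra_simps)
  moreover have "Ck_bounded k UNIV (\<lambda>p. a * (\<i> * of_real (?L v)) * mode j p) (norm a * ?w ^ Suc k * norm v)" for v
  proof (rule Ck_bounded_mono[OF Suc])
    have "\<bar>?L v\<bar> \<le> \<bar>of_int (fst j)\<bar> * norm v + \<bar>of_int (snd j)\<bar> * norm v"
      using norm_fst_le[of "fst v" "snd v"] norm_snd_le[of "snd v" "fst v"]
      by (intro order_trans[OF abs_triangle_ineq] add_mono) (auto simp: abs_mult intro!: mult_left_mono)
    also have "\<dots> \<le> ?w * norm v" by (simp add: algebra_simps)
    finally have "norm a * \<bar>?L v\<bar> * ?w ^ k \<le> norm a * (?w * norm v) * ?w ^ k"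
      by (intro mult_right_mono mult_left_mono) auto
    then show "norm (a * (\<i> * of_real (?L v))) * ?w ^ k \<le> norm a * ?w ^ Suc k * norm v"
      by (simp add: norm_mult algebra_simps del: of_real_add of_real_mult)
  qed
  moreover have "norm (a * mode j p) \<le> norm a * ?w ^ Suc k" for p
    using mult_left_mono[OF one_le_power[of ?w "Suc k"], of "norm a"] by (simp add: norm_mult)
  ultimately show ?case unfolding Ck_bounded.simps by (intro conjI ballI exI[of _ "\<lambda>p v. a * (\<i> * of_real (?L v)) * mode j p"]) auto
qed

lemma smooth_on_fourier: "rapid c \<Longrightarrow> smooth_on UNIV (fourier c)"
  unfolding smooth_on_def
proof
  fix k assume "rapid c"
  then have "(\<lambda>j. norm (c j) * (1 + \<bar>of_int (fst j)\<bar> + \<bar>of_int (snd j)\<bar>) ^ k) summable_on UNIV"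
    by (simp add: rapid_def)
  from Ck_on_infsum[OF convex_UNIV _ _ Ck_bounded_mode this] show "Ck_on k UNIV (fourier c)"
    by (simp add: fourier_def[abs_def] finite_prod)
qed

lemma biperiodic_fourier [simp]: "biperiodic (fourier c)"
  using biperiodic_mode unfolding biperiodic_def fourier_def by simp

lemma fourier_smooth_bdry: "rapid c \<Longrightarrow> fourier c \<in> smooth_bdry"
  by (simp add: smooth_bdry_iff smooth_on_fourier)

text \<open>One-variable uniqueness applied twice: for fixed m the coefficient in \<theta> is a
  periodic function of s, and its own coefficients are those of \<open>G\<close>.\<close>

lemma coef_eq_0_imp:
  assumes c: "continuous_on UNIV G" and p: "biperiodic G" and z: "\<And>j. coef G j = 0"
  shows "G (\<theta>, s) = 0"
proof (rule fourier_unique[where f = "\<lambda>\<theta>. G (\<theta>, s)"])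
  show "continuous_on UNIV (\<lambda>\<theta>. G (\<theta>, s))" by (rule continuous_on_UNIV_slice[OF c])
  show "G (\<theta> + 2 * pi, s) = G (\<theta>, s)" for \<theta> using p by (simp add: biperiodic_def)
  fix m :: int
  let ?H = "\<lambda>s. integral {0..2*pi} (\<lambda>\<theta>. G (\<theta>, s) * cis (- (of_int m * \<theta>)))"
  show "?H s = 0"
  proof (rule fourier_unique[where f = ?H])
    show "continuous_on UNIV ?H"
      by (rule continuous_on_inner_integral[where G = "\<lambda>p. G p * cis (- (of_int m * fst p))", simplified])
         (intro continuous_intros c)
    show "?H (s + 2 * pi) = ?H s" for s using p by (simp add: biperiodic_def)
    fix l :: int
    have "integral {0..2*pi} (\<lambda>s. ?H s * cis (- (of_int l * s)))
        = integral {0..2*pi} (\<lambda>s. integral {0..2*pi} (\<lambda>\<theta>. G (\<theta>, s) * mode (- (m, l)) (\<theta>, s)))"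
      unfolding integral_mult_left[symmetric] by (simp add: mode_def mult.assoc cis_mult algebra_simps)
    also have "\<dots> = 0" using z[of "(m, l)"] by (simp add: coef_def)
    finally show "integral {0..2*pi} (\<lambda>s. ?H s * cis (- (of_int l * s))) = 0" .
  qed
qed

text \<open>Integration by parts; periodicity cancels the boundary terms.\<close>

lemma integral_deriv_cis:
  fixes f :: "real \<Rightarrow> complex"
  assumes d: "\<And>t. (f has_vector_derivative f' t) (at t)" and c: "continuous_on UNIV f'" and p: "f (2*pi) = f 0"
  shows "integral {0..2*pi} (\<lambda>t. f' t * cis (- (of_int k * t))) = \<i> * of_int k * integral {0..2*pi} (\<lambda>t. f t * cis (- (of_int k * t)))"
proof -
  have fc: "continuous_on A f" for A
    by (intro continuous_at_imp_continuous_on ballI has_vector_derivative_continuous[OF d])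
  let ?D = "\<lambda>t. f' t * cis (- (of_int k * t)) - \<i> * of_int k * (f t * cis (- (of_int k * t)))"
  have "(?D has_integral (f (2*pi) * cis (- (of_int k * (2*pi))) - f 0 * cis (- (of_int k * 0)))) {0..2*pi}"
  proof (rule fundamental_theorem_of_calculus)
    fix t :: real
    have "((\<lambda>t. cis (- (of_int k * t))) has_vector_derivative - (\<i> * of_int k) * cis (- (of_int k * t))) (at t)"
      unfolding has_vector_derivative_def by (auto intro!: derivative_eq_intros simp: scaleR_conv_of_real algebra_simps)
    note deriv = has_vector_derivative_mult[OF d this]
    have "f t * (- (\<i> * of_int k) * cis (- (of_int k * t))) + f' t * cis (- (of_int k * t)) = ?D t"
      by (simp only: diff_conv_add_uminus mult_minus_left mult_minus_right ac_simps)
    then show "((\<lambda>t. f t * cis (- (of_int k * t))) has_vector_derivative ?D t) (at t within {0..2*pi})"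
      using has_vector_derivative_at_within[OF deriv] by (simp only:)
  qed simp
  moreover have "cis (- (of_int k * (2*pi))) = 1" using cis_of_int_2pi(1)[of "-k"] by simp
  ultimately have "integral {0..2*pi} ?D = 0" using p by (simp add: integral_unique)
  moreover have "integral {0..2*pi} ?D = integral {0..2*pi} (\<lambda>t. f' t * cis (- (of_int k * t)))
      - integral {0..2*pi} (\<lambda>t. \<i> * of_int k * (f t * cis (- (of_int k * t))))"
    by (intro Henstock_Kurzweil_Integration.integral_diff integrable_continuous_real continuous_intros fc
        continuous_on_subset[OF c]) auto
  ultimately show ?thesis by (simp only: integral_mult_right) simp
qed

lemma integral_torus_swap:
  fixes H :: bdry_fun
  assumes "continuous_on UNIV H"
  shows "integral {a..b} (\<lambda>s. integral {c..d} (\<lambda>\<theta>. H (\<theta>, s))) = integral {c..d} (\<lambda>\<theta>. integral {a..b} (\<lambda>s. H (\<theta>, s)))"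
proof -
  have "continuous_on (cbox (a, c) (b, d)) (\<lambda>(s, \<theta>). H (\<theta>, s))"
    unfolding case_prod_unfold by (intro continuous_on_compose2[OF assms] continuous_intros) auto
  from integral_swap_continuous[OF this] show ?thesis by simp
qed

lemma has_vector_derivative_slice:
  fixes G :: bdry_fun
  assumes "\<And>p. (G has_derivative G' p) (at p)"
  shows "((\<lambda>\<theta>. G (\<theta>, s)) has_vector_derivative G' (\<theta>, s) (1, 0)) (at \<theta>)"
    "((\<lambda>s. G (\<theta>, s)) has_vector_derivative G' (\<theta>, s) (0, 1)) (at s)"
proof -
  have lin: "linear (G' (\<theta>, s))" using assms has_derivative_linear by blast
  have "((\<lambda>\<theta>. G (\<theta>, s)) has_derivative (\<lambda>h. G' (\<theta>, s) (h, 0))) (at \<theta>)"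
    by (rule has_derivative_compose[OF _ assms, of "\<lambda>\<theta>. (\<theta>, s)" "\<lambda>h. (h, 0)"]) (auto intro!: derivative_eq_intros)
  moreover have "(\<lambda>h. G' (\<theta>, s) (h, 0)) = (\<lambda>h. h *\<^sub>R G' (\<theta>, s) (1, 0))"
  proof
    show "G' (\<theta>, s) (h, 0) = h *\<^sub>R G' (\<theta>, s) (1,0)" for h using linear_cmul[OF lin, of h "(1,0)"] by simp
  qed
  ultimately show "((\<lambda>\<theta>. G (\<theta>, s)) has_vector_derivative G' (\<theta>, s) (1, 0)) (at \<theta>)"
    unfolding has_vector_derivative_def by (simp only:)
  have "((\<lambda>s. G (\<theta>, s)) has_derivative (\<lambda>h. G' (\<theta>, s) (0, h))) (at s)"
    by (rule has_derivative_compose[OF _ assms, of "\<lambda>s. (\<theta>, s)" "\<lambda>h. (0, h)"]) (auto intro!: derivative_eq_intros)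
  moreover have "(\<lambda>h. G' (\<theta>, s) (0, h)) = (\<lambda>h. h *\<^sub>R G' (\<theta>, s) (0, 1))"
  proof
    show "G' (\<theta>, s) (0, h) = h *\<^sub>R G' (\<theta>, s) (0,1)" for h using linear_cmul[OF lin, of h "(0,1)"] by simp
  qed
  ultimately show "((\<lambda>s. G (\<theta>, s)) has_vector_derivative G' (\<theta>, s) (0, 1)) (at s)"
    unfolding has_vector_derivative_def by (simp only:)
qed

lemma coef_partial_derivatives:
  assumes "G \<in> smooth_bdry"
  obtains G1 G2 where "G1 \<in> smooth_bdry" "\<And>j. coef G1 j = \<i> * of_int (fst j) * coef G j"
    and "G2 \<in> smooth_bdry" "\<And>j. coef G2 j = \<i> * of_int (snd j) * coef G j"
proof -
  have sm: "smooth_on UNIV G" and per: "biperiodic G" using assms by (auto simp: smooth_bdry_iff)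
  obtain G' where d: "\<And>p. (G has_derivative G' p) (at p)" and s': "\<And>v. smooth_on UNIV (\<lambda>p. G' p v)"
    using smooth_on_derivative[OF sm] by blast
  \<comment> \<open>A period of \<open>G\<close> is a period of its derivative, because the
    translate has both derivatives and derivatives are unique.\<close>
  have shift: "G' (p + q) = G' p" if "\<And>p. G (p + q) = G p" for p q
  proof -
    have "((\<lambda>p. G (p + q)) has_derivative G' (p + q)) (at p)"
      by (rule has_derivative_compose[OF _ d, of "\<lambda>p. p + q" "\<lambda>h. h"]) (auto intro!: derivative_eq_intros)
    then show ?thesis using d[of p] that by (simp add: has_derivative_unique)
  qed
  have "G' (p + (2*pi, 0)) = G' p" "G' (p + (0, 2*pi)) = G' p" for p
    using per by (intro shift; simp add: biperiodic_def split: prod.splits; force)+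
  then have "biperiodic (\<lambda>p. G' p v)" for v
    unfolding biperiodic_def by (metis add_Pair add.right_neutral)
  then have sm': "(\<lambda>p. G' p v) \<in> smooth_bdry" for v using s' by (simp add: smooth_bdry_iff)
  have c': "continuous_on UNIV (\<lambda>p. G' p v)" for v using s' smooth_on_continuous by blast
  have Gc: "continuous_on UNIV G" using sm smooth_on_continuous by blast
  have per1: "G (2*pi, s) = G (0, s)" "G (\<theta>, 2*pi) = G (\<theta>, 0)" for \<theta> s
    using per unfolding biperiodic_def by (metis add_0)+
  have split1: "mode (- j) (\<theta>, s) = cis (- (of_int (fst j) * \<theta>)) * cis (- (of_int (snd j) * s))"
    and split2: "mode (- j) (\<theta>, s) = cis (- (of_int (snd j) * s)) * cis (- (of_int (fst j) * \<theta>))" for \<theta> s j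
    by (simp_all add: mode_def cis_mult algebra_simps)
  have "coef (\<lambda>p. G' p (1,0)) j = \<i> * of_int (fst j) * coef G j" for j
  proof -
    have "integral {0..2*pi} (\<lambda>\<theta>. G' (\<theta>, s) (1,0) * cis (- (of_int (fst j) * \<theta>)))
      = \<i> * of_int (fst j) * integral {0..2*pi} (\<lambda>\<theta>. G (\<theta>, s) * cis (- (of_int (fst j) * \<theta>)))" for s
      by (rule integral_deriv_cis[OF has_vector_derivative_slice(1)[OF d] continuous_on_UNIV_slice(1)[OF c'] per1(1)])
    then show ?thesis unfolding coef_def split1 mult.assoc[symmetric]
      by (simp only: integral_mult_left) (simp only: mult.assoc integral_mult_right times_divide_eq_right)
  qed
  moreover have "coef (\<lambda>p. G' p (0,1)) j = \<i> * of_int (snd j) * coef G j" for j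
  proof -
    have ibp: "integral {0..2*pi} (\<lambda>s. G' (\<theta>, s) (0,1) * cis (- (of_int (snd j) * s)))
      = \<i> * of_int (snd j) * integral {0..2*pi} (\<lambda>s. G (\<theta>, s) * cis (- (of_int (snd j) * s)))" for \<theta>
      by (rule integral_deriv_cis[OF has_vector_derivative_slice(2)[OF d] continuous_on_UNIV_slice(2)[OF c'] per1(2)])
    \<comment> \<open>For the second variable the integrals are swapped, so that integration by
      parts again takes place in the inner one.\<close>
    have "coef F j = integral {0..2*pi} (\<lambda>\<theta>. integral {0..2*pi} (\<lambda>s. F (\<theta>, s) * mode (- j) (\<theta>, s))) / of_real (4 * pi\<^sup>2)"
      if "continuous_on UNIV F" for F
      unfolding coef_def by (subst integral_torus_swap[where H = "\<lambda>p. F p * mode (- j) p"]) (intro continuous_intros that, simp)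
    note sw = this
    show ?thesis unfolding sw[OF c'] sw[OF Gc] unfolding split2 mult.assoc[symmetric]
      by (simp only: integral_mult_left ibp) (simp only: mult.assoc integral_mult_right times_divide_eq_right)
  qed
  ultimately show thesis using that sm' by blast
qed

lemma coef_bounded:
  assumes "continuous_on UNIV G"
  obtains C where "\<And>j. norm (coef G j) \<le> C"
proof -
  have "compact ({0..2*pi} \<times> {0..2*pi} :: (real \<times> real) set)" by (intro compact_Times compact_Icc)
  then have "bounded (G ` ({0..2*pi} \<times> {0..2*pi}))"
    by (intro compact_imp_bounded compact_continuous_image continuous_on_subset[OF assms]) auto
  then obtain M where M: "\<And>\<theta> s. \<theta> \<in> {0..2*pi} \<Longrightarrow> s \<in> {0..2*pi} \<Longrightarrow> norm (G (\<theta>, s)) \<le> M"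
    unfolding bounded_iff by (metis imageI mem_Sigma_iff)
  have "norm (coef G j) \<le> M" for j
  proof -
    let ?f = "\<lambda>p. G p * mode (- j) p"
    have fc: "continuous_on UNIV ?f" by (intro continuous_intros assms)
    have nb: "norm (?f (\<theta>, s)) \<le> M" if "\<theta> \<in> {0..2*pi}" "s \<in> {0..2*pi}" for \<theta> s
      using M[OF that] by (simp add: norm_mult)
    have "norm (integral {0..2*pi} (\<lambda>\<theta>. ?f (\<theta>, s))) \<le> M * (2*pi - 0)" if "s \<in> {0..2*pi}" for s
      by (rule integral_bound[OF _ continuous_on_UNIV_slice(1)[OF fc] nb[OF _ that]]) auto
    note nb2 = this
    have "norm (integral {0..2*pi} (\<lambda>s. integral {0..2*pi} (\<lambda>\<theta>. ?f (\<theta>, s)))) \<le> (M * (2*pi - 0)) * (2*pi - 0)"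
      by (rule integral_bound[OF _ continuous_on_inner_integral[OF fc] nb2]) auto
    then show ?thesis by (simp add: coef_def norm_divide norm_mult norm_power power2_eq_square field_simps)
  qed
  then show thesis by (rule that)
qed

lemma summable_on_inverse_square_int: "(\<lambda>m::int. inverse ((1 + \<bar>of_int m\<bar>)\<^sup>2 :: real)) summable_on UNIV"
proof -
  have "summable (\<lambda>n. inverse (real (Suc n) ^ 2))"
    using inverse_power_summable[of 2, where 'a = real] by (subst summable_Suc_iff) simp
  then have s: "(\<lambda>n::nat. inverse ((1 + real n)\<^sup>2)) summable_on UNIV"
    by (intro norm_summable_imp_summable_on) (simp add: add.commute)
  have "(\<lambda>m::int. inverse ((1 + \<bar>of_int m\<bar>)\<^sup>2 :: real)) summable_on range int"
    "(\<lambda>m::int. inverse ((1 + \<bar>of_int m\<bar>)\<^sup>2 :: real)) summable_on range (\<lambda>n. - int n)"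
    using s by (subst summable_on_reindex; simp add: inj_on_def o_def)+
  then have "(\<lambda>m::int. inverse ((1 + \<bar>of_int m\<bar>)\<^sup>2 :: real)) summable_on (range int \<union> range (\<lambda>n. - int n))"
    by (rule summable_on_union)
  moreover have "range int \<union> range (\<lambda>n. - int n) = UNIV"
    using int_cases2 by (auto simp: image_iff) metis
  ultimately show ?thesis by simp
qed

lemma rapidI:
  assumes "\<And>N. \<exists>C. \<forall>j. norm (c j) * (1 + \<bar>of_int (fst j)\<bar> + \<bar>of_int (snd j)\<bar>) ^ N \<le> C"
  shows "rapid c"
  unfolding rapid_def
proof
  fix N
  let ?w = "\<lambda>j::int \<times> int. 1 + \<bar>of_int (fst j)\<bar> + \<bar>of_int (snd j)\<bar> :: real"
  let ?i = "\<lambda>m::int. inverse ((1 + \<bar>of_int m\<bar>)\<^sup>2 :: real)"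
  \<comment> \<open>Four spare powers of the weight dominate (1 + |m|)^2 (1 + |l|)^2, whose inverse
    is summable over all pairs of integers.\<close>
  obtain C where C: "\<And>j. norm (c j) * ?w j ^ (N + 4) \<le> C" using assms by blast
  have "(\<lambda>j. ?i (fst j) * ?i (snd j)) summable_on Sigma UNIV (\<lambda>_. UNIV)"
    by (rule summable_on_SigmaI[where g = "\<lambda>m. ?i m * infsum ?i UNIV"])
       (auto intro!: has_sum_cmult_right has_sum_infsum summable_on_cmult_left summable_on_inverse_square_int)
  then have "(\<lambda>j. C * (?i (fst j) * ?i (snd j))) summable_on UNIV" by (intro summable_on_cmult_right) simp
  then show "(\<lambda>j. norm (c j) * ?w j ^ N) summable_on UNIV"
  proof (rule summable_on_comparison_test)
    fix j :: "int \<times> int"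
    have w: "?w j > 0" by (simp add: add_pos_nonneg)
    have C0: "C \<ge> 0" using order_trans[OF _ C[of j]] w by simp
    have "(1 + \<bar>of_int (fst j)\<bar>)\<^sup>2 * (1 + \<bar>of_int (snd j)\<bar>)\<^sup>2 \<le> ?w j ^ 2 * ?w j ^ 2"
      by (intro mult_mono power_mono) auto
    then have *: "inverse (?w j ^ 4) \<le> ?i (fst j) * ?i (snd j)"
      unfolding inverse_mult_distrib[symmetric] by (intro le_imp_inverse_le) (auto simp flip: power_add intro!: mult_pos_pos zero_less_power add_pos_nonneg)
    have "norm (c j) * ?w j ^ N = norm (c j) * ?w j ^ (N + 4) * inverse (?w j ^ 4)"
      using w by (simp add: power_add)
    also have "\<dots> \<le> C * (?i (fst j) * ?i (snd j))"
      using C[of j] * C0 w by (intro mult_mono) auto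
    finally show "norm (c j) * ?w j ^ N \<le> C * (?i (fst j) * ?i (snd j))" .
  qed simp
qed

lemma rapid_coef:
  assumes "G \<in> smooth_bdry" shows "rapid (coef G)"
proof (rule rapidI)
  fix N
  show "\<exists>C. \<forall>j. norm (coef G j) * (1 + \<bar>of_int (fst j)\<bar> + \<bar>of_int (snd j)\<bar>) ^ N \<le> C"
    using assms
  proof (induction N arbitrary: G)
    case 0
    then have "continuous_on UNIV G" by (auto simp: smooth_bdry_iff smooth_on_continuous)
    then show ?case using coef_bounded[of G] by (metis power_0 mult.right_neutral)
  next
    case (Suc N)
    let ?w = "\<lambda>j::int \<times> int. 1 + \<bar>of_int (fst j)\<bar> + \<bar>of_int (snd j)\<bar> :: real"
    from coef_partial_derivatives[OF Suc.prems] obtain G1 G2 where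
      G: "G1 \<in> smooth_bdry" "\<And>j. coef G1 j = \<i> * of_int (fst j) * coef G j"
         "G2 \<in> smooth_bdry" "\<And>j. coef G2 j = \<i> * of_int (snd j) * coef G j" by metis
    obtain C C1 C2 where C: "\<And>j. norm (coef G j) * ?w j ^ N \<le> C" "\<And>j. norm (coef G1 j) * ?w j ^ N \<le> C1"
      "\<And>j. norm (coef G2 j) * ?w j ^ N \<le> C2" using Suc.IH[OF Suc.prems] Suc.IH[OF G(1)] Suc.IH[OF G(3)] by metis
    have "norm (coef G j) * ?w j ^ Suc N \<le> C + C1 + C2" for j
    proof -
      \<comment> \<open>The extra weight 1 + |m| + |l| is exactly the sum of the absolute
        multipliers of \<open>G\<close> and of its two partial derivatives.\<close>
      have "norm (coef G j) * ?w j ^ Suc N = (norm (coef G j) + norm (coef G1 j) + norm (coef G2 j)) * ?w j ^ N"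
        by (simp add: G norm_mult algebra_simps)
      then show ?thesis using C[of j] by (simp add: ring_distribs)
    qed
    then show ?case by blast
  qed
qed

lemma coef_diff:
  assumes "continuous_on UNIV F" "continuous_on UNIV G"
  shows "coef (\<lambda>p. F p - G p) j = coef F j - coef G j"
proof -
  have c: "continuous_on UNIV (\<lambda>p. F p * mode (- j) p)" "continuous_on UNIV (\<lambda>p. G p * mode (- j) p)"
    by (intro continuous_intros assms)+
  have "integral {0..2*pi} (\<lambda>\<theta>. F (\<theta>, s) * mode (- j) (\<theta>, s) - G (\<theta>, s) * mode (- j) (\<theta>, s))
    = integral {0..2*pi} (\<lambda>\<theta>. F (\<theta>, s) * mode (- j) (\<theta>, s)) - integral {0..2*pi} (\<lambda>\<theta>. G (\<theta>, s) * mode (- j) (\<theta>, s))" for s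
    by (intro Henstock_Kurzweil_Integration.integral_diff integrable_continuous_real continuous_on_UNIV_slice(1)[OF c(1)]
        continuous_on_UNIV_slice(1)[OF c(2)])
  then show ?thesis unfolding coef_def left_diff_distrib diff_divide_distrib[symmetric]
    by (simp add: Henstock_Kurzweil_Integration.integral_diff integrable_continuous_real
        continuous_on_inner_integral[OF c(1)] continuous_on_inner_integral[OF c(2)])
qed

lemma coef_inject:
  assumes "continuous_on UNIV F" "biperiodic F" "continuous_on UNIV G" "biperiodic G" "\<And>j. coef F j = coef G j"
  shows "F = G"
proof
  fix p :: "real \<times> real"
  obtain \<theta> s where p: "p = (\<theta>, s)" by (cases p)
  have "(\<lambda>p. F p - G p) (\<theta>, s) = 0"
    by (rule coef_eq_0_imp) (use assms in \<open>auto intro!: continuous_intros simp: coef_diff biperiodic_def\<close>)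
  then show "F p = G p" by (simp add: p)
qed

lemma fourier_coef:
  assumes "G \<in> smooth_bdry"
  shows "fourier (coef G) = G"
proof (rule coef_inject)
  have r: "rapid (coef G)" by (rule rapid_coef[OF assms])
  show "coef (fourier (coef G)) j = coef G j" for j by (rule coef_fourier[OF rapid_abs_summable[OF r]])
  show "continuous_on UNIV (fourier (coef G))" by (rule smooth_on_continuous[OF smooth_on_fourier[OF r]])
qed (use assms in \<open>auto simp: smooth_bdry_iff smooth_on_continuous\<close>)

text \<open>Uniqueness of polar coordinates in an angular window shorter than 2\<pi>. Real angles,
  not only angles modulo 2\<pi>, are identified this way below.\<close>

lemma cis_scaled_eq_imp:
  assumes "cis x * of_real a = cis y * of_real b" "a > 0" "b > 0" "\<bar>x - y\<bar> < 2 * pi"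
  shows "x = y" "a = b"
proof -
  have "norm (cis x * of_real a) = norm (cis y * of_real b)" using assms(1) by simp
  then show ab: "a = b" using assms(2,3) by (simp add: norm_mult)
  then have "cis x = cis y" using assms(1,3) by simp
  then have "cis (x - y) = 1" by (simp add: cis_divide[symmetric])
  then have "cos (x - y) = 1" by (metis cis.sel(1) one_complex.sel(1))
  then obtain n :: int where "x - y = of_int n * 2 * pi" unfolding cos_one_2pi_int by blast
  then have n: "x - y = of_int n * (2 * pi)" by simp
  have "\<bar>of_int n\<bar> * (2 * pi) < 1 * (2 * pi)" using assms(4) unfolding n by (simp add: abs_mult)
  then have "\<bar>of_int n\<bar> < (1::real)" using mult_less_cancel_right_pos pi_gt_zero by (metis mult_pos_pos zero_less_numeral)
  then have "\<bar>n\<bar> < 1" by (metis of_int_abs of_int_less_1_iff)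
  then show "x = y" using n by simp
qed

section \<open>The scattering angle\<close>

lemma cis_arctan: "cis (arctan y) * of_real (sqrt (1 + y\<^sup>2)) = 1 + \<i> * of_real y"
proof -
  have "sqrt (1 + y\<^sup>2) > 0" by (simp add: add_pos_nonneg)
  then show ?thesis by (simp add: complex_eq_iff cos_arctan sin_arctan)
qed

locale curvature =
  fixes \<kappa> :: real
  assumes \<kappa>: "-1 < \<kappa>" "\<kappa> < 1"
begin

abbreviation "s \<equiv> scat_angle \<kappa>"

text \<open>The squared modulus of \<open>cis \<alpha> + \<kappa> cis (-\<alpha>)\<close>. The
  quotient (1 - \<kappa>^2) / \<open>pois\<close> is a Poisson kernel in the doubled angle and turns
  out to be the derivative of the scattering angle; \<open>wt\<close> is its square root.\<close>

definition pois :: "real \<Rightarrow> real" where "pois \<alpha> = 1 + \<kappa>\<^sup>2 + 2 * \<kappa> * cos (2 * \<alpha>)"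

definition wt :: "real \<Rightarrow> real" where "wt \<alpha> = sqrt ((1 - \<kappa>\<^sup>2) / pois \<alpha>)"

lemma \<kappa>_cos: "\<bar>\<kappa> * cos x\<bar> \<le> \<bar>\<kappa>\<bar>" "\<bar>\<kappa>\<bar> < 1"
  using mult_left_mono[of "\<bar>cos x\<bar>" 1 "\<bar>\<kappa>\<bar>"] \<kappa> by (auto simp: abs_mult)

lemma one_plus_pos: "1 + \<kappa> * cos x > 0"
  using \<kappa>_cos(1)[of x] \<kappa>_cos(2) by linarith

lemma pois_pos: "pois \<alpha> > 0"
proof -
  have "(1 - \<bar>\<kappa>\<bar>)\<^sup>2 > 0" using \<kappa>_cos(2) by simp
  moreover have "(1 - \<bar>\<kappa>\<bar>)\<^sup>2 = 1 + \<kappa>\<^sup>2 - 2 * \<bar>\<kappa>\<bar>" by (simp add: power2_eq_square algebra_simps)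
  ultimately show ?thesis using \<kappa>_cos(1)[of "2 * \<alpha>"] by (simp add: pois_def)
qed

lemma \<kappa>2: "1 - \<kappa>\<^sup>2 > 0"
  using \<kappa>_cos(2) by (simp add: abs_square_less_1)

lemma wt_pos: "wt \<alpha> > 0"
  using pois_pos \<kappa>2 by (simp add: wt_def)

lemma wt_sq: "(wt \<alpha>)\<^sup>2 = (1 - \<kappa>\<^sup>2) / pois \<alpha>"
  using pois_pos[of \<alpha>] \<kappa>2 by (simp add: wt_def)

text \<open>A closed form for the scattering angle that is manifestly smooth.\<close>

definition s' :: "real \<Rightarrow> real" where
  "s' \<alpha> = \<alpha> - arctan (\<kappa> * sin (2 * \<alpha>) / (1 + \<kappa> * cos (2 * \<alpha>)))"

text \<open>The number 1 + \<kappa> \<open>cis (- (2 * \<alpha>))\<close> has positive real part, so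
  its argument is the arctangent that occurs in \<open>s'\<close>; multiplication by
  \<open>cis \<alpha>\<close> adds \<alpha>.\<close>

lemma cis_s': "cis (s' \<alpha>) * of_real (sqrt (pois \<alpha>)) = cis \<alpha> + of_real \<kappa> * cis (- \<alpha>)"
proof -
  define d where "d = 1 + \<kappa> * cos (2 * \<alpha>)"
  define y where "y = \<kappa> * sin (2 * \<alpha>) / d"
  have d: "d > 0" unfolding d_def by (rule one_plus_pos)
  have "pois \<alpha> = d\<^sup>2 + (\<kappa> * sin (2*\<alpha>))\<^sup>2"
    unfolding pois_def d_def using sin_cos_squared_add[of "2*\<alpha>"] by algebra
  then have "pois \<alpha> = d\<^sup>2 * (1 + y\<^sup>2)" using d by (simp add: y_def field_simps)
  then have "sqrt (pois \<alpha>) = d * sqrt (1 + (-y)\<^sup>2)" using d by (simp add: real_sqrt_mult)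
  then have "cis (s' \<alpha>) * of_real (sqrt (pois \<alpha>)) = cis \<alpha> * of_real d * (cis (arctan (-y)) * of_real (sqrt (1 + (-y)\<^sup>2)))"
    by (simp add: s'_def y_def d_def cis_mult arctan_minus)
  also have "\<dots> = cis \<alpha> * (of_real d - \<i> * of_real (\<kappa> * sin (2*\<alpha>)))"
    unfolding cis_arctan using d by (simp add: y_def field_simps)
  also have "of_real d - \<i> * of_real (\<kappa> * sin (2*\<alpha>)) = 1 + of_real \<kappa> * cis (- (2*\<alpha>))"
    by (simp add: d_def complex_eq_iff)
  also have "cis \<alpha> * (1 + of_real \<kappa> * cis (- (2*\<alpha>))) = cis \<alpha> + of_real \<kappa> * cis (- \<alpha>)"
    by (simp add: algebra_simps cis_mult)
  finally show ?thesis .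
qed

text \<open>After removal of multiples of \<pi>, which shift both sides alike, both angles are
  arguments of \<open>cis a + \<kappa> cis (-a)\<close> and lie less than 2\<pi> apart. Only the
  endpoint -\<pi>/2, where the tangent takes a default value, is checked directly.\<close>

lemma scat_angle_eq: "s \<alpha> = s' \<alpha>"
proof -
  define m where "m = \<lfloor>\<alpha> / pi + 1/2\<rfloor>"
  define a where "a = \<alpha> - of_int m * pi"
  have "of_int m \<le> \<alpha> / pi + 1/2" "\<alpha> / pi + 1/2 < of_int m + 1" unfolding m_def by linarith+
  then have "of_int m * pi \<le> (\<alpha> / pi + 1/2) * pi" "(\<alpha> / pi + 1/2) * pi < (of_int m + 1) * pi"
    by (intro mult_right_mono mult_strict_right_mono; simp)+
  then have a: "- (pi/2) \<le> a" "a < pi/2" by (auto simp: a_def algebra_simps)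
  have \<alpha>: "\<alpha> = a + of_int m * pi" by (simp add: a_def)
  have per: "sin (2*\<alpha>) = sin (2*a)" "cos (2*\<alpha>) = cos (2*a)"
  proof -
    have "cis (2*\<alpha>) = cis (2*a) * cis (of_int m * (2*pi))"
      unfolding cis_mult by (simp add: \<alpha> algebra_simps)
    then have "cis (2*\<alpha>) = cis (2*a)" by simp
    then show "sin (2*\<alpha>) = sin (2*a)" "cos (2*\<alpha>) = cos (2*a)" by (metis cis.sel)+
  qed
  have s'\<alpha>: "s' \<alpha> = of_int m * pi + s' a" unfolding s'_def per by (simp add: \<alpha>)
  have s\<alpha>: "s \<alpha> = of_int m * pi + (if a = - (pi/2) then - (pi/2) else arctan ((1 - \<kappa>) / (1 + \<kappa>) * tan a))"
    unfolding scat_angle_def Let_def m_def[symmetric] a_def[symmetric] ..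
  show ?thesis
  proof (cases "a = - (pi/2)")
    case True
    then have "s' a = - (pi/2)" by (simp add: s'_def)
    then show ?thesis using True s\<alpha> s'\<alpha> by simp
  next
    case False
    then have ca: "cos a > 0" using a by (intro cos_gt_zero_pi) auto
    define y where "y = (1 - \<kappa>) / (1 + \<kappa>) * tan a"
    have yc: "y * ((1 + \<kappa>) * cos a) = (1 - \<kappa>) * sin a"
      using ca \<kappa> by (simp add: y_def tan_def)
    have "cis (arctan y) * of_real (sqrt (1 + y\<^sup>2) * ((1 + \<kappa>) * cos a)) = (1 + \<i> * of_real y) * of_real ((1 + \<kappa>) * cos a)"
      unfolding cis_arctan[symmetric] by simp
    also have "\<dots> = of_real ((1 + \<kappa>) * cos a) + \<i> * of_real ((1 - \<kappa>) * sin a)"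
      unfolding yc[symmetric] by (simp add: algebra_simps)
    also have "\<dots> = cis a + of_real \<kappa> * cis (- a)" by (simp add: complex_eq_iff algebra_simps)
    finally have eq: "cis (arctan y) * of_real (sqrt (1 + y\<^sup>2) * ((1 + \<kappa>) * cos a)) = cis (s' a) * of_real (sqrt (pois a))"
      unfolding cis_s' .
    have pos: "sqrt (1 + y\<^sup>2) * ((1 + \<kappa>) * cos a) > 0" using ca \<kappa> by (simp add: add_pos_nonneg)
    have bnd: "\<bar>arctan y - s' a\<bar> < 2 * pi"
      using a arctan_lbound[of y] arctan_ubound[of y] arctan_lbound[of "\<kappa> * sin (2 * a) / (1 + \<kappa> * cos (2 * a))"]
        arctan_ubound[of "\<kappa> * sin (2 * a) / (1 + \<kappa> * cos (2 * a))"] pi_gt_zero unfolding s'_def by linarith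
    have "arctan y = s' a" by (rule cis_scaled_eq_imp(1)[OF eq pos _ bnd]) (simp add: pois_pos)
    then show ?thesis using False s\<alpha> s'\<alpha> by (simp add: y_def)
  qed
qed

lemma cis_s: "cis (s \<alpha>) * of_real (sqrt (pois \<alpha>)) = cis \<alpha> + of_real \<kappa> * cis (- \<alpha>)"
  unfolding scat_angle_eq by (rule cis_s')

lemma cos_s: "cos (s \<alpha>) * sqrt (pois \<alpha>) = (1 + \<kappa>) * cos \<alpha>"
  using arg_cong[OF cis_s, of Re] by (simp add: algebra_simps)

lemma sin_s: "sin (s \<alpha>) * sqrt (pois \<alpha>) = (1 - \<kappa>) * sin \<alpha>"
  using arg_cong[OF cis_s, of Im] by (simp add: algebra_simps)

lemma s_diff_bound: "\<bar>s \<alpha> - \<alpha>\<bar> < pi/2"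
  using arctan_lbound[of "\<kappa> * sin (2 * \<alpha>) / (1 + \<kappa> * cos (2 * \<alpha>))"]
        arctan_ubound[of "\<kappa> * sin (2 * \<alpha>) / (1 + \<kappa> * cos (2 * \<alpha>))"] unfolding scat_angle_eq s'_def by linarith

lemma s_add_pi [simp]: "s (\<alpha> + pi) = s \<alpha> + pi"
proof -
  have "sin (2 * (\<alpha> + pi)) = sin (2*\<alpha>)" "cos (2 * (\<alpha> + pi)) = cos (2*\<alpha>)" by (simp_all add: distrib_left)
  then show ?thesis unfolding scat_angle_eq s'_def by simp
qed

lemma s_add_2pi [simp]: "s (\<alpha> + 2*pi) = s \<alpha> + 2*pi"
  using s_add_pi[of \<alpha>] s_add_pi[of "\<alpha> + pi"] by (simp add: algebra_simps)

lemma s_minus [simp]: "s (- \<alpha>) = - s \<alpha>"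
  unfolding scat_angle_eq s'_def by (simp add: arctan_minus)

lemma s_pi_minus [simp]: "s (pi - \<alpha>) = pi - s \<alpha>"
  using s_add_pi[of "-\<alpha>"] by simp

lemma s_half_pi [simp]: "s (pi/2) = pi/2"
  unfolding scat_angle_eq s'_def by simp

lemma has_real_derivative_s: "(s has_real_derivative (wt \<alpha>)\<^sup>2) (at \<alpha> within A)"
proof -
  define C S where "C = cos (2*\<alpha>)" and "S = sin (2*\<alpha>)"
  define d where "d = 1 + \<kappa> * C"
  have d: "d > 0" unfolding d_def C_def by (rule one_plus_pos)
  have SC: "S\<^sup>2 + C\<^sup>2 = 1" by (simp add: S_def C_def)
  define y' where "y' = (2 * \<kappa> * C * d + 2 * \<kappa> * S * (\<kappa> * S)) / d\<^sup>2"
  have hY: "((\<lambda>\<alpha>. \<kappa> * sin (2 * \<alpha>) / (1 + \<kappa> * cos (2 * \<alpha>))) has_real_derivative y') (at \<alpha> within A)"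
    unfolding y'_def using d
    by (auto intro!: derivative_eq_intros simp: C_def S_def d_def power2_eq_square algebra_simps)
  have "(s' has_real_derivative 1 - inverse (1 + (\<kappa> * S / d)\<^sup>2) * y') (at \<alpha> within A)"
    unfolding s'_def using DERIV_diff[OF DERIV_ident DERIV_chain'[OF hY DERIV_arctan]] by (simp add: C_def S_def d_def)
  moreover have "1 - inverse (1 + (\<kappa> * S / d)\<^sup>2) * y' = (wt \<alpha>)\<^sup>2"
  proof -
    have p: "pois \<alpha> = d\<^sup>2 + (\<kappa> * S)\<^sup>2" unfolding pois_def d_def C_def[symmetric] using SC by algebra
    have "inverse (1 + (\<kappa> * S / d)\<^sup>2) = d\<^sup>2 / pois \<alpha>" unfolding p using d by (simp add: field_simps)
    then have "1 - inverse (1 + (\<kappa> * S / d)\<^sup>2) * y' = (pois \<alpha> - (2 * \<kappa> * C * d + 2 * \<kappa> * S * (\<kappa> * S))) / pois \<alpha>"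
      unfolding y'_def using d pois_pos[of \<alpha>] by (simp add: field_simps)
    also have "pois \<alpha> - (2 * \<kappa> * C * d + 2 * \<kappa> * S * (\<kappa> * S)) = 1 - \<kappa>\<^sup>2"
      unfolding pois_def d_def C_def[symmetric] using SC by algebra
    finally show ?thesis by (simp add: wt_sq)
  qed
  ultimately show ?thesis by (simp add: scat_angle_eq[abs_def])
qed

lemma deriv_s: "deriv s \<alpha> = (wt \<alpha>)\<^sup>2"
  using has_real_derivative_s by (intro DERIV_imp_deriv)

lemma strict_mono_s: "strict_mono s"
proof (rule strict_monoI)
  fix x y :: real assume "x < y"
  then show "s x < s y"
  proof (rule DERIV_pos_imp_increasing)
    show "\<exists>D. (s has_real_derivative D) (at z) \<and> 0 < D" for z
      using has_real_derivative_s[of z UNIV] wt_pos[of z] by (intro exI[of _ "(wt z)\<^sup>2"]) simp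
  qed
qed

lemma s_influx: "\<alpha> \<in> {- (pi/2)..pi/2} \<Longrightarrow> s \<alpha> \<in> {- (pi/2)..pi/2}"
  using strict_mono_less_eq[OF strict_mono_s, of "-(pi/2)" \<alpha>] strict_mono_less_eq[OF strict_mono_s, of \<alpha> "pi/2"] by simp

lemma smooth_on_s [smooth_intros]: "smooth_on A f \<Longrightarrow> smooth_on A (\<lambda>x. s (f x))"
  unfolding scat_angle_eq s'_def by (intro smooth_intros) (use one_plus_pos less_irrefl in metis)+

lemma smooth_on_wt [smooth_intros]: "smooth_on A f \<Longrightarrow> smooth_on A (\<lambda>x. wt (f x))"
  unfolding wt_def pois_def[abs_def]
  by (intro smooth_intros) (use pois_pos \<kappa>2 in \<open>auto simp: pois_def less_imp_neq[THEN not_sym]\<close>)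

lemma continuous_on_s [continuous_intros]: "continuous_on A f \<Longrightarrow> continuous_on A (\<lambda>x. s (f x))"
  by (rule continuous_on_compose2[OF smooth_on_continuous[OF smooth_on_s[OF smooth_on_id, of UNIV]]]) auto

lemma continuous_on_wt [continuous_intros]: "continuous_on A f \<Longrightarrow> continuous_on A (\<lambda>x. wt (f x))"
  by (rule continuous_on_compose2[OF smooth_on_continuous[OF smooth_on_wt[OF smooth_on_id, of UNIV]]]) auto

lemma wt_simps [simp]: "wt (- \<alpha>) = wt \<alpha>" "wt (\<alpha> + pi) = wt \<alpha>" "wt (pi - \<alpha>) = wt \<alpha>" "wt (\<alpha> + 2*pi) = wt \<alpha>"
proof -
  have p: "pois (\<alpha> + pi) = pois \<alpha>" "pois (- \<alpha>) = pois \<alpha>" for \<alpha> by (simp_all add: pois_def distrib_left)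
  show "wt (- \<alpha>) = wt \<alpha>" and a: "wt (\<alpha> + pi) = wt \<alpha>" by (simp_all add: wt_def p)
  show "wt (pi - \<alpha>) = wt \<alpha>" using p(1)[of "-\<alpha>"] p(2) by (simp add: wt_def)
  show "wt (\<alpha> + 2*pi) = wt \<alpha>" using p(1)[of \<alpha>] p(1)[of "\<alpha> + pi"] by (simp add: wt_def algebra_simps)
qed

lemma den_nonzero: "norm z \<le> 1 \<Longrightarrow> 1 + of_real \<kappa> * z\<^sup>2 \<noteq> (0::complex)"
proof
  assume z: "norm z \<le> 1" and "1 + of_real \<kappa> * z\<^sup>2 = 0"
  then have "of_real \<kappa> * z\<^sup>2 = - 1" by (simp add: add_eq_0_iff)
  then have "\<bar>\<kappa>\<bar> * (norm z)\<^sup>2 = 1" by (metis norm_minus_cancel norm_mult norm_of_real norm_one norm_power)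
  moreover have "\<bar>\<kappa>\<bar> * (norm z)\<^sup>2 \<le> \<bar>\<kappa>\<bar> * 1" using z by (intro mult_left_mono) (auto simp: power_le_one)
  ultimately show False using \<kappa>_cos(2) by simp
qed

lemma cis_double: "cis \<alpha> ^ 2 = cis (2 * \<alpha>)"
  by (simp add: power2_eq_square cis_mult)

lemma cis_plus_factor: "cis \<alpha> + of_real \<kappa> * cis (- \<alpha>) = cis (- \<alpha>) * ((cis \<alpha>)\<^sup>2 + of_real \<kappa>)"
  by (simp add: power2_eq_square algebra_simps cis_mult)

lemma pois_factor: "of_real (pois \<alpha>) = (cis \<alpha> + of_real \<kappa> * cis (- \<alpha>)) * (cis (- \<alpha>) * (1 + of_real \<kappa> * (cis \<alpha>)\<^sup>2))"
proof -
  have "cis \<alpha> * cis (- \<alpha>) = 1" by (simp add: cis_mult)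
  then have "(cis \<alpha> + of_real \<kappa> * cis (- \<alpha>)) * (cis (- \<alpha>) * (1 + of_real \<kappa> * (cis \<alpha>)\<^sup>2))
     = 1 + of_real \<kappa> * ((cis \<alpha>)\<^sup>2 + (cis (- \<alpha>))\<^sup>2) + (of_real \<kappa>)\<^sup>2" by algebra
  also have "\<dots> = 1 + of_real \<kappa> * (cis (2*\<alpha>) + cis (-(2*\<alpha>))) + (of_real \<kappa>)\<^sup>2"
    by (simp add: cis_double)
  also have "\<dots> = of_real (pois \<alpha>)" by (simp add: pois_def complex_eq_iff power2_eq_square)
  finally show ?thesis ..
qed

text \<open>The weight turns \<open>cis (s \<alpha>)\<close> into a rational function of z =
  \<open>cis \<alpha>\<close> without poles in the closed disk and with a zero at 0. Together with
  \<open>cis_2s\<close> this covers all odd positive multiples of the scattering angle.\<close>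

lemma wt_cis: "of_real (wt \<alpha>) * cis (s \<alpha>) = of_real (sqrt (1 - \<kappa>\<^sup>2)) * cis \<alpha> / (1 + of_real \<kappa> * (cis \<alpha>)\<^sup>2)"
proof -
  define P where "P = sqrt (pois \<alpha>)"
  have P: "P > 0" "P * P = pois \<alpha>" using pois_pos[of \<alpha>] by (auto simp: P_def)
  have D: "1 + of_real \<kappa> * (cis \<alpha>)\<^sup>2 \<noteq> 0" by (rule den_nonzero) simp
  have c: "cis (s \<alpha>) * of_real P = cis \<alpha> + of_real \<kappa> * cis (- \<alpha>)" using cis_s by (simp add: P_def)
  have "of_real P * of_real P = cis (s \<alpha>) * of_real P * (cis (- \<alpha>) * (1 + of_real \<kappa> * (cis \<alpha>)\<^sup>2))"
    unfolding c pois_factor[symmetric] P(2)[symmetric] by simp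
  then have "of_real P = cis (s \<alpha>) * (cis (- \<alpha>) * (1 + of_real \<kappa> * (cis \<alpha>)\<^sup>2))" using P(1) by simp
  then have "of_real P * cis \<alpha> = cis (s \<alpha>) * (1 + of_real \<kappa> * (cis \<alpha>)\<^sup>2) * (cis \<alpha> * cis (- \<alpha>))" by (simp add: ac_simps)
  then have e: "of_real P * cis \<alpha> = cis (s \<alpha>) * (1 + of_real \<kappa> * (cis \<alpha>)\<^sup>2)" by (simp add: cis_mult)
  have "wt \<alpha> * P = sqrt (1 - \<kappa>\<^sup>2)" using P by (simp add: wt_def P_def real_sqrt_divide)
  then have "of_real (sqrt (1 - \<kappa>\<^sup>2)) * cis \<alpha> = of_real (wt \<alpha>) * (of_real P * cis \<alpha>)" by (metis mult.assoc of_real_mult)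
  then show ?thesis unfolding e using D by (simp add: field_simps)
qed

text \<open>The Moebius map of the overview; it acts on the doubled angle.\<close>

lemma cis_2s: "(cis (s \<alpha>))\<^sup>2 = ((cis \<alpha>)\<^sup>2 + of_real \<kappa>) / (1 + of_real \<kappa> * (cis \<alpha>)\<^sup>2)"
proof -
  have D: "1 + of_real \<kappa> * (cis \<alpha>)\<^sup>2 \<noteq> 0" by (rule den_nonzero) simp
  have p: "of_real (pois \<alpha>) \<noteq> (0::complex)" using pois_pos[of \<alpha>] by simp
  have "(cis (s \<alpha>))\<^sup>2 * of_real (pois \<alpha>) = (cis \<alpha> + of_real \<kappa> * cis (- \<alpha>))\<^sup>2"
    using pois_pos[of \<alpha>] by (simp flip: cis_s add: power_mult_distrib flip: of_real_power)
  then have "(cis (s \<alpha>))\<^sup>2 * ((cis \<alpha> + of_real \<kappa> * cis (- \<alpha>)) * (cis (- \<alpha>) * (1 + of_real \<kappa> * (cis \<alpha>)\<^sup>2)))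
      = (cis \<alpha> + of_real \<kappa> * cis (- \<alpha>)) * (cis \<alpha> + of_real \<kappa> * cis (- \<alpha>))"
    unfolding pois_factor by (simp add: power2_eq_square)
  moreover have "cis \<alpha> + of_real \<kappa> * cis (- \<alpha>) \<noteq> 0" using p unfolding pois_factor by auto
  ultimately have "(cis (s \<alpha>))\<^sup>2 * (cis (- \<alpha>) * (1 + of_real \<kappa> * (cis \<alpha>)\<^sup>2)) = cis (- \<alpha>) * ((cis \<alpha>)\<^sup>2 + of_real \<kappa>)"
    unfolding cis_plus_factor[symmetric] by (metis mult.left_commute mult_cancel_left)
  then have "cis (- \<alpha>) * ((cis (s \<alpha>))\<^sup>2 * (1 + of_real \<kappa> * (cis \<alpha>)\<^sup>2)) = cis (- \<alpha>) * ((cis \<alpha>)\<^sup>2 + of_real \<kappa>)"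
    by (simp only: ac_simps)
  then have "(cis (s \<alpha>))\<^sup>2 * (1 + of_real \<kappa> * (cis \<alpha>)\<^sup>2) = (cis \<alpha>)\<^sup>2 + of_real \<kappa>" by simp
  then show ?thesis using D by (simp add: field_simps)
qed

end

text \<open>The inverse Moebius map has parameter -\<kappa>: combining the relation \<open>c\<close>
  with its conjugate \<open>c'\<close> eliminates \<open>cis (- \<alpha>)\<close>. Both angles move
  by less than \<pi>/2, which excludes a multiple of 2\<pi>.\<close>

lemma scat_angle_inverse:
  assumes "-1 < \<kappa>" "\<kappa> < 1"
  shows "scat_angle (- \<kappa>) (scat_angle \<kappa> \<alpha>) = \<alpha>"
proof -
  interpret p: curvature \<kappa> using assms by unfold_locales
  interpret m: curvature "- \<kappa>" using assms by unfold_locales auto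
  define \<sigma> where "\<sigma> = scat_angle \<kappa> \<alpha>"
  define P where "P = sqrt (p.pois \<alpha>)"
  have P: "P > 0" using p.pois_pos by (simp add: P_def)
  have c: "cis \<sigma> * of_real P = cis \<alpha> + of_real \<kappa> * cis (- \<alpha>)" unfolding \<sigma>_def P_def by (rule p.cis_s)
  from arg_cong[OF this, of cnj] have c': "cis (- \<sigma>) * of_real P = cis (- \<alpha>) + of_real \<kappa> * cis \<alpha>"
    by (simp add: cis_cnj)
  have "cis (scat_angle (- \<kappa>) \<sigma>) * of_real (sqrt (m.pois \<sigma>) * P) = cis \<sigma> * of_real P - of_real \<kappa> * (cis (- \<sigma>) * of_real P)"
    using arg_cong[OF m.cis_s[of \<sigma>], of "\<lambda>z. z * of_real P"] by (simp add: algebra_simps)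
  also have "\<dots> = cis \<alpha> * of_real (1 - \<kappa>\<^sup>2)" unfolding c c' by (simp add: algebra_simps power2_eq_square)
  finally have eq: "cis (scat_angle (- \<kappa>) \<sigma>) * of_real (sqrt (m.pois \<sigma>) * P) = cis \<alpha> * of_real (1 - \<kappa>\<^sup>2)" .
  have bnd: "\<bar>scat_angle (- \<kappa>) \<sigma> - \<alpha>\<bar> < 2*pi"
    using p.s_diff_bound[of \<alpha>] m.s_diff_bound[of \<sigma>] unfolding \<sigma>_def by linarith
  have "sqrt (m.pois \<sigma>) * P > 0" using m.pois_pos[of \<sigma>] P by simp
  from cis_scaled_eq_imp(1)[OF eq this p.\<kappa>2 bnd] show ?thesis by (simp add: \<sigma>_def)
qed

section \<open>Mean values on the circle and inversion on a single fiber\<close>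

lemma integral_holomorphic_cis:
  assumes "g holomorphic_on ball 0 R" "1 < R"
  shows "integral {0..2*pi} (\<lambda>t. g (cis t)) = of_real (2*pi) * g 0"
proof -
  have "g holomorphic_on cball 0 1" by (rule holomorphic_on_subset[OF assms(1)]) (use assms(2) in auto)
  then have "((\<lambda>u. g u / (u - 0)) has_contour_integral 2 * of_real pi * \<i> * g 0) (circlepath 0 1)"
    by (intro Cauchy_integral_circlepath_simple) auto
  then have "((\<lambda>t. g (cis t) * \<i>) has_integral 2 * of_real pi * \<i> * g 0) {0..2*pi}"
    unfolding circlepath_def by (subst (asm) has_contour_integral_part_circlepath_iff) simp_all
  then have "((\<lambda>t. g (cis t) * \<i> * (- \<i>)) has_integral 2 * of_real pi * \<i> * g 0 * (- \<i>)) {0..2*pi}"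
    by (rule has_integral_mult_left)
  moreover have "2 * of_real pi * \<i> * g 0 * (- \<i>) = of_real (2*pi) * g 0" by (simp add: complex_eq_iff)
  moreover have "(\<lambda>t. g (cis t) * \<i> * (- \<i>)) = (\<lambda>t. g (cis t))" by (simp add: mult.assoc)
  ultimately have "((\<lambda>t. g (cis t)) has_integral of_real (2*pi) * g 0) {0..2*pi}" by (simp only:)
  then show ?thesis by (rule integral_unique)
qed

lemma fourier_has_sum:
  assumes "(\<lambda>j. norm (c j)) summable_on UNIV"
  shows "((\<lambda>j. c j * mode j p) has_sum fourier c p) UNIV"
  unfolding fourier_def
  by (rule has_sum_infsum[OF abs_summable_summable]) (use assms in \<open>simp add: norm_mult\<close>)

lemma fourier_lincomb:
  assumes "(\<lambda>j. norm (c j)) summable_on UNIV" "(\<lambda>j. norm (d j)) summable_on UNIV"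
  shows "fourier (\<lambda>j. a * c j + b * d j) p = a * fourier c p + b * fourier d p"
proof -
  have "((\<lambda>j. a * (c j * mode j p) + b * (d j * mode j p)) has_sum a * fourier c p + b * fourier d p) UNIV"
    by (intro has_sum_add has_sum_cmult_right fourier_has_sum assms)
  then show ?thesis unfolding fourier_def[of "\<lambda>j. a * c j + b * d j"] by (intro infsumI) (simp add: algebra_simps)
qed

lemma coef_fst_const:
  assumes c: "continuous_on UNIV F"
  shows "coef (\<lambda>p. F (\<beta>, snd p)) j = (if fst j = 0 then fiber_coeff F (snd j) \<beta> else 0)"
proof -
  have m: "mode (- j) (\<theta>, t) = cis (- (of_int (snd j) * t)) * cis (of_int (- fst j) * \<theta>)" for \<theta> t
    by (simp add: mode_def cis_mult algebra_simps)
  have "integral {0..2*pi} (\<lambda>t. integral {0..2*pi} (\<lambda>\<theta>. F (\<beta>, t) * mode (- j) (\<theta>, t)))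
    = integral {0..2*pi} (\<lambda>t. F (\<beta>, t) * cis (- (of_int (snd j) * t)) * (if - fst j = 0 then of_real (2*pi) else 0))"
    unfolding m mult.assoc[symmetric] by (simp only: integral_mult_right integral_cis_int)
  then show ?thesis
    by (auto simp: coef_def fiber_coeff_def power2_eq_square)
qed

text \<open>The one-variable inversion formula comes from the torus:
  \<open>F (\<beta>, \<cdot>)\<close> is regarded as a function on the torus that does not depend on
  the first variable.\<close>

lemma fiber_inversion:
  assumes F: "F \<in> smooth_bdry"
  shows "((\<lambda>k. fiber_coeff F k \<beta> * cis (of_int k * \<alpha>)) has_sum F (\<beta>, \<alpha>)) UNIV"
proof -
  let ?G = "\<lambda>p. F (\<beta>, snd p)"
  have Fs: "smooth_on UNIV F" and Fp: "biperiodic F" using F by (auto simp: smooth_bdry_iff)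
  have "smooth_on UNIV ?G"
    by (rule smooth_on_compose[OF Fs, of _ "\<lambda>p. (\<beta>, snd p)"]) (intro smooth_intros, simp)
  then have G: "?G \<in> smooth_bdry" using Fp by (simp add: smooth_bdry_iff biperiodic_def)
  have cG: "coef ?G j = (if fst j = 0 then fiber_coeff F (snd j) \<beta> else 0)" for j
    by (rule coef_fst_const[OF smooth_on_continuous[OF Fs]])
  have "((\<lambda>j. coef ?G j * mode j (0, \<alpha>)) has_sum fourier (coef ?G) (0, \<alpha>)) UNIV"
    by (rule fourier_has_sum[OF rapid_abs_summable[OF rapid_coef[OF G]]])
  then have "((\<lambda>j. coef ?G j * mode j (0, \<alpha>)) has_sum F (\<beta>, \<alpha>)) UNIV" by (simp add: fourier_coef[OF G])
  also have "?this \<longleftrightarrow> ((\<lambda>j. coef ?G j * mode j (0, \<alpha>)) has_sum F (\<beta>, \<alpha>)) (range (Pair 0))"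
    by (rule has_sum_cong_neutral) (auto simp: cG image_iff)
  also have "\<dots> \<longleftrightarrow> ((\<lambda>k. fiber_coeff F k \<beta> * cis (of_int k * \<alpha>)) has_sum F (\<beta>, \<alpha>)) UNIV"
    by (subst has_sum_reindex) (auto simp: inj_on_def o_def cG mode_def)
  finally show ?thesis .
qed

section \<open>The fiberwise Hilbert transform on weighted modes\<close>

context curvature begin

text \<open>
  The weight satisfies \<open>wt\<^sup>2 = s'\<close>, so \<open>lift\<close> is an isometry between functions of \<open>(\<theta>, t)\<close> and
  functions of \<open>(\<beta>, \<alpha>)\<close>.
\<close>

definition lift :: "bdry_fun \<Rightarrow> bdry_fun" where
  "lift G p = of_real (wt (snd p)) * G (fst p + s (snd p), s (snd p))"

lemma smooth_on_lift: "smooth_on UNIV G \<Longrightarrow> smooth_on UNIV (lift G)"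
  unfolding lift_def[abs_def]
  by (intro smooth_intros smooth_on_compose[of UNIV G _ "\<lambda>p. (fst p + s (snd p), s (snd p))"]) auto

lemma lift_smooth_bdry: "G \<in> smooth_bdry \<Longrightarrow> lift G \<in> smooth_bdry"
proof -
  assume "G \<in> smooth_bdry"
  then have G: "smooth_on UNIV G" "biperiodic G" by (auto simp: smooth_bdry_iff)
  have p: "G (x + 2*pi, y) = G (x, y)" "G (x, y + 2*pi) = G (x, y)" for x y using G(2) by (auto simp: biperiodic_def)
  have "G (\<theta> + 2*pi + x, y) = G (\<theta> + x, y)" for \<theta> x y
    using p(1)[of "\<theta> + x" y] by (simp add: ac_simps)
  moreover have "G (\<theta> + (x + 2*pi), y + 2*pi) = G (\<theta> + x, y)" for \<theta> x y
    using p(1)[of "\<theta> + x" y] p(2)[of "\<theta> + x + 2*pi" y] by (simp add: ac_simps)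
  ultimately have "biperiodic (lift G)" unfolding biperiodic_def lift_def by simp
  then show ?thesis using smooth_on_lift[OF G(1)] by (simp add: smooth_bdry_iff)
qed

text \<open>For odd q > 0 the weighted exponential is the boundary value of a function holomorphic
  near the closed disk that vanishes at 0, so it has no frequencies k \<le> 0. Conjugation gives q <
  0, and the shift by \<pi> removes even k.\<close>

lemma integral_fiber_eq_0:
  assumes q: "odd q" and "(0 < q \<and> k \<le> 0) \<or> (q < 0 \<and> 0 \<le> k) \<or> even k"
  shows "integral {0..2*pi} (\<lambda>\<alpha>. of_real (wt \<alpha>) * cis (of_int q * s \<alpha>) * cis (- (of_int k * \<alpha>))) = 0"
  using assms(2)
proof (elim disjE)
  have pos: "integral {0..2*pi} (\<lambda>\<alpha>. of_real (wt \<alpha>) * cis (of_int q * s \<alpha>) * cis (- (of_int k * \<alpha>))) = 0"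
    if "odd q" "0 < q" "k \<le> 0" for q k
  proof -
    obtain j where j: "q = 2 * int j + 1"
    proof -
      from \<open>odd q\<close> obtain i where "q = 2 * i + 1" by (elim oddE)
      then show thesis using that(1)[of "nat i"] \<open>0 < q\<close> by simp
    qed
    obtain n where n: "k = - int n" using \<open>k \<le> 0\<close> nonpos_int_cases by blast
    define g where "g z = of_real (sqrt (1 - \<kappa>\<^sup>2)) * z / (1 + of_real \<kappa> * z\<^sup>2) * ((z\<^sup>2 + of_real \<kappa>) / (1 + of_real \<kappa> * z\<^sup>2)) ^ j * z ^ n" for z :: complex
    \<comment> \<open>Any radius with R > 1 and |\<kappa>| R^2 < 1 keeps the poles outside. This one
      works because 4 |\<kappa>| < (1 + |\<kappa>|)^2.\<close>
    define R where "R = 2 / (1 + \<bar>\<kappa>\<bar>)"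
    have R: "1 < R" using \<kappa>_cos(2) by (simp add: R_def)
    have "4 * \<bar>\<kappa>\<bar> < (1 + \<bar>\<kappa>\<bar>)\<^sup>2"
    proof -
      have "(1 - \<bar>\<kappa>\<bar>)\<^sup>2 > 0" using \<kappa>_cos(2) by simp
      then show ?thesis by (simp add: power2_eq_square algebra_simps)
    qed
    then have \<kappa>R: "\<bar>\<kappa>\<bar> * R\<^sup>2 < 1" by (simp add: R_def power_divide field_simps add_pos_nonneg)
    have nz: "1 + of_real \<kappa> * z\<^sup>2 \<noteq> 0" if "norm z < R" for z :: complex
    proof
      assume "1 + of_real \<kappa> * z\<^sup>2 = 0"
      then have "of_real \<kappa> * z\<^sup>2 = - 1" by (simp add: add_eq_0_iff)
      then have "\<bar>\<kappa>\<bar> * (norm z)\<^sup>2 = 1" by (metis norm_minus_cancel norm_mult norm_of_real norm_one norm_power)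
      moreover have "\<bar>\<kappa>\<bar> * (norm z)\<^sup>2 \<le> \<bar>\<kappa>\<bar> * R\<^sup>2" using that by (intro mult_left_mono power_mono) auto
      ultimately show False using \<kappa>R by simp
    qed
    have "g holomorphic_on ball 0 R" unfolding g_def using nz by (intro holomorphic_intros) auto
    from integral_holomorphic_cis[OF this R] have "integral {0..2*pi} (\<lambda>t. g (cis t)) = 0" by (simp add: g_def)
    moreover have "of_real (wt \<alpha>) * cis (of_int q * s \<alpha>) * cis (- (of_int k * \<alpha>)) = g (cis \<alpha>)" for \<alpha>
    proof -
      have "cis (of_int q * s \<alpha>) = cis (s \<alpha>) * ((cis (s \<alpha>))\<^sup>2) ^ j"
        by (simp add: j Complex.DeMoivre cis_mult power_mult[symmetric] algebra_simps)
      moreover have "cis (- (of_int k * \<alpha>)) = cis \<alpha> ^ n" by (simp add: n Complex.DeMoivre)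
      ultimately show ?thesis unfolding g_def cis_2s[symmetric] wt_cis[symmetric] by (simp add: mult.assoc)
    qed
    ultimately show ?thesis by simp
  qed
  show ?thesis if "0 < q \<and> k \<le> 0" using pos q that by blast
  show ?thesis if "q < 0 \<and> 0 \<le> k"
  proof -
    have "integral {0..2*pi} (\<lambda>\<alpha>. of_real (wt \<alpha>) * cis (of_int (-q) * s \<alpha>) * cis (- (of_int (-k) * \<alpha>))) = 0"
      using that q by (intro pos) auto
    then have "cnj (integral {0..2*pi} (\<lambda>\<alpha>. of_real (wt \<alpha>) * cis (of_int (-q) * s \<alpha>) * cis (- (of_int (-k) * \<alpha>)))) = 0" by simp
    then show ?thesis unfolding integral_cnj by (simp add: cis_cnj)
  qed
  show ?thesis if "even k"
  proof -
    define F where "F \<alpha> = of_real (wt \<alpha>) * cis (of_int q * s \<alpha>) * cis (- (of_int k * \<alpha>))" for \<alpha>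
    have Fc: "continuous_on A F" for A unfolding F_def by (intro continuous_intros)
    \<comment> \<open>Both \<alpha> and the scattering angle advance by \<pi>, so the integrand
      acquires the sign of q - k, which is odd.\<close>
    have Fpi: "F (\<alpha> + pi) = - F \<alpha>" for \<alpha>
    proof -
      obtain a b where ab: "q = 2 * a + 1" "k = 2 * b" using q \<open>even k\<close> by (metis oddE evenE)
      have "cis (of_int q * pi) = cis pi * cis (of_int a * (2 * pi))" unfolding cis_mult ab by (simp add: algebra_simps)
      then have 1: "cis (of_int q * pi) = - 1" by simp
      have "cis (- (of_int k * pi)) = cis (of_int (- b) * (2 * pi))" unfolding ab by (simp add: algebra_simps)
      then have 2: "cis (- (of_int k * pi)) = 1" using cis_of_int_2pi(1)[of "-b"] by simp
      have "cis (of_int q * (s \<alpha> + pi)) = cis (of_int q * s \<alpha>) * cis (of_int q * pi)"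
        "cis (- (of_int k * (\<alpha> + pi))) = cis (- (of_int k * \<alpha>)) * cis (- (of_int k * pi))"
        unfolding cis_mult by (simp_all add: algebra_simps)
      then have "F (\<alpha> + pi) = of_real (wt \<alpha>) * (cis (of_int q * s \<alpha>) * cis (of_int q * pi)) * (cis (- (of_int k * \<alpha>)) * cis (- (of_int k * pi)))"
        unfolding F_def by (simp only: s_add_pi wt_simps)
      then show ?thesis unfolding 1 2 by (simp add: F_def)
    qed
    have F2: "F (\<alpha> + 2*pi) = F \<alpha>" for \<alpha> using Fpi[of "\<alpha> + pi"] Fpi[of \<alpha>] by (simp add: algebra_simps)
    have "integral {0..2*pi} F = integral {pi..pi + 2*pi} F" by (rule integral_periodic[OF Fc F2, symmetric]) simp
    also have "\<dots> = integral {0..2*pi} (\<lambda>\<alpha>. F (\<alpha> + pi))"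
      using integral_shift[of 0 pi "2*pi" F] Fc by (simp add: o_def add.commute)
    also have "\<dots> = - integral {0..2*pi} F" by (simp add: Fpi)
    finally show ?thesis by (simp add: F_def[abs_def])
  qed
qed

lemma fiber_coeff_lift_mode:
  assumes "odd (fst j + snd j)" "(0 < fst j + snd j \<and> k \<le> 0) \<or> (fst j + snd j < 0 \<and> 0 \<le> k) \<or> even k"
  shows "fiber_coeff (lift (mode j)) k \<beta> = 0"
proof -
  have "lift (mode j) (\<beta>, \<alpha>) * cis (- (of_int k * \<alpha>))
      = cis (of_int (fst j) * \<beta>) * (of_real (wt \<alpha>) * cis (of_int (fst j + snd j) * s \<alpha>) * cis (- (of_int k * \<alpha>)))" for \<alpha>
    by (simp add: lift_def mode_def cis_mult algebra_simps)
  then show ?thesis unfolding fiber_coeff_def by (simp only: integral_mult_right integral_fiber_eq_0[OF assms]) simp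
qed

lemma fiber_coeff_lift_fourier:
  assumes c: "(\<lambda>j. norm (c j)) summable_on UNIV" and z: "\<And>j. c j = 0 \<or> fiber_coeff (lift (mode j)) k \<beta> = 0"
  shows "fiber_coeff (lift (fourier c)) k \<beta> = 0"
proof -
  obtain W where W: "\<And>\<alpha>. \<alpha> \<in> {0..2*pi} \<Longrightarrow> norm (wt \<alpha>) \<le> W"
    using compact_imp_bounded[OF compact_continuous_image[OF continuous_on_wt[OF continuous_on_id] compact_Icc]]
    unfolding bounded_iff by (metis imageI)
  have "((\<lambda>j. integral {0..2*pi} (\<lambda>\<alpha>. c j * lift (mode j) (\<beta>, \<alpha>) * cis (- (of_int k * \<alpha>)))) has_sum
     integral {0..2*pi} (\<lambda>\<alpha>. \<Sum>\<^sub>\<infinity>j. c j * lift (mode j) (\<beta>, \<alpha>) * cis (- (of_int k * \<alpha>)))) UNIV"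
  proof (rule has_sum_integral_infsum)
    show "(\<lambda>j. norm (c j) * W) summable_on UNIV" by (rule summable_on_cmult_left[OF c])
    show "norm (c j * lift (mode j) (\<beta>, \<alpha>) * cis (- (of_int k * \<alpha>))) \<le> norm (c j) * W" if "\<alpha> \<in> {0..2*pi}" for j \<alpha>
      using W[OF that] by (auto simp: norm_mult lift_def intro!: mult_left_mono)
    show "continuous_on {0..2*pi} (\<lambda>\<alpha>. c j * lift (mode j) (\<beta>, \<alpha>) * cis (- (of_int k * \<alpha>)))" for j
      unfolding lift_def by (intro continuous_intros)
  qed
  moreover have "(\<Sum>\<^sub>\<infinity>j. c j * lift (mode j) (\<beta>, \<alpha>) * cis (- (of_int k * \<alpha>))) = lift (fourier c) (\<beta>, \<alpha>) * cis (- (of_int k * \<alpha>))" for \<alpha>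
  proof (rule infsumI)
    have "((\<lambda>j. of_real (wt \<alpha>) * (c j * mode j (\<beta> + s \<alpha>, s \<alpha>)) * cis (- (of_int k * \<alpha>))) has_sum
      of_real (wt \<alpha>) * fourier c (\<beta> + s \<alpha>, s \<alpha>) * cis (- (of_int k * \<alpha>))) UNIV"
      by (intro has_sum_cmult_left has_sum_cmult_right fourier_has_sum c)
    then show "((\<lambda>j. c j * lift (mode j) (\<beta>, \<alpha>) * cis (- (of_int k * \<alpha>))) has_sum lift (fourier c) (\<beta>, \<alpha>) * cis (- (of_int k * \<alpha>))) UNIV"
      by (simp add: lift_def ac_simps)
  qed
  moreover have "integral {0..2*pi} (\<lambda>\<alpha>. c j * lift (mode j) (\<beta>, \<alpha>) * cis (- (of_int k * \<alpha>))) = 0" for j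
  proof -
    have "integral {0..2*pi} (\<lambda>\<alpha>. c j * lift (mode j) (\<beta>, \<alpha>) * cis (- (of_int k * \<alpha>)))
      = c j * (of_real (2*pi) * fiber_coeff (lift (mode j)) k \<beta>)"
      unfolding mult.assoc fiber_coeff_def by (simp only: integral_mult_right) simp
    then show ?thesis using z[of j] by auto
  qed
  ultimately have "integral {0..2*pi} (\<lambda>\<alpha>. lift (fourier c) (\<beta>, \<alpha>) * cis (- (of_int k * \<alpha>))) = 0"
    by (simp add: has_sum_0_simp has_sum_unique)
  then show ?thesis by (simp add: fiber_coeff_def)
qed

text \<open>Split the coefficients by the sign of m + l. By \<open>fiber_coeff_lift_mode\<close> the
  two lifts have only odd positive, respectively odd negative, fiber frequencies, so the Hilbert
  transform multiplies them by -i and i, and discarding even frequencies changes nothing.\<close>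

lemma H_minus_lift:
  assumes c: "rapid c" and odd: "\<And>j. even (fst j + snd j) \<Longrightarrow> c j = 0"
  shows "H_minus (lift (fourier c)) = lift (fourier (\<lambda>j. - \<i> * of_int (sgn (fst j + snd j)) * c j))"
proof
  fix p :: "real \<times> real"
  obtain \<beta> \<alpha> where p: "p = (\<beta>, \<alpha>)" by (cases p)
  define cp where "cp j = (if fst j + snd j > 0 then c j else 0)" for j
  define cm where "cm j = (if fst j + snd j < 0 then c j else 0)" for j
  have "rapid cp" "rapid cm" by (rule rapid_mono[OF c, of _ 1]; simp add: cp_def cm_def)+
  then have sm: "lift (fourier cp) \<in> smooth_bdry" "lift (fourier cm) \<in> smooth_bdry"
    and ab: "(\<lambda>j. norm (cp j)) summable_on UNIV" "(\<lambda>j. norm (cm j)) summable_on UNIV"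
    by (auto intro: lift_smooth_bdry fourier_smooth_bdry rapid_abs_summable)
  let ?Fp = "\<lambda>k. fiber_coeff (lift (fourier cp)) k \<beta>" and ?Fm = "\<lambda>k. fiber_coeff (lift (fourier cm)) k \<beta>"
  have zp: "?Fp k = 0" if "k \<le> 0 \<or> even k" for k
  proof (rule fiber_coeff_lift_fourier[OF ab(1)])
    fix j
    show "cp j = 0 \<or> fiber_coeff (lift (mode j)) k \<beta> = 0"
    proof (cases "even (fst j + snd j) \<or> \<not> 0 < fst j + snd j")
      case True then show ?thesis using odd[of j] unfolding cp_def by metis
    next
      case False
      then have "fiber_coeff (lift (mode j)) k \<beta> = 0" using that by (intro fiber_coeff_lift_mode) blast+
      then show ?thesis ..
    qed
  qed
  have zm: "?Fm k = 0" if "k \<ge> 0 \<or> even k" for k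
  proof (rule fiber_coeff_lift_fourier[OF ab(2)])
    fix j
    show "cm j = 0 \<or> fiber_coeff (lift (mode j)) k \<beta> = 0"
    proof (cases "even (fst j + snd j) \<or> \<not> 0 > fst j + snd j")
      case True then show ?thesis using odd[of j] unfolding cm_def by metis
    next
      case False
      then have "fiber_coeff (lift (mode j)) k \<beta> = 0" using that by (intro fiber_coeff_lift_mode) blast+
      then show ?thesis ..
    qed
  qed
  have split: "c j = 1 * cp j + 1 * cm j" for j
    using odd[of j] by (cases "fst j + snd j" "0::int" rule: linorder_cases) (auto simp: cp_def cm_def)
  have Lsum: "lift (fourier c) q = lift (fourier cp) q + lift (fourier cm) q" for q
  proof -
    have "fourier c q = fourier cp q + fourier cm q" for q
      using fourier_lincomb[OF ab, of 1 1 q] unfolding split[symmetric] by simp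
    then show ?thesis by (simp add: lift_def algebra_simps)
  qed
  have cont: "continuous_on {0..2*pi} (\<lambda>\<alpha>. lift (fourier d) (\<beta>, \<alpha>) * cis (- (of_int k * \<alpha>)))" if "lift (fourier d) \<in> smooth_bdry" for d k
    by (intro continuous_intros continuous_on_UNIV_slice(2) smooth_on_continuous) (use that in \<open>auto simp: smooth_bdry_iff\<close>)
  have F: "fiber_coeff (lift (fourier c)) k \<beta> = ?Fp k + ?Fm k" for k
  proof -
    have "integral {0..2*pi} (\<lambda>\<alpha>. lift (fourier cp) (\<beta>, \<alpha>) * cis (- (of_int k * \<alpha>)) + lift (fourier cm) (\<beta>, \<alpha>) * cis (- (of_int k * \<alpha>)))
      = integral {0..2*pi} (\<lambda>\<alpha>. lift (fourier cp) (\<beta>, \<alpha>) * cis (- (of_int k * \<alpha>)))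
        + integral {0..2*pi} (\<lambda>\<alpha>. lift (fourier cm) (\<beta>, \<alpha>) * cis (- (of_int k * \<alpha>)))"
      by (intro Henstock_Kurzweil_Integration.integral_add integrable_continuous_real cont sm)
    then show ?thesis unfolding fiber_coeff_def Lsum distrib_right add_divide_distrib[symmetric] by simp
  qed
  have trm: "- \<i> * of_int (sgn k) * (?Fp k + ?Fm k) * cis (of_int k * \<alpha>)
     = - \<i> * (?Fp k * cis (of_int k * \<alpha>)) + \<i> * (?Fm k * cis (of_int k * \<alpha>))" for k
    using zp[of k] zm[of k] by (cases k "0::int" rule: linorder_cases) (auto simp: algebra_simps)
  have "((\<lambda>k. - \<i> * (?Fp k * cis (of_int k * \<alpha>)) + \<i> * (?Fm k * cis (of_int k * \<alpha>))) has_sum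
     - \<i> * lift (fourier cp) (\<beta>, \<alpha>) + \<i> * lift (fourier cm) (\<beta>, \<alpha>)) UNIV"
    by (intro has_sum_add has_sum_cmult_right fiber_inversion sm)
  then have "((\<lambda>k. - \<i> * of_int (sgn k) * fiber_coeff (lift (fourier c)) k \<beta> * cis (of_int k * \<alpha>)) has_sum
     - \<i> * lift (fourier cp) (\<beta>, \<alpha>) + \<i> * lift (fourier cm) (\<beta>, \<alpha>)) UNIV"
    unfolding F trm .
  also have "?this \<longleftrightarrow> ((\<lambda>k. - \<i> * of_int (sgn k) * fiber_coeff (lift (fourier c)) k \<beta> * cis (of_int k * \<alpha>)) has_sum
     - \<i> * lift (fourier cp) (\<beta>, \<alpha>) + \<i> * lift (fourier cm) (\<beta>, \<alpha>)) {k. odd k}"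
    by (rule has_sum_cong_neutral) (auto simp: zp zm F)
  finally have "H_minus (lift (fourier c)) p = - \<i> * lift (fourier cp) p + \<i> * lift (fourier cm) p"
    unfolding p H_minus_def hilbert_modes_def by (simp add: infsumI)
  also have "\<dots> = lift (fourier (\<lambda>j. - \<i> * cp j + \<i> * cm j)) p"
    unfolding lift_def fourier_lincomb[OF ab] by (simp add: algebra_simps)
  also have "(\<lambda>j. - \<i> * cp j + \<i> * cm j) = (\<lambda>j. - \<i> * of_int (sgn (fst j + snd j)) * c j)"
    by (auto simp: cp_def cm_def fun_eq_iff sgn_if)
  finally show "H_minus (lift (fourier c)) p = lift (fourier (\<lambda>j. - \<i> * of_int (sgn (fst j + snd j)) * c j)) p" .
qed

end

section \<open>Boundary operators in Fourier coordinates\<close>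

definition parity_sign :: "int \<Rightarrow> complex" where "parity_sign l = (if even l then 1 else - 1)"

lemma parity_sign_mult_self [simp]: "parity_sign l * parity_sign l = 1" "parity_sign l * (parity_sign l * x) = x" "parity_sign (- l) = parity_sign l"
  by (simp_all add: parity_sign_def)

lemma cis_int_pi: "cis (of_int l * pi) = parity_sign l"
proof (cases "even l")
  case True
  then obtain b where "l = 2 * b" by (elim evenE)
  then have "cis (of_int l * pi) = cis (of_int b * (2 * pi))" by (simp add: algebra_simps)
  then show ?thesis using True by (simp add: parity_sign_def)
next
  case False
  then obtain b where "l = 2 * b + 1" by (elim oddE)
  then have "cis (of_int l * pi) = cis pi * cis (of_int b * (2 * pi))" unfolding cis_mult by (simp add: algebra_simps)
  then show ?thesis using False by (simp add: parity_sign_def)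
qed

text \<open>The action on frequencies of reversing the sign of t.\<close>

definition flip :: "int \<times> int \<Rightarrow> int \<times> int" where "flip j = (fst j, - snd j)"

lemma flip_simps [simp]: "fst (flip j) = fst j" "snd (flip j) = - snd j" "flip (flip j) = j"
  by (simp_all add: flip_def)

lemma bij_flip: "bij_betw flip UNIV UNIV"
  by (rule bij_betwI[where g = flip]) auto

lemma rapid_flip: "rapid c \<Longrightarrow> rapid (\<lambda>j. c (flip j))"
  unfolding rapid_def
proof
  fix N assume "\<forall>N. (\<lambda>j. norm (c j) * (1 + \<bar>of_int (fst j)\<bar> + \<bar>of_int (snd j)\<bar>) ^ N) summable_on UNIV"
  then have "(\<lambda>j. norm (c (flip j)) * (1 + \<bar>of_int (fst (flip j))\<bar> + \<bar>of_int (snd (flip j))\<bar>) ^ N) summable_on UNIV"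
    using summable_on_reindex_bij_betw[OF bij_flip, of "\<lambda>j. norm (c j) * (1 + \<bar>of_int (fst j)\<bar> + \<bar>of_int (snd j)\<bar>) ^ N"] by blast
  then show "(\<lambda>j. norm (c (flip j)) * (1 + \<bar>of_int (fst j)\<bar> + \<bar>of_int (snd j)\<bar>) ^ N) summable_on UNIV" by simp
qed

lemma fourier_reflect: "fourier c (\<theta>, pi - t) = fourier (\<lambda>j. parity_sign (snd j) * c (flip j)) (\<theta>, t)"
proof -
  have "fourier c (\<theta>, pi - t) = (\<Sum>\<^sub>\<infinity>j. c (flip j) * mode (flip j) (\<theta>, pi - t))"
    unfolding fourier_def by (rule infsum_reindex_bij_betw[OF bij_flip, symmetric])
  also have "\<dots> = fourier (\<lambda>j. parity_sign (snd j) * c (flip j)) (\<theta>, t)"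
    unfolding fourier_def
  proof (rule infsum_cong)
    fix j :: "int \<times> int"
    have "mode (flip j) (\<theta>, pi - t) = cis (of_int (- snd j) * pi) * mode j (\<theta>, t)"
      unfolding mode_def cis_mult by (simp add: algebra_simps)
    then show "c (flip j) * mode (flip j) (\<theta>, pi - t) = parity_sign (snd j) * c (flip j) * mode j (\<theta>, t)"
      unfolding cis_int_pi by simp
  qed
  finally show ?thesis .
qed

lemma fourier_antipodal: "fourier c (\<theta> + pi, - t) = fourier (\<lambda>j. parity_sign (fst j) * c (flip j)) (\<theta>, t)"
proof -
  have "fourier c (\<theta> + pi, - t) = (\<Sum>\<^sub>\<infinity>j. c (flip j) * mode (flip j) (\<theta> + pi, - t))"
    unfolding fourier_def by (rule infsum_reindex_bij_betw[OF bij_flip, symmetric])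
  also have "\<dots> = fourier (\<lambda>j. parity_sign (fst j) * c (flip j)) (\<theta>, t)"
    unfolding fourier_def
  proof (rule infsum_cong)
    fix j :: "int \<times> int"
    have "mode (flip j) (\<theta> + pi, - t) = cis (of_int (fst j) * pi) * mode j (\<theta>, t)"
      unfolding mode_def cis_mult by (simp add: algebra_simps)
    then show "c (flip j) * mode (flip j) (\<theta> + pi, - t) = parity_sign (fst j) * c (flip j) * mode j (\<theta>, t)"
      unfolding cis_int_pi by simp
  qed
  finally show ?thesis .
qed

lemma fourier_inject:
  assumes "rapid c" "rapid d" "\<And>p. fourier c p = fourier d p"
  shows "c = d"
  using assms coef_fourier[OF rapid_abs_summable[OF assms(1)]] coef_fourier[OF rapid_abs_summable[OF assms(2)]]
  by (metis ext)

lemma rapid_sgn_mult: "rapid c \<Longrightarrow> (\<And>j. norm (a j) \<le> M) \<Longrightarrow> rapid (\<lambda>j. a j * c j)"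
  by (rule rapid_mono[where M = M]) (auto simp: norm_mult intro: mult_right_mono)

lemma norm_parity_sign [simp]: "norm (parity_sign l) = 1"
  by (simp add: parity_sign_def)

text \<open>The window and the floor expression are those in \<open>A_ext\<close>.\<close>

lemma periodic_reduce:
  fixes x :: real
  obtains n :: int and a where "x = a + 2 * pi * of_int n" "- (pi/2) \<le> a" "a < 3 * pi / 2"
    "n = \<lfloor>(x + pi/2) / (2 * pi)\<rfloor>"
proof -
  define n where "n = \<lfloor>(x + pi/2) / (2 * pi)\<rfloor>"
  have "of_int n \<le> (x + pi/2) / (2*pi)" "(x + pi/2) / (2*pi) < of_int n + 1" unfolding n_def by linarith+
  then have "of_int n * (2*pi) \<le> x + pi/2" "x + pi/2 < (of_int n + 1) * (2*pi)"
    by (simp_all add: pos_le_divide_eq pos_divide_less_eq)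
  then show thesis by (intro that[of "x - 2 * pi * of_int n" n]) (auto simp: algebra_simps n_def)
qed

lemma periodic_int:
  fixes f :: "real \<Rightarrow> 'a"
  assumes "\<And>x. f (x + 2 * pi) = f x"
  shows "f (x + 2 * pi * of_int n) = f x"
proof (induction n rule: int_induct[where k = 0])
  case (step1 i) then show ?case using assms[of "x + 2 * pi * of_int i"] by (simp add: algebra_simps)
next
  case (step2 i) then show ?case using assms[of "x + 2 * pi * of_int (i - 1)"] by (simp add: algebra_simps)
qed simp

section \<open>Extension across the glancing set, multipliers of the boundary operators\<close>

context curvature begin

lemma minus: "curvature (- \<kappa>)"
  using \<kappa> by unfold_locales auto

abbreviation sinv :: "real \<Rightarrow> real" where "sinv \<equiv> scat_angle (- \<kappa>)"

lemma sinv_s [simp]: "sinv (s \<alpha>) = \<alpha>"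
  using scat_angle_inverse[OF \<kappa>] .

lemma s_sinv [simp]: "s (sinv t) = t"
  using scat_angle_inverse[of "- \<kappa>"] \<kappa> by simp

lemma wt_nonzero [simp]: "wt \<alpha> \<noteq> 0"
  using wt_pos[of \<alpha>] by simp

definition unlift :: "bdry_fun \<Rightarrow> bdry_fun" where
  "unlift U p = of_real (inverse (wt (sinv (snd p)))) * U (fst p - snd p, sinv (snd p))"

lemma lift_unlift [simp]: "lift (unlift U) = U"
  by (simp add: lift_def unlift_def fun_eq_iff mult.assoc[symmetric])

lemma unlift_lift [simp]: "unlift (lift G) = G"
  by (simp add: lift_def unlift_def fun_eq_iff mult.assoc[symmetric])

lemma unlift_smooth_bdry: "U \<in> smooth_bdry \<Longrightarrow> unlift U \<in> smooth_bdry"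
proof -
  assume "U \<in> smooth_bdry"
  then have U: "smooth_on UNIV U" "biperiodic U" by (auto simp: smooth_bdry_iff)
  have p: "U (x + 2*pi, y) = U (x, y)" "U (x, y + 2*pi) = U (x, y)" for x y using U(2) by (auto simp: biperiodic_def)
  have ms: "sinv (t + 2*pi) = sinv t + 2*pi" for t by (rule curvature.s_add_2pi[OF minus])
  have "U (\<theta> + 2*pi - x, y) = U (\<theta> - x, y)" for \<theta> x y
    using p(1)[of "\<theta> - x" y] by (simp add: algebra_simps)
  moreover have "U (\<theta> - (x + 2*pi), y + 2*pi) = U (\<theta> - x, y)" for \<theta> x y
    using p(1)[of "\<theta> - x - 2*pi" "y + 2*pi"] p(2)[of "\<theta> - x" y] by (simp add: algebra_simps)
  ultimately have "biperiodic (unlift U)" unfolding biperiodic_def unlift_def by (simp add: ms)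
  moreover have "smooth_on UNIV (unlift U)"
    unfolding unlift_def[abs_def]
    by (intro smooth_intros smooth_on_compose[OF U(1), of _ "\<lambda>p. (fst p - snd p, sinv (snd p))"]
        curvature.smooth_on_s[OF minus]) simp_all
  ultimately show ?thesis by (simp add: smooth_bdry_iff)
qed

text \<open>The two ends of a geodesic share the angle \<theta> = \<beta> + s \<alpha> up to 2\<pi>,
  since it describes the direction of the chord; only t is reflected. The antipodal version reverses
  the chord, hence \<theta> + \<pi> and -t.\<close>

lemma lift_scat:
  assumes "biperiodic G"
  shows "lift G (scat \<kappa> p) = lift (\<lambda>q. G (fst q, pi - snd q)) p"
proof -
  obtain \<beta> \<alpha> where p: "p = (\<beta>, \<alpha>)" by (cases p)
  have "\<beta> + pi + 2 * s \<alpha> + (pi - s \<alpha>) = (\<beta> + s \<alpha>) + 2*pi" by simp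
  then show ?thesis using assms unfolding p scat_def lift_def biperiodic_def by (simp only: split fst_conv snd_conv s_pi_minus wt_simps)
qed

lemma lift_antipodal: "lift G (antipodal_scat \<kappa> p) = lift (\<lambda>q. G (fst q + pi, - snd q)) p"
proof -
  obtain \<beta> \<alpha> where p: "p = (\<beta>, \<alpha>)" by (cases p)
  have "\<beta> + pi + 2 * s \<alpha> + - s \<alpha> = (\<beta> + s \<alpha>) + pi" by simp
  then show ?thesis unfolding p antipodal_scat_def lift_def by (simp only: split fst_conv snd_conv s_minus wt_simps)
qed

lemma lift_fourier_scat: "lift (fourier c) (scat \<kappa> p) = lift (fourier (\<lambda>j. parity_sign (snd j) * c (flip j))) p"
  unfolding lift_scat[OF biperiodic_fourier] fourier_reflect by simp

lemma lift_fourier_antipodal: "lift (fourier c) (antipodal_scat \<kappa> p) = lift (fourier (\<lambda>j. parity_sign (fst j) * c (flip j))) p"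
  unfolding lift_antipodal fourier_antipodal by simp

lemma lift_fourier_inject:
  assumes "rapid c" "rapid d" "\<And>p. lift (fourier c) p = lift (fourier d) p"
  shows "c = d"
proof (rule fourier_inject[OF assms(1,2)])
  have "lift (fourier c) = lift (fourier d)" using assms(3) by auto
  then show "fourier c p = fourier d p" for p by (metis unlift_lift)
qed

lemma fourier_cmult: "a * fourier c p = fourier (\<lambda>j. a * c j) p"
  unfolding fourier_def mult.assoc by (rule infsum_cmult_right'[symmetric])

lemma lift_fourier_cmult: "a * lift (fourier c) p = lift (fourier (\<lambda>j. a * c j)) p"
  unfolding lift_def fourier_cmult[symmetric] by simp

lemma scat_influx: "(\<beta>, \<alpha>) \<in> influx \<Longrightarrow> antipodal_scat \<kappa> (\<beta>, \<alpha>) \<in> influx"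
  by (simp add: influx_def antipodal_scat_def)

text \<open>Scattering carries the outward half of the fiber into the inward half, so the values on
  \<open>influx\<close> and the symmetry determine \<open>U\<close>.\<close>

lemma A_ext_eqI:
  assumes per: "\<And>\<beta> \<alpha>. U (\<beta>, \<alpha> + 2*pi) = U (\<beta>, \<alpha>)" and eq: "\<And>p. p \<in> influx \<Longrightarrow> U p = u p"
    and sc: "\<And>p. U p = \<epsilon> * U (scat \<kappa> p)"
  shows "A_ext \<kappa> \<epsilon> u = U"
proof
  fix p :: "real \<times> real"
  obtain \<beta> \<alpha> where p: "p = (\<beta>, \<alpha>)" by (cases p)
  obtain n a where a: "\<alpha> = a + 2 * pi * of_int n" "- (pi/2) \<le> a" "a < 3 * pi / 2" "n = \<lfloor>(\<alpha> + pi/2) / (2 * pi)\<rfloor>"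
    by (rule periodic_reduce)
  have Ua: "U (\<beta>, \<alpha>) = U (\<beta>, a)" unfolding a(1) using periodic_int[of "\<lambda>\<alpha>. U (\<beta>, \<alpha>)"] per by blast
  have "\<alpha> - 2 * pi * of_int \<lfloor>(\<alpha> + pi/2) / (2 * pi)\<rfloor> = a" using a by simp
  then have A: "A_ext \<kappa> \<epsilon> u p = (if a \<le> pi/2 then u (\<beta>, a) else \<epsilon> * u (scat \<kappa> (\<beta>, a)))"
    by (simp add: A_ext_def p)
  show "A_ext \<kappa> \<epsilon> u p = U p"
  proof (cases "a \<le> pi/2")
    case True
    then show ?thesis unfolding A using a eq[of "(\<beta>, a)"] Ua by (simp add: p influx_def)
  next
    case False
    then have "scat \<kappa> (\<beta>, a) \<in> influx" using a by (simp add: scat_def influx_def)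
    then show ?thesis unfolding A using False eq sc[of "(\<beta>, a)"] Ua by (simp add: p)
  qed
qed

lemma A_ext_influx: "p \<in> influx \<Longrightarrow> A_ext \<kappa> \<epsilon> u p = u p"
proof -
  assume "p \<in> influx"
  then obtain \<beta> \<alpha> where p: "p = (\<beta>, \<alpha>)" "- (pi/2) \<le> \<alpha>" "\<alpha> \<le> pi/2" by (cases p) (auto simp: influx_def)
  have "\<lfloor>(\<alpha> + pi/2) / (2 * pi)\<rfloor> = 0"
    using p pi_gt3 by (intro floor_unique) (auto simp: pos_le_divide_eq pos_divide_less_eq)
  then show ?thesis using p by (simp add: A_ext_def)
qed

lemma A_ext_scat:
  assumes u: "u \<in> smooth_alpha \<kappa> \<epsilon>" and \<epsilon>: "\<epsilon> * \<epsilon> = 1"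
  shows "A_ext \<kappa> \<epsilon> u p = \<epsilon> * A_ext \<kappa> \<epsilon> u (scat \<kappa> p)"
proof -
  define U where "U = A_ext \<kappa> \<epsilon> u"
  have U: "smooth_on UNIV U" "biperiodic U" using u by (auto simp: smooth_alpha_def smooth_bdry_iff U_def)
  have per: "U (x + 2*pi, y) = U (x, y)" "U (x, y + 2*pi) = U (x, y)" for x y using U(2) by (auto simp: biperiodic_def)
  have u_per: "u (\<beta> + 2*pi, \<alpha>) = u (\<beta>, \<alpha>)" if "(\<beta>, \<alpha>) \<in> influx" for \<beta> \<alpha>
    using u that by (auto simp: smooth_alpha_def smooth_influx_def)
  have infl: "U q = u q" if "q \<in> influx" for q unfolding U_def by (rule A_ext_influx[OF that])
  have out: "U (\<beta>, a) = \<epsilon> * U (scat \<kappa> (\<beta>, a))" if "pi/2 < a" "a < 3 * pi/2" for \<beta> a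
  proof -
    have "\<lfloor>(a + pi/2) / (2 * pi)\<rfloor> = 0"
      using that pi_gt3 by (intro floor_unique) (auto simp: pos_le_divide_eq pos_divide_less_eq)
    then have "U (\<beta>, a) = \<epsilon> * u (scat \<kappa> (\<beta>, a))" using that by (simp add: U_def A_ext_def)
    moreover have "scat \<kappa> (\<beta>, a) \<in> influx" using that by (simp add: scat_def influx_def)
    ultimately show ?thesis using infl by simp
  qed
  \<comment> \<open>Scattering is an involution up to periods, so the outward identity at the image
    point, with \<epsilon>^2 = 1, is the inward identity.\<close>
  have ins: "U (\<beta>, a) = \<epsilon> * U (scat \<kappa> (\<beta>, a))" if "- (pi/2) < a" "a < pi/2" for \<beta> a
  proof -
    have "U (\<beta> + pi + 2 * s a, pi - a) = \<epsilon> * U (scat \<kappa> (\<beta> + pi + 2 * s a, pi - a))"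
      using that by (intro out) auto
    also have "scat \<kappa> (\<beta> + pi + 2 * s a, pi - a) = (\<beta> + 2*pi + 2*pi, a)" by (simp add: scat_def)
    also have "U (\<beta> + 2*pi + 2*pi, a) = U (\<beta>, a)" unfolding per ..
    finally show ?thesis using \<epsilon> by (simp add: scat_def mult.assoc[symmetric])
  qed
  \<comment> \<open>At glancing vectors \<open>A_ext\<close> takes the inward value by convention.
    There the identity is a limit from the open inward interval, and this is where continuity of the
    extension enters.\<close>
  define D where "D \<beta> a = U (\<beta>, a) - \<epsilon> * U (scat \<kappa> (\<beta>, a))" for \<beta> a
  have Uc: "continuous_on UNIV U" using U(1) by (rule smooth_on_continuous)
  have Dc: "continuous_on A (D \<beta>)" for A \<beta>
    unfolding D_def scat_def split
    by (intro continuous_intros continuous_on_compose2[OF Uc]) auto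
  have "D \<beta> a = 0" if "- (pi/2) \<le> a" "a < 3 * pi/2" for \<beta> a
  proof (cases "a \<le> pi/2")
    case True
    have "D \<beta> a = 0"
      by (rule continuous_constant_on_closure[OF Dc, of "{- (pi/2)<..<pi/2}"])
         (use that True ins in \<open>auto simp: D_def closure_greaterThanLessThan\<close>)
    then show ?thesis .
  next
    case False then show ?thesis using out that by (simp add: D_def)
  qed
  moreover have Dper: "D \<beta> (a + 2*pi) = D \<beta> a" for \<beta> a
  proof -
    have "scat \<kappa> (\<beta>, a + 2*pi) = (\<beta> + pi + 2 * s a + 2*pi + 2*pi, pi - a - 2*pi)"
      unfolding scat_def split s_add_2pi by (simp add: algebra_simps)
    then have "U (scat \<kappa> (\<beta>, a + 2*pi)) = U (\<beta> + pi + 2 * s a, pi - a - 2*pi)" by (simp only: per(1))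
    also have "\<dots> = U (scat \<kappa> (\<beta>, a))" using per(2)[of _ "pi - a - 2*pi"] by (simp add: scat_def)
    finally show ?thesis by (simp add: D_def per)
  qed
  ultimately have D0: "D \<beta> \<alpha> = 0" for \<beta> \<alpha>
  proof -
    obtain n a where "\<alpha> = a + 2 * pi * of_int n" "- (pi/2) \<le> a" "a < 3 * pi / 2" by (rule periodic_reduce)
    with periodic_int[of "D \<beta>" a n] Dper \<open>\<And>a \<beta>. - (pi/2) \<le> a \<Longrightarrow> a < 3 * pi/2 \<Longrightarrow> D \<beta> a = 0\<close> show ?thesis by simp
  qed
  show ?thesis using D0[of "fst p" "snd p"] unfolding D_def U_def by simp
qed

lemma A_ext_antipodal:
  assumes u: "u \<in> smooth_alpha \<kappa> \<epsilon>" and \<epsilon>: "\<epsilon> * \<epsilon> = 1"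
    and a: "\<And>p. p \<in> influx \<Longrightarrow> u (antipodal_scat \<kappa> p) = \<eta> * u p"
  shows "A_ext \<kappa> \<epsilon> u (antipodal_scat \<kappa> p) = \<eta> * A_ext \<kappa> \<epsilon> u p"
proof -
  define U where "U = A_ext \<kappa> \<epsilon> u"
  have "biperiodic U" using u by (auto simp: smooth_alpha_def smooth_bdry_iff U_def)
  then have per: "U (x + 2*pi, y) = U (x, y)" "U (x, y + 2*pi) = U (x, y)" for x y by (auto simp: biperiodic_def)
  have sc: "U q = \<epsilon> * U (scat \<kappa> q)" for q unfolding U_def by (rule A_ext_scat[OF u \<epsilon>])
  have inf: "U (antipodal_scat \<kappa> (\<beta>, a)) = \<eta> * U (\<beta>, a)" if "- (pi/2) \<le> a" "a \<le> pi/2" for \<beta> a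
  proof -
    have q: "(\<beta>, a) \<in> influx" using that by (simp add: influx_def)
    show ?thesis unfolding U_def A_ext_influx[OF q] A_ext_influx[OF scat_influx[OF q]] by (rule a[OF q])
  qed
  have red: "U (antipodal_scat \<kappa> (\<beta>, a)) = \<eta> * U (\<beta>, a)" if "- (pi/2) \<le> a" "a < 3*pi/2" for \<beta> a
  proof (cases "a \<le> pi/2")
    case True then show ?thesis using inf that by simp
  next
    case False
    \<comment> \<open>An outward vector is moved to the inward half by scattering, which commutes
      with the antipodal map up to periods.\<close>
    have "U (antipodal_scat \<kappa> (\<beta>, a)) = \<epsilon> * U (scat \<kappa> (antipodal_scat \<kappa> (\<beta>, a)))" by (rule sc)
    also have "scat \<kappa> (antipodal_scat \<kappa> (\<beta>, a)) = (\<beta> + 2*pi, (a - pi) + 2*pi)" by (simp add: scat_def antipodal_scat_def)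
    also have "U \<dots> = U (\<beta> + 2*pi + 2*pi, a - pi)" unfolding per ..
    also have "(\<beta> + 2*pi + 2*pi, a - pi) = antipodal_scat \<kappa> (\<beta> + pi + 2 * s a, pi - a)"
      by (simp add: antipodal_scat_def)
    also have "U \<dots> = \<eta> * U (\<beta> + pi + 2 * s a, pi - a)" using False that by (intro inf) auto
    also have "\<epsilon> * \<dots> = \<eta> * U (\<beta>, a)" using sc[of "(\<beta>, a)"] by (simp add: scat_def)
    finally show ?thesis .
  qed
  have "U (antipodal_scat \<kappa> (\<beta>, \<alpha>)) = \<eta> * U (\<beta>, \<alpha>)" for \<beta> \<alpha>
  proof -
    define E where "E a = U (antipodal_scat \<kappa> (\<beta>, a)) - \<eta> * U (\<beta>, a)" for a
    have "E (a + 2*pi) = E a" for a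
    proof -
      have "antipodal_scat \<kappa> (\<beta>, a + 2*pi) = (\<beta> + pi + 2 * s a + 2*pi + 2*pi, - a - 2*pi)"
          unfolding antipodal_scat_def split s_add_2pi by (simp add: algebra_simps)
      then have "U (antipodal_scat \<kappa> (\<beta>, a + 2*pi)) = U (\<beta> + pi + 2 * s a, - a - 2*pi)" by (simp only: per(1))
      also have "\<dots> = U (antipodal_scat \<kappa> (\<beta>, a))" using per(2)[of _ "- a - 2*pi"] by (simp add: antipodal_scat_def)
      finally show ?thesis by (simp add: E_def per)
    qed
    moreover obtain n a where "\<alpha> = a + 2 * pi * of_int n" "- (pi/2) \<le> a" "a < 3 * pi / 2" by (rule periodic_reduce)
    ultimately have "E \<alpha> = 0" using periodic_int[of E a n] red[of a \<beta>] by (simp add: E_def)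
    then show ?thesis by (simp add: E_def)
  qed
  then show ?thesis unfolding U_def by (cases p) auto
qed

definition bcoef :: "complex \<Rightarrow> bdry_fun \<Rightarrow> int \<times> int \<Rightarrow> complex" where
  "bcoef \<epsilon> u = coef (unlift (A_ext \<kappa> \<epsilon> u))"

lemma bcoef_props:
  assumes u: "u \<in> smooth_alpha \<kappa> \<epsilon>"
  shows rapid_bcoef: "rapid (bcoef \<epsilon> u)"
    and lift_fourier_bcoef: "lift (fourier (bcoef \<epsilon> u)) = A_ext \<kappa> \<epsilon> u"
    and bcoef_flip: "\<epsilon> * \<epsilon> = 1 \<Longrightarrow> parity_sign (snd j) * bcoef \<epsilon> u (flip j) = \<epsilon> * bcoef \<epsilon> u j"
    and bcoef_antipodal: "\<epsilon> * \<epsilon> = 1 \<Longrightarrow> (\<And>p. p \<in> influx \<Longrightarrow> u (antipodal_scat \<kappa> p) = \<eta> * u p) \<Longrightarrow>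
      parity_sign (fst j) * bcoef \<epsilon> u (flip j) = \<eta> * bcoef \<epsilon> u j"
proof -
  have U: "A_ext \<kappa> \<epsilon> u \<in> smooth_bdry" using u by (simp add: smooth_alpha_def)
  show r: "rapid (bcoef \<epsilon> u)" unfolding bcoef_def by (rule rapid_coef[OF unlift_smooth_bdry[OF U]])
  show l: "lift (fourier (bcoef \<epsilon> u)) = A_ext \<kappa> \<epsilon> u"
    unfolding bcoef_def fourier_coef[OF unlift_smooth_bdry[OF U]] by simp
  have rs: "rapid (\<lambda>j. parity_sign (f j) * bcoef \<epsilon> u (flip j))" for f
    by (rule rapid_sgn_mult[OF rapid_flip[OF r], where M = 1]) simp
  have rm: "rapid (\<lambda>j. x * bcoef \<epsilon> u j)" for x
    by (rule rapid_sgn_mult[OF r, where M = "norm x"]) simp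
  show "parity_sign (snd j) * bcoef \<epsilon> u (flip j) = \<epsilon> * bcoef \<epsilon> u j" if \<epsilon>: "\<epsilon> * \<epsilon> = 1"
  proof -
    have "lift (fourier (\<lambda>j. parity_sign (snd j) * bcoef \<epsilon> u (flip j))) p = lift (fourier (\<lambda>j. \<epsilon> * bcoef \<epsilon> u j)) p" for p
      unfolding lift_fourier_scat[symmetric] lift_fourier_cmult[symmetric] l
      using A_ext_scat[OF u \<epsilon>, of p] \<epsilon> by (metis mult.assoc mult_1)
    from lift_fourier_inject[OF rs rm this] show ?thesis by meson
  qed
  show "parity_sign (fst j) * bcoef \<epsilon> u (flip j) = \<eta> * bcoef \<epsilon> u j"
    if \<epsilon>: "\<epsilon> * \<epsilon> = 1" and a: "\<And>p. p \<in> influx \<Longrightarrow> u (antipodal_scat \<kappa> p) = \<eta> * u p"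
  proof -
    have "lift (fourier (\<lambda>j. parity_sign (fst j) * bcoef \<epsilon> u (flip j))) p = lift (fourier (\<lambda>j. \<eta> * bcoef \<epsilon> u j)) p" for p
      unfolding lift_fourier_antipodal[symmetric] lift_fourier_cmult[symmetric] l
      by (rule A_ext_antipodal[OF u \<epsilon> a])
    from lift_fourier_inject[OF rs rm this] show ?thesis by meson
  qed
qed

text \<open>Both symmetries express the coefficient at \<open>flip j\<close>. When m and l have
  equal parity the two expressions have opposite signs. Hence only fiber modes of odd total
  frequency occur.\<close>

lemma bcoef_parity:
  assumes u: "u \<in> smooth_alpha \<kappa> \<epsilon>" and \<epsilon>: "\<epsilon> * \<epsilon> = 1"
    and a: "\<And>p. p \<in> influx \<Longrightarrow> u (antipodal_scat \<kappa> p) = - \<epsilon> * u p" and e: "even (fst j + snd j)"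
  shows "bcoef \<epsilon> u j = 0"
proof -
  have "parity_sign (fst j) = parity_sign (snd j)" using e by (auto simp: parity_sign_def)
  then have "\<epsilon> * bcoef \<epsilon> u j = - \<epsilon> * bcoef \<epsilon> u j"
    using bcoef_flip[OF u \<epsilon>, of j] bcoef_antipodal[OF u \<epsilon> a, of j] by simp
  then have "\<epsilon> * (\<epsilon> * bcoef \<epsilon> u j) = 0" by simp
  then show ?thesis using \<epsilon> by auto
qed

text \<open>The common Fourier form of the four conditions.\<close>

definition fourier_range :: "bdry_fun \<Rightarrow> bool" where
  "fourier_range u \<longleftrightarrow> u \<in> smooth_alpha \<kappa> (- 1) \<and> (\<forall>j. \<bar>snd j\<bar> \<le> \<bar>fst j\<bar> \<longrightarrow> bcoef (- 1) u j = 0)"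

text \<open>The Hilbert transform contributes sgn (m + l). Composition with scattering turns this
  into sgn (m - l), while the coefficients reproduce themselves up to \<epsilon>. The integer copy
  \<epsilon>' of the sign keeps the multiplier an integer.\<close>

lemma A_adj_H_minus:
  assumes c: "rapid c" and e: "\<And>j. even (fst j + snd j) \<Longrightarrow> c j = 0"
    and f: "\<And>j. parity_sign (snd j) * c (flip j) = \<epsilon> * c j" and \<epsilon>: "of_int \<epsilon>' = \<epsilon>"
  shows "A_adj \<kappa> (- 1) (H_minus (lift (fourier c))) p
    = lift (fourier (\<lambda>j. - \<i> * of_int (sgn (fst j + snd j) - \<epsilon>' * sgn (fst j - snd j)) * c j)) p"
proof -
  let ?h = "\<lambda>j. - \<i> * of_int (sgn (fst j + snd j)) * c j"
  have r: "rapid ?h" by (rule rapid_sgn_mult[OF c, where M = 1]) (simp add: norm_mult sgn_if)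
  have "(\<lambda>j. parity_sign (snd j) * ?h (flip j)) = (\<lambda>j. - \<i> * of_int (sgn (fst j - snd j)) * (parity_sign (snd j) * c (flip j)))" by (auto simp: algebra_simps)
  then have h: "(\<lambda>j. parity_sign (snd j) * ?h (flip j)) = (\<lambda>j. - \<i> * of_int (sgn (fst j - snd j)) * (\<epsilon> * c j))" unfolding f .
  have r': "rapid (\<lambda>j. - \<i> * of_int (sgn (fst j - snd j)) * (\<epsilon> * c j))"
    unfolding h[symmetric] by (rule rapid_sgn_mult[OF rapid_flip[OF r], where M = 1]) simp
  have "A_adj \<kappa> (- 1) (H_minus (lift (fourier c))) p
    = lift (fourier ?h) p + (- 1) * lift (fourier (\<lambda>j. - \<i> * of_int (sgn (fst j - snd j)) * (\<epsilon> * c j))) p"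
  proof -
    have H: "H_minus (lift (fourier c)) = lift (fourier ?h)" by (rule H_minus_lift[OF c e])
    have "lift (fourier ?h) (scat \<kappa> p) = lift (fourier (\<lambda>j. - \<i> * of_int (sgn (fst j - snd j)) * (\<epsilon> * c j))) p"
      unfolding h[symmetric] by (rule lift_fourier_scat)
    then show ?thesis by (simp only: A_adj_def H)
  qed
  also have "\<dots> = lift (fourier (\<lambda>j. 1 * ?h j + (- 1) * (- \<i> * of_int (sgn (fst j - snd j)) * (\<epsilon> * c j)))) p"
    unfolding lift_def fourier_lincomb[OF rapid_abs_summable[OF r] rapid_abs_summable[OF r']] by (simp add: algebra_simps)
  also have "(\<lambda>j. 1 * ?h j + (- 1) * (- \<i> * of_int (sgn (fst j - snd j)) * (\<epsilon> * c j)))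
     = (\<lambda>j. - \<i> * of_int (sgn (fst j + snd j) - \<epsilon>' * sgn (fst j - snd j)) * c j)"
    unfolding \<epsilon>[symmetric] by (auto simp: fun_eq_iff algebra_simps)
  finally show ?thesis .
qed

text \<open>The reflection symmetry propagates vanishing from \<open>influx\<close> to the whole
  torus, where Fourier coefficients are unique.\<close>

lemma lift_fourier_eq_0:
  assumes d: "rapid d" and f: "\<And>j. parity_sign (snd j) * d (flip j) = \<epsilon> * d j"
    and z: "\<And>p. p \<in> influx \<Longrightarrow> lift (fourier d) p = 0"
  shows "d j = 0"
proof -
  let ?U = "lift (fourier d)"
  have sc: "?U (scat \<kappa> p) = \<epsilon> * ?U p" for p unfolding lift_fourier_scat f lift_fourier_cmult ..
  have "?U \<in> smooth_bdry" by (intro lift_smooth_bdry fourier_smooth_bdry d)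
  then have per: "?U (x, y + 2*pi) = ?U (x, y)" and per1: "?U (x + 2*pi, y) = ?U (x, y)" for x y by (auto simp: smooth_bdry_def)
  have "?U (\<beta>, \<alpha>) = 0" for \<beta> \<alpha>
  proof -
    obtain n a where a: "\<alpha> = a + 2 * pi * of_int n" "- (pi/2) \<le> a" "a < 3 * pi / 2" by (rule periodic_reduce)
    have "?U (\<beta>, a) = 0"
    proof (cases "a \<le> pi/2")
      case True then show ?thesis using a by (intro z) (simp add: influx_def)
    next
      case False
      then have "?U (\<beta> + pi + 2 * s a, pi - a) = 0" using a by (intro z) (simp add: influx_def)
      moreover have "scat \<kappa> (\<beta> + pi + 2 * s a, pi - a) = (\<beta> + 2*pi + 2*pi, a)" by (simp add: scat_def)
      moreover have "?U (\<beta> + 2*pi + 2*pi, a) = ?U (\<beta>, a)" unfolding per1 ..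
      ultimately show ?thesis using sc[of "(\<beta> + pi + 2 * s a, pi - a)"] by simp
    qed
    then show ?thesis using periodic_int[of "\<lambda>\<alpha>. ?U (\<beta>, \<alpha>)" a n] per a by simp
  qed
  then have "?U p = lift (fourier (\<lambda>j. 0)) p" for p by (cases p) (simp add: lift_def fourier_def)
  moreover have "rapid (\<lambda>j. 0)" by (simp add: rapid_def)
  ultimately have "d = (\<lambda>j. 0)" using lift_fourier_inject[OF d] by blast
  then show ?thesis by simp
qed

lemma fourier_range_iff_C_minus:
  assumes a: "\<And>p. p \<in> influx \<Longrightarrow> u (antipodal_scat \<kappa> p) = u p"
  shows "fourier_range u \<longleftrightarrow> u \<in> smooth_alpha \<kappa> (-1) \<and> (\<forall>p\<in>influx. C_minus \<kappa> u p = 0)"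
proof (cases "u \<in> smooth_alpha \<kappa> (-1)")
  case True
  define c where "c = bcoef (- 1) u"
  define d where "d j = - \<i> * of_int (sgn (fst j + snd j) - (- 1) * sgn (fst j - snd j)) * c j" for j
  have c: "rapid c" "lift (fourier c) = A_ext \<kappa> (- 1) u" "\<And>j. parity_sign (snd j) * c (flip j) = (- 1) * c j"
    "\<And>j. even (fst j + snd j) \<Longrightarrow> c j = 0"
    unfolding c_def using bcoef_props(1-3)[OF True] bcoef_parity[OF True] a by simp_all
  have d: "rapid d" unfolding d_def by (rule rapid_sgn_mult[OF c(1), where M = 2]) (simp add: norm_mult sgn_if)
  have fd: "parity_sign (snd j) * d (flip j) = (- 1) * d j" for j
  proof -
    have "parity_sign (snd j) * d (flip j) = - \<i> * of_int (sgn (fst j - snd j) + sgn (fst j + snd j)) * (parity_sign (snd j) * c (flip j))"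
      by (simp add: d_def algebra_simps)
    then show ?thesis unfolding c(3) by (simp add: d_def algebra_simps)
  qed
  have C: "C_minus \<kappa> u p = 1/2 * lift (fourier d) p" for p
    unfolding C_minus_def c(2)[symmetric] d_def by (subst A_adj_H_minus[OF c(1,4,3), of "-1"]) simp_all
  have "(\<forall>p\<in>influx. C_minus \<kappa> u p = 0) \<longleftrightarrow> (\<forall>j. d j = 0)"
  proof
    assume "\<forall>p\<in>influx. C_minus \<kappa> u p = 0"
    then show "\<forall>j. d j = 0" unfolding C using lift_fourier_eq_0[OF d fd] by auto
  next
    assume "\<forall>j. d j = 0"
    then have "d = (\<lambda>j. 0)" by auto
    then show "\<forall>p\<in>influx. C_minus \<kappa> u p = 0" unfolding C by (simp add: lift_def fourier_def)
  qed
  also have "\<dots> \<longleftrightarrow> (\<forall>j. \<bar>snd j\<bar> \<le> \<bar>fst j\<bar> \<longrightarrow> c j = 0)"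
  proof -
    have "d j = 0 \<longleftrightarrow> (\<bar>snd j\<bar> \<le> \<bar>fst j\<bar> \<longrightarrow> c j = 0)" for j
    proof (cases "even (fst j + snd j)")
      case True then show ?thesis using c(4) by (simp add: d_def)
    next
      case False
      then have "\<bar>snd j\<bar> \<noteq> \<bar>fst j\<bar>" by presburger
      \<comment> \<open>Off the diagonals the sum of the two signs is 2 sgn m inside the cone |l| <
        |m| and 0 outside it.\<close>
      then have "sgn (fst j + snd j) - (- 1) * sgn (fst j - snd j) = 0 \<longleftrightarrow> \<not> \<bar>snd j\<bar> \<le> \<bar>fst j\<bar>"
        by (auto simp: sgn_if abs_if split: if_splits)
      moreover have "d j = 0 \<longleftrightarrow> sgn (fst j + snd j) - (- 1) * sgn (fst j - snd j) = 0 \<or> c j = 0"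
        unfolding d_def mult_eq_0_iff of_int_eq_0_iff by simp
      ultimately show ?thesis by blast
    qed
    then show ?thesis by blast
  qed
  finally show ?thesis using True by (simp add: fourier_range_def c_def)
qed (simp add: fourier_range_def)

lemma lift_in_smooth_alpha:
  assumes c: "rapid c" and f: "\<And>j. parity_sign (snd j) * c (flip j) = \<epsilon> * c j" and \<epsilon>: "\<epsilon> * \<epsilon> = 1"
    and u: "\<And>p. p \<in> influx \<Longrightarrow> u p = lift (fourier c) p" and sm: "u \<in> smooth_influx"
  shows "u \<in> smooth_alpha \<kappa> \<epsilon>" "bcoef \<epsilon> u = c"
proof -
  have L: "lift (fourier c) \<in> smooth_bdry" by (intro lift_smooth_bdry fourier_smooth_bdry c)
  have sc: "lift (fourier c) p = \<epsilon> * lift (fourier c) (scat \<kappa> p)" for p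
    unfolding lift_fourier_scat f lift_fourier_cmult[symmetric] using \<epsilon> by (metis mult.assoc mult_1)
  have "lift (fourier c) (\<beta>, \<alpha> + 2*pi) = lift (fourier c) (\<beta>, \<alpha>)" for \<beta> \<alpha> using L by (auto simp: smooth_bdry_def)
  from A_ext_eqI[OF this _ sc] u have A: "A_ext \<kappa> \<epsilon> u = lift (fourier c)" by simp
  then show "u \<in> smooth_alpha \<kappa> \<epsilon>" using sm L by (simp add: smooth_alpha_def)
  show "bcoef \<epsilon> u = c" unfolding bcoef_def A by (auto simp: coef_fourier[OF rapid_abs_summable[OF c]])
qed

lemma lift_smooth_influx: "rapid c \<Longrightarrow> lift (fourier c) \<in> smooth_influx"
  using lift_smooth_bdry[OF fourier_smooth_bdry, of c] smooth_on_subset[of UNIV _ influx]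
  by (auto simp: smooth_bdry_def smooth_influx_def)

text \<open>Here the difference of signs is 0 where |l| < |m| and 2 sgn l where |l| > |m|. So P_-
  produces only modes outside the cone and is invertible on these.\<close>

lemma fourier_range_iff_P_minus:
  assumes sm: "u \<in> smooth_influx" and a: "\<And>p. p \<in> influx \<Longrightarrow> u (antipodal_scat \<kappa> p) = u p"
  shows "fourier_range u \<longleftrightarrow> (\<exists>w \<in> smooth_alpha_plus_minus \<kappa>. \<forall>p\<in>influx. u p = P_minus \<kappa> w p)"
proof
  assume "\<exists>w \<in> smooth_alpha_plus_minus \<kappa>. \<forall>p\<in>influx. u p = P_minus \<kappa> w p"
  then obtain w where w: "w \<in> smooth_alpha \<kappa> 1" "\<And>p. p \<in> influx \<Longrightarrow> w (antipodal_scat \<kappa> p) = - 1 * w p"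
    and u: "\<And>p. p \<in> influx \<Longrightarrow> u p = P_minus \<kappa> w p" by (auto simp: smooth_alpha_plus_minus_def)
  define c where "c = bcoef 1 w"
  have c: "rapid c" "lift (fourier c) = A_ext \<kappa> 1 w" "\<And>j. parity_sign (snd j) * c (flip j) = 1 * c j"
    "\<And>j. even (fst j + snd j) \<Longrightarrow> c j = 0"
    unfolding c_def using bcoef_props(1-3)[OF w(1)] bcoef_parity[OF w(1) _ w(2)] by simp_all
  define d where "d j = - \<i> * of_int (sgn (fst j + snd j) - 1 * sgn (fst j - snd j)) * c j" for j
  have d: "rapid d" unfolding d_def by (rule rapid_sgn_mult[OF c(1), where M = 2]) (simp add: norm_mult sgn_if)
  have fd: "parity_sign (snd j) * d (flip j) = (- 1) * d j" for j
  proof -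
    have "parity_sign (snd j) * d (flip j) = - \<i> * of_int (sgn (fst j - snd j) - sgn (fst j + snd j)) * (parity_sign (snd j) * c (flip j))"
      by (simp add: d_def algebra_simps)
    then show ?thesis unfolding c(3) by (simp add: d_def algebra_simps)
  qed
  have "u p = lift (fourier d) p" if "p \<in> influx" for p
    unfolding u[OF that] P_minus_def c(2)[symmetric] d_def by (subst A_adj_H_minus[OF c(1,4,3), of 1]) simp_all
  from lift_in_smooth_alpha[OF d fd _ this sm] have "u \<in> smooth_alpha \<kappa> (- 1)" "bcoef (- 1) u = d" by simp_all
  moreover have "d j = 0" if "\<bar>snd j\<bar> \<le> \<bar>fst j\<bar>" for j
  proof (cases "even (fst j + snd j)")
    case True then show ?thesis using c(4) by (simp add: d_def)
  next
    case False
    then have "\<bar>snd j\<bar> \<noteq> \<bar>fst j\<bar>" by presburger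
    then have "sgn (fst j + snd j) - 1 * sgn (fst j - snd j) = 0" using that
      by (auto simp: sgn_if abs_if split: if_splits)
    then show ?thesis unfolding d_def by simp
  qed
  ultimately show "fourier_range u" by (simp add: fourier_range_def)
next
  assume h: "fourier_range u"
  then have u: "u \<in> smooth_alpha \<kappa> (- 1)" by (simp add: fourier_range_def)
  define c where "c = bcoef (- 1) u"
  have c: "rapid c" "lift (fourier c) = A_ext \<kappa> (- 1) u" "\<And>j. parity_sign (snd j) * c (flip j) = (- 1) * c j"
    "\<And>j. even (fst j + snd j) \<Longrightarrow> c j = 0" "\<And>j. parity_sign (fst j) * c (flip j) = 1 * c j"
    unfolding c_def using bcoef_props(1-3)[OF u] bcoef_parity[OF u] bcoef_antipodal[OF u, of 1] a by simp_all
  \<comment> \<open>The reciprocal of the multiplier -2i sgn l. The factor sgn l is odd under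
    \<open>flip\<close>, which converts the symmetries of u under A_- into those required of w under
    A_+.\<close>
  define b where "b j = \<i> / 2 * of_int (sgn (snd j)) * c j" for j
  have b: "rapid b" unfolding b_def by (rule rapid_sgn_mult[OF c(1), where M = 1]) (simp add: norm_mult norm_divide sgn_if)
  have fb: "parity_sign (snd j) * b (flip j) = 1 * b j" "parity_sign (fst j) * b (flip j) = - 1 * b j" for j
  proof -
    have xb: "x * b (flip j) = - \<i> / 2 * of_int (sgn (snd j)) * (x * c (flip j))" for x
      by (simp add: b_def sgn_minus algebra_simps)
    show "parity_sign (snd j) * b (flip j) = 1 * b j" "parity_sign (fst j) * b (flip j) = - 1 * b j"
      unfolding xb c(3,5) by (simp_all add: b_def)
  qed
  have eb: "b j = 0" if "even (fst j + snd j)" for j using c(4)[OF that] by (simp add: b_def)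
  let ?w = "lift (fourier b)"
  have w: "?w \<in> smooth_alpha \<kappa> 1" "bcoef 1 ?w = b"
    by (rule lift_in_smooth_alpha[OF b fb(1) _ refl lift_smooth_influx[OF b]], simp)+
  have A: "A_ext \<kappa> 1 ?w = ?w" using lift_fourier_bcoef[OF w(1)] w(2) by simp
  have "?w (antipodal_scat \<kappa> p) = - ?w p" for p
    unfolding lift_fourier_antipodal fb(2) lift_fourier_cmult[symmetric] by simp
  then have "?w \<in> smooth_alpha_plus_minus \<kappa>" using w(1) by (simp add: smooth_alpha_plus_minus_def)
  moreover have "u p = P_minus \<kappa> ?w p" if "p \<in> influx" for p
  proof -
    have "P_minus \<kappa> ?w p = lift (fourier (\<lambda>j. - \<i> * of_int (sgn (fst j + snd j) - 1 * sgn (fst j - snd j)) * b j)) p"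
      unfolding P_minus_def A by (rule A_adj_H_minus[OF b eb fb(1) of_int_1])
    also have "(\<lambda>j. - \<i> * of_int (sgn (fst j + snd j) - 1 * sgn (fst j - snd j)) * b j) = c"
    proof
      fix j
      show "- \<i> * of_int (sgn (fst j + snd j) - 1 * sgn (fst j - snd j)) * b j = c j"
      proof (cases "\<bar>snd j\<bar> \<le> \<bar>fst j\<bar>")
        case True
        then have "c j = 0" using h unfolding fourier_range_def c_def by blast
        then show ?thesis by (simp add: b_def)
      next
        case False
        then have *: "(sgn (fst j + snd j) - 1 * sgn (fst j - snd j)) * sgn (snd j) = 2"
          by (auto simp: sgn_if abs_if split: if_splits)
        have "- \<i> * of_int (sgn (fst j + snd j) - 1 * sgn (fst j - snd j)) * b j
          = - \<i> * \<i> / 2 * of_int ((sgn (fst j + snd j) - 1 * sgn (fst j - snd j)) * sgn (snd j)) * c j"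
          unfolding of_int_mult b_def by (simp only: times_divide_eq_right times_divide_eq_left ac_simps)
        then show ?thesis unfolding * by simp
      qed
    qed
    also have "lift (fourier c) p = u p" unfolding c(2) by (rule A_ext_influx[OF that])
    finally show ?thesis ..
  qed
  ultimately show "\<exists>w \<in> smooth_alpha_plus_minus \<kappa>. \<forall>p\<in>influx. u p = P_minus \<kappa> w p" by blast
qed

end

section \<open>Moment conditions\<close>

lemma cnj_mode: "cnj (mode j p) = mode (- j) p"
  by (simp add: mode_def cis_cnj)

lemma integral_density_const_compact:
  fixes V :: "'a::euclidean_space \<Rightarrow> complex"
  assumes V: "continuous_on UNIV V" and S: "compact S" and r: "r \<ge> 0"
  shows "set_lebesgue_integral (density lborel (\<lambda>_. ennreal r)) S V = of_real r * integral S V"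
proof -
  have Vc: "continuous_on S V" by (rule continuous_on_subset[OF V]) simp
  have Sb: "S \<in> sets borel" using S by (simp add: borel_compact)
  have m: "(\<lambda>p. indicator S p *\<^sub>R V p) \<in> borel_measurable lborel"
    using borel_measurable_continuous_on_indicator[OF Sb Vc] by simp
  have "set_integrable lborel S V"
    unfolding set_integrable_def using borel_integrable_compact[OF S Vc] by simp
  then have "(LINT p:S|lborel. V p) = integral S V" by (rule set_borel_integral_eq_integral(2))
  moreover have "set_lebesgue_integral (density lborel (\<lambda>_. ennreal r)) S V = (LINT p|lborel. r *\<^sub>R (indicator S p *\<^sub>R V p))"
    unfolding set_lebesgue_integral_def by (rule integral_density) (use m r in auto)
  moreover have "(LINT p|lborel. r *\<^sub>R (indicator S p *\<^sub>R V p)) = r *\<^sub>R (LINT p:S|lborel. V p)"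
    unfolding set_lebesgue_integral_def by (rule integral_scaleR_right) 
  ultimately show ?thesis by (simp add: scaleR_conv_of_real)
qed

lemma integral_reflect_half_period:
  fixes K :: "real \<Rightarrow> complex"
  assumes c: "continuous_on UNIV K" and per: "\<And>t. K (t + 2*pi) = K t" and sym: "\<And>t. K (pi - t) = K t"
  shows "integral {0..2*pi} K = 2 * integral {- (pi/2)..pi/2} K"
proof -
  have cA: "continuous_on A K" for A by (rule continuous_on_subset[OF c]) simp
  have cm: "continuous_on A (\<lambda>t. K (- t))" for A
    by (intro continuous_on_compose2[OF c] continuous_intros) auto
  have ki: "K integrable_on {a..b}" for a b by (intro integrable_continuous_real cA)
  have "integral {pi/2..3*pi/2} K = integral {pi/2..3*pi/2} (\<lambda>t. K (- (t - pi)))"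
    using sym by (intro Henstock_Kurzweil_Integration.integral_cong) (simp add: algebra_simps)
  also have "\<dots> = integral {- (pi/2)..pi/2} (\<lambda>t. K (- t))"
    using integral_shift[of "pi/2" "- pi" "3*pi/2" "\<lambda>t. K (- t)"] cm by (simp add: o_def)
  also have "\<dots> = integral {- (pi/2)..pi/2} K"
    using Henstock_Kurzweil_Integration.integral_reflect_real[where f = K and a = "-(pi/2)" and b = "pi/2"] by simp
  finally have h: "integral {pi/2..3*pi/2} K = integral {- (pi/2)..pi/2} K" .
  have "integral {0..2*pi} K = integral {- (pi/2)..- (pi/2) + 2*pi} K"
    by (rule integral_periodic[OF c per, symmetric]) simp
  also have "- (pi/2) + 2*pi = 3*pi/2" by simp
  also have "integral {- (pi/2)..3*pi/2} K = integral {- (pi/2)..pi/2} K + integral {pi/2..3*pi/2} K"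
    by (rule Henstock_Kurzweil_Integration.integral_combine[symmetric, OF _ _ ki]) auto
  finally show ?thesis by (simp add: h)
qed

context curvature begin

text \<open>Periodicity absorbs the shift of \<beta>; the substitution t = s \<alpha> absorbs the
  squared weight, which is the derivative of \<open>s\<close>; and the reflection symmetry makes the
  inward half of the fiber carry half of the integral.\<close>

lemma integral_lift_influx:
  assumes c: "continuous_on UNIV \<Phi>" and per: "biperiodic \<Phi>" and sym: "\<And>\<theta> t. \<Phi> (\<theta>, pi - t) = \<Phi> (\<theta>, t)"
  shows "integral {0..2*pi} (\<lambda>\<beta>. integral {- (pi/2)..pi/2} (\<lambda>\<alpha>. of_real ((wt \<alpha>)\<^sup>2) * \<Phi> (\<beta> + s \<alpha>, s \<alpha>)))
    = 1/2 * integral {0..2*pi} (\<lambda>t. integral {0..2*pi} (\<lambda>\<theta>. \<Phi> (\<theta>, t)))"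
proof -
  define K where "K t = integral {0..2*pi} (\<lambda>\<theta>. \<Phi> (\<theta>, t))" for t
  have Kc: "continuous_on A K" for A unfolding K_def by (rule continuous_on_inner_integral[OF c])
  let ?H = "\<lambda>p. of_real ((wt (snd p))\<^sup>2) * \<Phi> (fst p + s (snd p), s (snd p))"
  have Hc: "continuous_on UNIV ?H"
    by (intro continuous_intros continuous_on_compose2[OF c]) auto
  have "integral {0..2*pi} (\<lambda>\<beta>. integral {- (pi/2)..pi/2} (\<lambda>\<alpha>. ?H (\<beta>, \<alpha>)))
    = integral {- (pi/2)..pi/2} (\<lambda>\<alpha>. integral {0..2*pi} (\<lambda>\<beta>. ?H (\<beta>, \<alpha>)))"
    by (rule integral_torus_swap[OF Hc, symmetric])
  also have "\<dots> = integral {- (pi/2)..pi/2} (\<lambda>\<alpha>. (wt \<alpha>)\<^sup>2 *\<^sub>R K (s \<alpha>))"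
  proof (rule Henstock_Kurzweil_Integration.integral_cong)
    fix \<alpha>
    have "integral {0..2*pi} (\<lambda>\<beta>. \<Phi> (\<beta> + s \<alpha>, s \<alpha>)) = integral {0 + s \<alpha>..2*pi + s \<alpha>} (\<lambda>\<theta>. \<Phi> (\<theta>, s \<alpha>))"
      using integral_shift[of 0 "s \<alpha>" "2*pi" "\<lambda>\<theta>. \<Phi> (\<theta>, s \<alpha>)"] continuous_on_UNIV_slice(1)[OF c] by (simp add: o_def)
    also have "\<dots> = integral {s \<alpha>..s \<alpha> + 2*pi} (\<lambda>\<theta>. \<Phi> (\<theta>, s \<alpha>))" by (simp add: add.commute)
    also have "\<dots> = K (s \<alpha>)" unfolding K_def
      by (rule integral_periodic[OF continuous_on_UNIV_slice(1)[OF c]]) (use per in \<open>auto simp: biperiodic_def\<close>)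
    finally show "integral {0..2*pi} (\<lambda>\<beta>. ?H (\<beta>, \<alpha>)) = (wt \<alpha>)\<^sup>2 *\<^sub>R K (s \<alpha>)"
      by (simp only: fst_conv snd_conv integral_mult_right scaleR_conv_of_real)
  qed
  also have "\<dots> = integral {s (- (pi/2))..s (pi/2)} K"
    by (rule integral_unique[OF has_integral_substitution[where c = "- (pi/2)" and d = "pi/2"]])
       (use Kc has_real_derivative_s s_influx in auto)
  also have "\<dots> = integral {- (pi/2)..pi/2} K" by simp
  also have "\<dots> = 1/2 * integral {0..2*pi} K"
    using integral_reflect_half_period[OF Kc] per sym by (simp add: K_def biperiodic_def)
  finally show ?thesis by (simp add: K_def[abs_def])
qed

text \<open>The function \<open>psi\<close> is the lift of a combination of the modes (n - 2k, n +
  1) and (n - 2k, -(n + 1)) that is odd under t \<mapsto> \<pi> - t, as is the unlifted extension of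
  \<open>u\<close>. Their product is even, so the inner product becomes an integral over the whole
  torus.\<close>

lemma inner_influx_psi:
  assumes u: "u \<in> smooth_alpha \<kappa> (- 1)"
  shows "inner_influx \<kappa> u (psi \<kappa> n k) = (- 1) ^ n * of_real (pi / (1 + \<kappa>)) * bcoef (- 1) u (int n - 2 * k, int n + 1)"
proof -
  define G where "G = unlift (A_ext \<kappa> (- 1) u)"
  have Gs: "G \<in> smooth_bdry" using u by (auto simp: G_def smooth_alpha_def intro: unlift_smooth_bdry)
  then have Gc: "continuous_on UNIV G" and Gp: "biperiodic G" by (auto simp: smooth_bdry_iff smooth_on_continuous)
  have GA: "A_ext \<kappa> (- 1) u = lift G" by (simp add: G_def)
  have cG: "coef G = bcoef (- 1) u" by (simp add: G_def bcoef_def)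
  define m l where "m = int n - 2 * k" and "l = int n + 1"
  have sgl: "parity_sign l = - ((- 1) ^ n)" by (auto simp: parity_sign_def l_def)
  have sgn2: "(- 1) ^ n * (- 1) ^ n = (1::complex)" by (metis power_mult_distrib mult_minus1 minus_minus power_one)
  have cflip: "coef G (m, - l) = (- 1) ^ n * coef G (m, l)"
  proof -
    have "parity_sign l * coef G (m, - l) = - coef G (m, l)" using bcoef_flip[OF u, of "(m, l)"] by (simp add: cG flip_def)
    then have "(- 1) ^ n * ((- 1) ^ n * coef G (m, - l)) = (- 1) ^ n * coef G (m, l)" unfolding sgl by simp
    then show ?thesis unfolding mult.assoc[symmetric] sgn2 by simp
  qed
  have Grefl: "G (\<theta>, pi - t) = - G (\<theta>, t)" for \<theta> t
  proof -
    have f: "fourier (coef G) = G" by (rule fourier_coef[OF Gs])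
    have "G (\<theta>, pi - t) = fourier (\<lambda>j. parity_sign (snd j) * coef G (flip j)) (\<theta>, t)"
      by (metis f fourier_reflect)
    also have "(\<lambda>j. parity_sign (snd j) * coef G (flip j)) = (\<lambda>j. (- 1) * coef G j)"
      unfolding cG using bcoef_flip[OF u] by simp
    also have "fourier (\<lambda>j. (- 1) * coef G j) (\<theta>, t) = (- 1) * G (\<theta>, t)" unfolding fourier_cmult[symmetric] f ..
    finally show ?thesis by simp
  qed
  define \<psi> where "\<psi> p = (- 1) ^ n / of_real (4 * pi) * (mode (m, l) p + (- 1) ^ n * mode (m, - l) p)" for p
  have psi: "psi \<kappa> n k = lift \<psi>"
  proof
    fix p :: "real \<times> real"
    obtain \<beta> \<alpha> where p: "p = (\<beta>, \<alpha>)" by (cases p)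
    have "sqrt (deriv s \<alpha>) = wt \<alpha>" using wt_pos[of \<alpha>] by (simp add: deriv_s)
    moreover have "mode (m, l) (\<beta> + s \<alpha>, s \<alpha>) = cis (of_int (int n - 2 * k) * (\<beta> + s \<alpha>)) * cis (of_nat (n + 1) * s \<alpha>)"
      "mode (m, - l) (\<beta> + s \<alpha>, s \<alpha>) = cis (of_int (int n - 2 * k) * (\<beta> + s \<alpha>)) * cis (- (of_nat (n + 1) * s \<alpha>))"
      unfolding mode_def cis_mult m_def l_def by (simp_all add: algebra_simps)
    ultimately show "psi \<kappa> n k p = lift \<psi> p"
      unfolding psi_def Let_def lift_def \<psi>_def p split fst_conv snd_conv by (simp only: distrib_left add_divide_distrib ac_simps times_divide_eq_left times_divide_eq_right)
  qed
  have mr: "mode (m, l') (\<theta>, pi - t) = parity_sign l' * mode (m, - l') (\<theta>, t)" for \<theta> t l'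
    unfolding cis_int_pi[symmetric] mode_def cis_mult by (simp add: algebra_simps)
  have \<psi>refl: "\<psi> (\<theta>, pi - t) = - \<psi> (\<theta>, t)" for \<theta> t
  proof -
    have 1: "mode (m, l) (\<theta>, pi - t) = - ((- 1) ^ n) * mode (m, - l) (\<theta>, t)"
      "mode (m, - l) (\<theta>, pi - t) = - ((- 1) ^ n) * mode (m, l) (\<theta>, t)"
      using mr[of l \<theta> t] mr[of "- l" \<theta> t] by (simp_all add: sgl)
    show ?thesis unfolding \<psi>_def 1 by (cases "even n") (simp_all add: algebra_simps add_divide_distrib diff_divide_distrib)
  qed
  define \<Phi> where "\<Phi> p = G p * cnj (\<psi> p)" for p
  have \<psi>c: "continuous_on UNIV (\<lambda>p. cnj (\<psi> p))" unfolding \<psi>_def by (intro continuous_intros) auto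
  have \<Phi>c: "continuous_on UNIV \<Phi>" unfolding \<Phi>_def by (intro continuous_intros Gc \<psi>c)
  have \<Phi>p: "biperiodic \<Phi>" using Gp biperiodic_mode unfolding \<Phi>_def \<psi>_def biperiodic_def by simp
  define V where "V p = of_real ((wt (snd p))\<^sup>2) * \<Phi> (fst p + s (snd p), s (snd p))" for p
  have Vc: "continuous_on UNIV V" unfolding V_def by (intro continuous_intros continuous_on_compose2[OF \<Phi>c]) auto
  let ?S = "{0..2*pi} \<times> {- (pi/2)..pi/2}"
  have V: "u p * cnj (psi \<kappa> n k p) = V p" if "p \<in> ?S" for p
  proof -
    have "p \<in> influx" using that by (auto simp: influx_def)
    then have "u p = lift G p" using A_ext_influx[of p "-1" u] by (simp add: GA)
    then show ?thesis by (simp add: psi lift_def V_def \<Phi>_def power2_eq_square)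
  qed
  have "inner_influx \<kappa> u (psi \<kappa> n k) = set_lebesgue_integral (fan_measure \<kappa>) ?S V"
    unfolding inner_influx_def set_lebesgue_integral_def
    by (intro Bochner_Integration.integral_cong refl) (use V in \<open>auto simp: indicator_def\<close>)
  also have "\<dots> = of_real (1 / (1 + \<kappa>)) * integral ?S V"
    unfolding fan_measure_def by (rule integral_density_const_compact[OF Vc]) (use \<kappa> in \<open>auto intro: compact_Times\<close>)
  also have "?S = cbox (0, - (pi/2)) (2*pi, pi/2)" by (simp add: cbox_Pair_eq)
  also have "integral (cbox (0, - (pi/2)) (2*pi, pi/2)) V = integral {0..2*pi} (\<lambda>\<beta>. integral {- (pi/2)..pi/2} (\<lambda>\<alpha>. V (\<beta>, \<alpha>)))"
    using integral_prod_continuous[OF continuous_on_subset[OF Vc]] by simp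
  also have "\<dots> = 1/2 * integral {0..2*pi} (\<lambda>t. integral {0..2*pi} (\<lambda>\<theta>. \<Phi> (\<theta>, t)))"
    unfolding V_def fst_conv snd_conv
    by (rule integral_lift_influx[OF \<Phi>c \<Phi>p]) (simp add: \<Phi>_def Grefl \<psi>refl)
  also have "integral {0..2*pi} (\<lambda>t. integral {0..2*pi} (\<lambda>\<theta>. \<Phi> (\<theta>, t)))
     = (- 1) ^ n / of_real (4 * pi) * (of_real (4 * pi\<^sup>2) * coef G (m, l) + (- 1) ^ n * (of_real (4 * pi\<^sup>2) * coef G (m, - l)))"
  proof -
    have c: "continuous_on UNIV (\<lambda>p. G p * mode (- j) p)" for j by (intro continuous_intros Gc)
    have F: "\<Phi> (\<theta>, t) = (- 1) ^ n / of_real (4 * pi) * (G (\<theta>, t) * mode (- (m, l)) (\<theta>, t) + (- 1) ^ n * (G (\<theta>, t) * mode (- (m, - l)) (\<theta>, t)))" for \<theta> t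
      unfolding \<Phi>_def \<psi>_def by (simp add: cnj_mode algebra_simps)
    have I: "integral {0..2*pi} (\<lambda>\<theta>. \<Phi> (\<theta>, t)) = (- 1) ^ n / of_real (4 * pi) * (integral {0..2*pi} (\<lambda>\<theta>. G (\<theta>, t) * mode (- (m, l)) (\<theta>, t))
        + (- 1) ^ n * integral {0..2*pi} (\<lambda>\<theta>. G (\<theta>, t) * mode (- (m, - l)) (\<theta>, t)))" for t
      unfolding F integral_mult_right
      by (subst Henstock_Kurzweil_Integration.integral_add)
         (simp_all only: integral_mult_right integrable_on_mult_right integrable_continuous_real continuous_on_UNIV_slice(1)[OF c])
    have ii: "(\<lambda>t. integral {0..2*pi} (\<lambda>\<theta>. G (\<theta>, t) * mode (- j) (\<theta>, t))) integrable_on {0..2*pi}" for j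
      by (intro integrable_continuous_real continuous_on_inner_integral[OF c])
    have cc: "integral {0..2*pi} (\<lambda>t. integral {0..2*pi} (\<lambda>\<theta>. G (\<theta>, t) * mode (- j) (\<theta>, t))) = of_real (4 * pi\<^sup>2) * coef G j" for j
      by (simp add: coef_def)
    show ?thesis
      unfolding I integral_mult_right
      by (subst Henstock_Kurzweil_Integration.integral_add)
         (simp_all only: integral_mult_right integrable_on_mult_right ii cc)
  qed
  \<comment> \<open>The modes l and -l contribute equally by \<open>cflip\<close>, and 1/2 times
    1/(4\<pi>) times twice 4\<pi>^2 leaves \<pi>.\<close>
  also have "of_real (1 / (1 + \<kappa>)) * (1/2 * \<dots>) = (- 1) ^ n * of_real (pi / (1 + \<kappa>)) * coef G (m, l)"
  proof -
    have "(- 1) ^ n * (of_real (4 * pi\<^sup>2) * coef G (m, - l)) = of_real (4 * pi\<^sup>2) * coef G (m, l)"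
      unfolding cflip by (cases "even n") simp_all
    then show ?thesis using \<kappa> by (simp add: power2_eq_square field_simps)
  qed
  finally show ?thesis by (simp add: cG m_def l_def)
qed

lemma fourier_range_iff_moments:
  assumes a: "\<And>p. p \<in> influx \<Longrightarrow> u (antipodal_scat \<kappa> p) = u p"
  shows "fourier_range u \<longleftrightarrow> u \<in> smooth_alpha \<kappa> (-1) \<and> (\<forall>n k. k < 0 \<or> k > int n \<longrightarrow> inner_influx \<kappa> u (psi \<kappa> n k) = 0)"
proof (cases "u \<in> smooth_alpha \<kappa> (-1)")
  case True
  let ?c = "bcoef (- 1) u"
  have par: "?c j = 0" if "even (fst j + snd j)" for j
    by (rule bcoef_parity[OF True _ _ that]) (use a in auto)
  have fl: "?c (m, - l) = - parity_sign l * ?c (m, l)" for m l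
    using bcoef_flip[OF True, of "(m, - l)"] by (auto simp: parity_sign_def flip_def split: if_splits)
  have inner: "inner_influx \<kappa> u (psi \<kappa> n k) = 0 \<longleftrightarrow> ?c (int n - 2 * k, int n + 1) = 0" for n k
  proof -
    have "(- 1) ^ n * of_real (pi / (1 + \<kappa>)) \<noteq> (0::complex)" using \<kappa> by (simp del: of_real_divide)
    then show ?thesis unfolding inner_influx_psi[OF True] by (metis mult_eq_0_iff)
  qed
  \<comment> \<open>With l = n + 1 and m = n - 2k, the condition k < 0 or k > n says |m| > l > 0.
    Equality |m| = l is excluded by parity, and the reflection symmetry handles l = 0 and l <
    0.\<close>
  have "(\<forall>n k. k < 0 \<or> k > int n \<longrightarrow> ?c (int n - 2 * k, int n + 1) = 0) \<longleftrightarrow> (\<forall>j. \<bar>snd j\<bar> \<le> \<bar>fst j\<bar> \<longrightarrow> ?c j = 0)"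
  proof (intro iffI allI impI)
    fix n k assume "\<forall>j. \<bar>snd j\<bar> \<le> \<bar>fst j\<bar> \<longrightarrow> ?c j = 0" and "k < 0 \<or> k > int n"
    then show "?c (int n - 2 * k, int n + 1) = 0" by (elim allE[of _ "(int n - 2 * k, int n + 1)"]) auto
  next
    fix j :: "int \<times> int" assume z: "\<forall>n k. k < 0 \<or> k > int n \<longrightarrow> ?c (int n - 2 * k, int n + 1) = 0" and j: "\<bar>snd j\<bar> \<le> \<bar>fst j\<bar>"
    have pos: "?c (m, l) = 0" if "0 < l" "l \<le> \<bar>m\<bar>" for m l
    proof (cases "even (m + l)")
      case True then show ?thesis using par[of "(m, l)"] by simp
    next
      case False
      define n where "n = nat (l - 1)"
      have n: "int n = l - 1" using that by (simp add: n_def)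
      from False have "even (int n - m)" unfolding n by presburger
      then obtain k where k: "int n - m = 2 * k" by (elim evenE)
      have "k < 0 \<or> k > int n" using that k n False by presburger
      then have "?c (int n - 2 * k, int n + 1) = 0" using z by blast
      moreover have "int n - 2 * k = m" "int n + 1 = l" using k n by auto
      ultimately show ?thesis by simp
    qed
    obtain m l where ml: "j = (m, l)" by (cases j)
    consider "0 < l" | "l = 0" | "l < 0" by linarith
    then show "?c j = 0"
    proof cases
      case 1 then show ?thesis using pos[of l m] j by (simp add: ml)
    next
      case 2 then show ?thesis using fl[of m 0] by (simp add: ml parity_sign_def)
    next
      case 3 then show ?thesis using pos[of "- l" m] fl[of m "- l"] j by (simp add: ml)
    qed
  qed
  then show ?thesis using True by (simp only: fourier_range_def inner)
qed (simp add: fourier_range_def)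

end

lemma has_vector_derivative_complexI:
  assumes "((\<lambda>t. Re (f t)) has_real_derivative Re f') F" "((\<lambda>t. Im (f t)) has_real_derivative Im f') F"
  shows "(f has_vector_derivative f') F"
  using assms by (simp add: has_vector_derivative_complex_iff)

section \<open>Geodesics in the projective model\<close>

context curvature begin

lemma q_pos: "z \<in> disk \<Longrightarrow> 1 + \<kappa> * (norm z)\<^sup>2 > 0" "z \<in> disk \<Longrightarrow> 1 - \<kappa> * (norm z)\<^sup>2 > 0"
proof -
  assume "z \<in> disk"
  then have "(norm z)\<^sup>2 \<le> 1" by (simp add: power_le_one)
  then have "\<bar>\<kappa> * (norm z)\<^sup>2\<bar> \<le> \<bar>\<kappa>\<bar>" using mult_left_mono[of "(norm z)\<^sup>2" 1 "\<bar>\<kappa>\<bar>"] by (simp add: abs_mult)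
  then show "1 + \<kappa> * (norm z)\<^sup>2 > 0" "1 - \<kappa> * (norm z)\<^sup>2 > 0" using \<kappa>_cos(2) by linarith+
qed

lemma g_kappa_has_derivative:
  assumes "1 + \<kappa> * (norm z)\<^sup>2 \<noteq> 0"
  shows "((\<lambda>y. g_kappa \<kappa> y v w) has_derivative (\<lambda>h. - 4 * \<kappa> * (z \<bullet> h) * (v \<bullet> w) / (1 + \<kappa> * (norm z)\<^sup>2) ^ 3)) (at z)"
proof -
  define Q where "Q y = 1 + \<kappa> * (y \<bullet> y)" for y :: complex
  have Qz: "Q z \<noteq> 0" using assms by (simp add: Q_def power2_norm_eq_inner)
  have dQ: "(Q has_derivative (\<lambda>h. \<kappa> * (2 * (z \<bullet> h)))) (at z)"
    unfolding Q_def by (auto intro!: derivative_eq_intros simp: inner_commute)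
  have "((\<lambda>r. (v \<bullet> w) / r\<^sup>2) has_real_derivative - 2 * (v \<bullet> w) / (Q z) ^ 3) (at (Q z))"
    using Qz by (auto intro!: derivative_eq_intros simp: power2_eq_square power3_eq_cube field_simps)
  from has_derivative_compose[OF dQ this[unfolded has_field_derivative_def]]
  have "((\<lambda>y. (v \<bullet> w) / (Q y)\<^sup>2) has_derivative (\<lambda>h. - 2 * (v \<bullet> w) / (Q z) ^ 3 * (\<kappa> * (2 * (z \<bullet> h))))) (at z)" .
  moreover have "- 2 * (v \<bullet> w) / (Q z) ^ 3 * (\<kappa> * (2 * (z \<bullet> h))) = - 4 * \<kappa> * (z \<bullet> h) * (v \<bullet> w) / (Q z) ^ 3" for h by simp
  ultimately show ?thesis unfolding g_kappa_def power2_norm_eq_inner Q_def by (simp only:)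
qed

text \<open>Testing against all w removes the inner product, and clearing the powers of the
  conformal factor leaves a vector equation that is polynomial in position and velocity.\<close>

lemma geodesic_equation_iff:
  assumes "1 + \<kappa> * (norm z)\<^sup>2 \<noteq> 0"
  shows "(\<forall>w. g_kappa \<kappa> z a w + christoffel (g_kappa \<kappa>) z v v w = 0) \<longleftrightarrow>
    (1 + \<kappa> * (norm z)\<^sup>2) *\<^sub>R a = (4 * \<kappa> * (z \<bullet> v)) *\<^sub>R v - (2 * \<kappa> * (v \<bullet> v)) *\<^sub>R z"
proof -
  define q where "q = 1 + \<kappa> * (norm z)\<^sup>2"
  have q: "q \<noteq> 0" using assms by (simp add: q_def)
  have fd: "frechet_derivative (\<lambda>y. g_kappa \<kappa> y v w) (at z) = (\<lambda>h. - 4 * \<kappa> * (z \<bullet> h) * (v \<bullet> w) / q ^ 3)" for v w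
    unfolding q_def by (rule frechet_derivative_at[OF g_kappa_has_derivative[OF assms], symmetric])
  have "g_kappa \<kappa> z a w + christoffel (g_kappa \<kappa>) z v v w
     = (q *\<^sub>R a - ((4 * \<kappa> * (z \<bullet> v)) *\<^sub>R v - (2 * \<kappa> * (v \<bullet> v)) *\<^sub>R z)) \<bullet> w / q ^ 3" for w
    unfolding christoffel_def fd using q
    by (simp add: g_kappa_def q_def[symmetric] inner_diff_left divide_simps) algebra
  then have "(\<forall>w. g_kappa \<kappa> z a w + christoffel (g_kappa \<kappa>) z v v w = 0) \<longleftrightarrow>
    (\<forall>w. (q *\<^sub>R a - ((4 * \<kappa> * (z \<bullet> v)) *\<^sub>R v - (2 * \<kappa> * (v \<bullet> v)) *\<^sub>R z)) \<bullet> w = 0)" using q by simp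
  also have "\<dots> \<longleftrightarrow> q *\<^sub>R a - ((4 * \<kappa> * (z \<bullet> v)) *\<^sub>R v - (2 * \<kappa> * (v \<bullet> v)) *\<^sub>R z) = 0"
    by (metis inner_eq_zero_iff inner_zero_left)
  finally show ?thesis by (simp add: q_def)
qed

text \<open>In the projective model, with inverse chart \<open>unklein\<close>, geodesics are Euclidean chords.\<close>

definition klein :: "complex \<Rightarrow> complex" where
  "klein z = ((1 - \<kappa>) / (1 - \<kappa> * (norm z)\<^sup>2)) *\<^sub>R z"

text \<open>The root of the discriminant when \<open>klein z = w\<close> is solved for the radius of
  z, a quadratic equation. The form of \<open>unklein\<close> puts the root in the denominator, so
  that it also makes sense for \<kappa> = 0.\<close>

definition hyp :: "complex \<Rightarrow> real" where
  "hyp w = sqrt ((1 - \<kappa>)\<^sup>2 + 4 * \<kappa> * (norm w)\<^sup>2)"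

definition unklein :: "complex \<Rightarrow> complex" where
  "unklein w = (2 / (1 - \<kappa> + hyp w)) *\<^sub>R w"

lemma hyp_arg_pos: "w \<in> disk \<Longrightarrow> (1 - \<kappa>)\<^sup>2 + 4 * \<kappa> * (norm w)\<^sup>2 > 0"
proof -
  assume "w \<in> disk"
  then have n: "0 \<le> (norm w)\<^sup>2" "(norm w)\<^sup>2 \<le> 1" by (simp_all add: power_le_one)
  \<comment> \<open>A convex combination of two positive squares.\<close>
  have "(1 - \<kappa>)\<^sup>2 + 4 * \<kappa> * (norm w)\<^sup>2 = (1 - \<kappa>)\<^sup>2 * (1 - (norm w)\<^sup>2) + (1 + \<kappa>)\<^sup>2 * (norm w)\<^sup>2" by algebra
  moreover have "(1 - \<kappa>)\<^sup>2 > 0" "(1 + \<kappa>)\<^sup>2 > 0" using \<kappa> by simp_all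
  ultimately show ?thesis using n by (cases "(norm w)\<^sup>2 = 1") (auto intro: add_pos_nonneg)
qed

lemma hyp_pos: "w \<in> disk \<Longrightarrow> hyp w > 0"
  using hyp_arg_pos by (simp add: hyp_def)

lemma hyp_klein:
  assumes "z \<in> disk"
  shows "hyp (klein z) = (1 - \<kappa>) * (1 + \<kappa> * (norm z)\<^sup>2) / (1 - \<kappa> * (norm z)\<^sup>2)"
proof -
  note q = q_pos[OF assms]
  have "(norm (klein z))\<^sup>2 = (1 - \<kappa>)\<^sup>2 * (norm z)\<^sup>2 / (1 - \<kappa> * (norm z)\<^sup>2)\<^sup>2"
    using q by (simp add: klein_def power_divide power_mult_distrib)
  then have "(1 - \<kappa>)\<^sup>2 + 4 * \<kappa> * (norm (klein z))\<^sup>2 = ((1 - \<kappa>) * (1 + \<kappa> * (norm z)\<^sup>2) / (1 - \<kappa> * (norm z)\<^sup>2))\<^sup>2"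
    using q by (simp add: divide_simps power_divide) algebra
  then show ?thesis using q \<kappa> unfolding hyp_def by (simp add: real_sqrt_unique)
qed

lemma klein_disk:
  assumes "z \<in> disk" shows "klein z \<in> disk"
proof -
  note q = q_pos[OF assms]
  have n: "norm z \<le> 1" using assms by simp
  have "\<bar>\<kappa> * norm z\<bar> \<le> \<bar>\<kappa>\<bar>" using mult_left_mono[OF n, of "\<bar>\<kappa>\<bar>"] by (simp add: abs_mult)
  then have "1 + \<kappa> * norm z \<ge> 0" using \<kappa>_cos(2) by linarith
  then have "(1 - norm z) * (1 + \<kappa> * norm z) \<ge> 0" using n by simp
  then have "(1 - \<kappa>) * norm z \<le> 1 - \<kappa> * (norm z)\<^sup>2" by (simp add: power2_eq_square algebra_simps)
  then show ?thesis using q \<kappa> by (simp add: klein_def)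
qed

lemma unklein_klein:
  assumes "z \<in> disk" shows "unklein (klein z) = z"
proof -
  note q = q_pos[OF assms]
  have e: "1 - \<kappa> + hyp (klein z) = 2 * (1 - \<kappa>) / (1 - \<kappa> * (norm z)\<^sup>2)"
    unfolding hyp_klein[OF assms] using q by (simp add: divide_simps) algebra
  have "2 / (2 * (1 - \<kappa>) / (1 - \<kappa> * (norm z)\<^sup>2)) * ((1 - \<kappa>) / (1 - \<kappa> * (norm z)\<^sup>2)) = 1"
    using q \<kappa> by (simp add: divide_simps) (simp add: algebra_simps)
  then show ?thesis unfolding unklein_def e unfolding klein_def scaleR_scaleR by simp
qed

lemma unklein_disk:
  assumes "w \<in> disk" shows "unklein w \<in> disk"
proof -
  have n: "norm w \<le> 1" using assms by simp
  have h: "hyp w > 0" by (rule hyp_pos[OF assms])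
  have "(2 * norm w - (1 - \<kappa>)) \<le> hyp w"
  proof (cases "2 * norm w \<le> 1 - \<kappa>")
    case True then show ?thesis using h by linarith
  next
    case False
    have "(2 * norm w - (1 - \<kappa>))\<^sup>2 \<le> (1 - \<kappa>)\<^sup>2 + 4 * \<kappa> * (norm w)\<^sup>2"
    proof -
      have "(1 - \<kappa>) * (norm w * (1 - norm w)) \<ge> 0" using n \<kappa> by simp
      then show ?thesis by (simp add: power2_eq_square algebra_simps)
    qed
    then show ?thesis unfolding hyp_def by (intro real_le_rsqrt)
  qed
  then show ?thesis using h \<kappa> by (simp add: unklein_def divide_le_eq)
qed

lemma klein_unklein:
  assumes "w \<in> disk" shows "klein (unklein w) = w"
proof -
  define D where "D = hyp w"
  have D: "D > 0" "D\<^sup>2 = (1 - \<kappa>)\<^sup>2 + 4 * \<kappa> * (norm w)\<^sup>2" using hyp_pos[OF assms] hyp_arg_pos[OF assms] by (simp_all add: D_def hyp_def)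
  have S: "1 - \<kappa> + D > 0" using D \<kappa> by simp
  have "(norm (unklein w))\<^sup>2 = 4 * (norm w)\<^sup>2 / (1 - \<kappa> + D)\<^sup>2" using S by (simp add: unklein_def D_def power_divide power_mult_distrib)
  then have *: "1 - \<kappa> * (norm (unklein w))\<^sup>2 = ((1 - \<kappa> + D)\<^sup>2 - 4 * \<kappa> * (norm w)\<^sup>2) / (1 - \<kappa> + D)\<^sup>2" using S by (simp add: field_simps)
  have **: "(1 - \<kappa> + D)\<^sup>2 - 4 * \<kappa> * (norm w)\<^sup>2 = 2 * (1 - \<kappa>) * (1 - \<kappa> + D)" using D(2) by algebra
  have ***: "1 - \<kappa> * (norm (unklein w))\<^sup>2 = 2 * (1 - \<kappa>) / (1 - \<kappa> + D)" unfolding * ** using S by (simp add: power2_eq_square)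
  have "(1 - \<kappa>) / (2 * (1 - \<kappa>) / (1 - \<kappa> + D)) * (2 / (1 - \<kappa> + D)) = 1" using S \<kappa> by (simp add: divide_simps)
  then show ?thesis unfolding klein_def *** unfolding unklein_def D_def[symmetric] scaleR_scaleR by simp
qed

lemma smooth_on_klein: "smooth_on disk klein"
proof -
  have "1 - \<kappa> * (z \<bullet> z) \<noteq> 0" if "z \<in> disk" for z
    using q_pos(2)[OF that] unfolding power2_norm_eq_inner by linarith
  then show ?thesis unfolding klein_def[abs_def] power2_norm_eq_inner by (intro smooth_intros)
qed

lemma smooth_on_hyp: "smooth_on disk hyp"
proof -
  have "(1 - \<kappa>)\<^sup>2 + 4 * \<kappa> * (w \<bullet> w) > 0" if "w \<in> disk" for w
    using hyp_arg_pos[OF that] unfolding power2_norm_eq_inner .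
  then show ?thesis unfolding hyp_def[abs_def] power2_norm_eq_inner by (intro smooth_intros)
qed

lemma smooth_on_unklein: "smooth_on disk unklein"
proof -
  have "1 - \<kappa> + hyp w \<noteq> 0" if "w \<in> disk" for w using hyp_pos[OF that] \<kappa> by linarith
  then show ?thesis unfolding unklein_def[abs_def] by (intro smooth_intros smooth_on_hyp)
qed

text \<open>Conservation law: with \<open>X = (z, (1 - \<kappa>|z|\<^sup>2) / 2) / (1 + \<kappa>|z|\<^sup>2)\<close> the geodesic equation becomes linear,
  so the Wronskian of the components of \<open>X\<close> is constant.\<close>

lemma wronskian_derivative:
  fixes a b a1 b1 :: "real \<Rightarrow> real"
  assumes d: "(a has_real_derivative a1 t) (at t within S)" "(b has_real_derivative b1 t) (at t within S)"
    "(a1 has_real_derivative a2) (at t within S)" "(b1 has_real_derivative b2) (at t within S)"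
    and q: "1 + \<kappa> * ((a t)\<^sup>2 + (b t)\<^sup>2) \<noteq> 0"
    and ode: "(1 + \<kappa> * ((a t)\<^sup>2 + (b t)\<^sup>2)) * a2 = 4 * \<kappa> * (a t * a1 t + b t * b1 t) * a1 t - 2 * \<kappa> * ((a1 t)\<^sup>2 + (b1 t)\<^sup>2) * a t"
      "(1 + \<kappa> * ((a t)\<^sup>2 + (b t)\<^sup>2)) * b2 = 4 * \<kappa> * (a t * a1 t + b t * b1 t) * b1 t - 2 * \<kappa> * ((a1 t)\<^sup>2 + (b1 t)\<^sup>2) * b t"
  shows "((\<lambda>t. ((1 - \<kappa> * ((a t)\<^sup>2 + (b t)\<^sup>2)) * a1 t + 2 * \<kappa> * (a t * a1 t + b t * b1 t) * a t) / (1 + \<kappa> * ((a t)\<^sup>2 + (b t)\<^sup>2))\<^sup>2)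
     has_real_derivative 0) (at t within S)"
proof -
  define q where "q = 1 + \<kappa> * ((a t)\<^sup>2 + (b t)\<^sup>2)"
  define r where "r = a t * a1 t + b t * b1 t"
  define N where "N = (2 - q) * a1 t + 2 * \<kappa> * r * a t"
  define r' where "r' = (a1 t)\<^sup>2 + (b1 t)\<^sup>2 + a t * a2 + b t * b2"
  define N' where "N' = (2 - q) * a2 + 2 * \<kappa> * r' * a t"
  have dq: "((\<lambda>t. 1 + \<kappa> * ((a t)\<^sup>2 + (b t)\<^sup>2)) has_real_derivative 2 * \<kappa> * r) (at t within S)"
    by (rule derivative_eq_intros d refl | simp add: r_def algebra_simps)+
  have dN: "((\<lambda>t. (1 - \<kappa> * ((a t)\<^sup>2 + (b t)\<^sup>2)) * a1 t + 2 * \<kappa> * (a t * a1 t + b t * b1 t) * a t) has_real_derivative N') (at t within S)"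
    by (rule derivative_eq_intros d refl | simp add: N'_def r'_def r_def q_def power2_eq_square algebra_simps)+
  have q0: "q \<noteq> 0" using q by (simp add: q_def)
  \<comment> \<open>The numerator of the derivative of \<open>N / q\<^sup>2\<close> after cancelling
    one factor q. The geodesic equation enters here.\<close>
  have "N' * q - 2 * N * (2 * \<kappa> * r) = 0"
    using ode unfolding q_def[symmetric] r_def[symmetric] N'_def N_def r'_def using q_def r_def by algebra
  then have e: "(N' * q\<^sup>2 - N * (2 * q * (2 * \<kappa> * r))) / (q\<^sup>2 * q\<^sup>2) = 0" using q0 by (simp add: power2_eq_square)
  have dq2: "((\<lambda>t. (1 + \<kappa> * ((a t)\<^sup>2 + (b t)\<^sup>2))\<^sup>2) has_real_derivative 2 * q * (2 * \<kappa> * r)) (at t within S)"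
    using DERIV_power[OF dq, of 2] by (simp add: q_def algebra_simps)
  have N: "(1 - \<kappa> * ((a t)\<^sup>2 + (b t)\<^sup>2)) * a1 t + 2 * \<kappa> * (a t * a1 t + b t * b1 t) * a t = N"
    by (simp add: N_def q_def r_def)
  show ?thesis using DERIV_divide[OF dN dq2] q0 e unfolding N q_def[symmetric] by simp
qed

end

section \<open>Motion along a line with prescribed speed\<close>

text \<open>Separation of variables: \<tau> is the antiderivative of the slowness h, that is, the
  time needed to reach x, and its inverse \<xi> is the motion itself. The case C = 0 is the glancing
  one.\<close>

lemma inverse_flow:
  fixes h :: "real \<Rightarrow> real"
  assumes h: "continuous_on UNIV h" and pos: "\<And>x. h x > 0" and C: "C \<ge> 0"
  obtains \<tau> \<xi> where "\<And>x. x \<in> {-C..C} \<Longrightarrow> (\<tau> has_real_derivative h x) (at x)"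
    "\<tau> (- C) = 0" "\<tau> C \<ge> 0" "\<And>x y. - C \<le> x \<Longrightarrow> x < y \<Longrightarrow> y \<le> C \<Longrightarrow> \<tau> x < \<tau> y"
    "\<And>t. t \<in> {0..\<tau> C} \<Longrightarrow> \<xi> t \<in> {-C..C}"
    "\<And>t. t \<in> {0..\<tau> C} \<Longrightarrow> (\<xi> has_real_derivative inverse (h (\<xi> t))) (at t)" "\<xi> 0 = - C"
proof -
  \<comment> \<open>The interval is enlarged so that -C and C become interior points; then all
    derivatives are two-sided, even for C = 0.\<close>
  obtain g where g: "\<And>x. x \<in> {-C-2..C+2} \<Longrightarrow> (g has_vector_derivative h x) (at x within {-C-2..C+2})"
    using antiderivative_continuous[OF continuous_on_subset[OF h]] by (metis subset_UNIV)
  define \<tau> where "\<tau> x = g x - g (- C)" for x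
  have d\<tau>: "(\<tau> has_real_derivative h x) (at x)" if "x \<in> {-C-1..C+1}" for x
  proof -
    have "x \<in> interior {-C-2..C+2}" using that by simp
    then have "(g has_real_derivative h x) (at x)"
      using g[of x] that at_within_interior[of x "{-C-2..C+2}"]
      by (simp add: has_real_derivative_iff_has_vector_derivative)
    then show ?thesis unfolding \<tau>_def by (auto intro!: derivative_eq_intros)
  qed
  have mono: "\<tau> x < \<tau> y" if "- C - 1 \<le> x" "x < y" "y \<le> C + 1" for x y
  proof (rule DERIV_pos_imp_increasing[OF that(2)])
    show "\<exists>d. (\<tau> has_real_derivative d) (at z) \<and> 0 < d" if "x \<le> z" "z \<le> y" for z
      using d\<tau>[of z] pos[of z] that \<open>- C - 1 \<le> x\<close> \<open>y \<le> C + 1\<close> by (intro exI[of _ "h z"]) auto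
  qed
  let ?I = "{-C-1..C+1}"
  have inj: "inj_on \<tau> ?I"
  proof (rule inj_onI)
    fix x y assume "x \<in> ?I" "y \<in> ?I" "\<tau> x = \<tau> y"
    then show "x = y" using mono[of x y] mono[of y x] by (cases x y rule: linorder_cases) auto
  qed
  have c\<tau>: "continuous_on ?I \<tau>"
    by (intro continuous_at_imp_continuous_on ballI) (use d\<tau> DERIV_isCont in blast)
  have surj: "\<exists>x\<in>?I. \<tau> x = t" if "\<tau> (- C - 1) \<le> t" "t \<le> \<tau> (C + 1)" for t
    using IVT'[of \<tau> "- C - 1" t "C + 1"] that C c\<tau> by auto
  define \<xi> where "\<xi> = the_inv_into ?I \<tau>"
  have \<xi>: "\<xi> t \<in> ?I" "\<tau> (\<xi> t) = t" if "\<tau> (- C - 1) \<le> t" "t \<le> \<tau> (C + 1)" for t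
    using surj[OF that] the_inv_into_f_f[OF inj] unfolding \<xi>_def by metis+
  have \<tau>C: "\<tau> (- C) = 0" by (simp add: \<tau>_def)
  have ends: "\<tau> (- C - 1) < 0" "\<tau> C < \<tau> (C + 1)" using mono[of "-C-1" "-C"] mono[of C "C+1"] C \<tau>C by auto
  have \<tau>C0: "\<tau> C \<ge> 0" using mono[of "-C" C] C \<tau>C by (cases "C = 0") auto
  have c\<xi>: "continuous_on {\<tau> (- C - 1)..\<tau> (C + 1)} \<xi>"
  proof -
    have "continuous_on (\<tau> ` ?I) \<xi>" unfolding \<xi>_def by (rule continuous_on_inv_into[OF c\<tau> compact_Icc inj])
    moreover have "{\<tau> (- C - 1)..\<tau> (C + 1)} \<subseteq> \<tau> ` ?I" using surj by force
    ultimately show ?thesis by (rule continuous_on_subset)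
  qed
  have \<xi>in: "\<xi> t \<in> {-C..C}" if "t \<in> {0..\<tau> C}" for t
  proof -
    have t: "\<tau> (- C - 1) \<le> t" "t \<le> \<tau> (C + 1)" using that ends by auto
    have "\<not> \<xi> t < - C" using mono[of "\<xi> t" "- C"] \<xi>[OF t] that \<tau>C C by auto
    moreover have "\<not> C < \<xi> t" using mono[of C "\<xi> t"] \<xi>[OF t] that C by auto
    ultimately show ?thesis by auto
  qed
  have d\<xi>: "(\<xi> has_real_derivative inverse (h (\<xi> t))) (at t)" if "t \<in> {0..\<tau> C}" for t
  proof (rule DERIV_inverse_function)
    show "(\<tau> has_real_derivative h (\<xi> t)) (at (\<xi> t))" using \<xi>in[OF that] by (intro d\<tau>) auto
    show "h (\<xi> t) \<noteq> 0" using pos[of "\<xi> t"] by simp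
    show "\<tau> (- C - 1) < t" "t < \<tau> (C + 1)" using that ends by auto
    show "\<tau> (\<xi> y) = y" if "\<tau> (- C - 1) < y" "y < \<tau> (C + 1)" for y using \<xi>(2) that by simp
    have "t \<in> interior {\<tau> (- C - 1)..\<tau> (C + 1)}" using that ends by (simp add: interior_atLeastAtMost_real)
    then show "isCont \<xi> t" by (rule continuous_on_interior[OF c\<xi>])
  qed
  have "\<xi> 0 = - C"
  proof -
    have "\<xi> 0 \<in> ?I" "\<tau> (\<xi> 0) = \<tau> (- C)" using \<xi>[of 0] ends \<tau>C0 \<tau>C by auto
    then show ?thesis using inj_onD[OF inj] C by auto
  qed
  with d\<tau> \<tau>C \<tau>C0 mono \<xi>in d\<xi> show thesis by (intro that[of \<tau> \<xi>]) auto
qed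

text \<open>Uniqueness by separation of variables: along any solution the difference between \<tau>
  and elapsed time has zero derivative.\<close>

lemma flow_time:
  assumes d\<tau>: "\<And>x. x \<in> {-C..C} \<Longrightarrow> (\<tau> has_real_derivative h x) (at x)" and "\<tau> (- C) = 0"
    and pos: "\<And>x. h x > (0::real)"
    and \<xi>: "\<And>t. t \<in> {0..T} \<Longrightarrow> \<xi> t \<in> {-C..C}" "\<xi> 0 = - C"
    "\<And>t. t \<in> {0..T} \<Longrightarrow> (\<xi> has_real_derivative inverse (h (\<xi> t))) (at t within {0..T})"
    and t: "t \<in> {0..T}"
  shows "\<tau> (\<xi> t) = t"
proof -
  have "((\<lambda>t. \<tau> (\<xi> t) - t) has_real_derivative 0) (at t within {0..T})" if "t \<in> {0..T}" for t
  proof -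
    have "((\<lambda>t. \<tau> (\<xi> t)) has_real_derivative h (\<xi> t) * inverse (h (\<xi> t))) (at t within {0..T})"
      by (rule DERIV_chain'[OF \<xi>(3)[OF that] d\<tau>[OF \<xi>(1)[OF that]]])
    then show ?thesis using pos[of "\<xi> t"] by (auto intro!: derivative_eq_intros)
  qed
  then obtain k where k: "\<And>t. t \<in> {0..T} \<Longrightarrow> \<tau> (\<xi> t) - t = k"
    using has_field_derivative_zero_constant[of "{0..T}" "\<lambda>t. \<tau> (\<xi> t) - t"] by auto
  show ?thesis using k[OF t] k[of 0] t assms(2) \<xi>(2) by simp
qed

context curvature begin

text \<open>The value of \<open>hyp\<close> at the foot of the chord, its point nearest to 0; see
  \<open>hyp_chord\<close> at x = 0.\<close>

definition amp :: "real \<Rightarrow> real" where "amp \<alpha> = (1 - \<kappa>\<^sup>2) / sqrt (pois \<alpha>)"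

lemma amp_pos: "amp \<alpha> > 0"
  using \<kappa>2 pois_pos by (simp add: amp_def)

lemma amp_wt: "amp \<alpha> = sqrt (1 - \<kappa>\<^sup>2) * wt \<alpha>"
  using \<kappa>2 by (simp add: amp_def wt_def real_sqrt_divide)

lemma amp_sq: "(amp \<alpha>)\<^sup>2 = (1 - \<kappa>)\<^sup>2 + 4 * \<kappa> * (sin (s \<alpha>))\<^sup>2"
proof -
  have p: "pois \<alpha> > 0" by (rule pois_pos)
  have "(sin (s \<alpha>))\<^sup>2 * pois \<alpha> = (1 - \<kappa>)\<^sup>2 * (sin \<alpha>)\<^sup>2"
    using arg_cong[OF sin_s[of \<alpha>], of "\<lambda>x. x\<^sup>2"] p by (simp add: power_mult_distrib)
  moreover have "pois \<alpha> = (1 + \<kappa>)\<^sup>2 - 4 * \<kappa> * (sin \<alpha>)\<^sup>2"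
    unfolding pois_def cos_double_sin by (simp add: power2_eq_square algebra_simps)
  ultimately have "((1 - \<kappa>)\<^sup>2 + 4 * \<kappa> * (sin (s \<alpha>))\<^sup>2) * pois \<alpha> = (1 - \<kappa>\<^sup>2)\<^sup>2" by algebra
  then have "(1 - \<kappa>)\<^sup>2 + 4 * \<kappa> * (sin (s \<alpha>))\<^sup>2 = (1 - \<kappa>\<^sup>2)\<^sup>2 / pois \<alpha>" using p by (simp add: eq_divide_eq)
  then show ?thesis using p by (simp add: amp_def power_divide)
qed

text \<open>The chord runs in direction \<open>- cis \<theta>\<close> at signed distance sin t from
  the origin, and x is Euclidean arc length from its foot. At x = -cos t it starts from
  \<open>cis (\<theta> - t)\<close>, which is \<open>cis \<beta>\<close> for \<theta> = \<beta> + s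
  \<alpha> and t = s \<alpha>.\<close>

definition chord :: "real \<Rightarrow> real \<Rightarrow> real \<Rightarrow> complex" where
  "chord \<theta> t x = - cis \<theta> * Complex x (sin t)"

lemma norm_chord: "(norm (chord \<theta> t x))\<^sup>2 = x\<^sup>2 + (sin t)\<^sup>2"
  by (simp add: chord_def norm_mult cmod_power2)

lemma chord_disk: "\<bar>x\<bar> \<le> cos t \<Longrightarrow> chord \<theta> t x \<in> disk"
proof -
  assume "\<bar>x\<bar> \<le> cos t"
  then have "x\<^sup>2 \<le> (cos t)\<^sup>2" by (metis abs_ge_zero power2_abs power_mono)
  then have "x\<^sup>2 + (sin t)\<^sup>2 \<le> 1" using sin_cos_squared_add[of t] by linarith
  then have "(norm (chord \<theta> t x))\<^sup>2 \<le> 1\<^sup>2" unfolding norm_chord by simp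
  then show ?thesis by (simp add: power2_le_imp_le)
qed

lemma hyp_chord: "hyp (chord \<theta> (s \<alpha>) x) = sqrt ((amp \<alpha>)\<^sup>2 + 4 * \<kappa> * x\<^sup>2)"
  unfolding hyp_def norm_chord amp_sq by (simp add: algebra_simps)

lemma hyp_chord_sq: "\<bar>x\<bar> \<le> cos (s \<alpha>) \<Longrightarrow> (hyp (chord \<theta> (s \<alpha>) x))\<^sup>2 = (amp \<alpha>)\<^sup>2 + 4 * \<kappa> * x\<^sup>2"
  "\<bar>x\<bar> \<le> cos (s \<alpha>) \<Longrightarrow> (amp \<alpha>)\<^sup>2 + 4 * \<kappa> * x\<^sup>2 > 0"
proof -
  assume "\<bar>x\<bar> \<le> cos (s \<alpha>)"
  from hyp_pos[OF chord_disk[OF this, of 0]] show "(amp \<alpha>)\<^sup>2 + 4 * \<kappa> * x\<^sup>2 > 0"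
    by (simp add: hyp_chord)
  then show "(hyp (chord \<theta> (s \<alpha>) x))\<^sup>2 = (amp \<alpha>)\<^sup>2 + 4 * \<kappa> * x\<^sup>2" by (simp add: hyp_chord)
qed

text \<open>The uniqueness half: whatever the solution, its projective image stays on one chord, and
  its position there solves a scalar autonomous equation.\<close>

lemma geodesic_klein:
  assumes \<alpha>: "\<alpha> \<in> {- (pi/2)..pi/2}"
    and geo: "geodesic_in_disk \<kappa> (cis \<beta>) (fan_vector \<kappa> (\<beta>, \<alpha>)) T \<gamma>"
  obtains \<xi> where "\<xi> 0 = - cos (s \<alpha>)" "\<And>t. t \<in> {0..T} \<Longrightarrow> \<bar>\<xi> t\<bar> \<le> cos (s \<alpha>)"
    "\<And>t. t \<in> {0..T} \<Longrightarrow> (\<xi> has_real_derivative ((amp \<alpha>)\<^sup>2 + 4 * \<kappa> * (\<xi> t)\<^sup>2) / amp \<alpha>) (at t within {0..T})"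
    "\<And>t. t \<in> {0..T} \<Longrightarrow> \<gamma> t = unklein (chord (\<beta> + s \<alpha>) (s \<alpha>) (\<xi> t))"
proof -
  define J where "J = {0..T}"
  have disk: "\<gamma> t \<in> disk" if "t \<in> J" for t
    using geo that unfolding geodesic_in_disk_def J_def by blast
  have T: "0 \<le> T" and g0: "\<gamma> 0 = cis \<beta>" using geo unfolding geodesic_in_disk_def by blast+
  obtain \<gamma>' where g'0: "\<gamma>' 0 = fan_vector \<kappa> (\<beta>, \<alpha>)" and gon: "geodesic_on (g_kappa \<kappa>) J \<gamma> \<gamma>'"
    using geo unfolding geodesic_in_disk_def J_def by blast
  obtain \<gamma>'' where gg: "\<forall>t\<in>J. (\<gamma> has_vector_derivative \<gamma>' t) (at t within J)
        \<and> (\<gamma>' has_vector_derivative \<gamma>'' t) (at t within J)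
        \<and> (\<forall>w. g_kappa \<kappa> (\<gamma> t) (\<gamma>'' t) w + christoffel (g_kappa \<kappa>) (\<gamma> t) (\<gamma>' t) (\<gamma>' t) w = 0)"
    using gon unfolding geodesic_on_def by blast
  have d1: "(\<gamma> has_vector_derivative \<gamma>' t) (at t within J)"
    and d2: "(\<gamma>' has_vector_derivative \<gamma>'' t) (at t within J)"
    and eq: "\<forall>w. g_kappa \<kappa> (\<gamma> t) (\<gamma>'' t) w + christoffel (g_kappa \<kappa>) (\<gamma> t) (\<gamma>' t) (\<gamma>' t) w = 0" if "t \<in> J" for t
    using gg that by blast+
  define a b a1 b1 where "a = (\<lambda>t. Re (\<gamma> t))" and "b = (\<lambda>t. Im (\<gamma> t))" and "a1 = (\<lambda>t. Re (\<gamma>' t))" and "b1 = (\<lambda>t. Im (\<gamma>' t))"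
  have nab: "(norm (\<gamma> t))\<^sup>2 = (a t)\<^sup>2 + (b t)\<^sup>2" for t by (simp add: a_def b_def cmod_power2)
  define q where "q t = 1 + \<kappa> * ((a t)\<^sup>2 + (b t)\<^sup>2)" for t
  define Q where "Q t = 1 - \<kappa> * ((a t)\<^sup>2 + (b t)\<^sup>2)" for t
  define r where "r t = a t * a1 t + b t * b1 t" for t
  have qpos: "q t > 0" "Q t > 0" if "t \<in> J" for t using q_pos[OF disk[OF that]] by (simp_all add: nab q_def Q_def)
  have da: "(a has_real_derivative a1 t) (at t within J)" "(b has_real_derivative b1 t) (at t within J)"
    "(a1 has_real_derivative Re (\<gamma>'' t)) (at t within J)" "(b1 has_real_derivative Im (\<gamma>'' t)) (at t within J)"
    if "t \<in> J" for t
    using d1[OF that] d2[OF that] by (simp_all add: has_vector_derivative_complex_iff a_def b_def a1_def b1_def)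
  have ode: "q t * Re (\<gamma>'' t) = 4 * \<kappa> * (a t * a1 t + b t * b1 t) * a1 t - 2 * \<kappa> * ((a1 t)\<^sup>2 + (b1 t)\<^sup>2) * a t"
    "q t * Im (\<gamma>'' t) = 4 * \<kappa> * (a t * a1 t + b t * b1 t) * b1 t - 2 * \<kappa> * ((a1 t)\<^sup>2 + (b1 t)\<^sup>2) * b t"
    if "t \<in> J" for t
  proof -
    have nz: "1 + \<kappa> * (norm (\<gamma> t))\<^sup>2 \<noteq> 0" using q_pos(1)[OF disk[OF that]] by simp
    from eq[OF that] have "q t *\<^sub>R \<gamma>'' t = (4 * \<kappa> * (\<gamma> t \<bullet> \<gamma>' t)) *\<^sub>R \<gamma>' t - (2 * \<kappa> * (\<gamma>' t \<bullet> \<gamma>' t)) *\<^sub>R \<gamma> t"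
      unfolding geodesic_equation_iff[OF nz] unfolding nab q_def .
    then show "q t * Re (\<gamma>'' t) = 4 * \<kappa> * (a t * a1 t + b t * b1 t) * a1 t - 2 * \<kappa> * ((a1 t)\<^sup>2 + (b1 t)\<^sup>2) * a t"
      "q t * Im (\<gamma>'' t) = 4 * \<kappa> * (a t * a1 t + b t * b1 t) * b1 t - 2 * \<kappa> * ((a1 t)\<^sup>2 + (b1 t)\<^sup>2) * b t"
      by (simp_all add: complex_eq_iff inner_complex_def a_def b_def a1_def b1_def power2_eq_square)
  qed
  \<comment> \<open>Twice the Wronskian of the components f / q and Q / (2q) in the conservation
    law.\<close>
  define M where "M f f1 t = (Q t * f1 t + 2 * \<kappa> * r t * f t) / (q t)\<^sup>2" for f f1 :: "real \<Rightarrow> real" and t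
  have dM: "(M a a1 has_real_derivative 0) (at t within J)" "(M b b1 has_real_derivative 0) (at t within J)" if "t \<in> J" for t
    using wronskian_derivative[OF da[OF that], OF _ ode[OF that, unfolded q_def]]
      wronskian_derivative[OF da(2)[OF that] da(1)[OF that] da(4)[OF that] da(3)[OF that]] ode[OF that] qpos(1)[OF that]
    unfolding M_def Q_def r_def q_def by (simp_all add: add.commute)
  have "convex J" by (simp add: J_def)
  have J0: "0 \<in> J" using T by (simp add: J_def)
  have constM: "M f f1 t = M f f1 0" if "\<And>t. t \<in> J \<Longrightarrow> (M f f1 has_real_derivative 0) (at t within J)" "t \<in> J" for f f1 t
    using has_field_derivative_zero_constant[OF \<open>convex J\<close>, of "M f f1"] that J0 by metis
  define P where "P = sqrt (pois \<alpha>)"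
  have P: "P > 0" "cos (s \<alpha>) * P = (1 + \<kappa>) * cos \<alpha>" "sin (s \<alpha>) * P = (1 - \<kappa>) * sin \<alpha>"
    unfolding P_def using pois_pos[of \<alpha>] cos_s sin_s by auto
  have amp: "amp \<alpha> = (1 - \<kappa>\<^sup>2) / P" by (simp add: amp_def P_def)
  have ab0: "a 0 = cos \<beta>" "b 0 = sin \<beta>" "a1 0 = - (1 + \<kappa>) * cos (\<beta> + \<alpha>)" "b1 0 = - (1 + \<kappa>) * sin (\<beta> + \<alpha>)"
    using g0 g'0 by (simp_all add: a_def b_def a1_def b1_def fan_vector_def algebra_simps cos_add sin_add)
  have r0: "r 0 = - (1 + \<kappa>) * cos \<alpha>"
  proof -
    have "r 0 = - (1 + \<kappa>) * (cos (\<beta> + \<alpha>) * cos \<beta> + sin (\<beta> + \<alpha>) * sin \<beta>)" unfolding r_def ab0 by (simp add: algebra_simps)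
    also have "cos (\<beta> + \<alpha>) * cos \<beta> + sin (\<beta> + \<alpha>) * sin \<beta> = cos \<alpha>" using cos_diff[of "\<beta> + \<alpha>" \<beta>] by simp
    finally show ?thesis .
  qed
  have q0: "q 0 = 1 + \<kappa>" "Q 0 = 1 - \<kappa>" by (simp_all add: q_def Q_def ab0)
  \<comment> \<open>These addition formulas evaluate the conserved vector at time 0: it is -P / (1 +
    \<kappa>) times the unit vector of angle \<beta> + s \<alpha>.\<close>
  have Pcs: "P * cos (\<beta> + s \<alpha>) = (1 - \<kappa>) * cos (\<beta> + \<alpha>) + 2 * \<kappa> * cos \<alpha> * cos \<beta>"
    "P * sin (\<beta> + s \<alpha>) = (1 - \<kappa>) * sin (\<beta> + \<alpha>) + 2 * \<kappa> * cos \<alpha> * sin \<beta>"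
    using P(2,3) unfolding cos_add sin_add by algebra+
  have M0: "M a a1 0 = - P * cos (\<beta> + s \<alpha>) / (1 + \<kappa>)" "M b b1 0 = - P * sin (\<beta> + s \<alpha>) / (1 + \<kappa>)"
  proof -
    have "(1 - \<kappa>) * (- (1 + \<kappa>) * cos (\<beta> + \<alpha>)) + 2 * \<kappa> * (- (1 + \<kappa>) * cos \<alpha>) * cos \<beta> = - (1 + \<kappa>) * (P * cos (\<beta> + s \<alpha>))"
      "(1 - \<kappa>) * (- (1 + \<kappa>) * sin (\<beta> + \<alpha>)) + 2 * \<kappa> * (- (1 + \<kappa>) * cos \<alpha>) * sin \<beta> = - (1 + \<kappa>) * (P * sin (\<beta> + s \<alpha>))"
      unfolding Pcs by algebra+
    moreover have "- (1 + \<kappa>) * X / (1 + \<kappa>)\<^sup>2 = - X / (1 + \<kappa>)" for X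
    proof -
      have k: "1 + \<kappa> \<noteq> 0" "(1 + \<kappa>)\<^sup>2 \<noteq> 0" using \<kappa> by simp_all
      show ?thesis unfolding frac_eq_eq[OF k(2,1)] by algebra
    qed
    ultimately show "M a a1 0 = - P * cos (\<beta> + s \<alpha>) / (1 + \<kappa>)" "M b b1 0 = - P * sin (\<beta> + s \<alpha>) / (1 + \<kappa>)"
      unfolding M_def q0 r0 ab0 by simp_all
  qed
  define w where "w t = klein (\<gamma> t)" for t
  define H where "H t = hyp (w t)" for t
  have H: "H t = (1 - \<kappa>) * q t / Q t" if "t \<in> J" for t
    unfolding H_def w_def hyp_klein[OF disk[OF that]] by (simp add: nab q_def Q_def)
  have w: "Re (w t) = (1 - \<kappa>) * a t / Q t" "Im (w t) = (1 - \<kappa>) * b t / Q t" for t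
    by (simp_all add: w_def klein_def nab Q_def a_def b_def)
  have dQ: "(Q has_real_derivative - (2 * \<kappa> * r t)) (at t within J)" if "t \<in> J" for t
    unfolding Q_def by (rule derivative_eq_intros da[OF that] refl | simp add: r_def algebra_simps)+
  \<comment> \<open>The derivative of f / Q is the conserved quantity times (q / Q)^2. So the
    projective image moves in a constant direction, with a speed that depends only on its
    position.\<close>
  have dw: "((\<lambda>t. (1 - \<kappa>) * f t / Q t) has_real_derivative (H t)\<^sup>2 / (1 - \<kappa>) * M f f1 0) (at t within J)"
    if t: "t \<in> J" and f: "(f has_real_derivative f1 t) (at t within J)" and fM: "\<And>t. t \<in> J \<Longrightarrow> (M f f1 has_real_derivative 0) (at t within J)" for t f f1
  proof -
    have "((\<lambda>t. (1 - \<kappa>) * f t / Q t) has_real_derivative ((1 - \<kappa>) * f1 t * Q t - (1 - \<kappa>) * f t * (- (2 * \<kappa> * r t))) / (Q t * Q t)) (at t within J)"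
      by (rule DERIV_divide[OF DERIV_cmult[OF f] dQ[OF t]]) (use qpos(2)[OF t] in simp)
    moreover have "((1 - \<kappa>) * f1 t * Q t - (1 - \<kappa>) * f t * (- (2 * \<kappa> * r t))) / (Q t * Q t) = (H t)\<^sup>2 / (1 - \<kappa>) * M f f1 t"
      unfolding H[OF t] M_def using qpos[OF t] \<kappa> by (simp add: field_simps power2_eq_square)
    ultimately show ?thesis using constM[OF fM t] by simp
  qed
  define \<theta> where "\<theta> = \<beta> + s \<alpha>"
  \<comment> \<open>Coordinates along and across the direction of motion; \<eta> will be
    constant.\<close>
  define \<xi> where "\<xi> t = - (Re (w t) * cos \<theta> + Im (w t) * sin \<theta>)" for t
  define \<eta> where "\<eta> t = - (Im (w t) * cos \<theta> - Re (w t) * sin \<theta>)" for t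
  have dRe: "((\<lambda>t. Re (w t)) has_real_derivative (H t)\<^sup>2 / (1 - \<kappa>) * (- P * cos \<theta> / (1 + \<kappa>))) (at t within J)"
    and dIm: "((\<lambda>t. Im (w t)) has_real_derivative (H t)\<^sup>2 / (1 - \<kappa>) * (- P * sin \<theta> / (1 + \<kappa>))) (at t within J)" if "t \<in> J" for t
    unfolding w \<theta>_def M0[symmetric] by (rule dw[OF that]; use da dM that in auto)+
  have d\<xi>: "(\<xi> has_real_derivative (H t)\<^sup>2 / amp \<alpha>) (at t within J)" if "t \<in> J" for t
  proof -
    have "(\<xi> has_real_derivative - ((H t)\<^sup>2 / (1 - \<kappa>) * (- P * cos \<theta> / (1 + \<kappa>)) * cos \<theta> + (H t)\<^sup>2 / (1 - \<kappa>) * (- P * sin \<theta> / (1 + \<kappa>)) * sin \<theta>)) (at t within J)"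
      unfolding \<xi>_def by (intro DERIV_minus DERIV_add DERIV_cmult_right dRe dIm that)
    also have "- ((H t)\<^sup>2 / (1 - \<kappa>) * (- P * cos \<theta> / (1 + \<kappa>)) * cos \<theta> + (H t)\<^sup>2 / (1 - \<kappa>) * (- P * sin \<theta> / (1 + \<kappa>)) * sin \<theta>)
        = (H t)\<^sup>2 / (1 - \<kappa>) * (P / (1 + \<kappa>)) * ((sin \<theta>)\<^sup>2 + (cos \<theta>)\<^sup>2)"
      by (simp only: divide_inverse power2_eq_square) algebra
    also have "\<dots> = (H t)\<^sup>2 * P / ((1 - \<kappa>) * (1 + \<kappa>))" by simp
    also have "(1 - \<kappa>) * (1 + \<kappa>) = 1 - \<kappa>\<^sup>2" by algebra
    also have "(H t)\<^sup>2 * P / (1 - \<kappa>\<^sup>2) = (H t)\<^sup>2 / amp \<alpha>" unfolding amp by simp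
    finally show ?thesis .
  qed
  have d\<eta>: "(\<eta> has_real_derivative 0) (at t within J)" if "t \<in> J" for t
  proof -
    have "(\<eta> has_real_derivative - ((H t)\<^sup>2 / (1 - \<kappa>) * (- P * sin \<theta> / (1 + \<kappa>)) * cos \<theta> - (H t)\<^sup>2 / (1 - \<kappa>) * (- P * cos \<theta> / (1 + \<kappa>)) * sin \<theta>)) (at t within J)"
      unfolding \<eta>_def by (intro DERIV_minus DERIV_diff DERIV_cmult_right dRe dIm that)
    then show ?thesis by simp
  qed
  have w0: "w 0 = cis \<beta>" using \<kappa> by (simp add: w_def g0 klein_def)
  have \<xi>0: "\<xi> 0 = - cos (s \<alpha>)" "\<eta> 0 = sin (s \<alpha>)"
    using cos_diff[of \<theta> \<beta>] sin_diff[of \<theta> \<beta>] by (simp_all add: \<xi>_def \<eta>_def w0 \<theta>_def algebra_simps)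
  have \<eta>: "\<eta> t = sin (s \<alpha>)" if "t \<in> J" for t
    using has_field_derivative_zero_constant[OF \<open>convex J\<close> d\<eta>] that J0 \<xi>0(2) by metis
  have wc: "w t = chord \<theta> (s \<alpha>) (\<xi> t)" if "t \<in> J" for t
  proof -
    have cs: "(sin \<theta>)\<^sup>2 + (cos \<theta>)\<^sup>2 = 1" by simp
    have "Re (w t) = - (cos \<theta> * \<xi> t - sin \<theta> * \<eta> t)" "Im (w t) = - (cos \<theta> * \<eta> t + sin \<theta> * \<xi> t)"
      unfolding \<xi>_def \<eta>_def using cs by algebra+
    then show ?thesis unfolding \<eta>[OF that] by (simp add: chord_def complex_eq_iff)
  qed
  have C0: "cos (s \<alpha>) \<ge> 0" using s_influx[OF \<alpha>] by (intro cos_ge_zero) auto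
  have bound: "\<bar>\<xi> t\<bar> \<le> cos (s \<alpha>)" if "t \<in> J" for t
  proof -
    have "norm (w t) \<le> 1" using klein_disk[OF disk[OF that]] by (simp add: w_def)
    then have "(norm (w t))\<^sup>2 \<le> 1" by (simp add: power_le_one)
    then have "(\<xi> t)\<^sup>2 \<le> (cos (s \<alpha>))\<^sup>2" unfolding wc[OF that] norm_chord using sin_cos_squared_add[of "s \<alpha>"] by linarith
    then show ?thesis using C0 by (simp add: abs_le_square_iff[symmetric])
  qed
  show thesis
  proof (rule that[of \<xi>])
    show "\<xi> 0 = - cos (s \<alpha>)" by (rule \<xi>0)
    fix t assume "t \<in> {0..T}"
    then have t: "t \<in> J" by (simp add: J_def)
    show "\<bar>\<xi> t\<bar> \<le> cos (s \<alpha>)" by (rule bound[OF t])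
    show "(\<xi> has_real_derivative ((amp \<alpha>)\<^sup>2 + 4 * \<kappa> * (\<xi> t)\<^sup>2) / amp \<alpha>) (at t within {0..T})"
      using d\<xi>[OF t] unfolding H_def wc[OF t] hyp_chord_sq(1)[OF bound[OF t]] by (simp add: J_def)
    show "\<gamma> t = unklein (chord (\<beta> + s \<alpha>) (s \<alpha>) (\<xi> t))"
      using unklein_klein[OF disk[OF t]] wc[OF t] by (simp add: w_def \<theta>_def)
  qed
qed

section \<open>Chords are geodesics: explicit verification\<close>

text \<open>In a frame rotated along the chord, a and b are the coordinates of
  \<open>unklein\<close> of a chord point, with D the value of \<open>hyp\<close> there, and the
  other letters are their first and second derivatives. Step \<open>e\<close> together with
  \<open>q\<close> says that the curve has unit speed.\<close>

lemma geodesic_identities: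
  fixes A D x p :: real
  defines "c \<equiv> 1 - \<kappa>"
  defines "S \<equiv> c + D"
  defines "a \<equiv> 2 * x / S" and "b \<equiv> 2 * p / S"
    and "a1 \<equiv> 2 * D * (c * D + A\<^sup>2) / (A * S\<^sup>2)" and "b1 \<equiv> - 8 * \<kappa> * p * x * D / (A * S\<^sup>2)"
    and "a2 \<equiv> 8 * \<kappa> * x * D * (2 * c\<^sup>2 * D + A\<^sup>2 * c - A\<^sup>2 * D) / (A\<^sup>2 * S ^ 3)"
    and "b2 \<equiv> - 8 * \<kappa> * p * D * (2 * c * D\<^sup>2 - A\<^sup>2 * c + A\<^sup>2 * D) / (A\<^sup>2 * S ^ 3)"
  assumes pos: "A > 0" "D > 0" and D: "D\<^sup>2 = A\<^sup>2 + 4 * \<kappa> * x\<^sup>2" and A: "A\<^sup>2 = c\<^sup>2 + 4 * \<kappa> * p\<^sup>2"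
  shows "(1 + \<kappa> * (a\<^sup>2 + b\<^sup>2)) * a2 = 4 * \<kappa> * (a * a1 + b * b1) * a1 - 2 * \<kappa> * (a1\<^sup>2 + b1\<^sup>2) * a"
    "(1 + \<kappa> * (a\<^sup>2 + b\<^sup>2)) * b2 = 4 * \<kappa> * (a * a1 + b * b1) * b1 - 2 * \<kappa> * (a1\<^sup>2 + b1\<^sup>2) * b"
proof -
  have S: "S > 0" using pos \<kappa> by (simp add: S_def c_def)
  note nz = pos[THEN less_imp_neq, THEN not_sym] S[THEN less_imp_neq, THEN not_sym]
  have q: "1 + \<kappa> * (a\<^sup>2 + b\<^sup>2) = 2 * D / S"
  proof -
    have "S\<^sup>2 + 4 * \<kappa> * (x\<^sup>2 + p\<^sup>2) = 2 * D * S" using D A S_def by algebra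
    then show ?thesis using nz by (simp add: a_def b_def power_divide power_mult_distrib divide_simps power2_eq_square) algebra
  qed
  have r: "a * a1 + b * b1 = 4 * c * x * D / (A * S\<^sup>2)"
  proof -
    have "a * a1 + b * b1 = 4 * x * D * (c * D + A\<^sup>2 - 4 * \<kappa> * p\<^sup>2) / (A * S ^ 3)"
      using nz unfolding a_def b_def a1_def b1_def by (simp add: divide_simps) algebra
    also have "c * D + A\<^sup>2 - 4 * \<kappa> * p\<^sup>2 = c * S" unfolding S_def A by algebra
    finally show ?thesis using nz by (simp add: power2_eq_square power3_eq_cube)
  qed
  have e: "a1\<^sup>2 + b1\<^sup>2 = 4 * D\<^sup>2 / S\<^sup>2"
  proof -
    have "a1\<^sup>2 + b1\<^sup>2 = 4 * D\<^sup>2 * ((c * D + A\<^sup>2)\<^sup>2 + 16 * \<kappa>\<^sup>2 * p\<^sup>2 * x\<^sup>2) / (A * S\<^sup>2)\<^sup>2"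
      unfolding a1_def b1_def by (simp add: power_divide add_divide_distrib[symmetric]) algebra
    also have "(c * D + A\<^sup>2)\<^sup>2 + 16 * \<kappa>\<^sup>2 * p\<^sup>2 * x\<^sup>2 = (A * S)\<^sup>2" using D A S_def by algebra
    finally show ?thesis using nz by (simp add: power2_eq_square)
  qed
  have k: "2 * D * (8 * \<kappa> * x * D * (2 * c\<^sup>2 * D + A\<^sup>2 * c - A\<^sup>2 * D))
    = 4 * \<kappa> * (4 * c * x * D) * (2 * D * (c * D + A\<^sup>2)) - 2 * \<kappa> * (4 * D\<^sup>2) * (2 * x) * (A\<^sup>2 * S)"
    unfolding S_def by algebra
  have l1: "2 * D / S * a2 = 2 * D * (8 * \<kappa> * x * D * (2 * c\<^sup>2 * D + A\<^sup>2 * c - A\<^sup>2 * D)) / (A\<^sup>2 * S ^ 4)"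
    unfolding a2_def using nz by (simp add: power4_eq_xxxx power3_eq_cube power2_eq_square)
  have r1: "4 * \<kappa> * (4 * c * x * D / (A * S\<^sup>2)) * a1 - 2 * \<kappa> * (4 * D\<^sup>2 / S\<^sup>2) * a
     = (4 * \<kappa> * (4 * c * x * D) * (2 * D * (c * D + A\<^sup>2)) - 2 * \<kappa> * (4 * D\<^sup>2) * (2 * x) * (A\<^sup>2 * S)) / (A\<^sup>2 * S ^ 4)"
    unfolding a1_def a_def diff_divide_distrib using nz
    by (simp add: power4_eq_xxxx power3_eq_cube power2_eq_square) (simp add: ac_simps)
  show "(1 + \<kappa> * (a\<^sup>2 + b\<^sup>2)) * a2 = 4 * \<kappa> * (a * a1 + b * b1) * a1 - 2 * \<kappa> * (a1\<^sup>2 + b1\<^sup>2) * a"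
    unfolding q r e l1 r1 k ..
  have k': "2 * D * (- 8 * \<kappa> * p * D * (2 * c * D\<^sup>2 - A\<^sup>2 * c + A\<^sup>2 * D))
    = 4 * \<kappa> * (4 * c * x * D) * (- 8 * \<kappa> * p * x * D) - 2 * \<kappa> * (4 * D\<^sup>2) * (2 * p) * (A\<^sup>2 * S)"
    unfolding S_def using D by algebra
  have l2: "2 * D / S * b2 = 2 * D * (- 8 * \<kappa> * p * D * (2 * c * D\<^sup>2 - A\<^sup>2 * c + A\<^sup>2 * D)) / (A\<^sup>2 * S ^ 4)"
    unfolding b2_def using nz by (simp add: power4_eq_xxxx power3_eq_cube power2_eq_square)
  have r2: "4 * \<kappa> * (4 * c * x * D / (A * S\<^sup>2)) * b1 - 2 * \<kappa> * (4 * D\<^sup>2 / S\<^sup>2) * b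
     = (4 * \<kappa> * (4 * c * x * D) * (- 8 * \<kappa> * p * x * D) - 2 * \<kappa> * (4 * D\<^sup>2) * (2 * p) * (A\<^sup>2 * S)) / (A\<^sup>2 * S ^ 4)"
    unfolding b1_def b_def diff_divide_distrib using nz
    by (simp add: power4_eq_xxxx power3_eq_cube power2_eq_square) (simp add: ac_simps)
  show "(1 + \<kappa> * (a\<^sup>2 + b\<^sup>2)) * b2 = 4 * \<kappa> * (a * a1 + b * b1) * b1 - 2 * \<kappa> * (a1\<^sup>2 + b1\<^sup>2) * b"
    unfolding q r e l2 r2 k' ..
qed

text \<open>The rules \<xi>' = D^2 / A and D' = 4 \<kappa> \<xi> D / A express all derivatives
  rationally in \<xi> and D; the relation for D^2 then brings them to the form in
  \<open>geodesic_identities\<close>.\<close>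

lemma geodesic_derivatives:
  fixes A p :: real and \<xi> D :: "real \<Rightarrow> real"
  defines "c \<equiv> 1 - \<kappa>"
  defines "S \<equiv> (\<lambda>t. c + D t)"
  assumes pos: "A > 0" "D t > 0" and D: "(D t)\<^sup>2 = A\<^sup>2 + 4 * \<kappa> * (\<xi> t)\<^sup>2"
    and d\<xi>: "(\<xi> has_real_derivative (D t)\<^sup>2 / A) (at t)"
    and dD: "(D has_real_derivative 4 * \<kappa> * \<xi> t * D t / A) (at t)"
  shows "((\<lambda>t. 2 * \<xi> t / S t) has_real_derivative 2 * D t * (c * D t + A\<^sup>2) / (A * (S t)\<^sup>2)) (at t)"
    "((\<lambda>t. 2 * p / S t) has_real_derivative - 8 * \<kappa> * p * \<xi> t * D t / (A * (S t)\<^sup>2)) (at t)"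
    "((\<lambda>t. 2 * D t * (c * D t + A\<^sup>2) / (A * (S t)\<^sup>2)) has_real_derivative
       8 * \<kappa> * \<xi> t * D t * (2 * c\<^sup>2 * D t + A\<^sup>2 * c - A\<^sup>2 * D t) / (A\<^sup>2 * (S t) ^ 3)) (at t)"
    "((\<lambda>t. - 8 * \<kappa> * p * \<xi> t * D t / (A * (S t)\<^sup>2)) has_real_derivative
       - 8 * \<kappa> * p * D t * (2 * c * (D t)\<^sup>2 - A\<^sup>2 * c + A\<^sup>2 * D t) / (A\<^sup>2 * (S t) ^ 3)) (at t)"
proof -
  have S: "S t > 0" using pos \<kappa> by (simp add: S_def c_def)
  note nz = pos[THEN less_imp_neq, THEN not_sym] S[THEN less_imp_neq, THEN not_sym]
  define x d D' \<sigma> where "x = \<xi> t" and "d = D t" and "D' = 4 * \<kappa> * \<xi> t * D t / A" and "\<sigma> = S t"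
  have \<sigma>: "\<sigma> = c + d" by (simp add: \<sigma>_def S_def d_def)
  have dS: "(S has_real_derivative D') (at t)"
    unfolding S_def D'_def by (rule derivative_eq_intros dD refl | simp)+
  have Dx: "d\<^sup>2 = A\<^sup>2 + 4 * \<kappa> * x\<^sup>2" using D by (simp add: d_def x_def)
  have nz': "A \<noteq> 0" "\<sigma> \<noteq> 0" using nz by (auto simp: \<sigma>_def)
  have D': "D' = 4 * \<kappa> * x * d / A" by (simp add: D'_def x_def d_def)
  have dS2: "((\<lambda>t. A * (S t)\<^sup>2) has_real_derivative A * (2 * \<sigma> * D')) (at t)"
    using DERIV_cmult[OF DERIV_power[OF dS, of 2], of A] by (simp add: \<sigma>_def algebra_simps)
  have nzS: "A * (S t)\<^sup>2 \<noteq> 0" using nz by simp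
  have "((\<lambda>t. 2 * \<xi> t / S t) has_real_derivative (2 * (d\<^sup>2 / A) * \<sigma> - 2 * x * D') / (\<sigma> * \<sigma>)) (at t)"
    unfolding \<sigma>_def x_def d_def by (rule DERIV_divide[OF DERIV_cmult[OF d\<xi>] dS nz(3)])
  moreover have "2 * (d\<^sup>2 / A) * \<sigma> - 2 * x * D' = 2 * d * (c * d + A\<^sup>2) / A"
  proof -
    have "2 * d\<^sup>2 * \<sigma> - 2 * x * (4 * \<kappa> * x * d) = 2 * d * (c * d + A\<^sup>2)" unfolding \<sigma> using Dx by algebra
    then show ?thesis unfolding D' by (simp add: diff_divide_distrib[symmetric])
  qed
  ultimately show "((\<lambda>t. 2 * \<xi> t / S t) has_real_derivative 2 * D t * (c * D t + A\<^sup>2) / (A * (S t)\<^sup>2)) (at t)"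
    by (simp add: \<sigma>_def d_def power2_eq_square)
  have "((\<lambda>t. 2 * p / S t) has_real_derivative (0 * \<sigma> - 2 * p * D') / (\<sigma> * \<sigma>)) (at t)"
    unfolding \<sigma>_def by (rule DERIV_divide[OF DERIV_const dS nz(3)])
  then show "((\<lambda>t. 2 * p / S t) has_real_derivative - 8 * \<kappa> * p * \<xi> t * D t / (A * (S t)\<^sup>2)) (at t)"
    by (simp add: D'_def \<sigma>_def power2_eq_square mult.assoc) (simp add: ac_simps)
  have dN: "((\<lambda>t. 2 * D t * (c * D t + A\<^sup>2)) has_real_derivative (4 * c * d + 2 * A\<^sup>2) * D') (at t)"
    by (rule derivative_eq_intros dD refl | simp add: D'_def d_def algebra_simps add_divide_distrib)+
  have "((\<lambda>t. 2 * D t * (c * D t + A\<^sup>2) / (A * (S t)\<^sup>2)) has_real_derivative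
     ((4 * c * d + 2 * A\<^sup>2) * D' * (A * \<sigma>\<^sup>2) - 2 * d * (c * d + A\<^sup>2) * (A * (2 * \<sigma> * D'))) / ((A * \<sigma>\<^sup>2) * (A * \<sigma>\<^sup>2))) (at t)"
    using DERIV_divide[OF dN dS2 nzS] by (simp only: \<sigma>_def[symmetric] d_def[symmetric])
  moreover have "((4 * c * d + 2 * A\<^sup>2) * D' * (A * \<sigma>\<^sup>2) - 2 * d * (c * d + A\<^sup>2) * (A * (2 * \<sigma> * D'))) / ((A * \<sigma>\<^sup>2) * (A * \<sigma>\<^sup>2))
     = 8 * \<kappa> * x * d * (2 * c\<^sup>2 * d + A\<^sup>2 * c - A\<^sup>2 * d) / (A\<^sup>2 * \<sigma> ^ 3)"
  proof -
    have "((4 * c * d + 2 * A\<^sup>2) * D' * (A * \<sigma>\<^sup>2) - 2 * d * (c * d + A\<^sup>2) * (A * (2 * \<sigma> * D'))) / ((A * \<sigma>\<^sup>2) * (A * \<sigma>\<^sup>2))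
      = D' * (A * \<sigma>) * ((4 * c * d + 2 * A\<^sup>2) * \<sigma> - 4 * d * (c * d + A\<^sup>2)) / ((A * \<sigma>) * (A * \<sigma> ^ 3))"
      by (rule arg_cong2[where f = "(/)"]) algebra+
    also have "\<dots> = D' * (2 * (2 * c\<^sup>2 * d + A\<^sup>2 * c - A\<^sup>2 * d)) / (A * \<sigma> ^ 3)"
    proof -
      have "(4 * c * d + 2 * A\<^sup>2) * \<sigma> - 4 * d * (c * d + A\<^sup>2) = 2 * (2 * c\<^sup>2 * d + A\<^sup>2 * c - A\<^sup>2 * d)"
        unfolding \<sigma> by algebra
      then show ?thesis using nz' by (simp add: mult.assoc)
    qed
    also have "\<dots> = 8 * \<kappa> * x * d * (2 * c\<^sup>2 * d + A\<^sup>2 * c - A\<^sup>2 * d) / (A\<^sup>2 * \<sigma> ^ 3)"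
    proof -
      have "D' * (2 * E) / (A * \<sigma> ^ 3) = 8 * \<kappa> * x * d * E / (A\<^sup>2 * \<sigma> ^ 3)" for E
        unfolding D' by (simp add: power2_eq_square ac_simps)
      then show ?thesis .
    qed
    finally show ?thesis .
  qed
  ultimately show "((\<lambda>t. 2 * D t * (c * D t + A\<^sup>2) / (A * (S t)\<^sup>2)) has_real_derivative
       8 * \<kappa> * \<xi> t * D t * (2 * c\<^sup>2 * D t + A\<^sup>2 * c - A\<^sup>2 * D t) / (A\<^sup>2 * (S t) ^ 3)) (at t)"
    by (simp only: \<sigma>_def d_def x_def)
  have dN2: "((\<lambda>t. - 8 * \<kappa> * p * \<xi> t * D t) has_real_derivative - 8 * \<kappa> * p * (d\<^sup>2 / A * d + x * D')) (at t)"
    by (rule derivative_eq_intros d\<xi> dD refl | simp add: D'_def d_def x_def algebra_simps)+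
  have "((\<lambda>t. - 8 * \<kappa> * p * \<xi> t * D t / (A * (S t)\<^sup>2)) has_real_derivative
     (- 8 * \<kappa> * p * (d\<^sup>2 / A * d + x * D') * (A * \<sigma>\<^sup>2) - - 8 * \<kappa> * p * x * d * (A * (2 * \<sigma> * D'))) / ((A * \<sigma>\<^sup>2) * (A * \<sigma>\<^sup>2))) (at t)"
    using DERIV_divide[OF dN2 dS2 nzS] by (simp only: \<sigma>_def[symmetric] d_def[symmetric] x_def[symmetric])
  moreover have "(- 8 * \<kappa> * p * (d\<^sup>2 / A * d + x * D') * (A * \<sigma>\<^sup>2) - - 8 * \<kappa> * p * x * d * (A * (2 * \<sigma> * D'))) / ((A * \<sigma>\<^sup>2) * (A * \<sigma>\<^sup>2))
     = - 8 * \<kappa> * p * d * (2 * c * d\<^sup>2 - A\<^sup>2 * c + A\<^sup>2 * d) / (A\<^sup>2 * \<sigma> ^ 3)"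
  proof -
    have AD: "A * D' = 4 * \<kappa> * x * d" using nz' by (simp add: D')
    have Ad: "A * (d\<^sup>2 / A * d) = d ^ 3" using nz' by (simp add: power3_eq_cube power2_eq_square)
    have "A * (- 8 * \<kappa> * p * (d\<^sup>2 / A * d + x * D') * (A * \<sigma>\<^sup>2) - - 8 * \<kappa> * p * x * d * (A * (2 * \<sigma> * D')))
       = - 8 * \<kappa> * p * A * \<sigma> * ((A * (d\<^sup>2 / A * d) + x * (A * D')) * \<sigma> - 2 * x * d * (A * D'))" by algebra
    also have "(A * (d\<^sup>2 / A * d) + x * (A * D')) * \<sigma> - 2 * x * d * (A * D') = d * (2 * c * d\<^sup>2 - A\<^sup>2 * c + A\<^sup>2 * d)"
      unfolding AD Ad \<sigma> using Dx by algebra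
    finally have "A * (- 8 * \<kappa> * p * (d\<^sup>2 / A * d + x * D') * (A * \<sigma>\<^sup>2) - - 8 * \<kappa> * p * x * d * (A * (2 * \<sigma> * D')))
       = A * (- 8 * \<kappa> * p * \<sigma> * (d * (2 * c * d\<^sup>2 - A\<^sup>2 * c + A\<^sup>2 * d)))" by (simp only: ac_simps)
    then have X: "- 8 * \<kappa> * p * (d\<^sup>2 / A * d + x * D') * (A * \<sigma>\<^sup>2) - - 8 * \<kappa> * p * x * d * (A * (2 * \<sigma> * D'))
       = - 8 * \<kappa> * p * \<sigma> * (d * (2 * c * d\<^sup>2 - A\<^sup>2 * c + A\<^sup>2 * d))" unfolding mult_left_cancel[OF nz'(1)] .
    have "- 8 * \<kappa> * p * \<sigma> * (d * E) / ((A * \<sigma>\<^sup>2) * (A * \<sigma>\<^sup>2)) = - 8 * \<kappa> * p * d * E / (A\<^sup>2 * \<sigma> ^ 3)" for E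
      using nz' by (simp add: power2_eq_square power3_eq_cube) (simp add: ac_simps)
    then show ?thesis unfolding X .
  qed
  ultimately show "((\<lambda>t. - 8 * \<kappa> * p * \<xi> t * D t / (A * (S t)\<^sup>2)) has_real_derivative
       - 8 * \<kappa> * p * D t * (2 * c * (D t)\<^sup>2 - A\<^sup>2 * c + A\<^sup>2 * D t) / (A\<^sup>2 * (S t) ^ 3)) (at t)"
    by (simp only: \<sigma>_def d_def x_def)
qed

end

lemma inner_rotate: "(- cis \<theta> * x) \<bullet> (- cis \<theta> * y) = x \<bullet> y"
proof -
  have cs: "(cos \<theta>)\<^sup>2 + (sin \<theta>)\<^sup>2 = 1" by simp
  have "(- cis \<theta> * x) \<bullet> (- cis \<theta> * y) = (sin \<theta> * Im x - cos \<theta> * Re x) * (sin \<theta> * Im y - cos \<theta> * Re y)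
      + (- (cos \<theta> * Im x) - sin \<theta> * Re x) * (- (cos \<theta> * Im y) - sin \<theta> * Re y)"
    by (simp add: inner_complex_def)
  also have "\<dots> = Re x * Re y + Im x * Im y" using cs by algebra
  finally show ?thesis by (simp add: inner_complex_def)
qed

context curvature begin

text \<open>The chord is scaled to the fixed interval [-1, 1]. So the integral depends smoothly on
  the chord, degenerates gracefully at glancing, and extends with a sign to t where cos t <
  0.\<close>

definition radon :: "(complex \<Rightarrow> complex) \<Rightarrow> bdry_fun" where
  "radon F p = of_real (cos (snd p)) * integral {-1..1} (\<lambda>y. F (chord (fst p) (snd p) (cos (snd p) * y)))"

text \<open>Clamping \<open>x\<close> to the chord keeps the function positive and continuous on the whole line.\<close>

definition speed :: "real \<Rightarrow> real \<Rightarrow> real" where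
  "speed \<alpha> x = amp \<alpha> / ((amp \<alpha>)\<^sup>2 + 4 * \<kappa> * (max (- cos (s \<alpha>)) (min (cos (s \<alpha>)) x))\<^sup>2)"

lemma amp_cos_sin: "amp \<alpha> * cos \<alpha> = (1 - \<kappa>) * cos (s \<alpha>)" "amp \<alpha> * sin \<alpha> = (1 + \<kappa>) * sin (s \<alpha>)"
proof -
  define P where "P = sqrt (pois \<alpha>)"
  have P: "P > 0" using pois_pos by (simp add: P_def)
  have a: "amp \<alpha> * P = (1 - \<kappa>) * (1 + \<kappa>)" using P by (simp add: amp_def P_def[symmetric]) (simp add: power2_eq_square algebra_simps)
  have "(1 + \<kappa>) * (amp \<alpha> * cos \<alpha>) = (1 + \<kappa>) * ((1 - \<kappa>) * cos (s \<alpha>))"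
    using cos_s[of \<alpha>, folded P_def] a by algebra
  then show "amp \<alpha> * cos \<alpha> = (1 - \<kappa>) * cos (s \<alpha>)" using \<kappa> by simp
  have "(1 - \<kappa>) * (amp \<alpha> * sin \<alpha>) = (1 - \<kappa>) * ((1 + \<kappa>) * sin (s \<alpha>))"
    using sin_s[of \<alpha>, folded P_def] a by algebra
  then show "amp \<alpha> * sin \<alpha> = (1 + \<kappa>) * sin (s \<alpha>)" using \<kappa> by simp
qed

lemma speed_eq: "\<bar>x\<bar> \<le> cos (s \<alpha>) \<Longrightarrow> speed \<alpha> x = amp \<alpha> / ((amp \<alpha>)\<^sup>2 + 4 * \<kappa> * x\<^sup>2)"
  unfolding speed_def by (simp add: max_def min_def abs_le_iff)

context
  fixes \<alpha> \<beta> :: real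
  assumes \<alpha>: "\<alpha> \<in> {- (pi/2)..pi/2}"
begin

lemma cos_s_nonneg: "cos (s \<alpha>) \<ge> 0"
  using s_influx[OF \<alpha>] by (intro cos_ge_zero) auto

lemma speed_pos: "speed \<alpha> x > 0" and continuous_on_speed: "continuous_on UNIV (speed \<alpha>)"
proof -
  have b: "\<bar>max (- cos (s \<alpha>)) (min (cos (s \<alpha>)) x)\<bar> \<le> cos (s \<alpha>)" for x using cos_s_nonneg by (auto simp: abs_le_iff)
  note p = hyp_chord_sq(2)[OF b]
  show "speed \<alpha> x > 0" unfolding speed_def using amp_pos p by simp
  show "continuous_on UNIV (speed \<alpha>)" unfolding speed_def
    by (intro continuous_intros ballI) (use p less_irrefl in metis)
qed

text \<open>The existence half, converse to \<open>geodesic_klein\<close>: following the chord with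
  the scalar motion \<xi> satisfies the geodesic equation with the prescribed initial data.\<close>

lemma geodesic_exists:
  assumes \<xi>: "\<And>t. t \<in> {0..T} \<Longrightarrow> \<xi> t \<in> {- cos (s \<alpha>)..cos (s \<alpha>)}"
    "\<And>t. t \<in> {0..T} \<Longrightarrow> (\<xi> has_real_derivative inverse (speed \<alpha> (\<xi> t))) (at t)" "\<xi> 0 = - cos (s \<alpha>)" and T: "T \<ge> 0"
  shows "geodesic_in_disk \<kappa> (cis \<beta>) (fan_vector \<kappa> (\<beta>, \<alpha>)) T (\<lambda>t. unklein (chord (\<beta> + s \<alpha>) (s \<alpha>) (\<xi> t)))"
proof -
  define \<theta> p A c D S where "\<theta> = \<beta> + s \<alpha>" and "p = sin (s \<alpha>)" and "A = amp \<alpha>" and "c = 1 - \<kappa>"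
    and "D = (\<lambda>t. sqrt (A\<^sup>2 + 4 * \<kappa> * (\<xi> t)\<^sup>2))" and "S = (\<lambda>t. c + D t)"
  define \<gamma> where "\<gamma> t = unklein (chord \<theta> (s \<alpha>) (\<xi> t))" for t
  define a b a1 b1 a2 b2 where "a = (\<lambda>t. 2 * \<xi> t / S t)" and "b = (\<lambda>t. 2 * p / S t)"
    and "a1 = (\<lambda>t. 2 * D t * (c * D t + A\<^sup>2) / (A * (S t)\<^sup>2))" and "b1 = (\<lambda>t. - 8 * \<kappa> * p * \<xi> t * D t / (A * (S t)\<^sup>2))"
    and "a2 = (\<lambda>t. 8 * \<kappa> * \<xi> t * D t * (2 * c\<^sup>2 * D t + A\<^sup>2 * c - A\<^sup>2 * D t) / (A\<^sup>2 * (S t) ^ 3))"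
    and "b2 = (\<lambda>t. - 8 * \<kappa> * p * D t * (2 * c * (D t)\<^sup>2 - A\<^sup>2 * c + A\<^sup>2 * D t) / (A\<^sup>2 * (S t) ^ 3))"
  have \<gamma>ab: "\<gamma> t = - cis \<theta> * Complex (a t) (b t)" for t
    unfolding \<gamma>_def unklein_def hyp_chord by (simp add: chord_def complex_eq_iff a_def b_def S_def D_def A_def c_def p_def diff_divide_distrib add_divide_distrib)
      (simp add: ac_simps)
  have A: "A > 0" by (simp add: A_def amp_pos)
  have A2: "A\<^sup>2 = c\<^sup>2 + 4 * \<kappa> * p\<^sup>2" unfolding A_def c_def p_def by (rule amp_sq)
  have bnd: "\<bar>\<xi> t\<bar> \<le> cos (s \<alpha>)" if "t \<in> {0..T}" for t using \<xi>(1)[OF that] by (simp add: abs_le_iff)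
  have Dp: "A\<^sup>2 + 4 * \<kappa> * (\<xi> t)\<^sup>2 > 0" "D t > 0" "(D t)\<^sup>2 = A\<^sup>2 + 4 * \<kappa> * (\<xi> t)\<^sup>2" if "t \<in> {0..T}" for t
    using hyp_chord_sq(2)[OF bnd[OF that]] by (simp_all add: D_def A_def)
  have d\<xi>: "(\<xi> has_real_derivative (D t)\<^sup>2 / A) (at t)" if "t \<in> {0..T}" for t
    using \<xi>(2)[OF that] unfolding speed_eq[OF bnd[OF that]] Dp(3)[OF that] by (simp add: A_def)
  have dD: "(D has_real_derivative 4 * \<kappa> * \<xi> t * D t / A) (at t)" if "t \<in> {0..T}" for t
  proof -
    have "((\<lambda>t. A\<^sup>2 + 4 * \<kappa> * (\<xi> t)\<^sup>2) has_real_derivative 4 * \<kappa> * (2 * \<xi> t * ((D t)\<^sup>2 / A))) (at t)"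
      by (rule derivative_eq_intros d\<xi>[OF that] refl | simp)+
    from DERIV_chain2[OF DERIV_real_sqrt[OF Dp(1)[OF that]] this]
    have "(D has_real_derivative inverse (D t) / 2 * (4 * \<kappa> * (2 * \<xi> t * ((D t)\<^sup>2 / A)))) (at t)" unfolding D_def .
    moreover have "inverse (D t) / 2 * (4 * \<kappa> * (2 * \<xi> t * ((D t)\<^sup>2 / A))) = 4 * \<kappa> * \<xi> t * D t / A"
      using Dp(2)[OF that] A by (simp add: field_simps power2_eq_square)
    ultimately show ?thesis by (simp only:)
  qed
  have dera: "(a has_real_derivative a1 t) (at t)" "(b has_real_derivative b1 t) (at t)"
    "(a1 has_real_derivative a2 t) (at t)" "(b1 has_real_derivative b2 t) (at t)" if "t \<in> {0..T}" for t
    unfolding a_def b_def a1_def b1_def a2_def b2_def S_def c_def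
    by (rule geodesic_derivatives[OF A Dp(2,3)[OF that] d\<xi>[OF that] dD[OF that]])+
  have disk: "\<gamma> t \<in> disk" if "t \<in> {0..T}" for t
    unfolding \<gamma>_def by (rule unklein_disk[OF chord_disk[OF bnd[OF that]]])
  define \<gamma>1 \<gamma>2 where "\<gamma>1 t = - cis \<theta> * Complex (a1 t) (b1 t)" and "\<gamma>2 t = - cis \<theta> * Complex (a2 t) (b2 t)" for t
  have v1: "(\<gamma> has_vector_derivative \<gamma>1 t) (at t within {0..T})" if "t \<in> {0..T}" for t
    unfolding \<gamma>ab[abs_def] \<gamma>1_def
    by (intro has_vector_derivative_mult_right has_vector_derivative_complexI)
       (use dera[OF that] in \<open>auto intro: has_field_derivative_at_within\<close>)
  have v2: "(\<gamma>1 has_vector_derivative \<gamma>2 t) (at t within {0..T})" if "t \<in> {0..T}" for t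
    unfolding \<gamma>1_def[abs_def] \<gamma>2_def
    by (intro has_vector_derivative_mult_right has_vector_derivative_complexI)
       (use dera[OF that] in \<open>auto intro: has_field_derivative_at_within\<close>)
  have eq: "\<forall>w. g_kappa \<kappa> (\<gamma> t) (\<gamma>2 t) w + christoffel (g_kappa \<kappa>) (\<gamma> t) (\<gamma>1 t) (\<gamma>1 t) w = 0" if t: "t \<in> {0..T}" for t
  proof -
    have nz: "1 + \<kappa> * (norm (\<gamma> t))\<^sup>2 \<noteq> 0" using q_pos(1)[OF disk[OF t]] by simp
    have n: "(norm (\<gamma> t))\<^sup>2 = (a t)\<^sup>2 + (b t)\<^sup>2" by (simp add: \<gamma>ab norm_mult cmod_power2)
    have i: "\<gamma> t \<bullet> \<gamma>1 t = a t * a1 t + b t * b1 t" "\<gamma>1 t \<bullet> \<gamma>1 t = (a1 t)\<^sup>2 + (b1 t)\<^sup>2"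
      unfolding \<gamma>ab \<gamma>1_def inner_rotate by (simp_all add: inner_complex_def power2_eq_square)
    note id = geodesic_identities[OF A Dp(2,3)[OF t] A2[unfolded c_def], folded c_def]
    have i1: "(1 + \<kappa> * ((a t)\<^sup>2 + (b t)\<^sup>2)) * a2 t = 4 * \<kappa> * (a t * a1 t + b t * b1 t) * a1 t - 2 * \<kappa> * ((a1 t)\<^sup>2 + (b1 t)\<^sup>2) * a t"
      "(1 + \<kappa> * ((a t)\<^sup>2 + (b t)\<^sup>2)) * b2 t = 4 * \<kappa> * (a t * a1 t + b t * b1 t) * b1 t - 2 * \<kappa> * ((a1 t)\<^sup>2 + (b1 t)\<^sup>2) * b t"
      unfolding a_def b_def a1_def b1_def a2_def b2_def S_def by (rule id)+
    have "(1 + \<kappa> * ((a t)\<^sup>2 + (b t)\<^sup>2)) *\<^sub>R Complex (a2 t) (b2 t)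
      = (4 * \<kappa> * (a t * a1 t + b t * b1 t)) *\<^sub>R Complex (a1 t) (b1 t) - (2 * \<kappa> * ((a1 t)\<^sup>2 + (b1 t)\<^sup>2)) *\<^sub>R Complex (a t) (b t)"
      unfolding complex_eq_iff minus_complex.sel scaleR_complex.sel complex.sel using i1 by blast
    then have "- cis \<theta> * ((1 + \<kappa> * ((a t)\<^sup>2 + (b t)\<^sup>2)) *\<^sub>R Complex (a2 t) (b2 t))
      = - cis \<theta> * ((4 * \<kappa> * (a t * a1 t + b t * b1 t)) *\<^sub>R Complex (a1 t) (b1 t) - (2 * \<kappa> * ((a1 t)\<^sup>2 + (b1 t)\<^sup>2)) *\<^sub>R Complex (a t) (b t))"
      by (rule arg_cong)
    then show ?thesis unfolding geodesic_equation_iff[OF nz] i unfolding n unfolding \<gamma>ab \<gamma>1_def \<gamma>2_def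
      unfolding right_diff_distrib mult_scaleR_right .
  qed
  have T0: "0 \<in> {0..T}" using T by simp
  have C2: "(cos (s \<alpha>))\<^sup>2 = 1 - p\<^sup>2" by (simp add: p_def cos_squared_eq)
  \<comment> \<open>The starting point lies on the unit circle, where \<open>hyp\<close> equals 1 +
    \<kappa>; hence \<open>S 0\<close> is 2 and \<open>unklein\<close> fixes this point.\<close>
  have D0: "D 0 = 1 + \<kappa>"
  proof -
    have "A\<^sup>2 + 4 * \<kappa> * (\<xi> 0)\<^sup>2 = (1 + \<kappa>)\<^sup>2" unfolding A2 \<xi>(3) power2_minus C2 c_def by algebra
    then show ?thesis unfolding D_def using \<kappa> by simp
  qed
  have S0: "S 0 = 2" by (simp add: S_def D0 c_def)
  have g0: "\<gamma> 0 = cis \<beta>"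
  proof -
    have "\<gamma> 0 = - cis \<theta> * (- cis (- s \<alpha>))" by (simp add: \<gamma>ab a_def b_def S0 \<xi>(3) complex_eq_iff p_def)
    also have "\<dots> = cis \<beta>" by (simp add: cis_mult \<theta>_def)
    finally show ?thesis .
  qed
  have g1: "\<gamma>1 0 = fan_vector \<kappa> (\<beta>, \<alpha>)"
  proof -
    have ac: "A * cos (\<alpha> - s \<alpha>) = (1 - \<kappa>) * (cos (s \<alpha>))\<^sup>2 + (1 + \<kappa>) * p\<^sup>2"
      "A * sin (\<alpha> - s \<alpha>) = 2 * \<kappa> * p * cos (s \<alpha>)"
      using amp_cos_sin[of \<alpha>] unfolding cos_diff sin_diff A_def p_def by algebra+
    have k: "4 * (1 + \<kappa>) * (A * z) / (A * 2\<^sup>2) = (1 + \<kappa>) * z" for z using A by (simp add: field_simps)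
    have e: "2 * (c * (1 + \<kappa>) + A\<^sup>2) = 4 * (A * cos (\<alpha> - s \<alpha>))" unfolding ac C2 A2 c_def by algebra
    have e': "(1 + \<kappa>) * (4 * (A * z)) = 4 * (1 + \<kappa>) * (A * z)" for z by algebra
    have "a1 0 = (1 + \<kappa>) * (2 * (c * (1 + \<kappa>) + A\<^sup>2)) / (A * 2\<^sup>2)" unfolding a1_def D0 S0 by (simp only: ac_simps)
    then have "a1 0 = (1 + \<kappa>) * cos (\<alpha> - s \<alpha>)" unfolding e e' k .
    moreover have "b1 0 = (1 + \<kappa>) * sin (\<alpha> - s \<alpha>)"
    proof -
      have "b1 0 = 4 * (1 + \<kappa>) * (A * sin (\<alpha> - s \<alpha>)) / (A * 2\<^sup>2)" unfolding b1_def D0 S0 \<xi>(3) ac by (simp add: algebra_simps)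
      then show ?thesis unfolding k .
    qed
    ultimately have "\<gamma>1 0 = - cis \<theta> * (of_real (1 + \<kappa>) * cis (\<alpha> - s \<alpha>))"
      unfolding \<gamma>1_def by (simp add: complex_eq_iff)
    also have "\<dots> = - (of_real (1 + \<kappa>) * cis (\<beta> + \<alpha>))" by (simp add: mult.left_commute[of "cis \<theta>"] cis_mult \<theta>_def add.commute)
    also have "\<dots> = fan_vector \<kappa> (\<beta>, \<alpha>)"
    proof -
      have "cis (\<beta> + pi + \<alpha>) = cis pi * cis (\<beta> + \<alpha>)" unfolding cis_mult by (simp add: algebra_simps)
      then show ?thesis by (simp add: fan_vector_def)
    qed
    finally show ?thesis .
  qed
  have "geodesic_on (g_kappa \<kappa>) {0..T} \<gamma> \<gamma>1"
    unfolding geodesic_on_def by (rule exI[of _ \<gamma>2]) (use v1 v2 eq in blast)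
  then show ?thesis unfolding geodesic_in_disk_def \<theta>_def[symmetric] \<gamma>_def[symmetric]
    using T disk g0 g1 by blast
qed

text \<open>Existence and uniqueness together show that the supremum of existence times is the chord
  travel time \<tau> C. The change of variables from time to chord position then has density
  \<open>speed\<close>.\<close>

lemma xray_eq_integral:
  assumes f: "continuous_on disk f"
  shows "xray \<kappa> f (\<beta>, \<alpha>) = integral {- cos (s \<alpha>)..cos (s \<alpha>)} (\<lambda>x. speed \<alpha> x *\<^sub>R f (unklein (chord (\<beta> + s \<alpha>) (s \<alpha>) x)))"
proof -
  define C x0 v where "C = cos (s \<alpha>)" and "x0 = cis \<beta>" and "v = fan_vector \<kappa> (\<beta>, \<alpha>)"
  have C: "C \<ge> 0" by (simp add: C_def cos_s_nonneg)
  obtain \<tau> \<xi> where d\<tau>: "\<And>x. x \<in> {-C..C} \<Longrightarrow> (\<tau> has_real_derivative speed \<alpha> x) (at x)"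
    and \<tau>: "\<tau> (- C) = 0" "\<tau> C \<ge> 0" "\<And>x y. - C \<le> x \<Longrightarrow> x < y \<Longrightarrow> y \<le> C \<Longrightarrow> \<tau> x < \<tau> y"
    and \<xi>: "\<And>t. t \<in> {0..\<tau> C} \<Longrightarrow> \<xi> t \<in> {-C..C}"
    "\<And>t. t \<in> {0..\<tau> C} \<Longrightarrow> (\<xi> has_real_derivative inverse (speed \<alpha> (\<xi> t))) (at t)" "\<xi> 0 = - C"
    using inverse_flow[OF continuous_on_speed speed_pos C] by blast
  have ex: "\<exists>\<gamma>. geodesic_in_disk \<kappa> x0 v (\<tau> C) \<gamma>"
    unfolding x0_def v_def using geodesic_exists[OF \<xi>[unfolded C_def] \<tau>(2)[unfolded C_def]] unfolding C_def by blast
  \<comment> \<open>Every geodesic with these initial data, of whatever duration, follows the chord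
    on the schedule \<tau>.\<close>
  have un: "\<exists>\<zeta>. \<zeta> 0 = - C \<and> (\<forall>t\<in>{0..T}. \<zeta> t \<in> {-C..C} \<and> \<tau> (\<zeta> t) = t \<and>
      (\<zeta> has_real_derivative inverse (speed \<alpha> (\<zeta> t))) (at t within {0..T}) \<and>
      \<gamma> t = unklein (chord (\<beta> + s \<alpha>) (s \<alpha>) (\<zeta> t)))" if g: "geodesic_in_disk \<kappa> x0 v T \<gamma>" for T \<gamma>
  proof -
    obtain \<zeta> where \<zeta>: "\<zeta> 0 = - C" "\<And>t. t \<in> {0..T} \<Longrightarrow> \<bar>\<zeta> t\<bar> \<le> C"
      "\<And>t. t \<in> {0..T} \<Longrightarrow> (\<zeta> has_real_derivative ((amp \<alpha>)\<^sup>2 + 4 * \<kappa> * (\<zeta> t)\<^sup>2) / amp \<alpha>) (at t within {0..T})"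
      "\<And>t. t \<in> {0..T} \<Longrightarrow> \<gamma> t = unklein (chord (\<beta> + s \<alpha>) (s \<alpha>) (\<zeta> t))"
      using geodesic_klein[OF \<alpha> g[unfolded x0_def v_def]] unfolding C_def by blast
    have in': "\<zeta> t \<in> {-C..C}" if "t \<in> {0..T}" for t using \<zeta>(2)[OF that] by (simp add: abs_le_iff)
    have d: "(\<zeta> has_real_derivative inverse (speed \<alpha> (\<zeta> t))) (at t within {0..T})" if "t \<in> {0..T}" for t
      using \<zeta>(3)[OF that] unfolding speed_eq[OF \<zeta>(2)[OF that, unfolded C_def]] by simp
    have "\<tau> (\<zeta> t) = t" if "t \<in> {0..T}" for t
      by (rule flow_time[OF d\<tau> \<tau>(1) speed_pos in' \<zeta>(1) d that])
    then show ?thesis using \<zeta>(1,4) in' d by blast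
  qed
  have le: "T \<le> \<tau> C" if g: "geodesic_in_disk \<kappa> x0 v T \<gamma>" for T \<gamma>
  proof -
    have T: "T \<in> {0..T}" using g by (simp add: geodesic_in_disk_def)
    obtain \<zeta> where "\<zeta> T \<in> {-C..C}" "\<tau> (\<zeta> T) = T" using un[OF g] T by blast
    then show ?thesis using \<tau>(3)[of "\<zeta> T" C] by (cases "\<zeta> T = C") auto
  qed
  have exit: "exit_time \<kappa> x0 v = \<tau> C"
    unfolding exit_time_def by (rule cSup_eq_maximum) (use ex le in auto)
  \<comment> \<open>The supremum is attained, so the choice in \<open>geod\<close> really returns a
    geodesic, and \<open>un\<close> applies to it.\<close>
  have "geodesic_in_disk \<kappa> x0 v (\<tau> C) (geod \<kappa> x0 v)"
    unfolding geod_def exit using ex by (rule someI_ex)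
  from un[OF this] obtain \<zeta> where \<zeta>: "\<zeta> 0 = - C" "\<And>t. t \<in> {0..\<tau> C} \<Longrightarrow> \<zeta> t \<in> {-C..C}"
    "\<And>t. t \<in> {0..\<tau> C} \<Longrightarrow> \<tau> (\<zeta> t) = t"
    "\<And>t. t \<in> {0..\<tau> C} \<Longrightarrow> (\<zeta> has_real_derivative inverse (speed \<alpha> (\<zeta> t))) (at t within {0..\<tau> C})"
    "\<And>t. t \<in> {0..\<tau> C} \<Longrightarrow> geod \<kappa> x0 v t = unklein (chord (\<beta> + s \<alpha>) (s \<alpha>) (\<zeta> t))" by blast
  have \<zeta>T: "\<zeta> (\<tau> C) = C"
  proof -
    have "\<tau> C \<in> {0..\<tau> C}" using \<tau>(2) by simp
    from \<zeta>(2,3)[OF this] show ?thesis using \<tau>(3)[of "\<zeta> (\<tau> C)" C] by (cases "\<zeta> (\<tau> C) = C") auto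
  qed
  let ?H = "\<lambda>x. speed \<alpha> x *\<^sub>R f (unklein (chord (\<beta> + s \<alpha>) (s \<alpha>) x))"
  have cH: "continuous_on {-C..C} ?H"
  proof -
    have ch: "chord (\<beta> + s \<alpha>) (s \<alpha>) ` {-C..C} \<subseteq> disk" using chord_disk[of _ "s \<alpha>"] by (auto simp: C_def abs_le_iff image_subset_iff)
    have "continuous_on {-C..C} (\<lambda>x. unklein (chord (\<beta> + s \<alpha>) (s \<alpha>) x))"
      by (rule continuous_on_compose2[OF smooth_on_continuous[OF smooth_on_unklein] _ ch])
         (simp add: chord_def Complex_eq, intro continuous_intros)
    moreover have "(\<lambda>x. unklein (chord (\<beta> + s \<alpha>) (s \<alpha>) x)) ` {-C..C} \<subseteq> disk" using unklein_disk ch by (simp only: image_subset_iff) blast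
    ultimately have "continuous_on {-C..C} (\<lambda>x. f (unklein (chord (\<beta> + s \<alpha>) (s \<alpha>) x)))"
      by (rule continuous_on_compose2[OF f])
    then show ?thesis by (intro continuous_intros continuous_on_subset[OF continuous_on_speed]) auto
  qed
  have "xray \<kappa> f (\<beta>, \<alpha>) = integral {0..\<tau> C} (\<lambda>t. f (geod \<kappa> x0 v t))"
    unfolding xray_def fan_point_def split x0_def[symmetric] v_def[symmetric] exit ..
  also have "\<dots> = integral {0..\<tau> C} (\<lambda>t. inverse (speed \<alpha> (\<zeta> t)) *\<^sub>R ?H (\<zeta> t))"
  proof (rule Henstock_Kurzweil_Integration.integral_cong)
    fix t assume "t \<in> {0..\<tau> C}"
    then show "f (geod \<kappa> x0 v t) = inverse (speed \<alpha> (\<zeta> t)) *\<^sub>R ?H (\<zeta> t)"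
      using \<zeta>(5) speed_pos[of "\<zeta> t"] by simp
  qed
  also have "\<dots> = integral {\<zeta> 0..\<zeta> (\<tau> C)} ?H"
    by (rule integral_unique[OF has_integral_substitution[where c = "- C" and d = C]])
       (use \<tau>(2) \<zeta> \<zeta>T C cH in auto)
  finally show ?thesis unfolding \<zeta>(1) \<zeta>T unfolding C_def .
qed

text \<open>The speed is \<open>amp\<close> divided by the square of \<open>hyp\<close>. The first
  factor depends only on the chord and is a multiple of the weight in \<open>lift\<close>; the
  second depends only on the point and joins the integrand.\<close>

lemma xray_eq_lift_radon:
  assumes f: "continuous_on disk f"
  shows "xray \<kappa> f (\<beta>, \<alpha>) = of_real (sqrt (1 - \<kappa>\<^sup>2)) * lift (radon (\<lambda>w. f (unklein w) / of_real ((hyp w)\<^sup>2))) (\<beta>, \<alpha>)"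
proof -
  define C where "C = cos (s \<alpha>)"
  have C: "C \<ge> 0" by (simp add: C_def cos_s_nonneg)
  let ?ch = "chord (\<beta> + s \<alpha>) (s \<alpha>)"
  let ?F = "\<lambda>w. f (unklein w) / of_real ((hyp w)\<^sup>2)"
  have ch: "?ch ` {-C..C} \<subseteq> disk" using chord_disk[of _ "s \<alpha>"] by (auto simp: C_def abs_le_iff image_subset_iff)
  have cF: "continuous_on disk ?F"
  proof (intro continuous_intros)
    show "continuous_on disk (\<lambda>w. f (unklein w))"
      by (rule continuous_on_compose2[OF f smooth_on_continuous[OF smooth_on_unklein]]) (use unklein_disk in blast)
    show "continuous_on disk hyp" by (rule smooth_on_continuous[OF smooth_on_hyp])
    show "\<forall>w\<in>disk. complex_of_real ((hyp w)\<^sup>2) \<noteq> 0" using hyp_pos by force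
  qed
  have "xray \<kappa> f (\<beta>, \<alpha>) = integral {-C..C} (\<lambda>x. of_real (amp \<alpha>) * ?F (?ch x))"
    unfolding xray_eq_integral[OF f] C_def
  proof (rule Henstock_Kurzweil_Integration.integral_cong)
    fix x assume "x \<in> {- cos (s \<alpha>)..cos (s \<alpha>)}"
    then have x: "\<bar>x\<bar> \<le> cos (s \<alpha>)" by (simp add: abs_le_iff)
    show "speed \<alpha> x *\<^sub>R f (unklein (?ch x)) = of_real (amp \<alpha>) * ?F (?ch x)"
      unfolding speed_eq[OF x] hyp_chord_sq(1)[OF x] by (simp add: scaleR_conv_of_real)
  qed
  also have "\<dots> = of_real (amp \<alpha>) * integral {-C..C} (\<lambda>x. ?F (?ch x))" by (rule integral_mult_right)
  also have "integral {-C..C} (\<lambda>x. ?F (?ch x)) = integral {-1..1} (\<lambda>y. C *\<^sub>R ?F (?ch (C * y)))"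
  proof -
    have "((\<lambda>y. C *\<^sub>R ?F (?ch (C * y))) has_integral (integral {C * (-1)..C * 1} (\<lambda>x. ?F (?ch x)))) {-1..1}"
    proof (rule has_integral_substitution[where c = "-C" and d = C])
      show "continuous_on {-C..C} (\<lambda>x. ?F (?ch x))"
        by (rule continuous_on_compose2[OF cF _ ch]) (simp add: chord_def Complex_eq, intro continuous_intros)
      show "(*) C ` {-1..1} \<subseteq> {-C..C}"
        using C mult_left_mono[of _ 1 C] mult_left_mono[of "-1" _ C] by (auto simp: image_subset_iff)
    qed (use C in \<open>auto intro!: derivative_eq_intros\<close>)
    from integral_unique[OF this] show ?thesis by (simp only: mult_minus1_right mult_1_right)
  qed
  also have "\<dots> = radon ?F (\<beta> + s \<alpha>, s \<alpha>)"
    by (simp only: C_def scaleR_conv_of_real integral_mult_right radon_def fst_conv snd_conv)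
  finally show ?thesis by (simp add: lift_def amp_wt mult.assoc)
qed

end

end

section \<open>The Radon transform\<close>

lemma norm_coef_le:
  assumes G: "continuous_on UNIV G" and M: "\<And>p. norm (G p) \<le> M"
  shows "norm (coef G j) \<le> M"
proof -
  let ?f = "\<lambda>p. G p * mode (- j) p"
  have fc: "continuous_on UNIV ?f" by (intro continuous_intros G)
  have nb: "norm (?f p) \<le> M" for p using M by (simp add: norm_mult)
  have nb2: "norm (integral {0..2*pi} (\<lambda>\<theta>. ?f (\<theta>, s))) \<le> M * (2*pi - 0)" for s
    by (rule integral_bound[OF _ continuous_on_UNIV_slice(1)[OF fc] nb]) auto
  have "norm (integral {0..2*pi} (\<lambda>s. integral {0..2*pi} (\<lambda>\<theta>. ?f (\<theta>, s)))) \<le> (M * (2*pi - 0)) * (2*pi - 0)"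
    by (rule integral_bound[OF _ continuous_on_inner_integral[OF fc] nb2]) auto
  then show ?thesis by (simp add: coef_def norm_divide norm_mult norm_power power2_eq_square field_simps)
qed

lemma coef_add:
  assumes "continuous_on UNIV F" "continuous_on UNIV G"
  shows "coef (\<lambda>p. F p + G p) j = coef F j + coef G j"
proof -
  have m: "continuous_on UNIV (\<lambda>p. - 1 * G p)" by (intro continuous_intros assms)
  have "coef (\<lambda>p. F p - (- 1 * G p)) j = coef F j - coef (\<lambda>p. - 1 * G p) j" by (rule coef_diff[OF assms(1) m])
  then show ?thesis unfolding coef_cmult by simp
qed

lemma coef_cnj: "coef (\<lambda>p. cnj (G p)) j = cnj (coef G (- j))"
proof -
  have e: "cnj (G p) * mode (- j) p = cnj (G p * mode (- (- j)) p)" for p by (simp add: cnj_mode)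
  show ?thesis unfolding coef_def complex_cnj_divide integral_cnj e by simp
qed

section \<open>Polynomials and the Fourier support of Radon transforms\<close>

inductive zpoly :: "(complex \<Rightarrow> complex) \<Rightarrow> bool" where
  monom: "zpoly (\<lambda>w. c * w ^ a * cnj w ^ b)"
| add: "zpoly f \<Longrightarrow> zpoly g \<Longrightarrow> zpoly (\<lambda>w. f w + g w)"

lemma zpoly_mult:
  assumes "zpoly f" "zpoly g"
  shows "zpoly (\<lambda>w. f w * g w)"
  using assms(1)
proof induction
  case (monom c a b)
  show ?case using assms(2)
  proof induction
    case (monom d a' b')
    have "(\<lambda>w. c * w ^ a * cnj w ^ b * (d * w ^ a' * cnj w ^ b')) = (\<lambda>w. (c * d) * w ^ (a + a') * cnj w ^ (b + b'))"
      by (simp add: power_add ac_simps)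
    then show ?case using zpoly.monom by simp
  next
    case (add f g)
    then show ?case unfolding distrib_left by (intro zpoly.add)
  qed
next
  case (add f1 f2)
  then show ?case unfolding distrib_right by (intro zpoly.add)
qed

lemma zpoly_const: "zpoly (\<lambda>w. c)"
  using zpoly.monom[of c 0 0] by simp

lemma zpoly_of_real_polynomial: "real_polynomial_function r \<Longrightarrow> zpoly (\<lambda>w. of_real (r w))"
proof (induction rule: real_polynomial_function.induct)
  case (linear f)
  interpret bounded_linear f by fact
  define A B :: complex where "A = (of_real (f 1) - \<i> * of_real (f \<i>)) / 2" and "B = (of_real (f 1) + \<i> * of_real (f \<i>)) / 2"
  have e: "of_real (f w) = A * w ^ 1 * cnj w ^ 0 + B * w ^ 0 * cnj w ^ 1" for w
  proof -
    have "w = Re w *\<^sub>R 1 + Im w *\<^sub>R \<i>" by (simp add: complex_eq_iff)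
    then have "f w = Re w * f 1 + Im w * f \<i>" by (metis add scaleR real_scaleR_def)
    then show ?thesis by (simp add: A_def B_def complex_eq_iff field_simps)
  qed
  show ?case unfolding e by (intro zpoly.add zpoly.monom)
qed (auto intro: zpoly_const zpoly.add zpoly_mult)

lemma zpoly_polynomial_function:
  assumes "polynomial_function (g :: complex \<Rightarrow> complex)"
  shows "zpoly g"
proof -
  have "real_polynomial_function (Re \<circ> g)" "real_polynomial_function (Im \<circ> g)"
    using assms bounded_linear_Re bounded_linear_Im unfolding polynomial_function_def by blast+
  then have "zpoly (\<lambda>w. of_real (Re (g w)) + \<i> * of_real (Im (g w)))"
    by (intro zpoly.add zpoly_mult zpoly_const) (auto dest: zpoly_of_real_polynomial)
  then show ?thesis by (simp add: complex_eq[symmetric])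
qed

lemma zpoly_continuous: "zpoly f \<Longrightarrow> continuous_on A f"
  by (induction rule: zpoly.induct) (auto intro!: continuous_intros)

text \<open>The inequality is strict: the diagonals |l| = |m| do occur for general Radon transforms
  and are excluded only later, by parity.\<close>

definition outside_cone :: "bdry_fun \<Rightarrow> bool" where
  "outside_cone G \<longleftrightarrow> continuous_on UNIV G \<and> (\<forall>j. \<bar>snd j\<bar> < \<bar>fst j\<bar> \<longrightarrow> coef G j = 0)"

lemma outside_cone_add: "outside_cone F \<Longrightarrow> outside_cone G \<Longrightarrow> outside_cone (\<lambda>p. F p + G p)"
  by (auto simp: outside_cone_def coef_add intro!: continuous_intros)

lemma outside_cone_cmult: "outside_cone F \<Longrightarrow> outside_cone (\<lambda>p. c * F p)"
  by (auto simp: outside_cone_def coef_cmult intro!: continuous_intros)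

lemma outside_cone_cnj: "outside_cone F \<Longrightarrow> outside_cone (\<lambda>p. cnj (F p))"
  by (auto simp: outside_cone_def coef_cnj intro!: continuous_intros)

lemma outside_cone_mode: "\<bar>fst j\<bar> \<le> \<bar>snd j\<bar> \<Longrightarrow> outside_cone (mode j)"
  unfolding outside_cone_def coef_mode using continuous_on_mode[OF continuous_on_id, of UNIV j] by auto

text \<open>Up to the sign (-1)^(a + b), the Radon transform of w^a times the conjugate of w^b at
  \<theta> = 0; rotation by \<theta> contributes a factor of frequency a - b.\<close>

definition chord_moment :: "nat \<Rightarrow> nat \<Rightarrow> real \<Rightarrow> complex" where
  "chord_moment a b t = of_real (cos t) * integral {-1..1} (\<lambda>y. Complex (cos t * y) (sin t) ^ a * Complex (cos t * y) (- sin t) ^ b)"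

text \<open>Along the chord, w and its conjugate become u and v (up to sign and rotation), both with
  derivative cos t. Integrating the derivative of the product of u^(a+1) and v^(b+1) leaves endpoint
  values, which are pure exponentials in t. The recursion trades a conjugate power for a holomorphic
  one.\<close>

lemma chord_moment_Suc:
  "of_nat (Suc a) * chord_moment a (Suc b) t + of_nat (Suc b) * chord_moment (Suc a) b t
   = cis (of_int (int a - int b) * t) - (- 1) ^ (a + b) * cis (- (of_int (int a - int b) * t))"
  "of_nat (Suc a) * chord_moment a 0 t = cis (of_nat (Suc a) * t) + (- 1) ^ a * cis (- (of_nat (Suc a) * t))"
proof -
  define u v where "u y = Complex (cos t * y) (sin t)" and "v y = Complex (cos t * y) (- sin t)" for y
  have du: "(u has_vector_derivative of_real (cos t)) (at y within A)" and dv: "(v has_vector_derivative of_real (cos t)) (at y within A)" for y A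
    unfolding u_def v_def by (rule has_vector_derivative_complexI; auto intro!: derivative_eq_intros)+
  have uc: "continuous_on A u" and vc: "continuous_on A v" for A unfolding u_def v_def Complex_eq by (intro continuous_intros)+
  have dpu: "((\<lambda>y. u y ^ Suc n) has_vector_derivative of_nat (Suc n) * of_real (cos t) * u y ^ n) (at y within A)" for n y A
    using field_vector_diff_chain_within[OF du, of "\<lambda>z. z ^ Suc n" "of_nat (Suc n) * u y ^ n" y A]
      DERIV_power_Suc[OF DERIV_ident, of n "u y" "u ` A"] by (simp add: o_def ac_simps)
  have dpv: "((\<lambda>y. v y ^ Suc n) has_vector_derivative of_nat (Suc n) * of_real (cos t) * v y ^ n) (at y within A)" for n y A
    using field_vector_diff_chain_within[OF dv, of "\<lambda>z. z ^ Suc n" "of_nat (Suc n) * v y ^ n" y A]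
      DERIV_power_Suc[OF DERIV_ident, of n "v y" "v ` A"] by (simp add: o_def ac_simps)
  have ends: "u 1 = cis t" "v 1 = cis (- t)" "u (- 1) = - cis (- t)" "v (- 1) = - cis t"
    by (simp_all add: u_def v_def complex_eq_iff)
  have ii: "(\<lambda>y. u y ^ m * v y ^ n) integrable_on {-1..1}" for m n
    by (intro integrable_continuous_real continuous_intros uc vc)
  have cm: "chord_moment m n t = of_real (cos t) * integral {-1..1} (\<lambda>y. u y ^ m * v y ^ n)" for m n
    by (simp add: chord_moment_def u_def v_def)
  let ?I = "\<lambda>m n. integral {-1..1} (\<lambda>y. u y ^ m * v y ^ n)"
  let ?C = "of_real (cos t) :: complex"
  have "((\<lambda>y. of_nat (Suc a) * ?C * u y ^ a * v y ^ Suc b + u y ^ Suc a * (of_nat (Suc b) * ?C * v y ^ b)) has_integral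
     (u 1 ^ Suc a * v 1 ^ Suc b - u (- 1) ^ Suc a * v (- 1) ^ Suc b)) {-1..1}"
    by (rule fundamental_theorem_of_calculus)
       (use has_vector_derivative_mult[OF dpu dpv] in \<open>auto simp: add.commute\<close>)
  moreover have "((\<lambda>y. of_nat (Suc a) * ?C * (u y ^ a * v y ^ Suc b) + of_nat (Suc b) * ?C * (u y ^ Suc a * v y ^ b)) has_integral
     (of_nat (Suc a) * ?C * ?I a (Suc b) + of_nat (Suc b) * ?C * ?I (Suc a) b)) {-1..1}"
    by (intro has_integral_add has_integral_mult_right integrable_integral ii)
  ultimately have "of_nat (Suc a) * ?C * ?I a (Suc b) + of_nat (Suc b) * ?C * ?I (Suc a) b
    = u 1 ^ Suc a * v 1 ^ Suc b - u (- 1) ^ Suc a * v (- 1) ^ Suc b"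
    by (intro has_integral_unique[of _ _ "{-1..1}"]) (simp_all add: ac_simps)
  then show "of_nat (Suc a) * chord_moment a (Suc b) t + of_nat (Suc b) * chord_moment (Suc a) b t
   = cis (of_int (int a - int b) * t) - (- 1) ^ (a + b) * cis (- (of_int (int a - int b) * t))"
  proof -
    assume e: "of_nat (Suc a) * ?C * ?I a (Suc b) + of_nat (Suc b) * ?C * ?I (Suc a) b
      = u 1 ^ Suc a * v 1 ^ Suc b - u (- 1) ^ Suc a * v (- 1) ^ Suc b"
    have 1: "u 1 ^ Suc a * v 1 ^ Suc b = cis (of_int (int a - int b) * t)"
      unfolding ends Complex.DeMoivre cis_mult by (simp add: algebra_simps)
    have "u (- 1) ^ Suc a * v (- 1) ^ Suc b = ((- 1) ^ Suc a * (- 1) ^ Suc b) * (cis (- t) ^ Suc a * cis t ^ Suc b)"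
      unfolding ends by (simp only: power_minus[of "cis (- t)"] power_minus[of "cis t"] ac_simps)
    also have "cis (- t) ^ Suc a * cis t ^ Suc b = cis (- (of_int (int a - int b) * t))"
      unfolding Complex.DeMoivre cis_mult by (simp add: algebra_simps)
    also have "(- 1) ^ Suc a * (- 1) ^ Suc b = ((- 1) ^ (a + b) :: complex)" by (simp add: power_add)
    finally show ?thesis using e 1 by (simp only: cm mult.assoc)
  qed
  have "((\<lambda>y. of_nat (Suc a) * ?C * u y ^ a) has_integral (u 1 ^ Suc a - u (- 1) ^ Suc a)) {-1..1}"
    by (rule fundamental_theorem_of_calculus) (use dpu in auto)
  moreover have "((\<lambda>y. of_nat (Suc a) * ?C * (u y ^ a * v y ^ 0)) has_integral (of_nat (Suc a) * ?C * ?I a 0)) {-1..1}"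
    by (intro has_integral_mult_right integrable_integral ii)
  ultimately have e: "of_nat (Suc a) * ?C * ?I a 0 = u 1 ^ Suc a - u (- 1) ^ Suc a"
    by (intro has_integral_unique[of _ _ "{-1..1}"]) simp_all
  have "u (- 1) ^ Suc a = (- 1) ^ Suc a * cis (- t) ^ Suc a" unfolding ends by (rule power_minus)
  then have "u 1 ^ Suc a - u (- 1) ^ Suc a = cis (of_nat (Suc a) * t) + (- 1) ^ a * cis (- (of_nat (Suc a) * t))"
    unfolding ends(1) Complex.DeMoivre by simp
  then show "of_nat (Suc a) * chord_moment a 0 t = cis (of_nat (Suc a) * t) + (- 1) ^ a * cis (- (of_nat (Suc a) * t))"
    using e by (simp only: cm mult.assoc)
qed

text \<open>For \<open>Suc b\<close> the hypothesis reads |m| \<le> a - b. This puts the endpoint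
  terms, of frequencies a - b and b - a, outside the cone, and it implies the hypothesis for the
  pair a + 1, b.\<close>

lemma outside_cone_chord_moment:
  "\<bar>m\<bar> \<le> int a - int b + 1 \<Longrightarrow> outside_cone (\<lambda>p. cis (of_int m * fst p) * chord_moment a b (snd p))"
proof (induction b arbitrary: a)
  case 0
  have cm: "chord_moment a 0 t = 1 / of_nat (Suc a) * (cis (of_nat (Suc a) * t) + (- 1) ^ a * cis (- (of_nat (Suc a) * t)))" for t
    using chord_moment_Suc(2)[of a t] by (simp add: field_simps del: of_nat_Suc)
  have "(\<lambda>p. cis (of_int m * fst p) * chord_moment a 0 (snd p))
    = (\<lambda>p. 1 / of_nat (Suc a) * (mode (m, int (Suc a)) p + (- 1) ^ a * mode (m, - int (Suc a)) p))"
    unfolding cm mode_def fst_conv snd_conv of_int_minus mult_minus_left cis_mult[symmetric] by (simp add: algebra_simps del: of_nat_Suc)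
  moreover have "outside_cone \<dots>"
    using 0 by (intro outside_cone_cmult outside_cone_add outside_cone_mode) auto
  ultimately show ?case by simp
next
  case (Suc b)
  have cm: "chord_moment a (Suc b) t = 1 / of_nat (Suc a) * (cis (of_int (int a - int b) * t) - (- 1) ^ (a + b) * cis (- (of_int (int a - int b) * t)) - of_nat (Suc b) * chord_moment (Suc a) b t)" for t
    using chord_moment_Suc(1)[of a b t] by (simp add: field_simps del: of_nat_Suc)
  have "(\<lambda>p. cis (of_int m * fst p) * chord_moment a (Suc b) (snd p))
    = (\<lambda>p. 1 / of_nat (Suc a) * (mode (m, int a - int b) p + ((- ((- 1) ^ (a + b))) * mode (m, - (int a - int b)) p
        + (- of_nat (Suc b)) * (cis (of_int m * fst p) * chord_moment (Suc a) b (snd p)))))"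
    unfolding cm mode_def fst_conv snd_conv of_int_minus mult_minus_left cis_mult[symmetric] by (simp add: algebra_simps del: of_nat_Suc)
  moreover have "outside_cone \<dots>"
    using Suc.prems by (intro outside_cone_cmult outside_cone_add outside_cone_mode Suc.IH) auto
  ultimately show ?case by simp
qed

context curvature begin

lemma chord_cos_disk:
  assumes "y \<in> {-1..1}" shows "chord \<theta> t (cos t * y) \<in> disk"
proof -
  have "\<bar>y\<bar> \<le> 1" using assms by auto
  then have "(cos t * y)\<^sup>2 \<le> (cos t)\<^sup>2" using mult_left_mono[of "y\<^sup>2" 1 "(cos t)\<^sup>2"] by (simp add: power_mult_distrib abs_square_le_1)
  then have "(cos t * y)\<^sup>2 + (sin t)\<^sup>2 \<le> 1" using sin_cos_squared_add[of t] by linarith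
  then have "(norm (chord \<theta> t (cos t * y)))\<^sup>2 \<le> 1\<^sup>2" unfolding norm_chord by simp
  then show ?thesis by (simp add: power2_le_imp_le)
qed

lemma smooth_on_chord: "smooth_on A (\<lambda>p. chord (fst (fst p)) (snd (fst p)) (cos (snd (fst p)) * snd p))"
  unfolding chord_def Complex_eq by (intro smooth_intros)

lemma smooth_on_radon:
  assumes F: "smooth_on disk F"
  shows "smooth_on UNIV (radon F)"
proof -
  have "smooth_on (UNIV \<times> {-1..1}) (\<lambda>p. F (chord (fst (fst p)) (snd (fst p)) (cos (snd (fst p)) * snd p)))"
    by (rule smooth_on_compose[OF F smooth_on_chord]) (use chord_cos_disk in auto)
  then have "smooth_on UNIV (\<lambda>p. integral {-1..1} (\<lambda>y. F (chord (fst p) (snd p) (cos (snd p) * y))))"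
    using Ck_on_integral unfolding smooth_on_def by fastforce
  then show ?thesis unfolding radon_def[abs_def] by (intro smooth_intros)
qed

lemma continuous_on_chord_slice:
  assumes F: "continuous_on disk F"
  shows "continuous_on {-1..1} (\<lambda>y. F (chord \<theta> t (cos t * y)))"
proof (rule continuous_on_compose2[OF F])
  show "continuous_on {-1..1} (\<lambda>y. chord \<theta> t (cos t * y))"
    unfolding chord_def Complex_eq by (intro continuous_intros)
qed (use chord_cos_disk in blast)

lemma continuous_on_radon:
  assumes F: "continuous_on disk F"
  shows "continuous_on UNIV (radon F)"
proof -
  have "continuous_on (UNIV \<times> {-1..1}) (\<lambda>p. F (chord (fst (fst p)) (snd (fst p)) (cos (snd (fst p)) * snd p)))"
  proof (rule continuous_on_compose2[OF F smooth_on_continuous[OF smooth_on_chord]])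
  qed (use chord_cos_disk in auto)
  then have "continuous_on UNIV (\<lambda>p. integral (cbox (-1) 1) (\<lambda>y. F (chord (fst p) (snd p) (cos (snd p) * y))))"
    by (intro integral_continuous_on_param) (simp add: case_prod_unfold)
  then show ?thesis unfolding radon_def[abs_def] by (intro continuous_intros) simp
qed

lemma radon_add:
  assumes "continuous_on disk F" "continuous_on disk G"
  shows "radon (\<lambda>w. F w + G w) p = radon F p + radon G p"
  unfolding radon_def distrib_left[symmetric]
  by (subst Henstock_Kurzweil_Integration.integral_add)
     (auto intro!: integrable_continuous_real continuous_on_chord_slice assms)

lemma norm_radon_le:
  assumes F: "continuous_on disk F" and M: "\<And>w. w \<in> disk \<Longrightarrow> norm (F w) \<le> M"
  shows "norm (radon F p) \<le> 2 * M"
proof -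
  have "norm (integral {-1..1} (\<lambda>y. F (chord (fst p) (snd p) (cos (snd p) * y)))) \<le> M * (1 - (- 1))"
    by (rule integral_bound[OF _ continuous_on_chord_slice[OF F] M[OF chord_cos_disk]]) auto
  moreover have "norm (radon F p) \<le> 1 * norm (integral {-1..1} (\<lambda>y. F (chord (fst p) (snd p) (cos (snd p) * y))))"
    unfolding radon_def norm_mult by (intro mult_right_mono) auto
  moreover have "M * (1 - (- 1)) = 2 * M" by simp
  ultimately show ?thesis by linarith
qed

lemma outside_cone_radon_zpoly: "zpoly f \<Longrightarrow> outside_cone (radon f)"
proof (induction rule: zpoly.induct)
  case (monom c a b)
  define K where "K = (\<lambda>a b p. cis (of_int (int a - int b) * fst p) * chord_moment a b (snd p))"
  have "radon (\<lambda>w. c * w ^ a * cnj w ^ b) p = (- 1) ^ (a + b) * c * K a b p" for p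
  proof -
    have "c * chord \<theta> t x ^ a * cnj (chord \<theta> t x) ^ b
      = (- 1) ^ (a + b) * c * cis (of_int (int a - int b) * \<theta>) * (Complex x (sin t) ^ a * Complex x (- sin t) ^ b)" for \<theta> t x
    proof -
      have "chord \<theta> t x ^ a = (- 1) ^ a * (cis \<theta> ^ a * Complex x (sin t) ^ a)"
        unfolding chord_def mult_minus_left power_minus[of "cis \<theta> * Complex x (sin t)"] power_mult_distrib ..
      moreover have "cnj (chord \<theta> t x) = - (cis (- \<theta>) * Complex x (- sin t))"
        by (simp add: chord_def cis_cnj complex_cnj)
      then have "cnj (chord \<theta> t x) ^ b = (- 1) ^ b * (cis (- \<theta>) ^ b * Complex x (- sin t) ^ b)"
        by (simp only: power_minus[of "cis (- \<theta>) * Complex x (- sin t)"] power_mult_distrib)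
      moreover have "cis (of_int (int a - int b) * \<theta>) = cis \<theta> ^ a * cis (- \<theta>) ^ b"
        unfolding Complex.DeMoivre cis_mult by (simp add: algebra_simps)
      ultimately show ?thesis by (simp only: power_add ac_simps)
    qed
    then show ?thesis unfolding radon_def K_def chord_moment_def by (simp only: integral_mult_right) (simp only: ac_simps)
  qed
  then have e: "radon (\<lambda>w. c * w ^ a * cnj w ^ b) = (\<lambda>p. (- 1) ^ (a + b) * c * K a b p)" by auto
  have K: "outside_cone (K a b)" if "b \<le> a" for a b
    unfolding K_def using that by (intro outside_cone_chord_moment) auto
  have "outside_cone (K a b)"
  \<comment> \<open>If b > a, conjugation exchanges the exponents.\<close>
  proof (cases "b \<le> a")
    case False
    have "cnj (chord_moment b a t) = chord_moment a b t" for t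
      unfolding chord_moment_def by (simp add: integral_cnj complex_cnj mult.commute)
    then have "K a b = (\<lambda>p. cnj (K b a p))"
      unfolding K_def by (auto simp: cis_cnj algebra_simps)
    then show ?thesis using outside_cone_cnj[OF K[of a b]] False by simp
  qed (rule K)
  then show ?case unfolding e by (rule outside_cone_cmult)
next
  case (add f g)
  have "radon (\<lambda>w. f w + g w) = (\<lambda>p. radon f p + radon g p)"
    using radon_add[OF zpoly_continuous[OF add.hyps(1)] zpoly_continuous[OF add.hyps(2)]] by auto
  then show ?case using outside_cone_add[OF add.IH] by simp
qed

text \<open>Each coefficient is continuous in F for the supremum norm on the disk, and it vanishes
  on polynomials in w and its conjugate, which are dense by Stone-Weierstrass.\<close>

lemma coef_radon_eq_0:
  assumes F: "continuous_on disk F" and j: "\<bar>snd j\<bar> < \<bar>fst j\<bar>"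
  shows "coef (radon F) j = 0"
proof -
  have "norm (coef (radon F) j) \<le> e" if e: "e > 0" for e
  proof -
    obtain g where g: "polynomial_function g" "\<And>w. w \<in> disk \<Longrightarrow> norm (F w - g w) < e / 2"
      using Stone_Weierstrass_polynomial_function[OF compact_cball F half_gt_zero[OF e]] by blast
    have z: "zpoly g" by (rule zpoly_polynomial_function[OF g(1)])
    have gc: "continuous_on disk g" by (rule zpoly_continuous[OF z])
    have dc: "continuous_on disk (\<lambda>w. F w - g w)" by (intro continuous_intros F gc)
    have "radon F = (\<lambda>p. radon (\<lambda>w. F w - g w) p + radon g p)"
      using radon_add[OF dc gc] by auto
    then have "coef (radon F) j = coef (radon (\<lambda>w. F w - g w)) j + coef (radon g) j"
      using coef_add[OF continuous_on_radon[OF dc] continuous_on_radon[OF gc]] by simp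
    also have "coef (radon g) j = 0" using outside_cone_radon_zpoly[OF z] j unfolding outside_cone_def by blast
    finally have "coef (radon F) j = coef (radon (\<lambda>w. F w - g w)) j" by simp
    also have "norm \<dots> \<le> 2 * (e / 2)"
      using g(2) by (intro norm_coef_le continuous_on_radon norm_radon_le dc) (auto intro: less_imp_le)
    finally show ?thesis by simp
  qed
  then have "norm (coef (radon F) j) \<le> 0 + e" if "e > 0" for e using that by simp
  then have "norm (coef (radon F) j) \<le> 0" by (rule field_le_epsilon)
  then show ?thesis by simp
qed

lemma biperiodic_radon: "biperiodic (radon F)"
proof -
  have "chord (\<theta> + 2*pi) t x = chord \<theta> t x" "chord \<theta> (t + 2*pi) x = chord \<theta> t x" for \<theta> t x
    by (simp_all add: chord_def complex_eq_iff)
  then show ?thesis by (simp add: biperiodic_def radon_def)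
qed

text \<open>The parameter \<pi> - t describes the same set of points, passed in the opposite order;
  the sign comes from the factor cos t.\<close>

lemma radon_reflect: "radon F (\<theta>, pi - t) = - radon F (\<theta>, t)"
proof -
  have "chord \<theta> (pi - t) (- (cos t * y)) = chord \<theta> t (cos t * (- y))" for y by (simp add: chord_def)
  then have "integral {-1..1} (\<lambda>y. F (chord \<theta> (pi - t) (cos (pi - t) * y))) = integral {-1..1} (\<lambda>y. F (chord \<theta> t (cos t * (- y))))" by simp
  also have "\<dots> = integral {-1..1} (\<lambda>y. F (chord \<theta> t (cos t * y)))"
    using Henstock_Kurzweil_Integration.integral_reflect_real[where f = "\<lambda>y. F (chord \<theta> t (cos t * y))" and a = "-1" and b = 1] by simp
  finally show ?thesis by (simp add: radon_def)
qed

end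

section \<open>Chebyshev and Zernike polynomials\<close>

fun chebU :: "nat \<Rightarrow> real poly" where
  "chebU 0 = 1"
| "chebU (Suc 0) = smult 2 [:0, 1:]"
| "chebU (Suc (Suc n)) = smult 2 ([:0, 1:] * chebU (Suc n)) - chebU n"

fun chebT :: "nat \<Rightarrow> real poly" where
  "chebT 0 = 1"
| "chebT (Suc 0) = [:0, 1:]"
| "chebT (Suc (Suc n)) = smult 2 ([:0, 1:] * chebT (Suc n)) - chebT n"

lemma chebU_cos: "poly (chebU n) (cos x) * sin x = sin (of_nat (Suc n) * x)"
proof (induction n rule: chebU.induct)
  case (3 n)
  have "poly (chebU (Suc (Suc n))) (cos x) * sin x
    = 2 * cos x * (poly (chebU (Suc n)) (cos x) * sin x) - poly (chebU n) (cos x) * sin x"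
    by (simp add: algebra_simps)
  also have "\<dots> = 2 * cos x * sin (of_nat (Suc (Suc n)) * x) - sin (of_nat (Suc n) * x)" unfolding 3 ..
  also have "\<dots> = sin (of_nat (Suc (Suc (Suc n))) * x)"
  proof -
    have e: "of_nat (Suc (Suc (Suc n))) * x = of_nat (Suc (Suc n)) * x + x" "of_nat (Suc n) * x = of_nat (Suc (Suc n)) * x - x"
      by (simp_all add: algebra_simps)
    show ?thesis unfolding e sin_add sin_diff by simp
  qed
  finally show ?case .
qed (simp_all add: sin_double)

lemma chebT_cos: "poly (chebT n) (cos x) = cos (of_nat n * x)"
proof (induction n rule: chebT.induct)
  case (3 n)
  have e: "of_nat (Suc (Suc n)) * x = of_nat (Suc n) * x + x" "of_nat n * x = of_nat (Suc n) * x - x"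
    by (simp_all add: algebra_simps)
  have "poly (chebT (Suc (Suc n))) (cos x) = 2 * cos x * cos (of_nat (Suc n) * x) - cos (of_nat n * x)"
    by (simp add: 3 del: of_nat_Suc)
  then show ?case unfolding e cos_add cos_diff by simp
qed simp_all

lemma chebT_eq: "poly (chebT (Suc n)) x = poly (chebU (Suc n)) x - x * poly (chebU n) x"
proof (induction n rule: chebU.induct)
  case (3 n)
  have T: "poly (chebT (Suc (Suc m))) x = 2 * x * poly (chebT (Suc m)) x - poly (chebT m) x" for m by simp
  have U: "poly (chebU (Suc (Suc m))) x = 2 * x * poly (chebU (Suc m)) x - poly (chebU m) x" for m by simp
  show ?case unfolding T[of "Suc n"] 3 U by algebra
qed simp_all

lemma pderiv_chebT: "poly (pderiv (chebT (Suc n))) x = of_nat (Suc n) * poly (chebU n) x"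
proof (induction n rule: chebU.induct)
  case (3 n)
  have "poly (pderiv (chebT (Suc (Suc (Suc n))))) x
    = 2 * poly (chebT (Suc (Suc n))) x + 2 * x * poly (pderiv (chebT (Suc (Suc n)))) x - poly (pderiv (chebT (Suc n))) x"
    by (simp only: chebT.simps pderiv_diff pderiv_smult pderiv_mult pderiv_pCons) (simp add: algebra_simps)
  then show ?case unfolding 3 chebT_eq by (simp add: algebra_simps)
qed (simp_all add: pderiv_pCons pderiv_diff pderiv_smult pderiv_mult algebra_simps)

text \<open>Differentiate 2 T_(n+2) = U_(n+2) - U_n and insert the derivative (n + 2) U_(n+1) of
  T_(n+2). This expresses derivatives of U through lower orders and lower degrees, which drives the
  bounds below.\<close>

lemma pderiv_chebU: "pderiv (chebU (Suc (Suc n))) = smult (2 * of_nat (Suc (Suc n))) (chebU (Suc n)) + pderiv (chebU n)"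
proof -
  have "2 * poly (chebT (Suc (Suc n))) x = poly (chebU (Suc (Suc n))) x - poly (chebU n) x" for x
    unfolding chebT_eq by simp
  then have "poly (smult 2 (chebT (Suc (Suc n)))) = poly (chebU (Suc (Suc n)) - chebU n)" by (simp add: fun_eq_iff)
  then have "smult 2 (chebT (Suc (Suc n))) = chebU (Suc (Suc n)) - chebU n" by (simp only: poly_eq_poly_eq_iff)
  then have "smult 2 (pderiv (chebT (Suc (Suc n)))) = pderiv (chebU (Suc (Suc n))) - pderiv (chebU n)"
    by (metis pderiv_smult pderiv_diff)
  moreover have "pderiv (chebT (Suc (Suc n))) = smult (of_nat (Suc (Suc n))) (chebU (Suc n))"
    by (rule iffD1[OF poly_eq_poly_eq_iff]) (simp add: fun_eq_iff pderiv_chebT del: of_nat_Suc chebT.simps chebU.simps)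
  ultimately show ?thesis by (simp add: algebra_simps del: of_nat_Suc chebU.simps)
qed

lemma chebU_uminus: "poly (chebU n) (- x) = (- 1) ^ n * poly (chebU n) x"
  by (induction n rule: chebU.induct) (simp_all add: algebra_simps)

lemma chebU_1: "poly (chebU n) 1 = of_nat (Suc n)"
  by (induction n rule: chebU.induct) (simp_all add: algebra_simps)

text \<open>The sine quotient as a geometric sum of exponentials. It yields the bound n + 1 on
  [-1, 1] and later isolates one angular frequency.\<close>

lemma chebU_cis_sum: "complex_of_real (poly (chebU n) (cos x)) = (\<Sum>i\<le>n. cis ((of_nat n - 2 * of_nat i) * x))"
proof (induction n rule: chebU.induct)
  case (3 n)
  let ?S = "\<lambda>n. \<Sum>i\<le>n. cis ((of_nat n - 2 * of_nat i) * x)"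
  have a: "?S (Suc n) * cis x = ?S (Suc (Suc n)) - cis (- (of_nat (Suc (Suc n)) * x))"
    unfolding sum_distrib_right cis_mult by (simp add: sum.atMost_Suc[of _ "Suc n"] algebra_simps)
  have b: "?S (Suc n) * cis (- x) = ?S n + cis (- (of_nat (Suc (Suc n)) * x))"
    unfolding sum_distrib_right cis_mult by (simp add: algebra_simps)
  have "complex_of_real (poly (chebU (Suc (Suc n))) (cos x)) = (cis x + cis (- x)) * ?S (Suc n) - ?S n"
    unfolding 3[symmetric] by (simp add: complex_eq_iff)
  also have "\<dots> = ?S (Suc n) * cis x + ?S (Suc n) * cis (- x) - ?S n" by (simp add: algebra_simps)
  also have "\<dots> = ?S (Suc (Suc n))" unfolding a b by simp
  finally show ?case .
qed (simp_all add: complex_eq_iff)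

lemma abs_chebU_le:
  assumes "\<bar>y\<bar> \<le> 1" shows "\<bar>poly (chebU n) y\<bar> \<le> of_nat (Suc n)"
proof -
  have y: "y = cos (arccos y)" using assms by (simp add: abs_le_iff)
  have "\<bar>poly (chebU n) y\<bar> = norm (complex_of_real (poly (chebU n) (cos (arccos y))))" using y by simp
  also have "\<dots> \<le> (\<Sum>i\<le>n. 1)" unfolding chebU_cis_sum by (rule sum_norm_le) simp
  finally show ?thesis by simp
qed

text \<open>Each derivative costs a factor of order n^2, by induction on the order and, within it,
  on the degree in steps of two. Polynomial growth in n suffices against rapidly decreasing
  coefficients.\<close>

lemma abs_higher_pderiv_chebU_le:
  assumes "\<bar>y\<bar> \<le> 1" shows "\<bar>poly ((pderiv ^^ k) (chebU n)) y\<bar> \<le> 2 ^ k * of_nat (Suc n) ^ (2 * k + 1)"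
proof (induction k arbitrary: n)
  case 0 then show ?case using abs_chebU_le[OF assms] by simp
next
  case (Suc k)
  show ?case
  proof (induction n rule: chebU.induct)
    case 1
    have "(pderiv ^^ Suc k) (chebU 0) = 0" by (simp add: funpow_swap1 pderiv_1)
    then show ?case by simp
  next
    case 2
    have e: "pderiv (chebU (Suc 0)) = smult 2 (chebU 0)" by (simp add: pderiv_pCons)
    have "(pderiv ^^ Suc k) (chebU (Suc 0)) = smult 2 ((pderiv ^^ k) (chebU 0))"
      by (simp only: funpow_Suc_right o_def e higher_pderiv_smult)
    then have "\<bar>poly ((pderiv ^^ Suc k) (chebU (Suc 0))) y\<bar> \<le> 2 * 2 ^ k" using Suc.IH[of 0] by (simp add: abs_mult)
    also have "\<dots> = 2 ^ Suc k * 1" by simp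
    also have "\<dots> \<le> 2 ^ Suc k * of_nat (Suc (Suc 0)) ^ (2 * Suc k + 1)" by (intro mult_left_mono one_le_power) auto
    finally show ?case .
  next
    case (3 n)
    let ?N = "of_nat (Suc (Suc n)) :: real"
    have p: "poly ((pderiv ^^ Suc k) (chebU (Suc (Suc n)))) y = (2 * ?N) * poly ((pderiv ^^ k) (chebU (Suc n))) y + poly ((pderiv ^^ Suc k) (chebU n)) y"
      by (simp only: funpow_Suc_right o_def pderiv_chebU higher_pderiv_add higher_pderiv_smult poly_add poly_smult)
    have "\<bar>poly ((pderiv ^^ Suc k) (chebU (Suc (Suc n)))) y\<bar>
      \<le> (2 * ?N) * \<bar>poly ((pderiv ^^ k) (chebU (Suc n))) y\<bar> + \<bar>poly ((pderiv ^^ Suc k) (chebU n)) y\<bar>"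
      unfolding p by (rule order_trans[OF abs_triangle_ineq]) (simp add: abs_mult del: of_nat_Suc funpow.simps chebU.simps)
    also have "\<dots> \<le> (2 * ?N) * (2 ^ k * ?N ^ (2 * k + 1)) + 2 ^ Suc k * of_nat (Suc n) ^ (2 * Suc k + 1)"
      by (intro add_mono mult_left_mono Suc.IH 3) simp
    also have "\<dots> = 2 ^ Suc k * (?N ^ (2 * k + 2) + of_nat (Suc n) * of_nat (Suc n) ^ (2 * k + 2))"
      by (simp add: algebra_simps)
    also have "\<dots> \<le> 2 ^ Suc k * (?N ^ (2 * k + 2) + of_nat (Suc n) * ?N ^ (2 * k + 2))"
      by (intro mult_left_mono add_left_mono power_mono) auto
    \<comment> \<open>With N = n + 2, the sum of 1 and n + 1 is again N, so the exponent rises by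
      one.\<close>
    also have "\<dots> = 2 ^ Suc k * ?N ^ (2 * Suc k + 1)"
      by (simp add: algebra_simps)
    also have "\<dots> \<le> 2 ^ Suc k * of_nat (Suc (Suc (Suc n))) ^ (2 * Suc k + 1)"
      by (intro mult_left_mono power_mono) auto
    finally show ?case .
  qed
qed

lemma sum_cis_roots:
  assumes N: "\<bar>k\<bar> < int N"
  shows "(\<Sum>i<N. cis (of_int k * (2 * pi * of_nat i / of_nat N))) = (if k = 0 then of_nat N else 0)"
proof (cases "k = 0")
  case False
  define z where "z = cis (of_int k * (2 * pi) / of_nat N)"
  have N0: "N > 0" using N False by linarith
  have "z \<noteq> 1"
  proof
    assume "z = 1"
    then have "cos (of_int k * (2 * pi) / of_nat N) = 1" by (simp add: z_def complex_eq_iff)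
    then obtain n :: int where "of_int k * (2 * pi) / of_nat N = of_int n * 2 * pi" unfolding cos_one_2pi_int ..
    then have "of_int k = (of_int n * of_nat N :: real)" using N0 by (simp add: field_simps)
    then have k: "k = n * int N" by (metis of_int_mult of_int_of_nat_eq of_int_eq_iff)
    with False have "\<bar>n\<bar> \<ge> 1" by auto
    then have "\<bar>n\<bar> * int N \<ge> 1 * int N" by (intro mult_right_mono) auto
    with N k show False by (simp add: abs_mult)
  qed
  have "cis (of_int k * (2 * pi * of_nat i / of_nat N)) = z ^ i" for i
    unfolding z_def Complex.DeMoivre by (simp add: algebra_simps)
  moreover have "z ^ N = 1" unfolding z_def Complex.DeMoivre using N0 by simp
  ultimately show ?thesis using geometric_sum[OF \<open>z \<noteq> 1\<close>, of N] False by simp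
qed simp

lemma Ck_bounded_add:
  "Ck_bounded k S f A \<Longrightarrow> Ck_bounded k S g B \<Longrightarrow> Ck_bounded k S (\<lambda>x. f x + g x) (A + B)"
proof (induction k arbitrary: f g A B)
  case 0
  then show ?case by (auto intro!: continuous_intros norm_triangle_mono)
next
  case (Suc k)
  from Suc.prems obtain f' g' where "\<forall>x\<in>S. (f has_derivative f' x) (at x within S)" "\<forall>v. Ck_bounded k S (\<lambda>x. f' x v) (A * norm v)"
    "\<forall>x\<in>S. (g has_derivative g' x) (at x within S)" "\<forall>v. Ck_bounded k S (\<lambda>x. g' x v) (B * norm v)" by auto
  then have "\<forall>x\<in>S. ((\<lambda>x. f x + g x) has_derivative (\<lambda>v. f' x v + g' x v)) (at x within S)"
    "\<forall>v. Ck_bounded k S (\<lambda>x. f' x v + g' x v) ((A + B) * norm v)"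
    using Suc.IH unfolding distrib_right by (auto intro: has_derivative_add)
  moreover have "\<forall>x\<in>S. norm (f x + g x) \<le> A + B" using Suc.prems by (auto intro!: norm_triangle_mono)
  ultimately show ?case unfolding Ck_bounded.simps by (intro conjI exI[of _ "\<lambda>x v. f' x v + g' x v"])
qed

lemma Ck_bounded_zero: "Ck_bounded k S (\<lambda>x. 0) 0"
proof (induction k)
  case (Suc k)
  then show ?case unfolding Ck_bounded.simps by (intro conjI exI[of _ "\<lambda>x v. 0"]) auto
qed simp

lemma Ck_bounded_sum:
  assumes "\<And>i. i \<in> I \<Longrightarrow> Ck_bounded k S (f i) (B i)"
  shows "Ck_bounded k S (\<lambda>x. \<Sum>i\<in>I. f i x) (\<Sum>i\<in>I. B i)"
  using assms
  by (induction I rule: infinite_finite_induct) (simp_all add: Ck_bounded_zero Ck_bounded_add)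

text \<open>A derivative in direction v replaces P by its derivative and a by a times v \<bullet> u,
  which is at most \<open>norm v\<close> larger in size. Hence the induction runs over all P and
  a.\<close>

lemma Ck_bounded_ridge:
  fixes a :: complex and u :: "'a::real_inner"
  assumes u: "\<And>x. x \<in> S \<Longrightarrow> \<bar>x \<bullet> u\<bar> \<le> 1" "norm u \<le> 1"
    and B: "\<And>i y. i \<le> k \<Longrightarrow> \<bar>y\<bar> \<le> 1 \<Longrightarrow> \<bar>poly ((pderiv ^^ i) P) y\<bar> \<le> B"
  shows "Ck_bounded k S (\<lambda>x. a * of_real (poly P (x \<bullet> u))) (norm a * B)"
  using B
proof (induction k arbitrary: P a)
  case 0
  have "norm a * \<bar>poly P (x \<bullet> u)\<bar> \<le> norm a * B" if "x \<in> S" for x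
    using 0[of 0, simplified, OF u(1)[OF that]] by (intro mult_left_mono) auto
  then show ?case by (auto simp: norm_mult intro!: continuous_intros)
next
  case (Suc k)
  have "norm a * \<bar>poly P (x \<bullet> u)\<bar> \<le> norm a * B" if "x \<in> S" for x
    using Suc.prems[of 0, simplified, OF u(1)[OF that]] by (intro mult_left_mono) auto
  then have "\<forall>x\<in>S. norm (a * of_real (poly P (x \<bullet> u))) \<le> norm a * B" by (simp add: norm_mult)
  moreover have "((\<lambda>x. a * of_real (poly P (x \<bullet> u))) has_derivative (\<lambda>v. a * of_real (v \<bullet> u) * of_real (poly (pderiv P) (x \<bullet> u)))) (at x within S)" for x
  proof -
    have "((\<lambda>x. poly P (x \<bullet> u)) has_derivative (\<lambda>v. (v \<bullet> u) * poly (pderiv P) (x \<bullet> u))) (at x within S)"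
      by (rule DERIV_compose_FDERIV[OF poly_DERIV]) (auto intro!: derivative_eq_intros)
    then have "((\<lambda>x. a * of_real (poly P (x \<bullet> u))) has_derivative (\<lambda>v. a * of_real ((v \<bullet> u) * poly (pderiv P) (x \<bullet> u)))) (at x within S)"
      by (intro has_derivative_mult_right has_derivative_of_real)
    then show ?thesis by (simp add: ac_simps)
  qed
  moreover have "Ck_bounded k S (\<lambda>x. a * of_real (v \<bullet> u) * of_real (poly (pderiv P) (x \<bullet> u))) (norm a * B * norm v)" for v
  proof (rule Ck_bounded_mono)
    show "Ck_bounded k S (\<lambda>x. a * of_real (v \<bullet> u) * of_real (poly (pderiv P) (x \<bullet> u))) (norm (a * complex_of_real (v \<bullet> u)) * B)"
    proof (rule Suc.IH)
      show "\<bar>poly ((pderiv ^^ i) (pderiv P)) y\<bar> \<le> B" if "i \<le> k" "\<bar>y\<bar> \<le> 1" for i y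
        using Suc.prems[of "Suc i" y] that by (simp add: funpow_swap1)
    qed
    have "0 \<le> B" using Suc.prems[of 0 0] by (simp add: order_trans[OF abs_ge_zero])
    moreover have "\<bar>v \<bullet> u\<bar> \<le> norm v"
      using Cauchy_Schwarz_ineq2[of v u] mult_left_mono[OF u(2), of "norm v"] by simp
    ultimately show "norm (a * complex_of_real (v \<bullet> u)) * B \<le> norm a * B * norm v"
      by (simp add: norm_mult mult_left_mono mult.assoc mult.commute[of B] mult_right_mono)
  qed
  ultimately show ?case unfolding Ck_bounded.simps
    by (intro conjI exI[of _ "\<lambda>x v. a * of_real (v \<bullet> u) * of_real (poly (pderiv P) (x \<bullet> u))"] ballI allI) auto
qed

section \<open>Inversion of single modes by ridge functions\<close>

context curvature begin

text \<open>On a chord the ridge function is U_n of an affine function, with antiderivative a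
  multiple of T_(n+1). The endpoints have arguments cos (a - b) and cos (a + b), so the difference
  factors into sin ((n+1) a) sin ((n+1) b): the transform separates t from \<theta> -
  \<phi>.\<close>

lemma radon_ridge:
  "radon (\<lambda>w. of_real (poly (chebU n) (w \<bullet> cis \<phi>))) (\<theta>, t)
   = of_real (2 * sin (of_nat (Suc n) * (pi/2 - t)) * poly (chebU n) (sin (\<theta> - \<phi>)) / of_nat (Suc n))"
proof -
  define \<delta> where "\<delta> = \<theta> - \<phi>"
  define g where "g y = sin t * sin \<delta> - cos t * y * cos \<delta>" for y
  define I where "I = integral {-1..1} (\<lambda>y. poly (chebU n) (g y))"
  let ?N = "of_nat (Suc n) :: real"
  have e: "chord \<theta> t (cos t * y) \<bullet> cis \<phi> = g y" for y
    by (simp add: chord_def inner_complex_def sin_diff cos_diff \<delta>_def g_def algebra_simps)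
  have gc: "continuous_on {-1..1} (\<lambda>y. poly (chebU n) (g y))" unfolding g_def by (intro continuous_intros)
  have I: "((\<lambda>y. poly (chebU n) (g y)) has_integral I) {-1..1}"
    unfolding I_def by (intro integrable_integral integrable_continuous_real gc)
  have "((\<lambda>y. complex_of_real (poly (chebU n) (g y))) has_integral of_real I) {-1..1}"
    using has_integral_linear[OF I bounded_linear_of_real] by (simp add: o_def)
  then have r: "radon (\<lambda>w. of_real (poly (chebU n) (w \<bullet> cis \<phi>))) (\<theta>, t) = of_real (cos t * I)"
    unfolding radon_def fst_conv snd_conv e by (simp add: integral_unique)
  have sU: "poly (chebU n) (sin x) * cos x = sin (?N * (pi/2 - x))" for x
    using chebU_cos[of n "pi/2 - x"] by (simp add: cos_diff sin_diff)
  have cI: "cos t * I = 2 * sin (?N * (pi/2 - t)) * poly (chebU n) (sin \<delta>) / ?N"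
  \<comment> \<open>The chord is then perpendicular to the ridge direction and the integrand is
    constant, so the antiderivative in y is of no help.\<close>
  proof (cases "cos \<delta> = 0")
    case True
    have g: "g y = sin t * sin \<delta>" for y by (simp add: g_def True)
    have "I = 2 * poly (chebU n) (sin t * sin \<delta>)" unfolding I_def g by simp
    then have cI: "cos t * I = 2 * (poly (chebU n) (sin t * sin \<delta>) * cos t)" by simp
    have "(sin \<delta>)\<^sup>2 = 1" using sin_cos_squared_add[of \<delta>] by (simp add: True)
    then consider "sin \<delta> = 1" | "sin \<delta> = - 1" by (auto simp: power2_eq_1_iff)
    then show ?thesis
    proof cases
      case 1
      have "cos t * I = 2 * sin (?N * (pi/2 - t))" unfolding cI 1 mult_1_right sU ..
      then show ?thesis unfolding 1 chebU_1 by simp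
    next
      case 2
      have "poly (chebU n) (sin t * sin \<delta>) * cos t = (- 1) ^ n * sin (?N * (pi/2 - t))"
        unfolding 2 mult_minus1_right chebU_uminus sU[symmetric] by simp
      then have "cos t * I = 2 * ((- 1) ^ n * sin (?N * (pi/2 - t)))" unfolding cI by simp
      then show ?thesis unfolding 2 chebU_uminus chebU_1 by simp
    qed
  next
    case False
    have h: "((\<lambda>y. cos t * cos \<delta> * poly (chebU n) (g y)) has_integral
       (- poly (chebT (Suc n)) (g 1) / ?N) - (- poly (chebT (Suc n)) (g (-1)) / ?N)) {-1..1}"
    proof (rule fundamental_theorem_of_calculus)
      fix y :: real
      have "(g has_field_derivative - (cos t * cos \<delta>)) (at y within {-1..1})"
        unfolding g_def by (auto intro!: derivative_eq_intros)
      from DERIV_chain2[OF poly_DERIV[of "chebT (Suc n)"] this]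
      have "((\<lambda>y. poly (chebT (Suc n)) (g y)) has_field_derivative ?N * poly (chebU n) (g y) * - (cos t * cos \<delta>)) (at y within {-1..1})"
        unfolding pderiv_chebT .
      from DERIV_cdivide[OF DERIV_minus[OF this], of ?N]
      have "((\<lambda>y. - poly (chebT (Suc n)) (g y) / ?N) has_field_derivative cos t * cos \<delta> * poly (chebU n) (g y)) (at y within {-1..1})"
        by (simp add: field_simps del: of_nat_Suc chebT.simps)
      then show "((\<lambda>y. - poly (chebT (Suc n)) (g y) / ?N) has_vector_derivative cos t * cos \<delta> * poly (chebU n) (g y)) (at y within {-1..1})"
        by (simp only: has_real_derivative_iff_has_vector_derivative)
    qed simp
    have "cos t * cos \<delta> * I = (- poly (chebT (Suc n)) (g 1) / ?N) - (- poly (chebT (Suc n)) (g (-1)) / ?N)"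
      by (rule has_integral_unique[OF has_integral_mult_right[OF I] h])
    then have 1: "cos t * cos \<delta> * I = (poly (chebT (Suc n)) (g (-1)) - poly (chebT (Suc n)) (g 1)) / ?N"
      by (simp add: diff_divide_distrib del: of_nat_Suc chebT.simps)
    define a b where "a = pi/2 - t" and "b = pi/2 - \<delta>"
    have ab: "cos a = sin t" "sin a = cos t" "cos b = sin \<delta>" "sin b = cos \<delta>"
      by (simp_all add: a_def b_def cos_diff sin_diff)
    have ends: "g (-1) = cos (a - b)" "g 1 = cos (a + b)"
      by (simp_all add: g_def cos_add cos_diff ab)
    have "poly (chebT (Suc n)) (g (-1)) - poly (chebT (Suc n)) (g 1) = cos (?N * a - ?N * b) - cos (?N * a + ?N * b)"
      unfolding ends chebT_cos by (simp only: distrib_left right_diff_distrib)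
    also have "\<dots> = 2 * sin (?N * a) * sin (?N * b)" unfolding cos_add cos_diff by simp
    also have "sin (?N * b) = poly (chebU n) (sin \<delta>) * cos \<delta>" unfolding sU b_def ..
    finally have "cos \<delta> * (cos t * I) = cos \<delta> * (2 * sin (?N * (pi/2 - t)) * poly (chebU n) (sin \<delta>) / ?N)"
      using 1 unfolding a_def by (simp only: ac_simps times_divide_eq_right)
    then show ?thesis unfolding mult_left_cancel[OF False] .
  qed
  show ?thesis unfolding r cI \<delta>_def ..
qed

text \<open>
  The average over \<open>N = 2n + 1\<close> equally spaced directions equals the integral over all directions,
  because the integrand is a trigonometric polynomial of degree at most \<open>2n < N\<close>.
\<close>

definition zernike :: "int \<times> int \<Rightarrow> complex \<Rightarrow> complex" where
  "zernike j w = (let m = fst j; n = nat (snd j - 1); N = 2 * n + 1 in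
     \<Sum>i<N. of_nat (Suc n) / of_nat N * cis (of_int (snd j + m - 1) * (pi/2)) * cis (of_int m * (2 * pi * of_nat i / of_nat N))
        * of_real (poly (chebU n) (w \<bullet> cis (2 * pi * of_nat i / of_nat N))))"

text \<open>Of each pair of modes exchanged by \<open>flip\<close>, the one with l > 0; the other is
  recovered from the reflection symmetry. With l = n + 1 these are the usual Zernike indices: |m|
  \<le> n and n - m even.\<close>

definition range_modes :: "(int \<times> int) set" where
  "range_modes = {j. \<bar>fst j\<bar> < snd j \<and> odd (fst j + snd j)}"

lemma zernike_Ck_bounded:
  assumes j: "j \<in> range_modes"
  shows "Ck_bounded k disk (\<lambda>w. c * zernike j w)
    (2 ^ k * (norm c * (1 + \<bar>of_int (fst j)\<bar> + \<bar>of_int (snd j)\<bar>) ^ (2 * k + 2)))"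
proof -
  define m n N where "m = fst j" and "n = nat (snd j - 1)" and "N = 2 * n + 1"
  define \<phi> where "\<phi> i = 2 * pi * of_nat i / of_nat N" for i :: nat
  define a where "a i = c * (of_nat (Suc n) / of_nat N * cis (of_int (snd j + m - 1) * (pi/2)) * cis (of_int m * \<phi> i))" for i
  have n: "snd j = int (Suc n)" using j by (auto simp: range_modes_def n_def)
  have z: "c * zernike j w = (\<Sum>i<N. a i * of_real (poly (chebU n) (w \<bullet> cis (\<phi> i))))" for w
    unfolding zernike_def Let_def sum_distrib_left a_def \<phi>_def N_def n_def m_def by (simp only: mult.assoc)
  have b: "\<bar>poly ((pderiv ^^ i) (chebU n)) y\<bar> \<le> 2 ^ k * of_nat (Suc n) ^ (2 * k + 1)" if "i \<le> k" "\<bar>y\<bar> \<le> 1" for i y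
    by (rule order_trans[OF abs_higher_pderiv_chebU_le[OF that(2)]]) (intro mult_mono power_increasing; use that(1) in auto)
  have "Ck_bounded k disk (\<lambda>w. \<Sum>i<N. a i * of_real (poly (chebU n) (w \<bullet> cis (\<phi> i))))
    (\<Sum>i<N. norm (a i) * (2 ^ k * of_nat (Suc n) ^ (2 * k + 1)))"
  proof (intro Ck_bounded_sum Ck_bounded_ridge b)
    fix w :: complex and i assume "w \<in> disk"
    then show "\<bar>w \<bullet> cis (\<phi> i)\<bar> \<le> 1" using Cauchy_Schwarz_ineq2[of w "cis (\<phi> i)"] by simp
  qed auto
  moreover have "(\<Sum>i<N. norm (a i) * (2 ^ k * of_nat (Suc n) ^ (2 * k + 1))) \<le> 2 ^ k * (norm c * (1 + \<bar>of_int (fst j)\<bar> + \<bar>of_int (snd j)\<bar>) ^ (2 * k + 2))"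
  proof -
    have N: "N > 0" by (simp add: N_def)
    have na: "norm (a i) = norm c * of_nat (Suc n) / of_nat N" for i
      unfolding a_def norm_mult norm_divide norm_of_nat norm_cis by simp
    \<comment> \<open>There are N directions of weight (n + 1) / N each, so averaging costs only one
      more factor n + 1.\<close>
    have "(\<Sum>i<N. norm (a i) * (2 ^ k * of_nat (Suc n) ^ (2 * k + 1))) = 2 ^ k * (norm c * of_nat (Suc n) ^ (2 * k + 2))"
      unfolding na using N by (simp add: field_simps del: of_nat_Suc)
    also have "\<dots> \<le> 2 ^ k * (norm c * (1 + \<bar>of_int (fst j)\<bar> + \<bar>of_int (snd j)\<bar>) ^ (2 * k + 2))"
      unfolding n by (intro mult_left_mono power_mono) auto
    finally show ?thesis .
  qed
  ultimately show ?thesis unfolding z by (rule Ck_bounded_mono)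
qed

lemma continuous_on_zernike: "j \<in> range_modes \<Longrightarrow> continuous_on disk (zernike j)"
  using zernike_Ck_bounded[of j 0 1] by simp

text \<open>The ridge formula leaves a factor in t and U_n of sin (\<theta> - \<phi>). The latter is
  a sum of exponentials of frequencies n - 2q in \<phi>, and averaging against the frequency m keeps
  exactly the term n - 2q = m.\<close>

lemma radon_zernike:
  assumes j: "j \<in> range_modes"
  shows "radon (zernike j) (\<theta>, t) = mode j (\<theta>, t) - mode j (\<theta>, pi - t)"
proof -
  define m n N where "m = fst j" and "n = nat (snd j - 1)" and "N = 2 * n + 1"
  define \<phi> where "\<phi> i = 2 * pi * of_nat i / of_nat N" for i :: nat
  define K where "K = of_nat (Suc n) * cis (of_int (snd j + m - 1) * (pi/2))"
  have n: "snd j = int (Suc n)" "\<bar>m\<bar> \<le> int n" "even (m + int n)" using j by (auto simp: range_modes_def n_def m_def)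
  obtain l where l: "m = int n - 2 * int l" "l \<le> n"
  proof -
    have "even (int n - m)" using n(3) by presburger
    then obtain q where q: "int n - m = 2 * q" by blast
    show thesis using q n(2) by (intro that[of "nat q"]) auto
  qed
  define P where "P = 2 * sin (of_nat (Suc n) * (pi/2 - t)) / of_nat (Suc n)"
  have "radon (zernike j) (\<theta>, t)
    = (\<Sum>i<N. K / of_nat N * cis (of_int m * \<phi> i) * radon (\<lambda>w. of_real (poly (chebU n) (w \<bullet> cis (\<phi> i)))) (\<theta>, t))"
  proof -
    have z: "zernike j w = (\<Sum>i<N. K / of_nat N * cis (of_int m * \<phi> i) * of_real (poly (chebU n) (w \<bullet> cis (\<phi> i))))" for w
      unfolding zernike_def Let_def K_def \<phi>_def N_def n_def m_def by (simp add: field_simps)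
    have "integral {-1..1} (\<lambda>y. \<Sum>i<N. K / of_nat N * cis (of_int m * \<phi> i) * of_real (poly (chebU n) (chord \<theta> t (cos t * y) \<bullet> cis (\<phi> i))))
      = (\<Sum>i<N. K / of_nat N * cis (of_int m * \<phi> i) * integral {-1..1} (\<lambda>y. of_real (poly (chebU n) (chord \<theta> t (cos t * y) \<bullet> cis (\<phi> i)))))"
      unfolding integral_mult_right[symmetric]
      by (rule integral_sum) (auto intro!: integrable_continuous_real continuous_intros simp: chord_def Complex_eq)
    then show ?thesis unfolding radon_def z fst_conv snd_conv by (simp only: sum_distrib_left ac_simps)
  qed
  also have "\<dots> = (\<Sum>i<N. K / of_nat N * of_real P * (\<Sum>q\<le>n. cis ((of_nat n - 2 * of_nat q) * (\<theta> - pi/2)) * cis (of_int (m - (int n - 2 * int q)) * \<phi> i)))"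
  proof (intro sum.cong refl)
    fix i
    have "complex_of_real (poly (chebU n) (sin (\<theta> - \<phi> i))) = complex_of_real (poly (chebU n) (cos (\<theta> - \<phi> i - pi/2)))"
      by (simp add: cos_diff)
    also have "\<dots> = (\<Sum>q\<le>n. cis ((of_nat n - 2 * of_nat q) * (\<theta> - \<phi> i - pi/2)))" by (rule chebU_cis_sum)
    finally have U: "complex_of_real (poly (chebU n) (sin (\<theta> - \<phi> i))) = (\<Sum>q\<le>n. cis ((of_nat n - 2 * of_nat q) * (\<theta> - \<phi> i - pi/2)))" .
    have s1: "cis (of_int m * \<phi> i) * complex_of_real (poly (chebU n) (sin (\<theta> - \<phi> i)))
      = (\<Sum>q\<le>n. cis ((of_nat n - 2 * of_nat q) * (\<theta> - pi/2)) * cis (of_int (m - (int n - 2 * int q)) * \<phi> i))"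
      unfolding U sum_distrib_left cis_mult by (intro sum.cong refl arg_cong[where f = cis]) (simp add: algebra_simps)
    have s2: "radon (\<lambda>w. of_real (poly (chebU n) (w \<bullet> cis (\<phi> i)))) (\<theta>, t) = of_real P * of_real (poly (chebU n) (sin (\<theta> - \<phi> i)))"
      unfolding radon_ridge P_def of_real_mult[symmetric] by (simp only: times_divide_eq_left)
    show "K / of_nat N * cis (of_int m * \<phi> i) * radon (\<lambda>w. of_real (poly (chebU n) (w \<bullet> cis (\<phi> i)))) (\<theta>, t)
      = K / of_nat N * of_real P * (\<Sum>q\<le>n. cis ((of_nat n - 2 * of_nat q) * (\<theta> - pi/2)) * cis (of_int (m - (int n - 2 * int q)) * \<phi> i))"
      unfolding s2 s1[symmetric] by (simp only: ac_simps)
  qed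
  also have "\<dots> = K / of_nat N * of_real P * (\<Sum>q\<le>n. cis ((of_nat n - 2 * of_nat q) * (\<theta> - pi/2)) * (\<Sum>i<N. cis (of_int (m - (int n - 2 * int q)) * \<phi> i)))"
    unfolding sum_distrib_left[symmetric] sum.swap[of _ "{..n}"] by (simp only: sum_distrib_left)
  also have "\<dots> = K / of_nat N * of_real P * (\<Sum>q\<le>n. if q = l then cis (of_int m * (\<theta> - pi/2)) * of_nat N else 0)"
  proof (intro arg_cong2[where f = "(*)"] sum.cong refl)
    fix q assume q: "q \<in> {..n}"
    have "\<bar>m - (int n - 2 * int q)\<bar> < int N" using q l by (auto simp: N_def)
    from sum_cis_roots[OF this]
    have "(\<Sum>i<N. cis (of_int (m - (int n - 2 * int q)) * \<phi> i)) = (if q = l then of_nat N else 0)"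
      unfolding \<phi>_def using l by simp
    then show "cis ((of_nat n - 2 * of_nat q) * (\<theta> - pi/2)) * (\<Sum>i<N. cis (of_int (m - (int n - 2 * int q)) * \<phi> i))
      = (if q = l then cis (of_int m * (\<theta> - pi/2)) * of_nat N else 0)" using l by simp
  qed
  also have "\<dots> = K * of_real P * cis (of_int m * (\<theta> - pi/2))"
    using l(2) by (simp add: N_def del: of_nat_add of_nat_Suc)
  also have "\<dots> = 2 * of_real (sin (of_nat (Suc n) * (pi/2 - t))) * (cis (of_int (snd j + m - 1) * (pi/2)) * cis (of_int m * (\<theta> - pi/2)))"
    unfolding K_def P_def by (simp add: field_simps del: of_nat_Suc)
  \<comment> \<open>The phase built into \<open>zernike\<close> is chosen so that, up to the factor
    -i, the phase l \<pi>/2 remains. This is the centre about which the mode and its reflection in t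
    differ by a sine.\<close>
  also have "\<dots> = - 2 * \<i> * of_real (sin (of_nat (Suc n) * (pi/2 - t))) * cis (of_int m * \<theta> + of_int (snd j) * (pi/2))"
  proof -
    have "cis (of_int (snd j + m - 1) * (pi/2)) * cis (of_int m * (\<theta> - pi/2)) = cis (- (pi/2)) * cis (of_int m * \<theta> + of_int (snd j) * (pi/2))"
      unfolding cis_mult by (simp add: algebra_simps)
    also have "cis (- (pi/2)) = - \<i>" by (simp add: complex_eq_iff)
    finally show ?thesis by simp
  qed
  also have "\<dots> = cis (of_int m * \<theta> + of_int (snd j) * (pi/2)) * (cis (- (of_nat (Suc n) * (pi/2 - t))) - cis (of_nat (Suc n) * (pi/2 - t)))"
  proof -
    have "cis (- x) - cis x = - 2 * \<i> * of_real (sin x)" for x by (simp add: complex_eq_iff)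
    then show ?thesis by (simp only: ac_simps)
  qed
  also have "\<dots> = mode j (\<theta>, t) - mode j (\<theta>, pi - t)"
  proof -
    have e: "of_int m * \<theta> + of_int (snd j) * (pi/2) + - (of_nat (Suc n) * (pi/2 - t)) = of_int m * \<theta> + of_int (snd j) * t"
      "of_int m * \<theta> + of_int (snd j) * (pi/2) + of_nat (Suc n) * (pi/2 - t) = of_int m * \<theta> + of_int (snd j) * (pi - t)"
      unfolding n(1) by (simp_all add: field_simps)
    show ?thesis unfolding right_diff_distrib[where 'a = complex] cis_mult e by (simp add: mode_def m_def)
  qed
  finally show ?thesis .
qed

text \<open>Rapid decrease beats the polynomial derivative bounds of the Zernike terms, so their sum
  is smooth up to the boundary and may be transformed term by term. The reflected modes supply the
  coefficients with l < 0.\<close>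

lemma radon_onto:
  assumes c: "rapid c" and supp: "\<And>j. \<bar>snd j\<bar> \<le> \<bar>fst j\<bar> \<Longrightarrow> c j = 0" and par: "\<And>j. even (fst j + snd j) \<Longrightarrow> c j = 0"
    and fl: "\<And>j. parity_sign (snd j) * c (flip j) = - 1 * c j"
  obtains F where "smooth_on disk F" "\<And>p. radon F p = fourier c p"
proof
  define F where "F w = (\<Sum>\<^sub>\<infinity>j\<in>range_modes. c j * zernike j w)" for w
  define B where "B k j = 2 ^ k * (norm (c j) * (1 + \<bar>of_int (fst j)\<bar> + \<bar>of_int (snd j)\<bar>) ^ (2 * k + 2))" for k :: nat and j :: "int \<times> int"
  have sB: "B k summable_on range_modes" for k
    unfolding B_def
    by (rule summable_on_cmult_right[OF summable_on_subset_banach[OF spec[OF c[unfolded rapid_def], of "2 * k + 2"] subset_UNIV]])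
  have CB: "Ck_bounded k disk (\<lambda>w. c j * zernike j w) (B k j)" if "j \<in> range_modes" for k j
    unfolding B_def by (rule zernike_Ck_bounded[OF that])
  have "infinite range_modes"
  proof
    assume "finite range_modes"
    then have "finite ((\<lambda>n::nat. (0 :: int, 2 * int n + 1)) ` UNIV)" by (rule finite_subset[rotated]) (auto simp: range_modes_def)
    then show False by (auto dest!: finite_imageD simp: inj_on_def)
  qed
  then have "Ck_on k disk F" for k
    unfolding F_def[abs_def] by (intro Ck_on_infsum[OF convex_cball _ _ CB sB]) auto
  then show "smooth_on disk F" by (simp add: smooth_on_def)
  fix p :: "real \<times> real"
  obtain \<theta> t where p: "p = (\<theta>, t)" by (cases p)
  define d where "d j = (if j \<in> range_modes then c j else 0)" for j
  have d: "rapid d" using rapid_mono[OF c, of d 1] by (auto simp: d_def)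
  have "((\<lambda>j. integral {-1..1} (\<lambda>y. c j * zernike j (chord \<theta> t (cos t * y)))) has_sum
     integral {-1..1} (\<lambda>y. F (chord \<theta> t (cos t * y)))) range_modes"
    unfolding F_def
  proof (rule has_sum_integral_infsum[OF _ _ sB[of 0]])
    fix j and y :: real assume j: "j \<in> range_modes"
    show "continuous_on {-1..1} (\<lambda>y. c j * zernike j (chord \<theta> t (cos t * y)))"
      by (intro continuous_intros continuous_on_chord_slice continuous_on_zernike j)
    show "norm (c j * zernike j (chord \<theta> t (cos t * y))) \<le> B 0 j" if "y \<in> {-1..1}"
      by (rule Ck_bounded_norm[OF CB[OF j] chord_cos_disk[OF that]])
  qed
  from has_sum_cmult_right[OF this, of "of_real (cos t)"]
  have "((\<lambda>j. c j * radon (zernike j) (\<theta>, t)) has_sum radon F (\<theta>, t)) range_modes"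
    by (simp add: radon_def mult.left_commute)
  then have r: "((\<lambda>j. c j * (mode j (\<theta>, t) - mode j (\<theta>, pi - t))) has_sum radon F (\<theta>, t)) range_modes"
    by (subst (asm) has_sum_cong[where g = "\<lambda>j. c j * (mode j (\<theta>, t) - mode j (\<theta>, pi - t))"]) (simp_all add: radon_zernike)
  have "((\<lambda>j. d j * mode j (\<theta>, t) + (- 1) * (d j * mode j (\<theta>, pi - t))) has_sum fourier d (\<theta>, t) + (- 1) * fourier d (\<theta>, pi - t)) UNIV"
    by (intro has_sum_add has_sum_cmult_right fourier_has_sum rapid_abs_summable d)
  also have "?this \<longleftrightarrow> ((\<lambda>j. c j * (mode j (\<theta>, t) - mode j (\<theta>, pi - t))) has_sum fourier d (\<theta>, t) + (- 1) * fourier d (\<theta>, pi - t)) range_modes"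
    by (rule has_sum_cong_neutral) (auto simp: d_def right_diff_distrib)
  finally have "radon F (\<theta>, t) = fourier d (\<theta>, t) + (- 1) * fourier d (\<theta>, pi - t)" using r has_sum_unique by blast
  also have "\<dots> = 1 * fourier d (\<theta>, t) + (- 1) * fourier (\<lambda>j. parity_sign (snd j) * d (flip j)) (\<theta>, t)"
    by (simp add: fourier_reflect)
  also have "\<dots> = fourier (\<lambda>j. 1 * d j + (- 1) * (parity_sign (snd j) * d (flip j))) (\<theta>, t)"
  proof (rule fourier_lincomb[symmetric])
    have "rapid (\<lambda>j. parity_sign (snd j) * d (flip j))"
      by (rule rapid_mono[OF rapid_flip[OF d], of _ 1]) (simp add: norm_mult parity_sign_def)
    then show "(\<lambda>j. norm (parity_sign (snd j) * d (flip j))) summable_on UNIV" by (rule rapid_abs_summable)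
  qed (rule rapid_abs_summable[OF d])
  \<comment> \<open>Either exactly one of j and \<open>flip j\<close> is a range mode, or neither is
    and then c vanishes at j by support or parity.\<close>
  also have "(\<lambda>j. 1 * d j + (- 1) * (parity_sign (snd j) * d (flip j))) = c"
  proof
    fix j :: "int \<times> int"
    consider "j \<in> range_modes" "flip j \<notin> range_modes" | "j \<notin> range_modes" "flip j \<in> range_modes"
      | "j \<notin> range_modes" "flip j \<notin> range_modes" "\<bar>snd j\<bar> \<le> \<bar>fst j\<bar> \<or> even (fst j + snd j)"
      unfolding range_modes_def mem_Collect_eq flip_simps
      by (cases "even (fst j + snd j)"; cases "\<bar>fst j\<bar> < \<bar>snd j\<bar>"; cases "0 < snd j") auto
    then show "1 * d j + (- 1) * (parity_sign (snd j) * d (flip j)) = c j"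
      by cases (use fl[of j] supp[of j] par[of j] in \<open>auto simp: d_def\<close>)
  qed
  finally show "radon F p = fourier c p" unfolding p .
qed

section \<open>The range of the X-ray transform\<close>

lemma radon_cong:
  assumes "\<And>w. w \<in> disk \<Longrightarrow> F w = G w"
  shows "radon F p = radon G p"
  unfolding radon_def
  by (intro arg_cong2[where f = "(*)"] integral_cong refl assms chord_cos_disk)

text \<open>Passing from f to f composed with \<open>unklein\<close>, divided by the square of
  \<open>hyp\<close>, is a bijection of smooth functions on the disk, because \<open>klein\<close>
  and \<open>unklein\<close> are mutually inverse and smooth there and \<open>hyp\<close> is
  positive. So the ranges of the X-ray and Radon transforms correspond under
  \<open>lift\<close>.\<close>

lemma fourier_range_iff_xray:
  assumes sm: "u \<in> smooth_influx" and a: "\<And>p. p \<in> influx \<Longrightarrow> u (antipodal_scat \<kappa> p) = u p"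
  shows "fourier_range u \<longleftrightarrow> (\<exists>f. smooth_on disk f \<and> (\<forall>p\<in>influx. u p = xray \<kappa> f p))"
proof
  define q where "q = complex_of_real (sqrt (1 - \<kappa>\<^sup>2))"
  have "\<kappa>\<^sup>2 < 1" using \<kappa> by (simp add: abs_square_less_1 abs_less_iff)
  then have q: "q \<noteq> 0" by (simp add: q_def)
  have X: "xray \<kappa> f p = q * lift (radon (\<lambda>w. f (unklein w) / of_real ((hyp w)\<^sup>2))) p"
    if "smooth_on disk f" "p \<in> influx" for f p
    using that xray_eq_lift_radon[OF _ smooth_on_continuous[OF that(1)]] by (cases p) (auto simp: influx_def q_def)
  {
    assume "\<exists>f. smooth_on disk f \<and> (\<forall>p\<in>influx. u p = xray \<kappa> f p)"
    then obtain f where f: "smooth_on disk f" "\<And>p. p \<in> influx \<Longrightarrow> u p = xray \<kappa> f p" by blast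
    define F where "F w = f (unklein w) / of_real ((hyp w)\<^sup>2)" for w
    have "smooth_on disk (\<lambda>w. f (unklein w) * of_real (inverse (hyp w) ^ 2))"
      by (intro smooth_intros smooth_on_compose[OF f(1) smooth_on_unklein] smooth_on_hyp)
         (use unklein_disk hyp_pos in force)+
    then have F: "smooth_on disk F"
      by (rule iffD1[OF smooth_on_cong, rotated]) (simp add: F_def divide_inverse power_inverse)
    define c where "c = coef (\<lambda>p. q * radon F p)"
    have G: "(\<lambda>p. q * radon F p) \<in> smooth_bdry"
      using biperiodic_radon[of F] smooth_on_radon[OF F] unfolding smooth_bdry_iff
      by (auto simp: biperiodic_def intro!: smooth_intros)
    have c: "rapid c" "fourier c = (\<lambda>p. q * radon F p)"
      unfolding c_def using rapid_coef[OF G] fourier_coef[OF G] by simp_all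
    have u: "u p = lift (fourier c) p" if "p \<in> influx" for p
      unfolding f(2)[OF that] X[OF f(1) that] c(2) F_def[symmetric] lift_def by simp
    have fl: "parity_sign (snd j) * c (flip j) = - 1 * c j" for j
    proof -
      have e: "fourier (\<lambda>j. parity_sign (snd j) * c (flip j)) = fourier (\<lambda>j. - 1 * c j)"
      proof
        fix p :: "real \<times> real"
        obtain \<theta> t where p: "p = (\<theta>, t)" by (cases p)
        show "fourier (\<lambda>j. parity_sign (snd j) * c (flip j)) p = fourier (\<lambda>j. - 1 * c j) p"
          unfolding p fourier_reflect[symmetric] fourier_cmult[symmetric] c(2) radon_reflect by simp
      qed
      have "rapid (\<lambda>j. parity_sign (snd j) * c (flip j))"
        by (rule rapid_mono[OF rapid_flip[OF c(1)], of _ 1]) (simp add: norm_mult parity_sign_def)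
      from coef_fourier[OF rapid_abs_summable[OF this], of j]
      have "parity_sign (snd j) * c (flip j) = coef (fourier (\<lambda>j. - 1 * c j)) j" unfolding e ..
      also have "\<dots> = - 1 * c j"
        using coef_fourier[OF rapid_abs_summable[OF rapid_mono[OF c(1), of "\<lambda>j. - 1 * c j" 1]]] by simp
      finally show ?thesis .
    qed
    note h = lift_in_smooth_alpha[OF c(1) fl _ u sm]
    have "bcoef (- 1) u j = 0" if j: "\<bar>snd j\<bar> \<le> \<bar>fst j\<bar>" for j
    \<comment> \<open>The Radon transform alone gives vanishing only in the open cone; on its edge m
      + l is even, and the antipodal symmetry of \<open>u\<close> takes over.\<close>
    proof (cases "\<bar>snd j\<bar> = \<bar>fst j\<bar>")
      case True
      then have "even (fst j + snd j)" by presburger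
      then show ?thesis using bcoef_parity[OF h(1), of j] a by simp
    next
      case False
      then have "coef (radon F) j = 0" using j by (intro coef_radon_eq_0 smooth_on_continuous F) simp
      then have "c j = 0" unfolding c_def coef_cmult by simp
      then show ?thesis using h(2) by simp
    qed
    with h(1) show "fourier_range u" by (simp add: fourier_range_def)
  }
  assume fourier_range: "fourier_range u"
  then have ua: "u \<in> smooth_alpha \<kappa> (- 1)" by (simp add: fourier_range_def)
  define c where "c j = inverse q * bcoef (- 1) u j" for j
  obtain F where F: "smooth_on disk F" "\<And>p. radon F p = fourier c p"
  proof (rule radon_onto)
    show "rapid c" by (rule rapid_mono[OF rapid_bcoef[OF ua], of _ "norm (inverse q)"]) (simp add: c_def norm_mult)
    show "c j = 0" if "\<bar>snd j\<bar> \<le> \<bar>fst j\<bar>" for j using fourier_range that unfolding c_def fourier_range_def by (cases j) auto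
    show "c j = 0" if "even (fst j + snd j)" for j using bcoef_parity[OF ua, of j] a that by (simp add: c_def)
    show "parity_sign (snd j) * c (flip j) = - 1 * c j" for j using bcoef_flip[OF ua, of j] by (simp add: c_def mult.left_commute)
  qed blast
  define f where "f z = F (klein z) * of_real (hyp (klein z) ^ 2)" for z
  have f: "smooth_on disk f"
    unfolding f_def
    by (intro smooth_intros smooth_on_compose[OF F(1) smooth_on_klein] smooth_on_compose[OF smooth_on_hyp smooth_on_klein])
       (use klein_disk in auto)
  have "xray \<kappa> f p = u p" if p: "p \<in> influx" for p
  proof -
    have "radon (\<lambda>w. f (unklein w) / of_real ((hyp w)\<^sup>2)) = radon F"
      by (intro ext radon_cong) (use hyp_pos in \<open>force simp: f_def klein_unklein\<close>)
    then have "xray \<kappa> f p = q * lift (radon F) p" using X[OF f p] by simp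
    also have "radon F = fourier c" using F(2) by auto
    also have "q * lift (fourier c) p = lift (fourier (bcoef (- 1) u)) p"
      unfolding lift_fourier_cmult c_def using q by (simp add: mult.assoc[symmetric])
    also have "\<dots> = u p" unfolding lift_fourier_bcoef[OF ua] by (rule A_ext_influx[OF p])
    finally show ?thesis .
  qed
  with f show "\<exists>f. smooth_on disk f \<and> (\<forall>p\<in>influx. u p = xray \<kappa> f p)" by metis
qed

end

theorem theorem1:
  fixes \<kappa> :: real and u :: "real \<times> real \<Rightarrow> complex"
  assumes "-1 < \<kappa>" and "\<kappa> < 1"
    and "u \<in> smooth_influx"
    and "\<forall>p\<in>influx. u (antipodal_scat \<kappa> p) = u p"
  defines "in_range_xray \<equiv> (\<exists>f. smooth_on disk f \<and> (\<forall>p\<in>influx. u p = xray \<kappa> f p))"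
    and "in_range_P_minus \<equiv>
      (\<exists>w \<in> smooth_alpha_plus_minus \<kappa>. \<forall>p\<in>influx. u p = P_minus \<kappa> w p)"
    and "in_kernel_C_minus \<equiv>
      (u \<in> smooth_alpha \<kappa> (-1) \<and> (\<forall>p\<in>influx. C_minus \<kappa> u p = 0))"
    and "moment_conditions \<equiv>
      (u \<in> smooth_alpha \<kappa> (-1) \<and>
       (\<forall>n k. k < 0 \<or> k > int n \<longrightarrow> inner_influx \<kappa> u (psi \<kappa> n k) = 0))"
  shows "(in_range_xray \<longleftrightarrow> in_range_P_minus)
    \<and> (in_range_xray \<longleftrightarrow> in_kernel_C_minus)
    \<and> (in_range_xray \<longleftrightarrow> moment_conditions)"
proof -
  interpret curvature \<kappa> by unfold_locales (fact assms)+
  have a: "u (antipodal_scat \<kappa> p) = u p" if "p \<in> influx" for p using assms(4) that by blast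
  have "fourier_range u \<longleftrightarrow> in_range_xray" unfolding in_range_xray_def by (rule fourier_range_iff_xray[OF assms(3)]) (rule a)
  moreover have "fourier_range u \<longleftrightarrow> in_range_P_minus" unfolding in_range_P_minus_def by (rule fourier_range_iff_P_minus[OF assms(3)]) (rule a)
  moreover have "fourier_range u \<longleftrightarrow> in_kernel_C_minus" unfolding in_kernel_C_minus_def by (rule fourier_range_iff_C_minus) (rule a)
  moreover have "fourier_range u \<longleftrightarrow> moment_conditions" unfolding moment_conditions_def by (rule fourier_range_iff_moments) (rule a)
  ultimately show ?thesis by blast
qed

end
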